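(* Assume the regularity conditions R1–R5 listed in the context. Let $\alpha\in(0,1)$ be fixed, let $z=z_{\alpha/2}$ be defined by $\Phi(z)=1-\alpha/2$, and let $\phi$ be the standard normal density. Then for any area $i$, as $m\to\infty$, $$P\{\theta_i\in I_i^{\mathrm{Cox}}(\hat A_{h_i})\}=1-\alpha+z\phi(z)\,\frac{a_i+b_i[h_i(A)]}{m}+O(m^{-3/2}),$$ where $$a_i=-\frac{m}{\operatorname{tr}(V^{-2})}\left[\frac{4D_i}{A(A+D_i)^2}+\frac{(1+z^2)D_i^2}{2A^2(A+D_i)^2}\right]-\frac{mD_i}{A(A+D_i)}\,x_i'\operatorname{Var}(\tilde\beta)x_i,$$ $$b_i\equiv b_i[h_i(A)]=\frac{2m}{\operatorname{tr}(V^{-2})}\,\frac{D_i}{A(A+D_i)}\,\tilde l^{(1)}_{i;\mathrm{ad}}(A).$$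
   Context: Fay–Herriot model: for $i=1,\dots,m$, $y_i=\theta_i+e_i$, $\theta_i=x_i'\beta+v_i$, where the $v_i$ and $e_i$ are mutually independent, $v_i\sim N(0,A)$, $e_i\sim N(0,D_i)$. Here $x_i\in\mathbb R^p$ ($p<m$, $p$ fixed) are known, $D_i>0$ are known, and $\beta\in\mathbb R^p$, $A\in(0,\infty)$ are fixed unknown parameters. $P$ and $\operatorname{Var}$ are with respect to this joint distribution of $(y,\theta)$ with $\beta,A$ fixed. Notation: $y=(y_1,\dots,y_m)'$; $X'=(x_1,\dots,x_m)$, so $X$ is $m\times p$; $q_i=x_i'(X'X)^{-1}x_i$; $V=\operatorname{diag}(A+D_1,\dots,A+D_m)$; $P_V=V^{-1}-V^{-1}X(X'V^{-1}X)^{-1}X'V^{-1}$. The residual likelihood is $L_{\mathrm{RE}}(A)=|X'V^{-1}X|^{-1/2}|V|^{-1/2}\exp(-\tfrac12 y'P_Vy)$. For area-specific adjustment factors $h_i(A)$, $L_{i;\mathrm{ad}}(A)=h_i(A)L_{\mathrm{RE}}(A)$, $\hat A_{h_i}=\arg\max_{A\in[0,\infty)}L_{i;\mathrm{ad}}(A)$, $\tilde l_{i;\mathrm{ad}}(A)=\log h_i(A)$, and $\tilde l^{(k)}_{i;\mathrm{ad}}$ is its $k$th derivative with respect to $A$. $\tilde\beta=(X'V^{-1}X)^{-1}X'V^{-1}y$ is the weighted least squares estimator for known $A$; $\hat\beta=(X'\hat V^{-1}X)^{-1}X'\hat V^{-1}y$ with $\hat V=\operatorname{diag}(\hat A_{h_1}+D_1,\dots,\hat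 A_{h_m}+D_m)$. Put $\hat B_i=D_i/(\hat A_{h_i}+D_i)$, $\hat\theta_i^{\mathrm{EB}}=(1-\hat B_i)y_i+\hat B_ix_i'\hat\beta$, $\sigma_i(A)=\sqrt{AD_i/(A+D_i)}$. The Cox-type empirical Bayes interval $I_i^{\mathrm{Cox}}(\hat A_{h_i})$ is the interval with endpoints $\hat\theta_i^{\mathrm{EB}}\pm z_{\alpha/2}\,\sigma_i(\hat A_{h_i})$. Regularity conditions (for the sequence of models as $m\to\infty$): R1: $\tilde l_{i;\mathrm{ad}}(A)$ is free of $y$ and five times continuously differentiable in $A$; moreover the $g$th power of $|\tilde l^{(j)}_{i;\mathrm{ad}}(A)|$ is bounded for $g>0$ and $j=1,\dots,5$. R2: $\operatorname{rank}(X)=p$. R3: the elements of $X$ are uniformly bounded, implying $\sup_{j\ge1}q_j=O(m^{-1})$. R4: $0<\inf_{j\ge1}D_j\le\sup_{j\ge1}D_j<\infty$, $A\in(0,\infty)$. R5: $|\hat A_{h_i}|<C_+m^{\lambda}$, where $C_+$ is a generic positive constant and $\lambda$ is a small positive constant. *)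

theory Defs
  imports "HOL-Probability.Probability" "HOL-Library.Landau_Symbols"
begin

text \<open>
  There is one infinite sequence of areas \<open>0, 1, 2, \<dots>\<close>; the model with \<open>m\<close> areas consists of
  the areas \<open>j < m\<close>. Objects of dimension \<open>m\<close> are written with explicit indices below \<open>m\<close>, objects
  of the fixed dimension \<open>p = CARD('p)\<close> with the type \<open>real ^ 'p\<close>. Row \<open>j\<close> of the design matrix
  \<open>X\<close> is \<open>x j\<close>, and diagonal \<open>m\<close>-by-\<open>m\<close> matrices are given by their diagonals.
\<close>

locale fay_herriot = prob_space M
  for M :: "'a measure" +
  fixes x :: "nat \<Rightarrow> real ^ 'p"
    and D :: "nat \<Rightarrow> real"
    and \<beta> :: "real ^ 'p"
    and A :: real
    and v e \<theta> y :: "nat \<Rightarrow> 'a \<Rightarrow> real"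
  assumes D_pos: "0 < D j"
    and A_pos: "0 < A"
    and indep_effects_errors: "indep_vars (\<lambda>_. borel) (case_sum v e) (UNIV :: (nat + nat) set)"
    and effect_distr: "distributed M lborel (v j) (normal_density 0 (sqrt A))"
    and error_distr: "distributed M lborel (e j) (normal_density 0 (sqrt (D j)))"
    and theta_eq: "\<theta> j \<omega> = x j \<bullet> \<beta> + v j \<omega>"
    and y_eq: "y j \<omega> = \<theta> j \<omega> + e j \<omega>"

text \<open>\<open>X' diag(w) X\<close>\<close>

definition gram :: "(nat \<Rightarrow> real ^ 'p) \<Rightarrow> nat \<Rightarrow> (nat \<Rightarrow> real) \<Rightarrow> real ^ 'p ^ 'p"
  where "gram x m w = (\<chi> a b. \<Sum>j<m. x j $ a * w j * x j $ b)"

text \<open>\<open>(X' diag(w) X)\<^sup>-\<^sup>1 X' diag(w) y\<close>\<close>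

definition wls :: "(nat \<Rightarrow> real ^ 'p) \<Rightarrow> nat \<Rightarrow> (nat \<Rightarrow> real) \<Rightarrow> (nat \<Rightarrow> real) \<Rightarrow> real ^ 'p"
  where "wls x m w y = matrix_inv (gram x m w) *v (\<Sum>j<m. (w j * y j) *\<^sub>R x j)"

definition design_rank :: "(nat \<Rightarrow> real ^ 'p) \<Rightarrow> nat \<Rightarrow> nat"
  where "design_rank x m = dim (x ` {..<m})"

definition leverage :: "(nat \<Rightarrow> real ^ 'p) \<Rightarrow> nat \<Rightarrow> nat \<Rightarrow> real"
  where "leverage x m j = x j \<bullet> (matrix_inv (gram x m (\<lambda>_. 1)) *v x j)"

text \<open>The entries of \<open>V\<^sup>-\<^sup>1 - V\<^sup>-\<^sup>1 X (X' V\<^sup>-\<^sup>1 X)\<^sup>-\<^sup>1 X' V\<^sup>-\<^sup>1\<close>, where \<open>V = diag(A + D j)\<close>:\<close>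

definition P_V :: "(nat \<Rightarrow> real ^ 'p) \<Rightarrow> (nat \<Rightarrow> real) \<Rightarrow> nat \<Rightarrow> real \<Rightarrow> nat \<Rightarrow> nat \<Rightarrow> real"
  where "P_V x D m A j k =
    (if j = k then 1 / (A + D j) else 0) -
    1 / (A + D j) * (x j \<bullet> (matrix_inv (gram x m (\<lambda>l. 1 / (A + D l))) *v x k)) * (1 / (A + D k))"

definition residual_likelihood ::
    "(nat \<Rightarrow> real ^ 'p) \<Rightarrow> (nat \<Rightarrow> real) \<Rightarrow> nat \<Rightarrow> (nat \<Rightarrow> real) \<Rightarrow> real \<Rightarrow> real"
  where "residual_likelihood x D m y A =
    det (gram x m (\<lambda>j. 1 / (A + D j))) powr (- 1 / 2) *
    (\<Prod>j<m. A + D j) powr (- 1 / 2) *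
    exp (- 1 / 2 * (\<Sum>j<m. \<Sum>k<m. y j * P_V x D m A j k * y k))"

text \<open>The factor \<open>h m i\<close> may depend on the number \<open>m\<close> of areas as well as on the area \<open>i\<close>.\<close>

definition adjusted_likelihood ::
    "(nat \<Rightarrow> real ^ 'p) \<Rightarrow> (nat \<Rightarrow> real) \<Rightarrow> (nat \<Rightarrow> nat \<Rightarrow> real \<Rightarrow> real) \<Rightarrow>
     nat \<Rightarrow> nat \<Rightarrow> (nat \<Rightarrow> real) \<Rightarrow> real \<Rightarrow> real"
  where "adjusted_likelihood x D h m i y A = h m i A * residual_likelihood x D m y A"

definition log_adj_deriv :: "(nat \<Rightarrow> nat \<Rightarrow> real \<Rightarrow> real) \<Rightarrow> nat \<Rightarrow> nat \<Rightarrow> nat \<Rightarrow> real \<Rightarrow> real"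
  where "log_adj_deriv h m i k = (deriv ^^ k) (\<lambda>A. ln (h m i A))"

text \<open>
  The bounds are uniform in \<open>A\<close>, in the area and in \<open>m\<close>. Continuity at \<open>A = 0\<close> is required because
  the likelihood is maximized over \<open>[0, \<infinity>)\<close>, while \<open>ln (h m j A)\<close> is only differentiated on
  \<open>(0, \<infinity>)\<close>. The number \<open>p\<close> is the dimension of the regression parameter.
\<close>

definition regular_adjustment :: "nat \<Rightarrow> (nat \<Rightarrow> nat \<Rightarrow> real \<Rightarrow> real) \<Rightarrow> bool"
  where "regular_adjustment p h \<longleftrightarrow>
    (\<forall>m>p. \<forall>j<m.
      (\<forall>A>0. 0 < h m j A) \<and> continuous_on {0..} (h m j) \<and>
      (\<forall>k<5. log_adj_deriv h m j k differentiable_on {0<..}) \<and>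
      continuous_on {0<..} (log_adj_deriv h m j 5)) \<and>
    (\<forall>g>0. \<exists>K. \<forall>m>p. \<forall>j<m. \<forall>k\<in>{1..5}. \<forall>A>0. \<bar>log_adj_deriv h m j k A\<bar> powr g \<le> K)"

definition EB_predictor ::
    "(nat \<Rightarrow> real ^ 'p) \<Rightarrow> (nat \<Rightarrow> real) \<Rightarrow> nat \<Rightarrow> nat \<Rightarrow> (nat \<Rightarrow> real) \<Rightarrow> (nat \<Rightarrow> real) \<Rightarrow> real"
  where "EB_predictor x D m i Ahat y =
    (let B = D i / (Ahat i + D i);
         betahat = wls x m (\<lambda>j. 1 / (Ahat j + D j)) y
     in (1 - B) * y i + B * (x i \<bullet> betahat))"

definition cox_sd :: "(nat \<Rightarrow> real) \<Rightarrow> nat \<Rightarrow> real \<Rightarrow> real"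
  where "cox_sd D i A = sqrt (A * D i / (A + D i))"

definition cox_interval ::
    "(nat \<Rightarrow> real ^ 'p) \<Rightarrow> (nat \<Rightarrow> real) \<Rightarrow> real \<Rightarrow> nat \<Rightarrow> nat \<Rightarrow>
     (nat \<Rightarrow> real) \<Rightarrow> (nat \<Rightarrow> real) \<Rightarrow> real set"
  where "cox_interval x D z m i Ahat y =
    {EB_predictor x D m i Ahat y - z * cox_sd D i (Ahat i) ..
     EB_predictor x D m i Ahat y + z * cox_sd D i (Ahat i)}"

definition covariance_matrix :: "'a measure \<Rightarrow> ('a \<Rightarrow> real ^ 'p) \<Rightarrow> real ^ 'p ^ 'p"
  where "covariance_matrix M Z =
    (\<chi> a b. \<integral>\<omega>. (Z \<omega> $ a - (\<integral>\<omega>'. Z \<omega>' $ a \<partial>M)) * (Z \<omega> $ b - (\<integral>\<omega>'. Z \<omega>' $ b \<partial>M)) \<partial>M)"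

definition trace_V_inv_sq :: "(nat \<Rightarrow> real) \<Rightarrow> nat \<Rightarrow> real \<Rightarrow> real"
  where "trace_V_inv_sq D m A = (\<Sum>j<m. 1 / (A + D j)\<^sup>2)"

text \<open>\<open>C\<close> stands for the covariance matrix of the weighted least squares estimator.\<close>

definition cox_a ::
    "(nat \<Rightarrow> real ^ 'p) \<Rightarrow> (nat \<Rightarrow> real) \<Rightarrow> real \<Rightarrow> real \<Rightarrow> real ^ 'p ^ 'p \<Rightarrow> nat \<Rightarrow> nat \<Rightarrow> real"
  where "cox_a x D A z C m i =
    - (m / trace_V_inv_sq D m A) *
      (4 * D i / (A * (A + D i)\<^sup>2) + (1 + z\<^sup>2) * (D i)\<^sup>2 / (2 * A\<^sup>2 * (A + D i)\<^sup>2))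
    - m * D i / (A * (A + D i)) * (x i \<bullet> (C *v x i))"

definition cox_b ::
    "(nat \<Rightarrow> real) \<Rightarrow> real \<Rightarrow> (nat \<Rightarrow> nat \<Rightarrow> real \<Rightarrow> real) \<Rightarrow> nat \<Rightarrow> nat \<Rightarrow> real"
  where "cox_b D A h m i =
    2 * m / trace_V_inv_sq D m A * (D i / (A * (A + D i))) * log_adj_deriv h m i 1 A"

end

theory Submission
  imports Defs
begin

text \<open>
  Let \<open>u j = v j + e j\<close> be the observation of area \<open>j\<close> without its fixed part. Given all observations, \<open>\<theta> i\<close> is
  normal with the best predictor as its mean and \<open>\<sigma> = cox_sd D i A\<close> as its standard deviation; its standardised error is
  independent of the whole sequence \<open>u\<close> (\<open>best_predictor_error\<close>). If \<open>\<delta>\<close> is the distance of the empirical from the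
  best predictor in units of \<open>\<sigma>\<close>, and \<open>\<rho>\<close> the ratio of the estimated standard deviation to \<open>\<sigma>\<close>, the conditional
  coverage probability is therefore \<open>Phi (\<delta> + z * \<rho>) - Phi (\<delta> - z * \<rho>)\<close>, a function of \<open>u\<close> alone (\<open>cox_interval_iff\<close>,
  \<open>coverage_probability\<close>). It is even in \<open>\<delta>\<close>, so up to terms of third order it depends on \<open>\<rho> - 1\<close>, \<open>(\<rho> - 1)\<^sup>2\<close>
  and \<open>\<delta>\<^sup>2\<close>, and the coverage error is of order \<open>1 / m\<close>.

  The variance estimators are given only as maximisers. All of them are controlled by a single event on \<open>u\<close>: that finitely
  many weighted sums of the centred squares \<open>(u j)\<^sup>2 - (A + D j)\<close> and of the rows \<open>u j *\<^sub>R x j\<close> are at most a small multiple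
  of their maximal order. On this event a maximiser in the range allowed for the estimators lies near \<open>A\<close>
  (\<open>likelihood_consistency\<close>), and near \<open>A\<close> each adjusted score is decreasing with slope of order \<open>-m\<close>
  (\<open>adj_score_slope\<close>), so that the estimator is its unique zero \<open>root m j u\<close> there (\<open>maximizer_eq_root\<close>). Since the sums have
  bounded fourth moments in their natural scale, the event fails with probability of order \<open>1 / m\<^sup>2\<close> (\<open>prob_not_good\<close>).

  The dominating variable \<open>W\<close> of the scaled sums serves as the unit of all expansions: every remainder is bounded by
  \<open>C * W ^ a * m powr (b / 2) * (1 + \<bar>u j\<bar>) ^ c\<close>. Two steps of Newton's method give the root up to order \<open>m powr (- 3 / 2)\<close>
  (\<open>bdd_root_step2\<close>). The leading step is the same for all areas, so the weighted least squares fit with different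
  estimated variances has the same expansion as with a common one (\<open>bdd_fit_root\<close>). Substitution gives a polynomial
  approximation of the conditional coverage with an error of at most \<open>C * W\<^sup>3 * (1 + \<bar>u i\<bar>)\<^sup>3 * m powr (- 3 / 2)\<close>
  (\<open>coverage_approx_error\<close>), whose expectation is of the required order because \<open>W\<close> has a bounded fourth moment.

  The expectation of the approximation is computed exactly (\<open>coverage_approx_mean\<close>). The estimation of \<open>\<beta>\<close> does not bias the
  residual score, and the two quadratic terms of the second Newton step cancel in the mean; what remains of the bias of the
  variance estimator is \<open>l1 m i A / info m\<close>, the contribution \<open>cox_b\<close> of the adjustment. The variance of the estimator and the mean
  of \<open>\<delta>\<^sup>2\<close>, in which the variance of the least squares fit appears, give \<open>cox_a\<close>.
\<close>

section \<open>Linear algebra of the design\<close>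

section \<open>Weighted Gram matrices\<close>

lemma gram_mult_vec:
  "gram x m c *v b = (\<Sum>j<m. (c j * (x j \<bullet> b)) *\<^sub>R x j)"
  unfolding gram_def matrix_vector_mult_def inner_vec_def vec_eq_iff
  by (simp add: sum_distrib_right sum_distrib_left sum.swap[of _ _ "{..<m}"] ac_simps)

lemma inner_gram_mult_vec:
  "b \<bullet> (gram x m c *v b') = (\<Sum>j<m. c j * ((x j \<bullet> b) * (x j \<bullet> b')))"
  by (simp add: gram_mult_vec inner_sum_right inner_commute ac_simps)

lemma continuous_det:
  fixes F :: "'b::topological_space \<Rightarrow> real ^ 'n ^ 'n"
  assumes "\<And>i j. continuous_on T (\<lambda>t. F t $ i $ j)"
  shows "continuous_on T (\<lambda>t. det (F t))"
  unfolding det_def by (intro continuous_intros assms)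

text \<open>
  Expand the determinant over permutations: at the identity matrix, every permutation other than
  the identity contributes a product with at least two vanishing factors, so only the diagonal
  terms survive differentiation.
\<close>

lemma has_real_derivative_det_at_mat_1:
  fixes F :: "real \<Rightarrow> real ^ 'n ^ 'n"
  assumes der: "\<And>i j. ((\<lambda>t. F t $ i $ j) has_real_derivative F' $ i $ j) (at t)"
    and one: "F t = mat 1"
  shows "((\<lambda>t. det (F t)) has_real_derivative trace F') (at t)"
proof -
  let ?P = "{p. p permutes (UNIV :: 'n set)}"
  have "((\<lambda>t. det (F t)) has_real_derivative
      (\<Sum>p\<in>?P. of_int (sign p) * (\<Sum>i\<in>UNIV. F' $ i $ p i * (\<Prod>j\<in>UNIV - {i}. F t $ j $ p j)))) (at t)"
    unfolding det_def
    by (intro DERIV_sum DERIV_cmult has_field_derivative_prod der) 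
  also have "(\<Sum>p\<in>?P. of_int (sign p) * (\<Sum>i\<in>UNIV. F' $ i $ p i * (\<Prod>j\<in>UNIV - {i}. F t $ j $ p j)))
      = (\<Sum>p\<in>{id}. of_int (sign p) * (\<Sum>i\<in>UNIV. F' $ i $ p i * (\<Prod>j\<in>UNIV - {i}. F t $ j $ p j)))"
  proof (rule sum.mono_neutral_right)
    show "\<forall>p\<in>?P - {id}. of_int (sign p) *
        (\<Sum>i\<in>UNIV. F' $ i $ p i * (\<Prod>j\<in>UNIV - {i}. F t $ j $ p j)) = 0"
    proof
      fix p assume p: "p \<in> ?P - {id}"
      have "(\<Prod>j\<in>UNIV - {i}. F t $ j $ p j) = 0" for i
      proof -
        have "\<exists>j. j \<noteq> i \<and> p j \<noteq> j"
        proof (rule ccontr)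
          assume "\<not> ?thesis"
          then have fixed: "\<And>j. j \<noteq> i \<Longrightarrow> p j = j" by blast
          have "p i = i"
            by (metis DiffD1 fixed mem_Collect_eq p permutes_inj inj_eq)
          with fixed have "p = id" by (metis eq_id_iff)
          then show False using p by simp
        qed
        then obtain j where j: "j \<noteq> i" "p j \<noteq> j" by blast
        then have "F t $ j $ p j = 0" by (simp add: one mat_def)
        then show ?thesis using j by (intro prod_zero) auto
      qed
      then show "of_int (sign p) *
        (\<Sum>i\<in>UNIV. F' $ i $ p i * (\<Prod>j\<in>UNIV - {i}. F t $ j $ p j)) = 0"
        by (simp only: mult_zero_right sum.neutral_const)
    qed
  qed (auto simp: permutes_id)
  also have "\<dots> = trace F'"
    by (simp add: one mat_def trace_def)
  finally show ?thesis .
qed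

lemma matrix_inv_mult:
  fixes B :: "'a::semiring_1 ^ 'n ^ 'm"
  assumes "invertible B"
  shows "B ** matrix_inv B = mat 1" "matrix_inv B ** B = mat 1"
  using someI_ex[OF assms[unfolded invertible_def]] by (auto simp: matrix_inv_def)

text \<open>
  Jacobi's formula. Multiplication by the inverse of \<open>F t\<close> moves the point of differentiation to the identity matrix.
\<close>

lemma has_real_derivative_det:
  fixes F :: "real \<Rightarrow> real ^ 'n ^ 'n"
  assumes der: "\<And>i j. ((\<lambda>t. F t $ i $ j) has_real_derivative F' $ i $ j) (at t)"
    and inv: "invertible (F t)"
  shows "((\<lambda>t. det (F t)) has_real_derivative det (F t) * trace (matrix_inv (F t) ** F')) (at t)"
proof -
  let ?B = "matrix_inv (F t)"
  have "((\<lambda>s. det (?B ** F s)) has_real_derivative trace (?B ** F')) (at t)"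
  proof (rule has_real_derivative_det_at_mat_1)
    show "((\<lambda>s. (?B ** F s) $ i $ j) has_real_derivative (?B ** F') $ i $ j) (at t)" for i j
      unfolding matrix_matrix_mult_def by (auto intro!: DERIV_sum DERIV_cmult der)
    show "?B ** F t = mat 1" using inv by (simp add: matrix_inv_mult)
  qed
  then have "((\<lambda>s. det (F t) * det (?B ** F s)) has_real_derivative det (F t) * trace (?B ** F')) (at t)"
    by (rule DERIV_cmult)
  moreover have "det (F t) * det (?B ** F s) = det (F s)" for s
  proof -
    have "det (F t ** ?B) = 1" by (simp add: matrix_inv_mult(1)[OF inv])
    then have "det (F t) * det ?B = 1" by (simp add: det_mul)
    then show ?thesis by (simp add: det_mul mult.assoc[symmetric])
  qed
  ultimately show ?thesis by simp
qed

text \<open>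
  The observations \<open>j < m\<close> determine \<open>\<beta>\<close>. Two dual norms measure all quantities relative to the design:
  \<open>design_norm\<close> is \<open>b \<mapsto> (b' X'X b)\<^sup>1\<^sup>/\<^sup>2\<close>, and \<open>score_norm\<close> is \<open>n \<mapsto> (n' (X'X)\<^sup>-\<^sup>1 n)\<^sup>1\<^sup>/\<^sup>2\<close>. The second gives the
  row \<open>x j\<close> the square root of its leverage as its norm, so the leverage condition enters
  every estimate through \<open>score_norm x m (x j)\<close>.
\<close>

definition design_norm :: "(nat \<Rightarrow> real ^ 'p) \<Rightarrow> nat \<Rightarrow> real ^ 'p \<Rightarrow> real"
  where "design_norm x m b = L2_set (\<lambda>j. x j \<bullet> b) {..<m}"

definition score_norm :: "(nat \<Rightarrow> real ^ 'p) \<Rightarrow> nat \<Rightarrow> real ^ 'p \<Rightarrow> real"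
  where "score_norm x m n = design_norm x m (matrix_inv (gram x m (\<lambda>_. 1)) *v n)"

lemma design_norm_nonneg: "0 \<le> design_norm x m b"
  by (simp add: design_norm_def L2_set_nonneg)

lemma score_norm_nonneg: "0 \<le> score_norm x m n"
  by (simp add: score_norm_def design_norm_nonneg)

lemma design_norm_sq: "(design_norm x m b)\<^sup>2 = (\<Sum>j<m. (x j \<bullet> b)\<^sup>2)"
  by (simp add: design_norm_def L2_set_def sum_nonneg)

lemma design_norm_add: "design_norm x m (b + b') \<le> design_norm x m b + design_norm x m b'"
  by (simp add: design_norm_def inner_add_right L2_set_triangle_ineq)

lemma design_norm_scaleR: "design_norm x m (c *\<^sub>R b) = \<bar>c\<bar> * design_norm x m b"
proof -
  have "design_norm x m (c *\<^sub>R b) = sqrt (c\<^sup>2 * (\<Sum>j<m. (x j \<bullet> b)\<^sup>2))"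
    by (simp add: design_norm_def L2_set_def power_mult_distrib sum_distrib_left)
  then show ?thesis by (simp add: real_sqrt_mult design_norm_def L2_set_def)
qed

lemma score_norm_add: "score_norm x m (n + n') \<le> score_norm x m n + score_norm x m n'"
  by (simp add: score_norm_def matrix_vector_right_distrib design_norm_add)

lemma score_norm_scaleR: "score_norm x m (c *\<^sub>R n) = \<bar>c\<bar> * score_norm x m n"
  by (simp add: score_norm_def matrix_vector_mult_scaleR design_norm_scaleR)

lemma score_norm_sum:
  "score_norm x m (\<Sum>j\<in>J. f j) \<le> (\<Sum>j\<in>J. score_norm x m (f j))"
proof (induction J rule: infinite_finite_induct)
  case (insert a J)
  then show ?case using score_norm_add[of x m "f a" "sum f J"] by simp
qed (simp_all add: score_norm_def design_norm_def L2_set_def)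

lemma sum_weighted_inner_le:
  assumes "\<And>j. j < m \<Longrightarrow> \<bar>d j\<bar> \<le> \<delta>" "0 \<le> \<delta>"
  shows "\<bar>\<Sum>j<m. d j * ((x j \<bullet> b) * (x j \<bullet> b'))\<bar> \<le> \<delta> * (design_norm x m b * design_norm x m b')"
proof -
  have "\<bar>\<Sum>j<m. d j * ((x j \<bullet> b) * (x j \<bullet> b'))\<bar> \<le> (\<Sum>j<m. \<delta> * (\<bar>x j \<bullet> b\<bar> * \<bar>x j \<bullet> b'\<bar>))"
    by (intro order.trans[OF sum_abs] sum_mono) (auto simp: abs_mult intro!: mult_mono assms)
  also have "\<dots> = \<delta> * (\<Sum>j<m. \<bar>x j \<bullet> b\<bar> * \<bar>x j \<bullet> b'\<bar>)"
    by (simp add: sum_distrib_left)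
  also have "\<dots> \<le> \<delta> * (design_norm x m b * design_norm x m b')"
    unfolding design_norm_def by (intro mult_left_mono L2_set_mult_ineq assms)
  finally show ?thesis .
qed

locale full_rank_design =
  fixes x :: "nat \<Rightarrow> real ^ 'p" and m :: nat
  assumes span_rows: "span (x ` {..<m}) = UNIV"
begin

lemma eq_0_if_orthogonal_rows:
  assumes "\<And>j. j < m \<Longrightarrow> x j \<bullet> b = 0"
  shows "b = 0"
proof -
  have "orthogonal b b"
    by (rule orthogonal_to_span[of b "x ` {..<m}"])
       (use span_rows assms in \<open>auto simp: orthogonal_def inner_commute\<close>)
  then show ?thesis by (simp add: orthogonal_def)
qed

lemma gram_pos_def:
  assumes c: "\<And>j. j < m \<Longrightarrow> 0 < c j" and b: "b \<noteq> 0"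
  shows "0 < b \<bullet> (gram x m c *v b)"
proof -
  obtain j where j: "j < m" "x j \<bullet> b \<noteq> 0" using eq_0_if_orthogonal_rows b by blast
  show ?thesis
    unfolding inner_gram_mult_vec
    using j c by (intro sum_pos2[of _ j]) (auto simp: less_imp_le zero_less_mult_iff linorder_neq_iff)
qed

lemma gram_invertible:
  assumes "\<And>j. j < m \<Longrightarrow> 0 < c j"
  shows "invertible (gram x m c)"
proof -
  have "\<forall>b. gram x m c *v b = 0 \<longrightarrow> b = 0"
    using gram_pos_def[OF assms] by fastforce
  then show ?thesis
    using matrix_left_invertible_ker[of "gram x m c"] invertible_left_inverse by blast
qed

lemma gram_inv_cancel:
  assumes "\<And>j. j < m \<Longrightarrow> 0 < c j"
  shows "gram x m c *v (matrix_inv (gram x m c) *v n) = n"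
    and "matrix_inv (gram x m c) *v (gram x m c *v n) = n"
  using matrix_inv_mult[OF gram_invertible[of c]] assms by (simp_all add: matrix_vector_mul_assoc)

lemma det_gram_pos:
  assumes c: "\<And>j. j < m \<Longrightarrow> 0 < c j"
  shows "0 < det (gram x m c)"
proof (rule ccontr)
  \<comment> \<open>The segment from the identity to the Gram matrix consists of positive definite matrices.\<close>
  define F where "F t = (1 - t) *\<^sub>R mat 1 + t *\<^sub>R gram x m c" for t :: real
  have nz: "det (F t) \<noteq> 0" if t: "0 \<le> t" "t \<le> 1" for t
  proof -
    have "F t *v b = 0 \<Longrightarrow> b = 0" for b
    proof (rule ccontr)
      assume "F t *v b = 0" and b: "b \<noteq> 0"
      moreover have "F t *v b = (1 - t) *\<^sub>R b + t *\<^sub>R (gram x m c *v b)"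
        unfolding F_def matrix_vector_mult_add_rdistrib scaleR_matrix_vector_assoc[symmetric] by simp
      ultimately have "0 = b \<bullet> ((1 - t) *\<^sub>R b + t *\<^sub>R (gram x m c *v b))" by simp
      then have eq: "0 = (1 - t) * (b \<bullet> b) + t * (b \<bullet> (gram x m c *v b))"
        by (simp only: inner_add_right inner_scaleR_right)
      have pos: "0 < b \<bullet> b" "0 < b \<bullet> (gram x m c *v b)"
        using b gram_pos_def[OF c b] by auto
      have "0 < (1 - t) * (b \<bullet> b) + t * (b \<bullet> (gram x m c *v b))"
      proof (cases "t = 1")
        case False
        then have "0 < (1 - t) * (b \<bullet> b)" using t pos by simp
        moreover have "0 \<le> t * (b \<bullet> (gram x m c *v b))" using t pos by simp
        ultimately show ?thesis by linarith
      qed (use pos in simp)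
      with eq show False by linarith
    qed
    then have "invertible (F t)"
      using matrix_left_invertible_ker[of "F t"] invertible_left_inverse by blast
    then show ?thesis by (simp add: invertible_det_nz)
  qed
  assume "\<not> ?thesis"
  then have "det (F 1) \<le> 0" "0 \<le> det (F 0)" by (simp_all add: F_def)
  moreover have "continuous_on {0..1} (\<lambda>t. det (F t))"
    unfolding F_def by (intro continuous_det) (auto intro!: continuous_intros)
  ultimately obtain t where "0 \<le> t" "t \<le> 1" "det (F t) = 0"
    using IVT2'[of "\<lambda>t. det (F t)" 1 0 0] by auto
  then show False using nz by blast
qed

lemma inner_le_norms: "\<bar>n \<bullet> b\<bar> \<le> score_norm x m n * design_norm x m b"
proof -
  define c where "c = matrix_inv (gram x m (\<lambda>_. 1)) *v n"
  have "n = gram x m (\<lambda>_. 1) *v c"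
    unfolding c_def by (simp add: gram_inv_cancel)
  then have "n \<bullet> b = (\<Sum>j<m. 1 * ((x j \<bullet> b) * (x j \<bullet> c)))"
    using inner_gram_mult_vec[of b x m "\<lambda>_. 1" c] by (simp add: inner_commute)
  then have "\<bar>n \<bullet> b\<bar> \<le> 1 * (design_norm x m b * design_norm x m c)"
    using sum_weighted_inner_le[of m "\<lambda>_. 1" 1 x b c] by simp
  then show ?thesis by (simp add: c_def score_norm_def mult.commute)
qed

lemma score_norm_row: "(score_norm x m (x j))\<^sup>2 = leverage x m j"
proof -
  define c where "c = matrix_inv (gram x m (\<lambda>_. 1)) *v x j"
  have "(score_norm x m (x j))\<^sup>2 = (\<Sum>k<m. 1 * ((x k \<bullet> c) * (x k \<bullet> c)))"
    unfolding score_norm_def c_def[symmetric] design_norm_sq by (simp add: power2_eq_square)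
  also have "\<dots> = c \<bullet> (gram x m (\<lambda>_. 1) *v c)" by (simp only: inner_gram_mult_vec)
  also have "\<dots> = c \<bullet> x j" by (simp add: c_def gram_inv_cancel)
  finally show ?thesis by (simp add: leverage_def c_def inner_commute)
qed

text \<open>
  Take the inner product of the linear system with its own solution \<open>b\<close>: the left-hand side is at least \<open>l\<close> times the square of
  \<open>design_norm x m b\<close>, the right-hand side at most the product of the two dual norms.
\<close>

lemma design_norm_solution_le:
  assumes c: "\<And>j. j < m \<Longrightarrow> l \<le> c j" "0 < l"
  shows "design_norm x m (matrix_inv (gram x m c) *v n) \<le> score_norm x m n / l"
proof -
  define b where "b = matrix_inv (gram x m c) *v n"
  have pos: "\<And>j. j < m \<Longrightarrow> 0 < c j" using c by force
  have "l * (design_norm x m b)\<^sup>2 \<le> b \<bullet> (gram x m c *v b)"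
    unfolding design_norm_sq inner_gram_mult_vec sum_distrib_left unfolding power2_eq_square
    by (intro sum_mono mult_right_mono c) auto
  also have "\<dots> = n \<bullet> b" by (simp add: b_def gram_inv_cancel[OF pos] inner_commute)
  also have "\<dots> \<le> score_norm x m n * design_norm x m b" using inner_le_norms[of n b] by linarith
  finally have *: "l * design_norm x m b * design_norm x m b \<le> score_norm x m n * design_norm x m b"
    by (simp add: power2_eq_square mult.assoc)
  have "l * design_norm x m b \<le> score_norm x m n"
  proof (cases "design_norm x m b = 0")
    case False
    then have "0 < design_norm x m b" using design_norm_nonneg[of x m b] by linarith
    with * show ?thesis by (simp add: mult_le_cancel_right)
  qed (simp add: score_norm_nonneg)
  then show ?thesis using c(2) by (simp add: b_def field_simps)
qed

text \<open>
  The difference of the solutions solves the first system with the right-hand side \<open>n - n'\<close> plus the effect of the change of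
  weights on the second solution.
\<close>

lemma design_norm_solution_diff_le:
  assumes c: "\<And>j. j < m \<Longrightarrow> l \<le> c j" "0 < l"
    and c': "\<And>j. j < m \<Longrightarrow> 0 < c' j"
    and d: "\<And>j. j < m \<Longrightarrow> \<bar>c j - c' j\<bar> \<le> \<delta>" "0 \<le> \<delta>"
  shows "design_norm x m (matrix_inv (gram x m c) *v n - matrix_inv (gram x m c') *v n')
    \<le> (score_norm x m (n - n') + \<delta> * design_norm x m (matrix_inv (gram x m c') *v n')) / l"
proof -
  define b b' where "b = matrix_inv (gram x m c) *v n" and "b' = matrix_inv (gram x m c') *v n'"
  let ?d = "design_norm x m (b - b')"
  have pos: "\<And>j. j < m \<Longrightarrow> 0 < c j" using c by force
  have 1: "gram x m c *v b = n" "gram x m c' *v b' = n'"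
    by (simp_all add: b_def b'_def gram_inv_cancel[OF pos] gram_inv_cancel[OF c'])
  have "l * ?d\<^sup>2 \<le> (b - b') \<bullet> (gram x m c *v (b - b'))"
    unfolding design_norm_sq inner_gram_mult_vec sum_distrib_left unfolding power2_eq_square
    by (intro sum_mono mult_right_mono c) auto
  also have "\<dots> = (n - n') \<bullet> (b - b')
      - (\<Sum>j<m. (c j - c' j) * ((x j \<bullet> (b - b')) * (x j \<bullet> b')))"
  proof -
    have "(\<Sum>j<m. (c j - c' j) * ((x j \<bullet> (b - b')) * (x j \<bullet> b')))
        = (b - b') \<bullet> (gram x m c *v b') - (b - b') \<bullet> (gram x m c' *v b')"
      unfolding inner_gram_mult_vec sum_subtractf[symmetric] left_diff_distrib ..
    then show ?thesis
      unfolding 1 matrix_vector_mult_diff_distrib by (simp add: inner_diff_right inner_diff_left inner_commute)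
  qed
  also have "\<dots> \<le> score_norm x m (n - n') * ?d + \<delta> * (?d * design_norm x m b')"
    using inner_le_norms[of "n - n'" "b - b'"]
      sum_weighted_inner_le[of m "\<lambda>j. c j - c' j" \<delta> x "b - b'" b', OF d] by linarith
  finally have *: "l * ?d * ?d \<le> (score_norm x m (n - n') + \<delta> * design_norm x m b') * ?d"
    by (simp add: power2_eq_square algebra_simps)
  have "l * ?d \<le> score_norm x m (n - n') + \<delta> * design_norm x m b'"
  proof (cases "?d = 0")
    case False
    then have "0 < ?d" using design_norm_nonneg[of x m "b - b'"] by linarith
    with * show ?thesis by (simp add: mult_le_cancel_right)
  qed (simp add: score_norm_nonneg d design_norm_nonneg)
  then show ?thesis using c(2) by (simp add: b_def b'_def field_simps)
qed

end

section \<open>The residual likelihood and its derivative\<close>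

section \<open>The residual likelihood and its score\<close>

definition wt :: "(nat \<Rightarrow> real) \<Rightarrow> real \<Rightarrow> nat \<Rightarrow> real"
  where "wt D a j = 1 / (a + D j)"

definition wsum :: "(nat \<Rightarrow> real ^ 'p) \<Rightarrow> nat \<Rightarrow> (nat \<Rightarrow> real) \<Rightarrow> (nat \<Rightarrow> real) \<Rightarrow> real ^ 'p"
  where "wsum x m c u = (\<Sum>j<m. (c j * u j) *\<^sub>R x j)"

definition fit :: "(nat \<Rightarrow> real ^ 'p) \<Rightarrow> nat \<Rightarrow> (nat \<Rightarrow> real) \<Rightarrow> (nat \<Rightarrow> real) \<Rightarrow> nat \<Rightarrow> real"
  where "fit x m c u j = x j \<bullet> wls x m c u"

text \<open>
  The entries of \<open>X (X' diag(c) X)\<^sup>-\<^sup>1 X'\<close>: the reproducing kernel of the column space of \<open>X\<close> for the inner product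
  with weights \<open>c\<close>.
\<close>

definition gkernel :: "(nat \<Rightarrow> real ^ 'p) \<Rightarrow> nat \<Rightarrow> (nat \<Rightarrow> real) \<Rightarrow> nat \<Rightarrow> nat \<Rightarrow> real"
  where "gkernel x m c j k = x j \<bullet> (matrix_inv (gram x m c) *v x k)"

definition wrss :: "(nat \<Rightarrow> real ^ 'p) \<Rightarrow> nat \<Rightarrow> (nat \<Rightarrow> real) \<Rightarrow> (nat \<Rightarrow> real) \<Rightarrow> real"
  where "wrss x m c u = (\<Sum>j<m. c j * (u j - fit x m c u j)\<^sup>2)"

lemma wls_eq: "wls x m c u = matrix_inv (gram x m c) *v wsum x m c u"
  by (simp add: wls_def wsum_def)

lemma inner_wsum: "wsum x m c u \<bullet> b = (\<Sum>j<m. c j * u j * (x j \<bullet> b))"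
  by (simp add: wsum_def inner_sum_left)

lemma fit_eq_sum: "fit x m c u j = (\<Sum>k<m. gkernel x m c j k * (c k * u k))"
  by (simp add: fit_def wls_def gkernel_def inner_sum_right matrix_vector_mult_scaleR
      linear_sum[OF matrix_vector_mul_linear] ac_simps)

lemma trace_mult_gram:
  "trace (B ** gram x m c) = (\<Sum>j<m. c j * (x j \<bullet> (B *v x j)))"
proof -
  have "trace (B ** gram x m c) = (\<Sum>a\<in>UNIV. \<Sum>b\<in>UNIV. \<Sum>j<m. B $ a $ b * (x j $ b * c j * x j $ a))"
    by (simp add: trace_def matrix_matrix_mult_def gram_def sum_distrib_left)
  also have "\<dots> = (\<Sum>j<m. \<Sum>a\<in>UNIV. \<Sum>b\<in>UNIV. B $ a $ b * (x j $ b * c j * x j $ a))"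
    by (simp only: sum.swap[of _ "{..<m}" UNIV])
  also have "\<dots> = (\<Sum>j<m. c j * (x j \<bullet> (B *v x j)))"
    by (simp add: inner_vec_def matrix_vector_mult_def sum_distrib_left ac_simps)
  finally show ?thesis .
qed

context full_rank_design
begin

context
  fixes c :: "nat \<Rightarrow> real"
  assumes c: "\<And>j. j < m \<Longrightarrow> 0 < c j"
begin

lemma normal_equations: "gram x m c *v wls x m c u = wsum x m c u"
  by (simp add: wls_eq gram_inv_cancel c)

lemma residuals_orthogonal: "(\<Sum>j<m. c j * (u j - fit x m c u j) * (x j \<bullet> b)) = 0"
proof -
  have "wsum x m c u \<bullet> b = b \<bullet> (gram x m c *v wls x m c u)"
    by (simp add: normal_equations inner_commute)
  then show ?thesis
    unfolding inner_wsum inner_gram_mult_vec fit_def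
    by (simp add: algebra_simps sum_subtractf)
qed

lemma wrss_eq: "wrss x m c u = (\<Sum>j<m. c j * (u j)\<^sup>2) - wsum x m c u \<bullet> wls x m c u"
proof -
  have "wrss x m c u = (\<Sum>j<m. c j * (u j)\<^sup>2) - (\<Sum>j<m. c j * u j * (x j \<bullet> wls x m c u))
      - (\<Sum>j<m. c j * (u j - fit x m c u j) * (x j \<bullet> wls x m c u))"
    unfolding wrss_def sum_subtractf[symmetric]
    by (intro sum.cong refl) (simp add: fit_def power2_eq_square algebra_simps)
  then show ?thesis by (simp add: residuals_orthogonal inner_wsum)
qed

lemma wrss_nonneg: "0 \<le> wrss x m c u"
  unfolding wrss_def using c by (intro sum_nonneg) (simp add: less_imp_le)

lemma wls_add_fixed: "wls x m c (\<lambda>j. x j \<bullet> b + u j) = b + wls x m c u"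
proof -
  have "wsum x m c (\<lambda>j. x j \<bullet> b + u j) = gram x m c *v b + wsum x m c u"
    by (simp add: wsum_def gram_mult_vec sum.distrib scaleR_left_distrib distrib_left)
  then show ?thesis
    by (simp add: wls_eq matrix_vector_right_distrib gram_inv_cancel c)
qed

lemma gkernel_sym: "gkernel x m c j k = gkernel x m c k j"
proof -
  define b b' where "b = matrix_inv (gram x m c) *v x j" and "b' = matrix_inv (gram x m c) *v x k"
  have eq: "gram x m c *v b = x j" "gram x m c *v b' = x k"
    by (simp_all add: b_def b'_def gram_inv_cancel c)
  have "b' \<bullet> (gram x m c *v b) = b \<bullet> (gram x m c *v b')"
    unfolding inner_gram_mult_vec by (simp add: mult.commute)
  then show ?thesis
    unfolding eq by (simp add: gkernel_def b_def b'_def inner_commute)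
qed

lemma gkernel_reproducing:
  "(\<Sum>l<m. c l * (gkernel x m c l j * gkernel x m c l k)) = gkernel x m c j k"
proof -
  define b b' where "b = matrix_inv (gram x m c) *v x j" and "b' = matrix_inv (gram x m c) *v x k"
  have "(\<Sum>l<m. c l * (gkernel x m c l j * gkernel x m c l k)) = b' \<bullet> (gram x m c *v b)"
    unfolding inner_gram_mult_vec gkernel_def b_def b'_def by (simp add: ac_simps)
  also have "\<dots> = b' \<bullet> x j" by (simp add: b_def gram_inv_cancel c)
  finally show ?thesis by (simp add: b'_def gkernel_def inner_commute)
qed

end

text \<open>
  By the normal equations for both weights, both weighted sums of squares equal sums of products of
  the two residual vectors. The difference is therefore exact, with no term from the change of
  the fit: this is the envelope theorem in finite form.
\<close>

lemma wrss_diff: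
  assumes c: "\<And>j. j < m \<Longrightarrow> 0 < c j" and c': "\<And>j. j < m \<Longrightarrow> 0 < c' j"
  shows "wrss x m c' u - wrss x m c u
    = (\<Sum>j<m. (c' j - c j) * ((u j - fit x m c u j) * (u j - fit x m c' u j)))"
proof -
  have "wrss x m c' u = (\<Sum>j<m. c' j * ((u j - fit x m c u j) * (u j - fit x m c' u j)))
      + (\<Sum>j<m. c' j * (u j - fit x m c' u j) * (x j \<bullet> (wls x m c u - wls x m c' u)))"
    unfolding wrss_def sum.distrib[symmetric]
    by (intro sum.cong refl) (simp add: fit_def power2_eq_square algebra_simps)
  moreover have "wrss x m c u = (\<Sum>j<m. c j * ((u j - fit x m c u j) * (u j - fit x m c' u j)))
      + (\<Sum>j<m. c j * (u j - fit x m c u j) * (x j \<bullet> (wls x m c' u - wls x m c u)))"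
    unfolding wrss_def sum.distrib[symmetric]
    by (intro sum.cong refl) (simp add: fit_def power2_eq_square algebra_simps)
  ultimately show ?thesis
    by (simp add: residuals_orthogonal c c' left_diff_distrib sum_subtractf)
qed

end

lemma DERIV_wt: "a + D j \<noteq> 0 \<Longrightarrow> ((\<lambda>a. wt D a j) has_real_derivative - (wt D a j)\<^sup>2) (at a)"
  unfolding wt_def by (auto intro!: derivative_eq_intros simp: power2_eq_square field_simps)

text \<open>
  The derivative of the logarithmic residual likelihood \<open>profile_loglik\<close> with respect to \<open>a\<close>.
\<close>

definition profile_score :: "(nat \<Rightarrow> real ^ 'p) \<Rightarrow> (nat \<Rightarrow> real) \<Rightarrow> nat \<Rightarrow> real \<Rightarrow> (nat \<Rightarrow> real) \<Rightarrow> real"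
  where "profile_score x D m a u = 1 / 2 * (\<Sum>j<m. (wt D a j)\<^sup>2 * (u j - fit x m (wt D a) u j)\<^sup>2
    - wt D a j + (wt D a j)\<^sup>2 * gkernel x m (wt D a) j j)"

definition profile_loglik :: "(nat \<Rightarrow> real ^ 'p) \<Rightarrow> (nat \<Rightarrow> real) \<Rightarrow> nat \<Rightarrow> real \<Rightarrow> (nat \<Rightarrow> real) \<Rightarrow> real"
  where "profile_loglik x D m a u =
    - 1 / 2 * (ln (det (gram x m (wt D a))) + (\<Sum>j<m. ln (a + D j)) + wrss x m (wt D a) u)"

locale bounded_design =
  fixes x :: "nat \<Rightarrow> real ^ 'p" and D :: "nat \<Rightarrow> real" and d\<^sub>0 d\<^sub>1 cq :: real and m\<^sub>0 :: nat
  assumes d0_pos: "0 < d\<^sub>0" and D_ge: "\<And>j. d\<^sub>0 \<le> D j" and D_le: "\<And>j. D j \<le> d\<^sub>1"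
    and m0_pos: "0 < m\<^sub>0"
    and full_rank: "\<And>m. m\<^sub>0 \<le> m \<Longrightarrow> full_rank_design x m"
    and leverage_le: "\<And>m j. m\<^sub>0 \<le> m \<Longrightarrow> j < m \<Longrightarrow> leverage x m j \<le> cq / real m"
begin

lemma D_pos: "0 < D j" using d0_pos D_ge[of j] by linarith
lemma d1_pos: "0 < d\<^sub>1" using D_pos[of 0] D_le[of 0] by linarith
lemma d0_le_d1: "d\<^sub>0 \<le> d\<^sub>1" using D_ge[of 0] D_le[of 0] by linarith

lemma wt_pos: "0 \<le> a \<Longrightarrow> 0 < wt D a j"
  using D_pos[of j] by (simp add: wt_def)

lemma wt_le: "0 \<le> a \<Longrightarrow> wt D a j \<le> 1 / d\<^sub>0"
  using D_ge[of j] d0_pos by (simp add: wt_def frac_le)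

lemma wt_ge: "0 \<le> a \<Longrightarrow> 1 / (a + d\<^sub>1) \<le> wt D a j"
  using D_le[of j] D_pos[of j] by (simp add: wt_def frac_le)

lemma wt_diff: "0 \<le> a \<Longrightarrow> 0 \<le> a' \<Longrightarrow> wt D a j - wt D a' j = (a' - a) * (wt D a j * wt D a' j)"
  using D_pos[of j] by (simp add: wt_def field_simps)

lemma wt_lipschitz: "0 \<le> a \<Longrightarrow> 0 \<le> a' \<Longrightarrow> \<bar>wt D a j - wt D a' j\<bar> \<le> \<bar>a - a'\<bar> / d\<^sub>0\<^sup>2"
proof -
  assume a: "0 \<le> a" "0 \<le> a'"
  have "\<bar>wt D a j - wt D a' j\<bar> = \<bar>a - a'\<bar> * (wt D a j * wt D a' j)"
    using wt_pos[OF a(1), of j] wt_pos[OF a(2), of j] by (simp add: wt_diff[OF a] abs_mult)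
  also have "\<dots> \<le> \<bar>a - a'\<bar> * (1 / d\<^sub>0 * (1 / d\<^sub>0))"
    using wt_pos[OF a(1), of j] wt_pos[OF a(2), of j] d0_pos
    by (intro mult_left_mono mult_mono wt_le a) auto
  finally show ?thesis by (simp add: power2_eq_square)
qed

lemma cq_nonneg: "0 \<le> cq"
proof -
  interpret full_rank_design x m\<^sub>0 by (rule full_rank) simp
  have "0 \<le> cq / real m\<^sub>0"
    using leverage_le[of m\<^sub>0 0] m0_pos score_norm_row[of 0] by (metis order_refl order_trans zero_le_power2)
  then show ?thesis using m0_pos by (simp add: zero_le_divide_iff)
qed

lemma score_norm_row_le:
  assumes "m\<^sub>0 \<le> m" "j < m"
  shows "score_norm x m (x j) \<le> sqrt (cq / real m)"
proof -
  interpret full_rank_design x m by (rule full_rank) fact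
  show ?thesis using leverage_le[OF assms] score_norm_row[of j]
    by (metis real_le_rsqrt)
qed

lemma design_norm_solution_row_le:
  assumes "m\<^sub>0 \<le> m" "j < m" "0 \<le> a"
  shows "design_norm x m (matrix_inv (gram x m (wt D a)) *v x j) \<le> (a + d\<^sub>1) * sqrt (cq / real m)"
proof -
  interpret full_rank_design x m by (rule full_rank) fact
  have pos: "0 < a + d\<^sub>1" using d1_pos assms by linarith
  have "design_norm x m (matrix_inv (gram x m (wt D a)) *v x j) \<le> score_norm x m (x j) / (1 / (a + d\<^sub>1))"
    using pos by (intro design_norm_solution_le wt_ge assms) auto
  also have "\<dots> \<le> sqrt (cq / real m) / (1 / (a + d\<^sub>1))"
    using pos by (intro divide_right_mono score_norm_row_le assms) auto
  finally show ?thesis using pos by (simp add: mult.commute)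
qed

lemma gkernel_le:
  assumes "m\<^sub>0 \<le> m" "j < m" "k < m" "0 \<le> a"
  shows "\<bar>gkernel x m (wt D a) j k\<bar> \<le> (a + d\<^sub>1) * (cq / real m)"
proof -
  interpret full_rank_design x m by (rule full_rank) fact
  have pos: "0 < a + d\<^sub>1" using d1_pos assms by linarith
  have "\<bar>gkernel x m (wt D a) j k\<bar>
      \<le> score_norm x m (x j) * design_norm x m (matrix_inv (gram x m (wt D a)) *v x k)"
    unfolding gkernel_def by (rule inner_le_norms)
  also have "\<dots> \<le> sqrt (cq / real m) * ((a + d\<^sub>1) * sqrt (cq / real m))"
    using cq_nonneg by (intro mult_mono score_norm_row_le design_norm_solution_row_le assms)
      (auto simp: design_norm_nonneg)
  also have "\<dots> = (a + d\<^sub>1) * (sqrt (cq / real m))\<^sup>2" by (simp only: power2_eq_square ac_simps)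
  finally show ?thesis using cq_nonneg by simp
qed

lemma gkernel_diag_nonneg:
  assumes "m\<^sub>0 \<le> m" "0 \<le> a"
  shows "0 \<le> gkernel x m (wt D a) j j"
proof -
  interpret full_rank_design x m by (rule full_rank) fact
  have "gkernel x m (wt D a) j j
      = (\<Sum>l<m. wt D a l * (gkernel x m (wt D a) l j * gkernel x m (wt D a) l j))"
    using gkernel_reproducing[of "wt D a" j j] wt_pos assms by simp
  also have "0 \<le> \<dots>"
    using wt_pos[OF assms(2)] by (intro sum_nonneg) (simp add: less_imp_le)
  finally show ?thesis .
qed

lemma fit_le:
  assumes "m\<^sub>0 \<le> m" "j < m"
  shows "\<bar>fit x m c u j\<bar> \<le> sqrt (cq / real m) * design_norm x m (wls x m c u)"
proof -
  interpret full_rank_design x m by (rule full_rank) fact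
  show ?thesis unfolding fit_def
    by (rule order.trans[OF inner_le_norms]) (intro mult_right_mono score_norm_row_le assms design_norm_nonneg)
qed

lemma score_norm_wsum_le:
  assumes "m\<^sub>0 \<le> m" "\<And>j. j < m \<Longrightarrow> \<bar>c j\<bar> \<le> \<delta>" "0 \<le> \<delta>"
  shows "score_norm x m (wsum x m c u) \<le> \<delta> * sqrt (cq / real m) * (\<Sum>j<m. \<bar>u j\<bar>)"
proof -
  have "score_norm x m (wsum x m c u) \<le> (\<Sum>j<m. \<bar>c j * u j\<bar> * score_norm x m (x j))"
    unfolding wsum_def using score_norm_sum[of x m "\<lambda>j. (c j * u j) *\<^sub>R x j" "{..<m}"]
    by (simp add: score_norm_scaleR)
  also have "\<dots> \<le> (\<Sum>j<m. (\<delta> * \<bar>u j\<bar>) * sqrt (cq / real m))"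
    unfolding abs_mult by (intro sum_mono mult_mono assms score_norm_row_le)
      (use assms in \<open>auto simp: score_norm_nonneg\<close>)
  also have "\<dots> = \<delta> * sqrt (cq / real m) * (\<Sum>j<m. \<bar>u j\<bar>)"
    by (simp add: sum_distrib_left ac_simps)
  finally show ?thesis .
qed

lemma wsum_diff: "wsum x m c u - wsum x m c' u = wsum x m (\<lambda>j. c j - c' j) u"
  by (simp add: wsum_def sum_subtractf scaleR_left_diff_distrib left_diff_distrib)

lemma has_real_derivative_ln_det_gram:
  assumes "m\<^sub>0 \<le> m" "0 \<le> a"
  shows "((\<lambda>a. ln (det (gram x m (wt D a)))) has_real_derivative
    - (\<Sum>j<m. (wt D a j)\<^sup>2 * gkernel x m (wt D a) j j)) (at a)"
proof -
  interpret full_rank_design x m by (rule full_rank) fact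
  have pos: "0 < det (gram x m (wt D a))" by (intro det_gram_pos wt_pos assms)
  have nz: "a + D j \<noteq> 0" for j using D_pos[of j] assms by linarith
  have "((\<lambda>a. det (gram x m (wt D a))) has_real_derivative det (gram x m (wt D a)) *
      trace (matrix_inv (gram x m (wt D a)) ** gram x m (\<lambda>j. - (wt D a j)\<^sup>2))) (at a)"
  proof (rule has_real_derivative_det)
    show "invertible (gram x m (wt D a))" by (intro gram_invertible wt_pos assms)
    show "((\<lambda>a. gram x m (wt D a) $ r $ s) has_real_derivative
        gram x m (\<lambda>j. - (wt D a j)\<^sup>2) $ r $ s) (at a)" for r s
      unfolding gram_def
      by (auto intro!: derivative_eq_intros DERIV_wt nz intro: sum.cong)
  qed
  from DERIV_chain2[OF DERIV_ln_divide[OF pos] this] pos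
  show ?thesis
    by (simp add: trace_mult_gram gkernel_def sum_negf)
qed

text \<open>
  The derivative is a sum of \<open>m\<close> leverages of order \<open>1 / m\<close>; hence the determinant stays of order one in the comparison of
  two likelihoods, whose other terms are of order \<open>m\<close>.
\<close>

lemma ln_det_gram_lipschitz:
  assumes "m\<^sub>0 \<le> m" "0 \<le> a" "0 \<le> a'"
  shows "\<bar>ln (det (gram x m (wt D a))) - ln (det (gram x m (wt D a')))\<bar> \<le> cq * d\<^sub>1 / d\<^sub>0\<^sup>2 * \<bar>a - a'\<bar>"
proof -
  have m: "0 < real m" using assms m0_pos by simp
  have bd: "\<bar>- (\<Sum>j<m. (wt D b j)\<^sup>2 * gkernel x m (wt D b) j j)\<bar> \<le> cq * d\<^sub>1 / d\<^sub>0\<^sup>2" if b: "0 \<le> b" for b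
  proof -
    have "\<bar>- (\<Sum>j<m. (wt D b j)\<^sup>2 * gkernel x m (wt D b) j j)\<bar>
        \<le> (\<Sum>j<m. cq * d\<^sub>1 / d\<^sub>0\<^sup>2 / real m)"
      unfolding abs_minus_cancel
    proof (intro order.trans[OF sum_abs] sum_mono)
      fix j assume "j \<in> {..<m}"
      then have j: "j < m" by simp
      have w: "wt D b j * (b + d\<^sub>1) \<le> d\<^sub>1 / d\<^sub>0"
      proof -
        have "d\<^sub>1 * d\<^sub>0 \<le> d\<^sub>1 * D j" "b * d\<^sub>0 \<le> b * d\<^sub>1"
          using d1_pos b by (simp_all add: mult_left_mono D_ge d0_le_d1)
        then have "(b + d\<^sub>1) * d\<^sub>0 \<le> d\<^sub>1 * (b + D j)"
          unfolding distrib_left distrib_right by (simp add: mult.commute)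
        moreover have "0 < b + D j" using b D_pos[of j] by linarith
        ultimately have "(b + d\<^sub>1) / (b + D j) \<le> d\<^sub>1 / d\<^sub>0"
          using d0_pos by (simp add: pos_divide_le_eq pos_le_divide_eq mult.commute)
        then show ?thesis unfolding wt_def by simp
      qed
      have "\<bar>(wt D b j)\<^sup>2 * gkernel x m (wt D b) j j\<bar> \<le> (wt D b j)\<^sup>2 * ((b + d\<^sub>1) * (cq / real m))"
        unfolding abs_mult abs_power2
        by (intro mult_left_mono gkernel_le assms j b) auto
      also have "\<dots> = wt D b j * (wt D b j * (b + d\<^sub>1)) * (cq / real m)"
        by (simp add: power2_eq_square)
      also have "\<dots> \<le> 1 / d\<^sub>0 * (d\<^sub>1 / d\<^sub>0) * (cq / real m)"
        using cq_nonneg d0_pos d1_pos b wt_pos[OF b, of j]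
        by (intro mult_right_mono mult_mono wt_le w) auto
      finally show "\<bar>(wt D b j)\<^sup>2 * gkernel x m (wt D b) j j\<bar> \<le> cq * d\<^sub>1 / d\<^sub>0\<^sup>2 / real m"
        by (simp add: power2_eq_square ac_simps)
    qed
    then show ?thesis using m by simp
  qed
  have "norm (ln (det (gram x m (wt D a))) - ln (det (gram x m (wt D a'))))
      \<le> (cq * d\<^sub>1 / d\<^sub>0\<^sup>2) * norm (a - a')"
  proof (rule field_differentiable_bound)
    show "((\<lambda>a. ln (det (gram x m (wt D a)))) has_field_derivative
        - (\<Sum>j<m. (wt D b j)\<^sup>2 * gkernel x m (wt D b) j j)) (at b within {0..})" if "b \<in> {0..}" for b
      by (rule has_field_derivative_at_within, rule has_real_derivative_ln_det_gram)
         (use assms that in auto)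
    show "norm (- (\<Sum>j<m. (wt D b j)\<^sup>2 * gkernel x m (wt D b) j j)) \<le> cq * d\<^sub>1 / d\<^sub>0\<^sup>2" if "b \<in> {0..}" for b
      unfolding real_norm_def by (rule bd) (use that in simp)
  qed (use assms in auto)
  then show ?thesis by simp
qed

text \<open>
  The quadratic form of \<open>P_V\<close> is the weighted residual sum of squares, which is unchanged by adding a vector of the column
  space of \<open>X\<close> to the observations. So \<open>\<beta>\<close> disappears and the likelihood is a function of \<open>u\<close>.
\<close>

lemma residual_likelihood_eq:
  assumes "m\<^sub>0 \<le> m" "0 \<le> a" and y: "\<And>j. y j = x j \<bullet> \<beta> + u j"
  shows "residual_likelihood x D m y a = exp (profile_loglik x D m a u)"
proof -
  interpret full_rank_design x m by (rule full_rank) fact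
  let ?c = "wt D a"
  have pos: "\<And>j. 0 < ?c j" by (rule wt_pos) fact
  have det: "0 < det (gram x m ?c)" by (intro det_gram_pos pos)
  have yy: "y = (\<lambda>j. x j \<bullet> \<beta> + u j)" using y by auto
  have g: "gram x m (\<lambda>j. 1 / (a + D j)) = gram x m ?c" by (simp add: wt_def[abs_def])
  have PV: "P_V x D m a j k = (if j = k then ?c j else 0) - ?c j * gkernel x m ?c j k * ?c k" for j k
    unfolding P_V_def gkernel_def g by (simp add: wt_def)
  have quad: "(\<Sum>j<m. \<Sum>k<m. y j * P_V x D m a j k * y k) = wrss x m ?c u"
  proof -
    have "(\<Sum>j<m. \<Sum>k<m. y j * P_V x D m a j k * y k)
        = (\<Sum>j<m. \<Sum>k<m. y j * (if j = k then ?c j else 0) * y k)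
          - (\<Sum>j<m. \<Sum>k<m. y j * (?c j * gkernel x m ?c j k * ?c k) * y k)"
      unfolding sum_subtractf[symmetric]
      by (intro sum.cong refl) (simp only: PV left_diff_distrib right_diff_distrib)
    also have "(\<Sum>j<m. \<Sum>k<m. y j * (if j = k then ?c j else 0) * y k) = (\<Sum>j<m. ?c j * (y j)\<^sup>2)"
    proof (intro sum.cong refl)
      fix j assume "j \<in> {..<m}"
      have "(\<Sum>k<m. y j * (if j = k then ?c j else 0) * y k) = (\<Sum>k<m. if j = k then ?c k * (y k)\<^sup>2 else 0)"
        by (intro sum.cong refl) (simp add: power2_eq_square)
      then show "(\<Sum>k<m. y j * (if j = k then ?c j else 0) * y k) = ?c j * (y j)\<^sup>2"
        using \<open>j \<in> {..<m}\<close> by simp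
    qed
    also have "(\<Sum>j<m. \<Sum>k<m. y j * (?c j * gkernel x m ?c j k * ?c k) * y k)
        = (\<Sum>j<m. ?c j * y j * fit x m ?c y j)"
    proof (intro sum.cong refl)
      fix j
      show "(\<Sum>k<m. y j * (?c j * gkernel x m ?c j k * ?c k) * y k) = ?c j * y j * fit x m ?c y j"
        unfolding fit_eq_sum sum_distrib_left by (intro sum.cong refl) (simp only: ac_simps)
    qed
    also have "\<dots> = wsum x m ?c y \<bullet> wls x m ?c y"
      by (simp add: inner_wsum fit_def)
    also have "(\<Sum>j<m. ?c j * (y j)\<^sup>2) - wsum x m ?c y \<bullet> wls x m ?c y = wrss x m ?c y"
      by (simp add: wrss_eq pos)
    also have "\<dots> = wrss x m ?c u"
      unfolding wrss_def fit_def yy wls_add_fixed[of ?c, OF pos]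
      by (simp add: inner_add_right)
    finally show ?thesis .
  qed
  have D: "0 < a + D j" for j using D_pos[of j] assms by linarith
  have "0 < (\<Prod>j<m. a + D j)" by (intro prod_pos) (simp add: D)
  moreover have "ln (\<Prod>j<m. a + D j) = (\<Sum>j<m. ln (a + D j))" by (intro ln_prod) (auto simp: less_imp_neq[OF D, symmetric])
  ultimately show ?thesis
    unfolding residual_likelihood_def quad g profile_loglik_def
    using det by (simp add: powr_def less_imp_neq[OF D, symmetric] exp_add[symmetric] algebra_simps)
qed

lemma fit_continuous:
  assumes "m\<^sub>0 \<le> m" "0 < a"
  shows "((\<lambda>a. fit x m (wt D a) u j) \<longlongrightarrow> fit x m (wt D a) u j) (at a)"
proof -
  interpret full_rank_design x m by (rule full_rank) fact
  define B where "B = (\<lambda>h. 1 / d\<^sub>0\<^sup>2 * sqrt (cq / real m) * (\<Sum>j<m. \<bar>u j\<bar>) * \<bar>h - a\<bar>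
    + 1 / d\<^sub>0\<^sup>2 * \<bar>h - a\<bar> * design_norm x m (wls x m (wt D a) u))"
  have "((\<lambda>h. score_norm x m (x j) * (B h * (2 * a + d\<^sub>1))) \<longlongrightarrow> score_norm x m (x j) * (B a * (2 * a + d\<^sub>1))) (at a)"
    unfolding B_def by (intro tendsto_intros)
  then have lim: "((\<lambda>h. score_norm x m (x j) * (B h * (2 * a + d\<^sub>1))) \<longlongrightarrow> 0) (at a)"
    by (simp add: B_def)
  have "eventually (\<lambda>h. 0 < h \<and> h < 2 * a) (at a)"
    using eventually_at_in_open[of "{0<..<2*a}" a] assms(2) by (auto elim: eventually_mono)
  then have "eventually (\<lambda>h. norm (fit x m (wt D h) u j - fit x m (wt D a) u j)
      \<le> score_norm x m (x j) * (B h * (2 * a + d\<^sub>1))) (at a)"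
  proof eventually_elim
    case (elim h)
    have l: "1 / (2 * a + d\<^sub>1) \<le> wt D h j" for j
      using wt_ge[of h j] elim d1_pos frac_le[of 1 1 "h + d\<^sub>1" "2 * a + d\<^sub>1"] by linarith
    have n: "score_norm x m (wsum x m (wt D h) u - wsum x m (wt D a) u)
        \<le> \<bar>h - a\<bar> / d\<^sub>0\<^sup>2 * sqrt (cq / real m) * (\<Sum>j<m. \<bar>u j\<bar>)"
      unfolding wsum_diff using elim assms by (intro score_norm_wsum_le wt_lipschitz) auto
    have "design_norm x m (wls x m (wt D h) u - wls x m (wt D a) u)
        \<le> (score_norm x m (wsum x m (wt D h) u - wsum x m (wt D a) u)
            + \<bar>h - a\<bar> / d\<^sub>0\<^sup>2 * design_norm x m (wls x m (wt D a) u)) / (1 / (2 * a + d\<^sub>1))"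
      unfolding wls_eq using elim assms d1_pos
      by (intro design_norm_solution_diff_le l wt_pos wt_lipschitz) auto
    also have "\<dots> \<le> B h / (1 / (2 * a + d\<^sub>1))"
      using n assms d1_pos unfolding B_def by (intro divide_right_mono) (auto simp: ac_simps)
    finally have "design_norm x m (wls x m (wt D h) u - wls x m (wt D a) u) \<le> B h * (2 * a + d\<^sub>1)"
      using assms d1_pos by simp
    then show ?case
      unfolding fit_def inner_diff_right[symmetric] real_norm_def
      by (intro order.trans[OF inner_le_norms] mult_left_mono score_norm_nonneg)
  qed
  from tendsto_0_le[OF lim, of _ 1] this
  have "((\<lambda>h. fit x m (wt D h) u j - fit x m (wt D a) u j) \<longlongrightarrow> 0) (at a)"
    by (intro Lim_null_comparison[OF _ lim])
  then show ?thesis by (simp add: LIM_zero_iff)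
qed

text \<open>With the exact formula for differences of \<open>wrss\<close>, continuity of the fit is enough.\<close>

lemma has_real_derivative_wrss:
  assumes "m\<^sub>0 \<le> m" "0 < a"
  shows "((\<lambda>a. wrss x m (wt D a) u) has_real_derivative
    - (\<Sum>j<m. (wt D a j)\<^sup>2 * (u j - fit x m (wt D a) u j)\<^sup>2)) (at a)"
  unfolding has_field_derivative_iff
proof (rule Lim_transform_eventually)
  interpret full_rank_design x m by (rule full_rank) fact
  have wt: "((\<lambda>h. (wt D h j - wt D a j) / (h - a)) \<longlongrightarrow> - (wt D a j)\<^sup>2) (at a)" for j
    using DERIV_wt[of a D j] D_pos[of j] assms by (simp add: has_field_derivative_iff)
  show "((\<lambda>h. \<Sum>j<m. (wt D h j - wt D a j) / (h - a) *
      ((u j - fit x m (wt D a) u j) * (u j - fit x m (wt D h) u j))) \<longlongrightarrow>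
    - (\<Sum>j<m. (wt D a j)\<^sup>2 * (u j - fit x m (wt D a) u j)\<^sup>2)) (at a)"
    unfolding sum_negf[symmetric] power2_eq_square[of "_ - _"] mult_minus_left[symmetric]
    by (intro tendsto_intros wt fit_continuous assms)
  have "eventually (\<lambda>h. 0 < h) (at a)"
    using eventually_at_in_open[of "{0<..}" a] assms(2) by (auto elim: eventually_mono)
  then show "eventually (\<lambda>h. (\<Sum>j<m. (wt D h j - wt D a j) / (h - a) *
      ((u j - fit x m (wt D a) u j) * (u j - fit x m (wt D h) u j)))
    = (wrss x m (wt D h) u - wrss x m (wt D a) u) / (h - a)) (at a)"
  proof eventually_elim
    case (elim h)
    then show ?case using assms
      by (subst wrss_diff) (auto intro!: wt_pos simp: sum_divide_distrib)
  qed
qed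

lemma has_real_derivative_profile_loglik:
  assumes "m\<^sub>0 \<le> m" "0 < a"
  shows "((\<lambda>a. profile_loglik x D m a u) has_real_derivative profile_score x D m a u) (at a)"
proof -
  have D: "0 < a + D j" for j using D_pos[of j] assms by linarith
  have ln: "((\<lambda>a. ln (a + D j)) has_real_derivative wt D a j) (at a)" for j
    using D[of j] by (auto intro!: derivative_eq_intros simp: wt_def)
  have "((\<lambda>a. profile_loglik x D m a u) has_real_derivative
      - 1 / 2 * (- (\<Sum>j<m. (wt D a j)\<^sup>2 * gkernel x m (wt D a) j j) + (\<Sum>j<m. wt D a j)
        + - (\<Sum>j<m. (wt D a j)\<^sup>2 * (u j - fit x m (wt D a) u j)\<^sup>2))) (at a)"
    unfolding profile_loglik_def
    by (rule DERIV_cmult, rule DERIV_add, rule DERIV_add, rule has_real_derivative_ln_det_gram)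
       (use assms in \<open>auto intro!: DERIV_sum ln has_real_derivative_wrss\<close>)
  then show ?thesis
    by (simp add: profile_score_def sum.distrib sum_subtractf algebra_simps)
qed

end

section \<open>The score near the true variance, and consistency\<close>

section \<open>Deterministic analysis of the score\<close>

text \<open>
  The score that would result from a known regression parameter. Its value at \<open>A\<close> is of order \<open>sqrt m\<close>.
\<close>

definition leading_score :: "(nat \<Rightarrow> real) \<Rightarrow> nat \<Rightarrow> real \<Rightarrow> (nat \<Rightarrow> real) \<Rightarrow> real"
  where "leading_score D m a u = 1 / 2 * (\<Sum>j<m. (wt D a j)\<^sup>2 * (u j)\<^sup>2 - wt D a j)"

text \<open>The effect of estimating the regression parameter on the score, of order one at \<open>A\<close>.\<close>

definition score_correction :: "(nat \<Rightarrow> real ^ 'p) \<Rightarrow> (nat \<Rightarrow> real) \<Rightarrow> nat \<Rightarrow> real \<Rightarrow> (nat \<Rightarrow> real) \<Rightarrow> real"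
  where "score_correction x D m a u =
    1 / 2 * (\<Sum>j<m. (wt D a j)\<^sup>2 * gkernel x m (wt D a) j j)
    - wsum x m (\<lambda>j. (wt D a j)\<^sup>2) u \<bullet> wls x m (wt D a) u
    + 1 / 2 * (\<Sum>j<m. (wt D a j)\<^sup>2 * ((x j \<bullet> wls x m (wt D a) u) * (x j \<bullet> wls x m (wt D a) u)))"

lemma profile_score_eq: "profile_score x D m a u = leading_score D m a u + score_correction x D m a u"
proof -
  have "profile_score x D m a u = 1 / 2 * (\<Sum>j<m. ((wt D a j)\<^sup>2 * (u j)\<^sup>2 - wt D a j)
      + (wt D a j)\<^sup>2 * gkernel x m (wt D a) j j
      - 2 * ((wt D a j)\<^sup>2 * u j * (x j \<bullet> wls x m (wt D a) u))
      + (wt D a j)\<^sup>2 * ((x j \<bullet> wls x m (wt D a) u) * (x j \<bullet> wls x m (wt D a) u)))"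
    unfolding profile_score_def
    by (intro arg_cong[where f = "\<lambda>s. 1 / 2 * s"] sum.cong refl)
       (simp add: fit_def power2_eq_square algebra_simps)
  also have "\<dots> = 1 / 2 * ((\<Sum>j<m. (wt D a j)\<^sup>2 * (u j)\<^sup>2 - wt D a j)
      + (\<Sum>j<m. (wt D a j)\<^sup>2 * gkernel x m (wt D a) j j)
      - 2 * (\<Sum>j<m. (wt D a j)\<^sup>2 * u j * (x j \<bullet> wls x m (wt D a) u))
      + (\<Sum>j<m. (wt D a j)\<^sup>2 * ((x j \<bullet> wls x m (wt D a) u) * (x j \<bullet> wls x m (wt D a) u))))"
    unfolding sum.distrib sum_subtractf sum_distrib_left[symmetric] ..
  finally show ?thesis
    unfolding leading_score_def score_correction_def inner_wsum by simp
qed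

text \<open>
  The two statistics through which the observations enter the score, both scaled to be of order one: a weighted sum of centred
  squares, and \<open>X' diag(c) u\<close> measured in the norm dual to the design.
\<close>

definition fluctuation :: "(nat \<Rightarrow> real ^ 'p) \<Rightarrow> (nat \<Rightarrow> real) \<Rightarrow> real \<Rightarrow> nat \<Rightarrow> (nat \<Rightarrow> real) \<Rightarrow> (nat \<Rightarrow> real) \<Rightarrow> real"
  where "fluctuation x D A m c u =
    \<bar>\<Sum>j<m. c j * ((u j)\<^sup>2 - (A + D j))\<bar> / sqrt (real m) + score_norm x m (wsum x m c u)"

lemma abs_mult_le: "\<bar>a\<bar> \<le> b \<Longrightarrow> \<bar>c\<bar> \<le> d \<Longrightarrow> \<bar>a * c\<bar> \<le> b * (d::real)"
  by (simp add: abs_mult mult_mono')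

lemma abs_half_diff_le:
  fixes k k' n n' s s' :: real
  assumes "\<bar>k - k'\<bar> \<le> c\<^sub>1" "\<bar>n - n'\<bar> \<le> c\<^sub>2" "\<bar>s - s'\<bar> \<le> c\<^sub>3"
  shows "\<bar>1 / 2 * k - n + 1 / 2 * s - (1 / 2 * k' - n' + 1 / 2 * s')\<bar> \<le> 1 / 2 * c\<^sub>1 + c\<^sub>2 + 1 / 2 * c\<^sub>3"
  using assms by linarith

lemma slope_arith:
  fixes r :: real
  assumes "s\<^sub>3 = f + s\<^sub>2" "\<bar>f\<bar> \<le> r'" "r \<le> s\<^sub>2" "r' = r / 20" "r'' = r / 5" "v \<le> t"
    "v = 17 / 10 * s\<^sub>3 - 6 / 5 * s\<^sub>2" "0 \<le> r"
  shows "2 * r'' \<le> t"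
  using assms abs_le_D2[OF assms(2)] by (simp add: field_simps)

text \<open>
  The function \<open>l1 m j\<close> stands for the derivative of the logarithm of the adjustment factor of area \<open>j\<close>.
\<close>

locale adjusted_design = bounded_design +
  fixes A K :: real and l1 :: "nat \<Rightarrow> nat \<Rightarrow> real \<Rightarrow> real"
  assumes A_pos: "0 < A"
    and l1_bound: "\<And>m j a. m\<^sub>0 \<le> m \<Longrightarrow> j < m \<Longrightarrow> 0 < a \<Longrightarrow> \<bar>l1 m j a\<bar> \<le> K"
    and l1_lipschitz: "\<And>m j a a'. m\<^sub>0 \<le> m \<Longrightarrow> j < m \<Longrightarrow> 0 < a \<Longrightarrow> 0 < a' \<Longrightarrow>
        \<bar>l1 m j a - l1 m j a'\<bar> \<le> K * \<bar>a - a'\<bar>"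
begin

lemma K_nonneg: "0 \<le> K"
  using l1_bound[of m\<^sub>0 0 1] m0_pos by simp

lemma fluctuation_ge:
  "\<bar>\<Sum>j<m. c j * ((u j)\<^sup>2 - (A + D j))\<bar> \<le> fluctuation x D A m c u * sqrt (real m)" (is ?A)
  "score_norm x m (wsum x m c u) \<le> fluctuation x D A m c u" (is ?B)
  "0 \<le> fluctuation x D A m c u" (is ?C)
proof -
  show ?B ?C by (simp_all add: fluctuation_def score_norm_nonneg)
  show ?A
  proof (cases "m = 0")
    case False
    then have "\<bar>\<Sum>j<m. c j * ((u j)\<^sup>2 - (A + D j))\<bar>
        = \<bar>\<Sum>j<m. c j * ((u j)\<^sup>2 - (A + D j))\<bar> / sqrt (real m) * sqrt (real m)" by simp
    also have "\<dots> \<le> fluctuation x D A m c u * sqrt (real m)"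
      by (intro mult_right_mono) (simp_all add: fluctuation_def score_norm_nonneg)
    finally show ?thesis .
  qed simp
qed

text \<open>Bounds the mean of \<open>u j ^ 2\<close> and of \<open>\<bar>u j\<bar>\<close>.\<close>

definition ubound :: real where "ubound = 1 + 2 * (A + d\<^sub>1)"

lemma ubound_ge_1: "1 \<le> ubound" using A_pos d1_pos by (simp add: ubound_def)

lemma sum_squares_le:
  assumes "fluctuation x D A m (wt D A) u \<le> sqrt (real m)"
  shows "(\<Sum>j<m. (u j)\<^sup>2) \<le> ubound * real m" "(\<Sum>j<m. \<bar>u j\<bar>) \<le> ubound * real m"
proof -
  have pos: "0 < A + D j" for j using A_pos D_pos[of j] by linarith
  have nz: "A + D j \<noteq> 0" for j using pos[of j] by simp
  have "(\<Sum>j<m. wt D A j * ((u j)\<^sup>2 - (A + D j))) \<le> sqrt (real m) * sqrt (real m)"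
    using fluctuation_ge(1)[where m = m and c = "wt D A" and u = u] mult_right_mono[OF assms, of "sqrt (real m)"] by simp
  moreover have "(\<Sum>j<m. wt D A j * ((u j)\<^sup>2 - (A + D j))) = (\<Sum>j<m. wt D A j * (u j)\<^sup>2) - real m"
    by (simp add: wt_def right_diff_distrib nz sum_subtractf)
  ultimately have 1: "(\<Sum>j<m. wt D A j * (u j)\<^sup>2) \<le> 2 * real m" by simp
  have "(\<Sum>j<m. (u j)\<^sup>2) \<le> (\<Sum>j<m. (A + d\<^sub>1) * (wt D A j * (u j)\<^sup>2))"
  proof (rule sum_mono)
    fix j
    have "1 \<le> (A + d\<^sub>1) * wt D A j"
      using pos[of j] D_le[of j] by (simp add: wt_def)
    from mult_right_mono[OF this, of "(u j)\<^sup>2"]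
    show "(u j)\<^sup>2 \<le> (A + d\<^sub>1) * (wt D A j * (u j)\<^sup>2)" by (simp add: mult.assoc)
  qed
  also have "\<dots> = (A + d\<^sub>1) * (\<Sum>j<m. wt D A j * (u j)\<^sup>2)" by (simp add: sum_distrib_left)
  also have "\<dots> \<le> (A + d\<^sub>1) * (2 * real m)"
    using A_pos d1_pos by (intro mult_left_mono 1) simp
  finally have 2: "(\<Sum>j<m. (u j)\<^sup>2) \<le> 2 * (A + d\<^sub>1) * real m" by (simp only: ac_simps)
  then show "(\<Sum>j<m. (u j)\<^sup>2) \<le> ubound * real m" by (simp add: ubound_def algebra_simps)
  have "(\<Sum>j<m. \<bar>u j\<bar>) \<le> (\<Sum>j<m. 1 + (u j)\<^sup>2)"
  proof (rule sum_mono)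
    fix j
    have "0 \<le> (\<bar>u j\<bar> - 1)\<^sup>2 + \<bar>u j\<bar>" by simp
    moreover have "(\<bar>u j\<bar> - 1)\<^sup>2 = (u j)\<^sup>2 - 2 * \<bar>u j\<bar> + 1" by (simp add: power2_diff)
    ultimately show "\<bar>u j\<bar> \<le> 1 + (u j)\<^sup>2" by linarith
  qed
  also have "\<dots> \<le> real m + 2 * (A + d\<^sub>1) * real m" using 2 by (simp add: sum.distrib)
  finally show "(\<Sum>j<m. \<bar>u j\<bar>) \<le> ubound * real m" by (simp add: ubound_def algebra_simps)
qed

lemma score_norm_wsum_le_sqrt:
  assumes "m\<^sub>0 \<le> m" "(\<Sum>j<m. \<bar>u j\<bar>) \<le> ubound * real m" "\<And>j. j < m \<Longrightarrow> \<bar>c j\<bar> \<le> \<delta>" "0 \<le> \<delta>"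
  shows "score_norm x m (wsum x m c u) \<le> \<delta> * (sqrt cq * ubound) * sqrt (real m)"
proof -
  have m: "0 < real m" using assms m0_pos by simp
  have "score_norm x m (wsum x m c u) \<le> \<delta> * sqrt (cq / real m) * (ubound * real m)"
    by (rule order.trans[OF score_norm_wsum_le[OF assms(1,3,4)]])
       (use assms cq_nonneg in \<open>auto intro!: mult_left_mono\<close>)
  also have "\<dots> = \<delta> * (sqrt cq * ubound) * (real m / sqrt (real m))"
    by (simp add: real_sqrt_divide)
  also have "real m / sqrt (real m) = sqrt (real m)" by (simp add: real_div_sqrt)
  finally show ?thesis .
qed

lemma wt_sq_lipschitz:
  assumes "0 \<le> a" "0 \<le> a'"
  shows "\<bar>(wt D a j)\<^sup>2 - (wt D a' j)\<^sup>2\<bar> \<le> 2 / d\<^sub>0 ^ 3 * \<bar>a - a'\<bar>"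
proof -
  have "\<bar>(wt D a j)\<^sup>2 - (wt D a' j)\<^sup>2\<bar> = \<bar>(wt D a j - wt D a' j) * (wt D a j + wt D a' j)\<bar>"
    by (simp add: power2_eq_square algebra_simps)
  also have "\<dots> \<le> (\<bar>a - a'\<bar> / d\<^sub>0\<^sup>2) * (1 / d\<^sub>0 + 1 / d\<^sub>0)"
    using wt_pos[OF assms(1), of j] wt_pos[OF assms(2), of j] wt_le[OF assms(1), of j] wt_le[OF assms(2), of j]
    by (intro abs_mult_le wt_lipschitz assms) auto
  finally show ?thesis by (simp add: power2_eq_square power3_eq_cube ac_simps)
qed

text \<open>
  The correction is quadratic in the weighted sums \<open>wsum\<close>, which are of order one. A uniform Lipschitz
  bound near \<open>A\<close> needs only the crude bound \<open>P\<close> on their increments; the expansion of the root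
  uses the same inequality with a sharper \<open>P\<close>.
\<close>

lemma score_correction_diff_le:
  obtains \<kappa> where "0 \<le> \<kappa>" and "\<And>m a a' u P H. m\<^sub>0 \<le> m \<Longrightarrow> 0 \<le> a \<Longrightarrow> a \<le> 2 * A \<Longrightarrow> 0 \<le> a' \<Longrightarrow> a' \<le> 2 * A \<Longrightarrow>
      score_norm x m (wsum x m (wt D a) u - wsum x m (wt D a') u) \<le> P \<Longrightarrow>
      score_norm x m (wsum x m (\<lambda>j. (wt D a j)\<^sup>2) u - wsum x m (\<lambda>j. (wt D a' j)\<^sup>2) u) \<le> P \<Longrightarrow>
      score_norm x m (wsum x m (wt D a) u) \<le> H \<Longrightarrow> score_norm x m (wsum x m (wt D a') u) \<le> H \<Longrightarrow>
      score_norm x m (wsum x m (\<lambda>j. (wt D a' j)\<^sup>2) u) \<le> H \<Longrightarrow>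
      \<bar>score_correction x D m a u - score_correction x D m a' u\<bar> \<le> \<kappa> * (P * H + \<bar>a - a'\<bar> * H\<^sup>2 + \<bar>a - a'\<bar>)"
proof
  define L where "L = 2 * A + d\<^sub>1"
  have L: "0 < L" using A_pos d1_pos by (simp add: L_def)
  define q where "q = 1 / d\<^sub>0"
  have q: "0 < q" using d0_pos by (simp add: q_def)
  define \<kappa> where "\<kappa> = 2 * L + L\<^sup>2 * q\<^sup>2 + L\<^sup>2 * q ^ 3 + L\<^sup>2 * q\<^sup>2 + L ^ 3 * q ^ 4 + cq * (L * q ^ 3 + L\<^sup>2 * q ^ 4)"
  show "0 \<le> \<kappa>" using L q cq_nonneg by (simp add: \<kappa>_def)
  fix m a a' u P H
  assume m: "m\<^sub>0 \<le> m" and a: "0 \<le> a" "a \<le> 2 * A" and a': "0 \<le> a'" "a' \<le> 2 * A"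
    and P1: "score_norm x m (wsum x m (wt D a) u - wsum x m (wt D a') u) \<le> P"
    and P2: "score_norm x m (wsum x m (\<lambda>j. (wt D a j)\<^sup>2) u - wsum x m (\<lambda>j. (wt D a' j)\<^sup>2) u) \<le> P"
    and H1: "score_norm x m (wsum x m (wt D a) u) \<le> H" and H1': "score_norm x m (wsum x m (wt D a') u) \<le> H"
    and H2: "score_norm x m (wsum x m (\<lambda>j. (wt D a' j)\<^sup>2) u) \<le> H"
  interpret full_rank_design x m by (rule full_rank) fact
  have mpos: "0 < real m" using m m0_pos by simp
  have H: "0 \<le> H" using H1 score_norm_nonneg order_trans by blast
  have P: "0 \<le> P" using P1 score_norm_nonneg order_trans by blast
  define \<delta> where "\<delta> = \<bar>a - a'\<bar>"
  have \<delta>: "0 \<le> \<delta>" by (simp add: \<delta>_def)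
  have ge: "1 / L \<le> wt D b j" if "0 \<le> b" "b \<le> 2 * A" for b j
    using wt_ge[OF that(1), of j] frac_le[of 1 1 "b + d\<^sub>1" L] that d1_pos by (simp add: L_def)
  have lip: "\<bar>wt D a j - wt D a' j\<bar> \<le> q\<^sup>2 * \<delta>" for j
    using wt_lipschitz[OF a(1) a'(1), of j] by (simp add: q_def \<delta>_def power_divide)
  have lip2: "\<bar>(wt D a j)\<^sup>2 - (wt D a' j)\<^sup>2\<bar> \<le> 2 * q ^ 3 * \<delta>" for j
    using wt_sq_lipschitz[OF a(1) a'(1), of j] by (simp add: q_def \<delta>_def power_divide)
  have sq: "\<bar>(wt D b j)\<^sup>2\<bar> \<le> q\<^sup>2" if "0 \<le> b" for b j
    using wt_pos[OF that, of j] wt_le[OF that, of j] by (simp add: q_def power_mono)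
  define b b' where "b = wls x m (wt D a) u" and "b' = wls x m (wt D a') u"
  have hb: "design_norm x m b \<le> L * H"
  proof -
    have "design_norm x m b \<le> score_norm x m (wsum x m (wt D a) u) / (1 / L)"
      unfolding b_def wls_eq using L by (intro design_norm_solution_le ge a) auto
    also have "\<dots> \<le> H / (1 / L)" using L by (intro divide_right_mono H1) auto
    finally show ?thesis by (simp add: mult.commute)
  qed
  have hb': "design_norm x m b' \<le> L * H"
  proof -
    have "design_norm x m b' \<le> score_norm x m (wsum x m (wt D a') u) / (1 / L)"
      unfolding b'_def wls_eq using L by (intro design_norm_solution_le ge a') auto
    also have "\<dots> \<le> H / (1 / L)" using L by (intro divide_right_mono H1') auto
    finally show ?thesis by (simp add: mult.commute)
  qed
  have hd: "design_norm x m (b - b') \<le> L * (P + q\<^sup>2 * \<delta> * (L * H))"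
  proof -
    have "design_norm x m (b - b') \<le> (score_norm x m (wsum x m (wt D a) u - wsum x m (wt D a') u)
        + q\<^sup>2 * \<delta> * design_norm x m b') / (1 / L)"
      unfolding b_def b'_def wls_eq using L \<delta>
      by (intro design_norm_solution_diff_le ge a wt_pos a' lip) auto
    also have "\<dots> \<le> (P + q\<^sup>2 * \<delta> * (L * H)) / (1 / L)"
      using L \<delta> by (intro divide_right_mono add_mono P1 mult_left_mono hb') auto
    finally show ?thesis by (simp add: mult.commute)
  qed
  have hs: "design_norm x m (b + b') \<le> 2 * (L * H)"
    using design_norm_add[of x m b b'] hb hb' by linarith
  have c1: "\<bar>wsum x m (\<lambda>j. (wt D a j)\<^sup>2) u \<bullet> b - wsum x m (\<lambda>j. (wt D a' j)\<^sup>2) u \<bullet> b'\<bar>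
      \<le> P * (L * H) + H * (L * (P + q\<^sup>2 * \<delta> * (L * H)))"
  proof -
    have "wsum x m (\<lambda>j. (wt D a j)\<^sup>2) u \<bullet> b - wsum x m (\<lambda>j. (wt D a' j)\<^sup>2) u \<bullet> b'
      = (wsum x m (\<lambda>j. (wt D a j)\<^sup>2) u - wsum x m (\<lambda>j. (wt D a' j)\<^sup>2) u) \<bullet> b
        + wsum x m (\<lambda>j. (wt D a' j)\<^sup>2) u \<bullet> (b - b')"
      by (simp add: inner_diff_left inner_diff_right)
    moreover have "\<bar>(wsum x m (\<lambda>j. (wt D a j)\<^sup>2) u - wsum x m (\<lambda>j. (wt D a' j)\<^sup>2) u) \<bullet> b\<bar> \<le> P * (L * H)"
      by (rule order.trans[OF inner_le_norms]) (intro mult_mono P2 hb P design_norm_nonneg)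
    moreover have "\<bar>wsum x m (\<lambda>j. (wt D a' j)\<^sup>2) u \<bullet> (b - b')\<bar> \<le> H * (L * (P + q\<^sup>2 * \<delta> * (L * H)))"
      by (rule order.trans[OF inner_le_norms]) (intro mult_mono H2 hd H design_norm_nonneg)
    ultimately show ?thesis by linarith
  qed
  have c2: "\<bar>(\<Sum>j<m. (wt D a j)\<^sup>2 * ((x j \<bullet> b) * (x j \<bullet> b))) - (\<Sum>j<m. (wt D a' j)\<^sup>2 * ((x j \<bullet> b') * (x j \<bullet> b')))\<bar>
      \<le> 2 * q ^ 3 * \<delta> * (L * H * (L * H)) + q\<^sup>2 * (L * (P + q\<^sup>2 * \<delta> * (L * H)) * (2 * (L * H)))"
  proof -
    have "(\<Sum>j<m. (wt D a j)\<^sup>2 * ((x j \<bullet> b) * (x j \<bullet> b))) - (\<Sum>j<m. (wt D a' j)\<^sup>2 * ((x j \<bullet> b') * (x j \<bullet> b')))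
      = (\<Sum>j<m. ((wt D a j)\<^sup>2 - (wt D a' j)\<^sup>2) * ((x j \<bullet> b) * (x j \<bullet> b)))
        + (\<Sum>j<m. (wt D a' j)\<^sup>2 * ((x j \<bullet> (b - b')) * (x j \<bullet> (b + b'))))"
      unfolding sum_subtractf[symmetric] sum.distrib[symmetric]
      by (intro sum.cong refl) (simp add: inner_diff_right inner_add_right algebra_simps)
    moreover have "\<bar>\<Sum>j<m. ((wt D a j)\<^sup>2 - (wt D a' j)\<^sup>2) * ((x j \<bullet> b) * (x j \<bullet> b))\<bar>
        \<le> 2 * q ^ 3 * \<delta> * (L * H * (L * H))"
    proof (rule order.trans[OF sum_weighted_inner_le])
      show "\<bar>(wt D a j)\<^sup>2 - (wt D a' j)\<^sup>2\<bar> \<le> 2 * q ^ 3 * \<delta>" for j by (rule lip2)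
      show "2 * q ^ 3 * \<delta> * (design_norm x m b * design_norm x m b) \<le> 2 * q ^ 3 * \<delta> * (L * H * (L * H))"
        using q \<delta> L H by (intro mult_left_mono mult_mono hb design_norm_nonneg) auto
    qed (use q \<delta> in simp)
    moreover have "\<bar>\<Sum>j<m. (wt D a' j)\<^sup>2 * ((x j \<bullet> (b - b')) * (x j \<bullet> (b + b')))\<bar>
        \<le> q\<^sup>2 * (L * (P + q\<^sup>2 * \<delta> * (L * H)) * (2 * (L * H)))"
    proof (rule order.trans[OF sum_weighted_inner_le[OF sq[OF a'(1)]]])
      show "q\<^sup>2 * (design_norm x m (b - b') * design_norm x m (b + b'))
          \<le> q\<^sup>2 * (L * (P + q\<^sup>2 * \<delta> * (L * H)) * (2 * (L * H)))"
        using q \<delta> L H P by (intro mult_left_mono mult_mono hd hs design_norm_nonneg) auto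
    qed simp
    ultimately show ?thesis by linarith
  qed
  have c3: "\<bar>(\<Sum>j<m. (wt D a j)\<^sup>2 * gkernel x m (wt D a) j j) - (\<Sum>j<m. (wt D a' j)\<^sup>2 * gkernel x m (wt D a') j j)\<bar>
      \<le> (2 * q ^ 3 * \<delta> * L + q\<^sup>2 * (L * (q\<^sup>2 * \<delta> * L))) * cq"
  proof -
    let ?s = "sqrt (cq / real m)"
    have ss: "?s * ?s = cq / real m" using cq_nonneg by simp
    have "\<bar>(wt D a j)\<^sup>2 * gkernel x m (wt D a) j j - (wt D a' j)\<^sup>2 * gkernel x m (wt D a') j j\<bar>
        \<le> (2 * q ^ 3 * \<delta> * L + q\<^sup>2 * (L * (q\<^sup>2 * \<delta> * L))) * (cq / real m)" if j: "j < m" for j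
    proof -
      define c c' where "c = matrix_inv (gram x m (wt D a)) *v x j" and "c' = matrix_inv (gram x m (wt D a')) *v x j"
      have hc': "design_norm x m c' \<le> L * ?s"
        using design_norm_solution_row_le[OF m j a'(1)] a' cq_nonneg mult_right_mono[of "a' + d\<^sub>1" L ?s]
        by (simp add: c'_def L_def)
      have "design_norm x m (c - c') \<le> (score_norm x m (x j - x j) + q\<^sup>2 * \<delta> * design_norm x m c') / (1 / L)"
        unfolding c_def c'_def using L \<delta> by (intro design_norm_solution_diff_le ge a wt_pos a' lip) auto
      also have "score_norm x m (x j - x j) = 0"
        using score_norm_scaleR[of x m 0 "x j"] by simp
      also have "(0 + q\<^sup>2 * \<delta> * design_norm x m c') / (1 / L) \<le> (0 + q\<^sup>2 * \<delta> * (L * ?s)) / (1 / L)"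
        using L \<delta> by (intro divide_right_mono add_mono mult_left_mono hc') auto
      finally have hcc: "design_norm x m (c - c') \<le> L * (q\<^sup>2 * \<delta> * (L * ?s))" by (simp add: mult.commute)
      have 1: "\<bar>gkernel x m (wt D a) j j - gkernel x m (wt D a') j j\<bar> \<le> ?s * (L * (q\<^sup>2 * \<delta> * (L * ?s)))"
        unfolding gkernel_def c_def[symmetric] c'_def[symmetric] inner_diff_right[symmetric]
        by (rule order.trans[OF inner_le_norms])
           (use cq_nonneg in \<open>intro mult_mono score_norm_row_le m j hcc design_norm_nonneg\<close>, simp)
      have 2: "\<bar>gkernel x m (wt D a) j j\<bar> \<le> L * (cq / real m)"
        using gkernel_le[OF m j j a(1)] a cq_nonneg mult_right_mono[of "a + d\<^sub>1" L "cq / real m"]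
        by (simp add: L_def)
      have "(wt D a j)\<^sup>2 * gkernel x m (wt D a) j j - (wt D a' j)\<^sup>2 * gkernel x m (wt D a') j j
          = ((wt D a j)\<^sup>2 - (wt D a' j)\<^sup>2) * gkernel x m (wt D a) j j
            + (wt D a' j)\<^sup>2 * (gkernel x m (wt D a) j j - gkernel x m (wt D a') j j)"
        by (simp add: algebra_simps)
      then have "\<bar>(wt D a j)\<^sup>2 * gkernel x m (wt D a) j j - (wt D a' j)\<^sup>2 * gkernel x m (wt D a') j j\<bar>
          \<le> 2 * q ^ 3 * \<delta> * (L * (cq / real m)) + q\<^sup>2 * (?s * (L * (q\<^sup>2 * \<delta> * (L * ?s))))"
        using abs_mult_le[OF lip2[of j] 2] abs_mult_le[OF sq[OF a'(1), of j] 1] by linarith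
      also have "?s * (L * (q\<^sup>2 * \<delta> * (L * ?s))) = L * (q\<^sup>2 * \<delta> * L) * (?s * ?s)"
        by (simp only: ac_simps)
      finally show ?thesis unfolding ss by (simp add: algebra_simps)
    qed
    then have "\<bar>(\<Sum>j<m. (wt D a j)\<^sup>2 * gkernel x m (wt D a) j j) - (\<Sum>j<m. (wt D a' j)\<^sup>2 * gkernel x m (wt D a') j j)\<bar>
        \<le> (\<Sum>j<m. (2 * q ^ 3 * \<delta> * L + q\<^sup>2 * (L * (q\<^sup>2 * \<delta> * L))) * (cq / real m))"
      unfolding sum_subtractf[symmetric] by (intro order.trans[OF sum_abs] sum_mono) simp
    then show ?thesis using mpos by simp
  qed
  have "\<bar>score_correction x D m a u - score_correction x D m a' u\<bar>
      \<le> 1 / 2 * ((2 * q ^ 3 * \<delta> * L + q\<^sup>2 * (L * (q\<^sup>2 * \<delta> * L))) * cq)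
        + (P * (L * H) + H * (L * (P + q\<^sup>2 * \<delta> * (L * H))))
        + 1 / 2 * (2 * q ^ 3 * \<delta> * (L * H * (L * H)) + q\<^sup>2 * (L * (P + q\<^sup>2 * \<delta> * (L * H)) * (2 * (L * H))))"
    unfolding score_correction_def b_def[symmetric] b'_def[symmetric]
    by (rule abs_half_diff_le[OF c3 c1 c2])
  also have "\<dots> \<le> \<kappa> * (P * H + \<delta> * H\<^sup>2 + \<delta>)"
  proof -
    have "\<kappa> * (P * H + \<delta> * H\<^sup>2 + \<delta>)
      - (1 / 2 * ((2 * q ^ 3 * \<delta> * L + q\<^sup>2 * (L * (q\<^sup>2 * \<delta> * L))) * cq)
        + (P * (L * H) + H * (L * (P + q\<^sup>2 * \<delta> * (L * H))))
        + 1 / 2 * (2 * q ^ 3 * \<delta> * (L * H * (L * H)) + q\<^sup>2 * (L * (P + q\<^sup>2 * \<delta> * (L * H)) * (2 * (L * H)))))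
      = (P * H) * (L\<^sup>2 * q\<^sup>2 + L\<^sup>2 * q ^ 3 + L ^ 3 * q ^ 4 + cq * (L * q ^ 3 + L\<^sup>2 * q ^ 4))
        + (\<delta> * H\<^sup>2) * (2 * L + L\<^sup>2 * q\<^sup>2 + cq * (L * q ^ 3 + L\<^sup>2 * q ^ 4))
        + \<delta> * (2 * L + L\<^sup>2 * q\<^sup>2 + L\<^sup>2 * q ^ 3 + L\<^sup>2 * q\<^sup>2 + L ^ 3 * q ^ 4 + cq * (1 / 2 * L\<^sup>2 * q ^ 4))"
      unfolding \<kappa>_def by algebra
    also have "0 \<le> \<dots>" using P H \<delta> L q cq_nonneg by simp
    finally show ?thesis by linarith
  qed
  finally show "\<bar>score_correction x D m a u - score_correction x D m a' u\<bar>
      \<le> \<kappa> * (P * H + \<bar>a - a'\<bar> * H\<^sup>2 + \<bar>a - a'\<bar>)" unfolding \<delta>_def .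
qed

definition adj_score :: "nat \<Rightarrow> nat \<Rightarrow> real \<Rightarrow> (nat \<Rightarrow> real) \<Rightarrow> real"
  where "adj_score m j a u = profile_score x D m a u + l1 m j a"

lemma leading_score_diff:
  assumes "0 \<le> a" "0 \<le> a'"
  shows "leading_score D m a' u - leading_score D m a u = - (a' - a) / 2 *
    (\<Sum>j<m. wt D a j * wt D a' j * (wt D a j + wt D a' j) * (u j)\<^sup>2 - wt D a j * wt D a' j)"
proof -
  have "((wt D a' j)\<^sup>2 * (u j)\<^sup>2 - wt D a' j) - ((wt D a j)\<^sup>2 * (u j)\<^sup>2 - wt D a j)
      = - (a' - a) * (wt D a j * wt D a' j * (wt D a j + wt D a' j) * (u j)\<^sup>2 - wt D a j * wt D a' j)" for j
  proof -
    have "wt D a' j = wt D a j - (a' - a) * (wt D a j * wt D a' j)"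
      using wt_diff[OF assms, of j] by linarith
    moreover have "((wt D a' j)\<^sup>2 * (u j)\<^sup>2 - wt D a' j) - ((wt D a j)\<^sup>2 * (u j)\<^sup>2 - wt D a j)
      = (wt D a' j - wt D a j) * ((wt D a j + wt D a' j) * (u j)\<^sup>2 - 1)"
      by (simp add: power2_eq_square algebra_simps)
    ultimately have "((wt D a' j)\<^sup>2 * (u j)\<^sup>2 - wt D a' j) - ((wt D a j)\<^sup>2 * (u j)\<^sup>2 - wt D a j)
      = (- (a' - a) * (wt D a j * wt D a' j)) * ((wt D a j + wt D a' j) * (u j)\<^sup>2 - 1)"
      by (metis add_diff_cancel_left' diff_conv_add_uminus mult_minus_left)
    then show ?thesis by (simp add: algebra_simps)
  qed
  then show ?thesis
    unfolding leading_score_def right_diff_distrib[symmetric] sum_subtractf[symmetric]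
    by (simp add: sum_distrib_left sum_negf)
qed

text \<open>
  Within the distance \<open>d\<^sub>0 / 20\<close> of \<open>A\<close> no weight changes by more than one part in twenty. The negative
  difference quotient is then at least half the sum of \<open>1.7 w\<^sup>3 u\<^sup>2 - 1.2 w\<^sup>2\<close>, and the mean of \<open>w\<^sup>3 u\<^sup>2\<close> is \<open>w\<^sup>2\<close>.
\<close>

lemma leading_score_decreasing:
  defines "L \<equiv> 2 * A + d\<^sub>1"
  assumes fl: "fluctuation x D A m (\<lambda>j. wt D A j ^ 3) u \<le> 1 / (20 * L\<^sup>2) * sqrt (real m)"
    and a: "0 \<le> a" "\<bar>a - A\<bar> \<le> d\<^sub>0 / 20" and a': "0 \<le> a'" "\<bar>a' - A\<bar> \<le> d\<^sub>0 / 20" and le: "a \<le> a'"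
  shows "leading_score D m a' u - leading_score D m a u \<le> - (a' - a) * (real m / (5 * L\<^sup>2))"
proof -
  have L: "0 < L" using A_pos d1_pos by (simp add: L_def)
  have A0: "0 \<le> A" using A_pos by simp
  have near: "20 / 21 * wt D A j \<le> wt D b j \<and> wt D b j \<le> 20 / 19 * wt D A j"
    if b: "0 \<le> b" "\<bar>b - A\<bar> \<le> d\<^sub>0 / 20" for b j
  proof -
    have "A + D j > 0" "b + D j > 0" using A_pos b D_pos[of j] by linarith+
    moreover have "19 / 20 * (A + D j) \<le> b + D j"
      using b(1) abs_le_D1[OF b(2)] abs_le_D2[OF b(2)] A_pos D_ge[of j] by (simp add: field_simps)
    moreover have "b + D j \<le> 21 / 20 * (A + D j)"
      using b(1) abs_le_D1[OF b(2)] abs_le_D2[OF b(2)] A_pos D_ge[of j] by (simp add: field_simps)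
    ultimately show ?thesis by (simp add: wt_def field_simps)
  qed
  have ge: "17 / 10 * (wt D A j ^ 3 * (u j)\<^sup>2) - 6 / 5 * (wt D A j)\<^sup>2
      \<le> wt D a j * wt D a' j * (wt D a j + wt D a' j) * (u j)\<^sup>2 - wt D a j * wt D a' j" for j
  proof -
    let ?w = "wt D A j" and ?v = "wt D a j" and ?v' = "wt D a' j"
    have w: "0 < ?w" using wt_pos[OF A0] .
    have lo: "20 / 21 * ?w \<le> ?v" "20 / 21 * ?w \<le> ?v'" and up: "?v \<le> 20 / 19 * ?w" "?v' \<le> 20 / 19 * ?w"
      using near[OF a, of j] near[OF a', of j] by auto
    have v: "0 < ?v" "0 < ?v'" using wt_pos a a' by auto
    have "?v * ?v' \<le> (20 / 19 * ?w) * (20 / 19 * ?w)" using v w by (intro mult_mono up) auto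
    also have "\<dots> \<le> 6 / 5 * ?w\<^sup>2" using w by (simp add: power2_eq_square)
    finally have 1: "?v * ?v' \<le> 6 / 5 * ?w\<^sup>2" .
    have "17 / 10 * ?w ^ 3 \<le> (20 / 21 * ?w) * (20 / 21 * ?w) * (20 / 21 * ?w + 20 / 21 * ?w)"
      using w by (simp add: power3_eq_cube)
    also have "\<dots> \<le> ?v * ?v' * (?v + ?v')" using v w by (intro mult_mono add_mono lo) auto
    finally have "17 / 10 * ?w ^ 3 * (u j)\<^sup>2 \<le> ?v * ?v' * (?v + ?v') * (u j)\<^sup>2"
      by (rule mult_right_mono) simp
    with 1 show ?thesis by (simp add: mult.assoc)
  qed
  have Ad: "A + D j \<noteq> 0" for j using A_pos D_pos[of j] by linarith
  have "(\<Sum>j<m. wt D A j ^ 3 * (u j)\<^sup>2)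
      = (\<Sum>j<m. wt D A j ^ 3 * ((u j)\<^sup>2 - (A + D j))) + (\<Sum>j<m. (wt D A j)\<^sup>2)"
    unfolding sum.distrib[symmetric]
    by (intro sum.cong refl) (simp add: right_diff_distrib wt_def power2_eq_square power3_eq_cube Ad)
  moreover have "\<bar>\<Sum>j<m. wt D A j ^ 3 * ((u j)\<^sup>2 - (A + D j))\<bar> \<le> 1 / (20 * L\<^sup>2) * real m"
    using order.trans[OF fluctuation_ge(1) mult_right_mono[OF fl]] by simp
  moreover have "real m / L\<^sup>2 \<le> (\<Sum>j<m. (wt D A j)\<^sup>2)"
  proof -
    have "1 / L\<^sup>2 \<le> (wt D A j)\<^sup>2" for j
    proof -
      have "1 / L \<le> wt D A j"
        using wt_ge[OF A0, of j] frac_le[of 1 1 "A + d\<^sub>1" L] A_pos d1_pos by (simp add: L_def)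
      from power_mono[OF this, of 2] L show ?thesis by (simp add: power_divide)
    qed
    then have "(\<Sum>j<m. 1 / L\<^sup>2) \<le> (\<Sum>j<m. (wt D A j)\<^sup>2)" by (intro sum_mono)
    then show ?thesis by simp
  qed
  moreover have "1 / (20 * L\<^sup>2) * real m = real m / L\<^sup>2 / 20" "real m / (5 * L\<^sup>2) = real m / L\<^sup>2 / 5" by simp_all
  moreover have "(\<Sum>j<m. 17 / 10 * (wt D A j ^ 3 * (u j)\<^sup>2) - 6 / 5 * (wt D A j)\<^sup>2)
      \<le> (\<Sum>j<m. wt D a j * wt D a' j * (wt D a j + wt D a' j) * (u j)\<^sup>2 - wt D a j * wt D a' j)"
    by (intro sum_mono ge)
  moreover have "(\<Sum>j<m. 17 / 10 * (wt D A j ^ 3 * (u j)\<^sup>2) - 6 / 5 * (wt D A j)\<^sup>2)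
      = 17 / 10 * (\<Sum>j<m. wt D A j ^ 3 * (u j)\<^sup>2) - 6 / 5 * (\<Sum>j<m. (wt D A j)\<^sup>2)"
    by (simp add: sum_subtractf sum_distrib_left)
  moreover have "0 \<le> real m / L\<^sup>2" by simp
  ultimately have "2 * (real m / (5 * L\<^sup>2))
      \<le> (\<Sum>j<m. wt D a j * wt D a' j * (wt D a j + wt D a' j) * (u j)\<^sup>2 - wt D a j * wt D a' j)"
    by (rule slope_arith)
  from mult_left_mono[OF this, of "(a' - a) / 2"] le
  have "(a' - a) * (real m / (5 * L\<^sup>2)) \<le> (a' - a) / 2 *
      (\<Sum>j<m. wt D a j * wt D a' j * (wt D a j + wt D a' j) * (u j)\<^sup>2 - wt D a j * wt D a' j)" by simp
  then show ?thesis
    unfolding leading_score_diff[OF a(1) a'(1)]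
    by (simp only: minus_divide_left[symmetric] mult_minus_left neg_le_iff_le)
qed

lemma leading_score_lipschitz:
  assumes "0 \<le> a" "0 \<le> a'" and sq: "(\<Sum>j<m. (u j)\<^sup>2) \<le> ubound * real m"
  shows "\<bar>leading_score D m a' u - leading_score D m a u\<bar>
    \<le> \<bar>a' - a\<bar> * ((ubound / d\<^sub>0 ^ 3 + 1 / d\<^sub>0\<^sup>2) * real m)"
proof -
  have "\<bar>\<Sum>j<m. wt D a j * wt D a' j * (wt D a j + wt D a' j) * (u j)\<^sup>2 - wt D a j * wt D a' j\<bar>
      \<le> (\<Sum>j<m. (1 / d\<^sub>0 * (1 / d\<^sub>0) * (1 / d\<^sub>0 + 1 / d\<^sub>0)) * (u j)\<^sup>2 + 1 / d\<^sub>0 * (1 / d\<^sub>0))"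
  proof (rule order.trans[OF sum_abs], rule sum_mono)
    fix j
    have w: "\<bar>wt D a j\<bar> \<le> 1 / d\<^sub>0" "\<bar>wt D a' j\<bar> \<le> 1 / d\<^sub>0"
      using wt_pos[OF assms(1), of j] wt_pos[OF assms(2), of j] wt_le[OF assms(1), of j] wt_le[OF assms(2), of j]
      by auto
    then have "\<bar>wt D a j + wt D a' j\<bar> \<le> 1 / d\<^sub>0 + 1 / d\<^sub>0" by linarith
    then have "\<bar>wt D a j * wt D a' j * (wt D a j + wt D a' j) * (u j)\<^sup>2\<bar>
        \<le> (1 / d\<^sub>0 * (1 / d\<^sub>0) * (1 / d\<^sub>0 + 1 / d\<^sub>0)) * (u j)\<^sup>2"
      using w by (intro abs_mult_le) auto
    moreover have "\<bar>wt D a j * wt D a' j\<bar> \<le> 1 / d\<^sub>0 * (1 / d\<^sub>0)" by (intro abs_mult_le w)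
    ultimately show "\<bar>wt D a j * wt D a' j * (wt D a j + wt D a' j) * (u j)\<^sup>2 - wt D a j * wt D a' j\<bar>
        \<le> (1 / d\<^sub>0 * (1 / d\<^sub>0) * (1 / d\<^sub>0 + 1 / d\<^sub>0)) * (u j)\<^sup>2 + 1 / d\<^sub>0 * (1 / d\<^sub>0)" by linarith
  qed
  also have "\<dots> = 2 / d\<^sub>0 ^ 3 * (\<Sum>j<m. (u j)\<^sup>2) + 1 / d\<^sub>0\<^sup>2 * real m"
    by (simp add: sum.distrib sum_distrib_left power2_eq_square power3_eq_cube)
  also have "\<dots> \<le> 2 / d\<^sub>0 ^ 3 * (ubound * real m) + 2 * (1 / d\<^sub>0\<^sup>2 * real m)"
    using d0_pos by (intro add_mono mult_left_mono sq) (auto intro!: divide_right_mono)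
  finally have "\<bar>\<Sum>j<m. wt D a j * wt D a' j * (wt D a j + wt D a' j) * (u j)\<^sup>2 - wt D a j * wt D a' j\<bar>
      \<le> 2 * ((ubound / d\<^sub>0 ^ 3 + 1 / d\<^sub>0\<^sup>2) * real m)" by (simp add: algebra_simps)
  from mult_left_mono[OF this, of "\<bar>a' - a\<bar> / 2"] show ?thesis
    unfolding leading_score_diff[OF assms(1,2)] abs_mult abs_minus_cancel by (simp add: abs_mult abs_minus_commute)
qed

text \<open>
  On a neighbourhood of \<open>A\<close> of fixed size, the leading part of the score has slope of order \<open>-m\<close> as soon as
  the fluctuations are a small multiple of \<open>sqrt m\<close>; the slope of the correction is then a small
  multiple of \<open>m\<close>, and that of the adjustment is bounded.
\<close>

lemma adj_score_slope:
  obtains \<epsilon> \<eta> c\<^sub>0 C\<^sub>0 m\<^sub>1 where "0 < \<epsilon>" "\<epsilon> \<le> A / 2" "0 < \<eta>" "\<eta> \<le> 1" "0 < c\<^sub>0" "m\<^sub>0 \<le> m\<^sub>1"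
    and "\<And>m u j a a'. m\<^sub>1 \<le> m \<Longrightarrow>
      (\<And>k. k \<in> {1, 2, 3} \<Longrightarrow> fluctuation x D A m (\<lambda>i. wt D A i ^ k) u \<le> \<eta> * sqrt (real m)) \<Longrightarrow>
      j < m \<Longrightarrow> \<bar>a - A\<bar> \<le> \<epsilon> \<Longrightarrow> \<bar>a' - A\<bar> \<le> \<epsilon> \<Longrightarrow> a \<le> a' \<Longrightarrow>
      adj_score m j a' u - adj_score m j a u \<le> - c\<^sub>0 * real m * (a' - a) \<and>
      \<bar>adj_score m j a' u - adj_score m j a u\<bar> \<le> C\<^sub>0 * real m * (a' - a)"
proof -
  obtain \<kappa> where \<kappa>: "0 \<le> \<kappa>" and corr: "\<And>m a a' u P H. m\<^sub>0 \<le> m \<Longrightarrow> 0 \<le> a \<Longrightarrow> a \<le> 2 * A \<Longrightarrow> 0 \<le> a' \<Longrightarrow> a' \<le> 2 * A \<Longrightarrow>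
      score_norm x m (wsum x m (wt D a) u - wsum x m (wt D a') u) \<le> P \<Longrightarrow>
      score_norm x m (wsum x m (\<lambda>j. (wt D a j)\<^sup>2) u - wsum x m (\<lambda>j. (wt D a' j)\<^sup>2) u) \<le> P \<Longrightarrow>
      score_norm x m (wsum x m (wt D a) u) \<le> H \<Longrightarrow> score_norm x m (wsum x m (wt D a') u) \<le> H \<Longrightarrow>
      score_norm x m (wsum x m (\<lambda>j. (wt D a' j)\<^sup>2) u) \<le> H \<Longrightarrow>
      \<bar>score_correction x D m a u - score_correction x D m a' u\<bar> \<le> \<kappa> * (P * H + \<bar>a - a'\<bar> * H\<^sup>2 + \<bar>a - a'\<bar>)"
    using score_correction_diff_le by metis
  define L where "L = 2 * A + d\<^sub>1"
  have L: "0 < L" using A_pos d1_pos by (simp add: L_def)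
  define \<kappa>\<^sub>1 where "\<kappa>\<^sub>1 = (1 / d\<^sub>0\<^sup>2 + 2 / d\<^sub>0 ^ 3) * (sqrt cq * ubound)"
  have \<kappa>\<^sub>1: "0 \<le> \<kappa>\<^sub>1" using d0_pos cq_nonneg ubound_ge_1 by (simp add: \<kappa>\<^sub>1_def)
  \<comment> \<open>Bounds the weighted sums relative to \<open>sqrt m\<close> so that the slope of the correction is at most a fraction of that of the leading score.\<close>
  define \<tau> where "\<tau> = min 1 (1 / (16 * L\<^sup>2 * (\<kappa> * (\<kappa>\<^sub>1 + 1) + 1)))"
  have den: "0 < 16 * L\<^sup>2 * (\<kappa> * (\<kappa>\<^sub>1 + 1) + 1)" using L \<kappa> \<kappa>\<^sub>1 by (intro mult_pos_pos add_nonneg_pos) auto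
  have \<tau>: "0 < \<tau>" "\<tau> \<le> 1" using den by (auto simp: \<tau>_def)
  have small: "\<kappa> * (\<kappa>\<^sub>1 * \<tau> + \<tau>\<^sup>2) \<le> 1 / (16 * L\<^sup>2)"
  proof -
    have "\<tau>\<^sup>2 \<le> \<tau>" using \<tau> by (simp add: power2_eq_square mult_left_le)
    then have "\<kappa> * (\<kappa>\<^sub>1 * \<tau> + \<tau>\<^sup>2) \<le> \<kappa> * ((\<kappa>\<^sub>1 + 1) * \<tau>)"
      using \<kappa> by (intro mult_left_mono) (auto simp: algebra_simps)
    also have "\<dots> \<le> (\<kappa> * (\<kappa>\<^sub>1 + 1) + 1) * \<tau>" using \<tau> by (simp add: algebra_simps)
    also have "\<dots> \<le> (\<kappa> * (\<kappa>\<^sub>1 + 1) + 1) * (1 / (16 * L\<^sup>2 * (\<kappa> * (\<kappa>\<^sub>1 + 1) + 1)))"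
      using \<kappa> \<kappa>\<^sub>1 by (intro mult_left_mono) (auto simp: \<tau>_def)
    also have "\<dots> = 1 / (16 * L\<^sup>2)"
      using den by (simp add: zero_less_mult_iff)
    finally show ?thesis .
  qed
  define \<epsilon> where "\<epsilon> = min (A / 2) (min (d\<^sub>0 / 20) (\<tau> / (2 * (\<kappa>\<^sub>1 + 1))))"
  define \<eta> where "\<eta> = min (\<tau> / 2) (1 / (20 * L\<^sup>2))"
  define m\<^sub>1 where "m\<^sub>1 = max m\<^sub>0 (nat \<lceil>(\<kappa> + K) * (16 * L\<^sup>2)\<rceil>)"
  define c\<^sub>0 where "c\<^sub>0 = 1 / (20 * L\<^sup>2)"
  define C\<^sub>0 where "C\<^sub>0 = ubound / d\<^sub>0 ^ 3 + 1 / d\<^sub>0\<^sup>2 + 1 / (8 * L\<^sup>2)"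
  have \<epsilon>: "0 < \<epsilon>" "\<epsilon> \<le> A / 2" "\<epsilon> \<le> d\<^sub>0 / 20"
    unfolding \<epsilon>_def using A_pos d0_pos \<tau> \<kappa>\<^sub>1 by (simp, linarith, linarith)
  have \<epsilon>\<tau>: "\<kappa>\<^sub>1 * \<epsilon> \<le> \<tau> / 2"
  proof -
    have "\<kappa>\<^sub>1 * \<epsilon> \<le> (\<kappa>\<^sub>1 + 1) * \<epsilon>" using \<epsilon> by (simp add: algebra_simps)
    also have "\<dots> \<le> (\<kappa>\<^sub>1 + 1) * (\<tau> / (2 * (\<kappa>\<^sub>1 + 1)))"
      using \<kappa>\<^sub>1 by (intro mult_left_mono) (auto simp: \<epsilon>_def)
    also have "\<dots> = \<tau> / 2" using \<kappa>\<^sub>1 by (simp add: field_simps)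
    finally show ?thesis .
  qed
  have \<eta>: "0 < \<eta>" "\<eta> \<le> \<tau> / 2" "\<eta> \<le> 1 / (20 * L\<^sup>2)" using \<tau> L by (auto simp: \<eta>_def)
  show ?thesis
  proof (rule that[of \<epsilon> \<eta> c\<^sub>0 m\<^sub>1 C\<^sub>0])
    fix m u j a a'
    assume m1: "m\<^sub>1 \<le> m" and j: "j < m" and a: "\<bar>a - A\<bar> \<le> \<epsilon>" and a': "\<bar>a' - A\<bar> \<le> \<epsilon>" and le: "a \<le> a'"
      and fl: "\<And>k. k \<in> {1, 2, 3} \<Longrightarrow> fluctuation x D A m (\<lambda>i. wt D A i ^ k) u \<le> \<eta> * sqrt (real m)"
    let ?s = "sqrt (real m)"
    have m: "m\<^sub>0 \<le> m" using m1 by (simp add: m\<^sub>1_def)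
    have mK: "\<kappa> + K \<le> real m / (16 * L\<^sup>2)"
    proof -
      have "(\<kappa> + K) * (16 * L\<^sup>2) \<le> real m" using m1 unfolding m\<^sub>1_def by linarith
      then show ?thesis using L by (simp add: field_simps)
    qed
    have ab: "0 \<le> a" "a \<le> 2 * A" "0 \<le> a'" "a' \<le> 2 * A" "0 < a" "0 < a'"
      using a a' \<epsilon> A_pos by (auto simp: abs_le_iff)
    have fl1: "fluctuation x D A m (wt D A) u \<le> ?s"
      using fl[of 1] \<eta> \<tau> mult_right_mono[of \<eta> 1 ?s] by (auto intro: order_trans)
    note sq = sum_squares_le[OF fl1]
    have sn: "score_norm x m (wsum x m (wt D A) u) \<le> \<eta> * ?s" "score_norm x m (wsum x m (\<lambda>j. (wt D A j)\<^sup>2) u) \<le> \<eta> * ?s"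
      using order.trans[OF fluctuation_ge(2) fl, of 1] order.trans[OF fluctuation_ge(2) fl, of 2] by simp_all
    have lip1: "score_norm x m (wsum x m (wt D b) u - wsum x m (wt D b') u) \<le> \<bar>b - b'\<bar> * \<kappa>\<^sub>1 * ?s"
      if b: "0 \<le> b" "0 \<le> b'" for b b'
    proof -
      have "score_norm x m (wsum x m (wt D b) u - wsum x m (wt D b') u)
          \<le> ((1 / d\<^sub>0\<^sup>2 + 2 / d\<^sub>0 ^ 3) * \<bar>b - b'\<bar>) * (sqrt cq * ubound) * ?s"
        unfolding wsum_diff
      proof (rule score_norm_wsum_le_sqrt[OF m sq(2)])
        show "\<bar>wt D b j - wt D b' j\<bar> \<le> (1 / d\<^sub>0\<^sup>2 + 2 / d\<^sub>0 ^ 3) * \<bar>b - b'\<bar>" for j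
          using d0_pos by (intro order.trans[OF wt_lipschitz[OF b]]) (simp add: distrib_right)
      qed (use d0_pos in simp)
      then show ?thesis by (simp add: \<kappa>\<^sub>1_def ac_simps)
    qed
    have lip2: "score_norm x m (wsum x m (\<lambda>j. (wt D b j)\<^sup>2) u - wsum x m (\<lambda>j. (wt D b' j)\<^sup>2) u) \<le> \<bar>b - b'\<bar> * \<kappa>\<^sub>1 * ?s"
      if b: "0 \<le> b" "0 \<le> b'" for b b'
    proof -
      have "score_norm x m (wsum x m (\<lambda>j. (wt D b j)\<^sup>2) u - wsum x m (\<lambda>j. (wt D b' j)\<^sup>2) u)
          \<le> ((1 / d\<^sub>0\<^sup>2 + 2 / d\<^sub>0 ^ 3) * \<bar>b - b'\<bar>) * (sqrt cq * ubound) * ?s"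
        unfolding wsum_diff
      proof (rule score_norm_wsum_le_sqrt[OF m sq(2)])
        show "\<bar>(wt D b j)\<^sup>2 - (wt D b' j)\<^sup>2\<bar> \<le> (1 / d\<^sub>0\<^sup>2 + 2 / d\<^sub>0 ^ 3) * \<bar>b - b'\<bar>" for j
          using d0_pos by (intro order.trans[OF wt_sq_lipschitz[OF b]]) (simp add: distrib_right)
      qed (use d0_pos in simp)
      then show ?thesis by (simp add: \<kappa>\<^sub>1_def ac_simps)
    qed
    have near: "\<eta> * ?s + \<bar>b - A\<bar> * \<kappa>\<^sub>1 * ?s \<le> \<tau> * ?s" if "\<bar>b - A\<bar> \<le> \<epsilon>" for b
    proof -
      have "\<bar>b - A\<bar> * \<kappa>\<^sub>1 \<le> \<kappa>\<^sub>1 * \<epsilon>" unfolding mult.commute[of _ \<kappa>\<^sub>1] by (intro mult_left_mono that \<kappa>\<^sub>1)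
      then have "\<eta> + \<bar>b - A\<bar> * \<kappa>\<^sub>1 \<le> \<tau>" using \<eta> \<epsilon>\<tau> by linarith
      from mult_right_mono[OF this, of ?s] show ?thesis by (simp add: distrib_right)
    qed
    have H1: "score_norm x m (wsum x m (wt D b) u) \<le> \<tau> * ?s" if "0 \<le> b" "\<bar>b - A\<bar> \<le> \<epsilon>" for b
      using score_norm_add[of x m "wsum x m (wt D b) u - wsum x m (wt D A) u" "wsum x m (wt D A) u"]
        lip1[of b A] that A_pos sn(1) near[of b] by simp
    have H2: "score_norm x m (wsum x m (\<lambda>j. (wt D b j)\<^sup>2) u) \<le> \<tau> * ?s" if "0 \<le> b" "\<bar>b - A\<bar> \<le> \<epsilon>" for b
      using score_norm_add[of x m "wsum x m (\<lambda>j. (wt D b j)\<^sup>2) u - wsum x m (\<lambda>j. (wt D A j)\<^sup>2) u" "wsum x m (\<lambda>j. (wt D A j)\<^sup>2) u"]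
        lip2[of b A] that A_pos sn(2) near[of b] by simp
    let ?\<delta> = "a' - a"
    have "\<bar>score_correction x D m a' u - score_correction x D m a u\<bar>
        \<le> \<kappa> * ((\<bar>a' - a\<bar> * \<kappa>\<^sub>1 * ?s) * (\<tau> * ?s) + \<bar>a' - a\<bar> * (\<tau> * ?s)\<^sup>2 + \<bar>a' - a\<bar>)"
      by (intro corr m ab lip1 lip2 H1 H2 a a')
    also have "\<dots> = ?\<delta> * ((\<kappa> * (\<kappa>\<^sub>1 * \<tau> + \<tau>\<^sup>2)) * (?s * ?s) + \<kappa>)"
      using le by (simp only: power2_eq_square abs_of_nonneg[of "a' - a"] diff_ge_0_iff_ge) algebra
    also have "?s * ?s = real m" by simp
    also have "?\<delta> * ((\<kappa> * (\<kappa>\<^sub>1 * \<tau> + \<tau>\<^sup>2)) * real m + \<kappa>) \<le> ?\<delta> * (1 / (16 * L\<^sup>2) * real m + \<kappa>)"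
      using le by (intro mult_left_mono add_mono mult_right_mono small) auto
    finally have c: "\<bar>score_correction x D m a' u - score_correction x D m a u\<bar> \<le> ?\<delta> * (1 / (16 * L\<^sup>2) * real m + \<kappa>)" .
    have l: "\<bar>l1 m j a' - l1 m j a\<bar> \<le> ?\<delta> * K"
      using l1_lipschitz[OF m j, of a' a] ab le by (simp add: mult.commute)
    have "?\<delta> * (1 / (16 * L\<^sup>2) * real m + \<kappa>) + ?\<delta> * K = ?\<delta> * (1 / (16 * L\<^sup>2) * real m + (\<kappa> + K))"
      by (simp add: algebra_simps)
    also have "\<dots> \<le> ?\<delta> * (1 / (16 * L\<^sup>2) * real m + real m / (16 * L\<^sup>2))"
      using le by (intro mult_left_mono add_mono mK order.refl) auto
    also have "\<dots> = ?\<delta> * (1 / (8 * L\<^sup>2) * real m)" by simp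
    finally have rest: "\<bar>score_correction x D m a' u - score_correction x D m a u\<bar> + \<bar>l1 m j a' - l1 m j a\<bar>
        \<le> ?\<delta> * (1 / (8 * L\<^sup>2) * real m)" using c l by linarith
    have fl3: "fluctuation x D A m (\<lambda>j. wt D A j ^ 3) u \<le> 1 / (20 * (2 * A + d\<^sub>1)\<^sup>2) * sqrt (real m)"
      using fl[of 3] \<eta>(3) mult_right_mono[OF \<eta>(3), of ?s] by (simp add: L_def)
    have lead: "leading_score D m a' u - leading_score D m a u \<le> - ?\<delta> * (real m / (5 * L\<^sup>2))"
      unfolding L_def using a a' \<epsilon> by (intro leading_score_decreasing fl3 ab le) linarith+
    have "- ?\<delta> * (real m / (5 * L\<^sup>2)) + ?\<delta> * (1 / (8 * L\<^sup>2) * real m) \<le> - c\<^sub>0 * real m * ?\<delta>"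
    proof -
      have "- ?\<delta> * (real m / (5 * L\<^sup>2)) + ?\<delta> * (1 / (8 * L\<^sup>2) * real m) = - (3 / 40) * (?\<delta> * real m / L\<^sup>2)"
      proof -
        define r where "r = ?\<delta> * real m / L\<^sup>2"
        have "- ?\<delta> * (real m / (5 * L\<^sup>2)) = - (r / 5)"
          unfolding mult_minus_left by (simp add: r_def)
        moreover have "?\<delta> * (1 / (8 * L\<^sup>2) * real m) = r / 8"
          by (simp add: r_def)
        ultimately show ?thesis unfolding r_def[symmetric] by simp
      qed
      also have "\<dots> \<le> - (1 / 20) * (?\<delta> * real m / L\<^sup>2)" using le by (intro mult_right_mono) auto
      also have "\<dots> = - c\<^sub>0 * real m * ?\<delta>" by (simp add: c\<^sub>0_def)
      finally show ?thesis .
    qed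
    moreover have "?\<delta> * ((ubound / d\<^sub>0 ^ 3 + 1 / d\<^sub>0\<^sup>2) * real m) + ?\<delta> * (1 / (8 * L\<^sup>2) * real m) = C\<^sub>0 * real m * ?\<delta>"
      unfolding C\<^sub>0_def by (simp add: algebra_simps)
    moreover have "\<bar>leading_score D m a' u - leading_score D m a u\<bar> \<le> ?\<delta> * ((ubound / d\<^sub>0 ^ 3 + 1 / d\<^sub>0\<^sup>2) * real m)"
      using leading_score_lipschitz[OF ab(1,3) sq(1)] le by simp
    ultimately show "adj_score m j a' u - adj_score m j a u \<le> - c\<^sub>0 * real m * (a' - a) \<and>
      \<bar>adj_score m j a' u - adj_score m j a u\<bar> \<le> C\<^sub>0 * real m * (a' - a)"
      using rest lead unfolding adj_score_def profile_score_eq by linarith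
  qed (use \<epsilon> \<eta> \<tau> L in \<open>auto simp: c\<^sub>0_def m\<^sub>1_def\<close>)
qed

lemma wrss_le: "m\<^sub>0 \<le> m \<Longrightarrow> 0 \<le> a \<Longrightarrow> wrss x m (wt D a) u \<le> (\<Sum>j<m. wt D a j * (u j)\<^sup>2)"
proof -
  assume a: "m\<^sub>0 \<le> m" "0 \<le> a"
  interpret full_rank_design x m by (rule full_rank) fact
  have "0 \<le> (\<Sum>j<m. wt D a j * ((x j \<bullet> wls x m (wt D a) u) * (x j \<bullet> wls x m (wt D a) u)))"
    using wt_pos[OF a(2)] by (intro sum_nonneg) (simp add: less_imp_le)
  also have "\<dots> = wls x m (wt D a) u \<bullet> wsum x m (wt D a) u"
    unfolding inner_gram_mult_vec[symmetric] by (simp add: normal_equations wt_pos a)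
  finally show ?thesis by (simp add: wrss_eq wt_pos a inner_commute)
qed

text \<open>
  The right-hand side is twice the Kullback-Leibler divergence of two centred normal distributions with variance ratio \<open>t\<close>.
\<close>

lemma ln_plus_inverse_ge:
  assumes "0 < (t::real)"
  shows "(sqrt (1 / t) - 1)\<^sup>2 \<le> ln t + 1 / t - 1"
proof -
  define r where "r = 1 / t"
  have r: "0 < r" using assms by (simp add: r_def)
  have "ln r = 2 * ln (sqrt r)" using r by (simp add: ln_sqrt)
  also have "\<dots> \<le> 2 * (sqrt r - 1)" using r by (intro mult_left_mono ln_le_minus_one) auto
  finally have "- ln t \<le> 2 * (sqrt r - 1)" using assms by (simp add: r_def ln_div)
  then have "r - 2 * sqrt r + 1 \<le> ln t + r - 1" by (simp add: algebra_simps)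
  moreover have "(sqrt r - 1)\<^sup>2 = r - 2 * sqrt r + 1"
    using r by (simp add: power2_diff)
  ultimately show ?thesis unfolding r_def[symmetric] by simp
qed

lemma likelihood_gap_arith:
  fixes t :: real
  assumes "t = la - lA + qa - qA - fa + fA" "w = qa - n" "la - lA + w - qA \<le> k\<^sub>1"
    "\<bar>fa\<bar> \<le> b\<^sub>1" "\<bar>fA\<bar> \<le> b\<^sub>2" "gm \<le> t" "n \<le> b\<^sub>3"
    "b\<^sub>1 + b\<^sub>2 + b\<^sub>3 = b" "b \<le> h" "h + h = gm" "k\<^sub>1 \<le> k\<^sub>2" "k\<^sub>2 < h"
  shows False
  using assms by linarith

text \<open>
  For \<open>a\<close> beyond a large constant the determinant terms alone decide. On the remaining compact interval the expected
  likelihood ratio is at least a multiple of \<open>m\<close> away from \<open>A\<close>, by convexity of \<open>t - 1 - ln t\<close>, and it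
  suffices to control the fluctuations on a grid of fixed size.
\<close>

lemma likelihood_consistency:
  assumes \<epsilon>: "0 < \<epsilon>" and C: "0 \<le> C" and lam: "0 < lam" "lam < 1"
  obtains G \<eta> m\<^sub>1 where "finite G" "\<And>b. b \<in> G \<Longrightarrow> 0 \<le> b" "0 < \<eta>" "\<eta> \<le> 1" "m\<^sub>0 \<le> m\<^sub>1"
    and "\<And>m u a. m\<^sub>1 \<le> m \<Longrightarrow>
      (\<And>b. b \<in> insert A G \<Longrightarrow> fluctuation x D A m (wt D b) u \<le> \<eta> * sqrt (real m)) \<Longrightarrow>
      0 \<le> a \<Longrightarrow> a \<le> C * real m powr lam \<Longrightarrow>
      profile_loglik x D m A u \<le> profile_loglik x D m a u + K * \<bar>a - A\<bar> \<Longrightarrow> \<bar>a - A\<bar> < \<epsilon>"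
proof -
  define q where "q = 1 / d\<^sub>0"
  have q: "0 < q" using d0_pos by (simp add: q_def)
  \<comment> \<open>Beyond \<open>M\<close> each term \<open>ln (a + D j) - ln (A + D j)\<close> is at least 3, while the weighted sum of squares at \<open>A\<close> is at most \<open>2 * m\<close>.\<close>
  define M where "M = (A + d\<^sub>1) * exp 3"
  have Ad: "0 < A + d\<^sub>1" using A_pos d1_pos by simp
  have M: "0 < M" using Ad by (simp add: M_def)
  define \<kappa> where "\<kappa> = cq * d\<^sub>1 / d\<^sub>0\<^sup>2 + 2 * K"
  have \<kappa>: "0 \<le> \<kappa>" using cq_nonneg d1_pos d0_pos K_nonneg by (simp add: \<kappa>_def)
  \<comment> \<open>A lower bound for twice the expected logarithmic likelihood ratio of one area at distance at least \<open>\<epsilon>\<close> from \<open>A\<close>.\<close>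
  define g where "g = (\<epsilon> / (M + d\<^sub>1) / (sqrt ((A + d\<^sub>1) / d\<^sub>0) + 1))\<^sup>2"
  have sq0: "0 \<le> sqrt ((A + d\<^sub>1) / d\<^sub>0)" using Ad d0_pos by simp
  have g: "0 < g" unfolding g_def using \<epsilon> M d1_pos sq0
    by (intro zero_less_power divide_pos_pos add_pos_pos add_nonneg_pos) auto
  define U where "U = sqrt cq * ubound"
  have U: "0 \<le> U" using cq_nonneg ubound_ge_1 by (simp add: U_def)
  \<comment> \<open>The errors from the fluctuations on the grid, from its mesh \<open>\<tau>\<close> and from the fit add up to at most \<open>\<tau> * \<Lambda>\<close> per area.\<close>
  define \<Lambda> where "\<Lambda> = 2 + 2 * ubound * q\<^sup>2 + (M + d\<^sub>1) * (1 + q\<^sup>2 * U)\<^sup>2"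
  have \<Lambda>: "2 \<le> \<Lambda>" using M d1_pos ubound_ge_1 by (simp add: \<Lambda>_def)
  define \<tau> where "\<tau> = min 1 (g / (2 * \<Lambda>))"
  have \<tau>: "0 < \<tau>" "\<tau> \<le> 1" "\<tau> * \<Lambda> \<le> g / 2"
  proof -
    show "0 < \<tau>" "\<tau> \<le> 1" using g \<Lambda> by (auto simp: \<tau>_def)
    have "\<tau> * \<Lambda> \<le> g / (2 * \<Lambda>) * \<Lambda>" using \<Lambda> by (intro mult_right_mono) (auto simp: \<tau>_def)
    then show "\<tau> * \<Lambda> \<le> g / 2" using \<Lambda> by simp
  qed
  define G where "G = (\<lambda>k. \<tau> * real k) ` {..nat \<lceil>M / \<tau>\<rceil>}"
  have ev: "eventually (\<lambda>m. \<kappa> * (C * real m powr lam + A) < real m \<and> \<kappa> * (M + A) < g / 2 * real m) sequentially"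
  proof (intro eventually_conj)
    have "((\<lambda>m. \<kappa> * (C * (real m powr lam / real m) + A / real m)) \<longlongrightarrow> \<kappa> * (C * 0 + 0)) sequentially"
    proof (intro tendsto_mult tendsto_add tendsto_const)
      have "((\<lambda>m. real m powr (lam - 1)) \<longlongrightarrow> 0) sequentially"
        using lam by (intro tendsto_neg_powr filterlim_real_sequentially) auto
      then show "((\<lambda>m. real m powr lam / real m) \<longlongrightarrow> 0) sequentially"
        by (rule Lim_transform_eventually)
           (use eventually_gt_at_top[of 0] in \<open>auto elim!: eventually_mono simp: powr_diff\<close>)
      show "((\<lambda>m. A / real m) \<longlongrightarrow> 0) sequentially" by (rule lim_const_over_n)
    qed
    then have "eventually (\<lambda>m. \<kappa> * (C * (real m powr lam / real m) + A / real m) < 1) sequentially"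
      by (rule order_tendstoD) simp
    then show "eventually (\<lambda>m. \<kappa> * (C * real m powr lam + A) < real m) sequentially"
      using eventually_gt_at_top[of 0]
    proof eventually_elim
      case (elim m)
      have "\<kappa> * (C * real m powr lam + A) = \<kappa> * (C * (real m powr lam / real m) + A / real m) * real m"
        using elim by (simp add: field_simps)
      also have "\<dots> < 1 * real m" using elim by (intro mult_strict_right_mono) auto
      finally show ?case by simp
    qed
    have "eventually (\<lambda>m. \<kappa> * (M + A) / (g / 2) < real m) sequentially"
      using filterlim_real_sequentially by (simp add: filterlim_at_top_dense)
    then show "eventually (\<lambda>m. \<kappa> * (M + A) < g / 2 * real m) sequentially"
      by eventually_elim (use g in \<open>simp add: field_simps\<close>)
  qed
  then obtain m\<^sub>2 where m2: "\<And>m. m\<^sub>2 \<le> m \<Longrightarrow> \<kappa> * (C * real m powr lam + A) < real m \<and> \<kappa> * (M + A) < g / 2 * real m"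
    by (auto simp: eventually_sequentially)
  show ?thesis
  proof (rule that[of G \<tau> "max m\<^sub>0 m\<^sub>2"])
    fix m u a
    assume m': "max m\<^sub>0 m\<^sub>2 \<le> m" and a: "0 \<le> a" "a \<le> C * real m powr lam"
      and fl: "\<And>b. b \<in> insert A G \<Longrightarrow> fluctuation x D A m (wt D b) u \<le> \<tau> * sqrt (real m)"
      and lik: "profile_loglik x D m A u \<le> profile_loglik x D m a u + K * \<bar>a - A\<bar>"
    let ?s = "sqrt (real m)"
    have m: "m\<^sub>0 \<le> m" "m\<^sub>2 \<le> m" using m' by auto
    have mpos: "0 < real m" using m m0_pos by simp
    interpret full_rank_design x m by (rule full_rank) fact
    have A0: "0 \<le> A" using A_pos by simp
    have nzA: "A + D j \<noteq> 0" "0 < A + D j" for j using A_pos D_pos[of j] by linarith+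
    have posa: "0 < a + D j" for j using a D_pos[of j] by linarith
    have fl1: "fluctuation x D A m (wt D A) u \<le> ?s"
      using fl[of A] \<tau> mult_right_mono[of \<tau> 1 ?s] by (auto intro: order_trans)
    note sq = sum_squares_le[OF fl1]
    have lip: "\<bar>ln (det (gram x m (wt D a))) - ln (det (gram x m (wt D A)))\<bar> \<le> cq * d\<^sub>1 / d\<^sub>0\<^sup>2 * \<bar>a - A\<bar>"
      using ln_det_gram_lipschitz[OF m(1) a(1) A0] .
    have "\<kappa> * \<bar>a - A\<bar> = cq * d\<^sub>1 / d\<^sub>0\<^sup>2 * \<bar>a - A\<bar> + 2 * (K * \<bar>a - A\<bar>)"
      unfolding \<kappa>_def by (simp add: algebra_simps)
    then have key: "(\<Sum>j<m. ln (a + D j)) - (\<Sum>j<m. ln (A + D j)) + wrss x m (wt D a) u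
        - (\<Sum>j<m. wt D A j * (u j)\<^sup>2) \<le> \<kappa> * \<bar>a - A\<bar>"
      using lik lip wrss_le[OF m(1) A0, of u] unfolding profile_loglik_def by (simp add: field_simps)
    have fluct: "\<bar>\<Sum>j<m. wt D b j * ((u j)\<^sup>2 - (A + D j))\<bar> \<le> \<tau> * real m" if "b \<in> insert A G" for b
    proof -
      have "\<bar>\<Sum>j<m. wt D b j * ((u j)\<^sup>2 - (A + D j))\<bar> \<le> \<tau> * ?s * ?s"
        using order.trans[OF fluctuation_ge(1) mult_right_mono[OF fl[OF that], of ?s]] by simp
      then show ?thesis by (simp add: mult.assoc)
    qed
    show "\<bar>a - A\<bar> < \<epsilon>"
    proof (rule ccontr)
      assume "\<not> \<bar>a - A\<bar> < \<epsilon>"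
      then have far: "\<epsilon> \<le> \<bar>a - A\<bar>" by simp
      show False
      proof (cases "M \<le> a")
        case True
        have "(\<Sum>j<m. 3) \<le> (\<Sum>j<m. ln (a + D j) - ln (A + D j))"
        proof (rule sum_mono)
          fix j
          have "ln M \<le> ln (a + D j)" using True M D_pos[of j] by (subst ln_le_cancel_iff) auto
          moreover have "ln (A + D j) \<le> ln (A + d\<^sub>1)" using nzA(2)[of j] D_le[of j] Ad by (subst ln_le_cancel_iff) auto
          moreover have "ln M = ln (A + d\<^sub>1) + 3" using Ad by (simp add: M_def ln_mult)
          ultimately show "3 \<le> ln (a + D j) - ln (A + D j)" by linarith
        qed
        then have "3 * real m \<le> (\<Sum>j<m. ln (a + D j)) - (\<Sum>j<m. ln (A + D j))"
          by (simp add: sum_subtractf mult.commute)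
        moreover have "(\<Sum>j<m. wt D A j * (u j)\<^sup>2) \<le> 2 * real m"
        proof -
          have "(\<Sum>j<m. wt D A j * ((u j)\<^sup>2 - (A + D j))) = (\<Sum>j<m. wt D A j * (u j)\<^sup>2) - real m"
            by (simp add: wt_def right_diff_distrib nzA sum_subtractf)
          moreover have "(\<Sum>j<m. wt D A j * ((u j)\<^sup>2 - (A + D j))) \<le> \<tau> * real m"
            using fluct[of A] by simp
          moreover have "\<tau> * real m \<le> 1 * real m" using \<tau> by (intro mult_right_mono) auto
          ultimately show ?thesis by linarith
        qed
        moreover have "0 \<le> wrss x m (wt D a) u" by (intro wrss_nonneg wt_pos a)
        moreover have "\<kappa> * \<bar>a - A\<bar> \<le> \<kappa> * (C * real m powr lam + A)"
          using a A_pos \<kappa> by (intro mult_left_mono) auto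
        ultimately show False using key m2[OF m(2)] by linarith
      next
        case False
        define k where "k = nat \<lfloor>a / \<tau>\<rfloor>"
        define b where "b = \<tau> * real k"
        have "real k \<le> a / \<tau>" "a / \<tau> < real k + 1" using a \<tau> by (simp_all add: k_def)
        then have "\<tau> * real k \<le> a" "a < \<tau> * (real k + 1)" using \<tau> by (simp_all add: field_simps)
        then have ab: "\<bar>a - b\<bar> \<le> \<tau>" unfolding b_def by (simp add: distrib_left)
        have b0: "0 \<le> b" using \<tau> by (simp add: b_def)
        have "k \<le> nat \<lceil>M / \<tau>\<rceil>"
        proof -
          have "a / \<tau> \<le> M / \<tau>" using False \<tau> by (simp add: divide_right_mono)
          then show ?thesis unfolding k_def by (intro nat_mono) linarith
        qed
        then have bG: "b \<in> insert A G" by (auto simp: b_def G_def)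
        have diff: "\<bar>wt D a j - wt D b j\<bar> \<le> q\<^sup>2 * \<tau>" for j
        proof -
          have "\<bar>wt D a j - wt D b j\<bar> \<le> \<bar>a - b\<bar> / d\<^sub>0\<^sup>2" by (rule wt_lipschitz[OF a(1) b0])
          also have "\<dots> \<le> \<tau> / d\<^sub>0\<^sup>2" by (intro divide_right_mono ab) simp
          finally show ?thesis by (simp add: q_def power_divide)
        qed
        have sn: "score_norm x m (wsum x m (wt D a) u) \<le> \<tau> * ((1 + q\<^sup>2 * U) * ?s)"
        proof -
          have "score_norm x m (wsum x m (wt D a) u - wsum x m (wt D b) u) \<le> q\<^sup>2 * \<tau> * (sqrt cq * ubound) * ?s"
            unfolding wsum_diff using \<tau> by (intro score_norm_wsum_le_sqrt[OF m(1) sq(2)] diff) auto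
          moreover have "score_norm x m (wsum x m (wt D b) u) \<le> \<tau> * ?s"
            using order.trans[OF fluctuation_ge(2) fl[OF bG]] .
          ultimately show ?thesis
            using score_norm_add[of x m "wsum x m (wt D a) u - wsum x m (wt D b) u" "wsum x m (wt D b) u"]
            unfolding U_def by (simp add: algebra_simps)
        qed
        have nb: "wsum x m (wt D a) u \<bullet> wls x m (wt D a) u \<le> \<tau> * ((M + d\<^sub>1) * (1 + q\<^sup>2 * U)\<^sup>2) * real m"
        proof -
          have pos: "0 < a + d\<^sub>1" using a d1_pos by linarith
          have "design_norm x m (wls x m (wt D a) u) \<le> score_norm x m (wsum x m (wt D a) u) / (1 / (a + d\<^sub>1))"
            unfolding wls_eq using pos by (intro design_norm_solution_le wt_ge a) auto
          also have "\<dots> = (a + d\<^sub>1) * score_norm x m (wsum x m (wt D a) u)" using pos by simp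
          also have "\<dots> \<le> (M + d\<^sub>1) * (\<tau> * ((1 + q\<^sup>2 * U) * ?s))"
            using False pos by (intro mult_mono sn score_norm_nonneg) auto
          finally have hn: "design_norm x m (wls x m (wt D a) u) \<le> (M + d\<^sub>1) * (\<tau> * ((1 + q\<^sup>2 * U) * ?s))" .
          have "wsum x m (wt D a) u \<bullet> wls x m (wt D a) u
              \<le> (\<tau> * ((1 + q\<^sup>2 * U) * ?s)) * ((M + d\<^sub>1) * (\<tau> * ((1 + q\<^sup>2 * U) * ?s)))"
            using inner_le_norms[of "wsum x m (wt D a) u" "wls x m (wt D a) u"] \<tau> U
              mult_mono[OF sn hn _ design_norm_nonneg]
            by (smt (verit) mult_nonneg_nonneg real_sqrt_ge_zero of_nat_0_le_iff zero_le_power2)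
          also have "\<dots> = \<tau> * (\<tau> * ((M + d\<^sub>1) * (1 + q\<^sup>2 * U)\<^sup>2) * (?s * ?s))"
            by (simp only: power2_eq_square ac_simps)
          also have "\<dots> \<le> 1 * (\<tau> * ((M + d\<^sub>1) * (1 + q\<^sup>2 * U)\<^sup>2) * (?s * ?s))"
            using \<tau> M d1_pos by (intro mult_right_mono) auto
          finally show ?thesis by simp
        qed
        have 1: "\<bar>\<Sum>j<m. wt D a j * ((u j)\<^sup>2 - (A + D j))\<bar> \<le> \<tau> * (1 + 2 * ubound * q\<^sup>2) * real m"
        proof -
          have "\<bar>\<Sum>j<m. (wt D a j - wt D b j) * ((u j)\<^sup>2 - (A + D j))\<bar>
              \<le> (\<Sum>j<m. q\<^sup>2 * \<tau> * ((u j)\<^sup>2 + (A + d\<^sub>1)))"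
          proof (rule order.trans[OF sum_abs], rule sum_mono, rule abs_mult_le[OF diff])
            fix j
            show "\<bar>(u j)\<^sup>2 - (A + D j)\<bar> \<le> (u j)\<^sup>2 + (A + d\<^sub>1)"
              using nzA(2)[of j] D_le[of j] zero_le_power2[of "u j"] unfolding abs_le_iff by linarith
          qed
          also have "\<dots> = q\<^sup>2 * \<tau> * ((\<Sum>j<m. (u j)\<^sup>2) + (A + d\<^sub>1) * real m)"
            by (simp add: sum_distrib_left[symmetric] sum.distrib mult.commute)
          also have "\<dots> \<le> q\<^sup>2 * \<tau> * (ubound * real m + ubound * real m)"
          proof (intro mult_left_mono add_mono sq mult_right_mono)
            show "A + d\<^sub>1 \<le> ubound" using Ad by (simp add: ubound_def)
          qed (use \<tau> in auto)
          finally have "\<bar>\<Sum>j<m. (wt D a j - wt D b j) * ((u j)\<^sup>2 - (A + D j))\<bar> \<le> \<tau> * (2 * ubound * q\<^sup>2) * real m"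
            by (simp add: algebra_simps)
          moreover have "(\<Sum>j<m. wt D a j * ((u j)\<^sup>2 - (A + D j)))
              = (\<Sum>j<m. (wt D a j - wt D b j) * ((u j)\<^sup>2 - (A + D j))) + (\<Sum>j<m. wt D b j * ((u j)\<^sup>2 - (A + D j)))"
            unfolding sum.distrib[symmetric] by (intro sum.cong refl) (simp add: algebra_simps)
          moreover have "\<tau> * (1 + 2 * ubound * q\<^sup>2) * real m = \<tau> * (2 * ubound * q\<^sup>2) * real m + \<tau> * real m"
            by (simp add: algebra_simps)
          ultimately show ?thesis using fluct[OF bG] by linarith
        qed
        have 2: "g * real m \<le> (\<Sum>j<m. ln (a + D j) - ln (A + D j) + (wt D a j - wt D A j) * (A + D j))"
        proof -
          have "(\<Sum>j<m. g) \<le> (\<Sum>j<m. ln (a + D j) - ln (A + D j) + (wt D a j - wt D A j) * (A + D j))"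
          proof (rule sum_mono)
            fix j
            define t where "t = (a + D j) / (A + D j)"
            have t: "0 < t" using nzA posa by (simp add: t_def)
            have "1 / t \<le> (A + d\<^sub>1) / d\<^sub>0"
              unfolding t_def using nzA(2)[of j] a D_le[of j] D_ge[of j] d0_pos by (simp add: frac_le)
            then have s: "sqrt (1 / t) + 1 \<le> sqrt ((A + d\<^sub>1) / d\<^sub>0) + 1" by simp
            have "\<epsilon> / (M + d\<^sub>1) \<le> \<bar>1 / t - 1\<bar>"
            proof -
              have "1 / t - 1 = (A - a) / (a + D j)" using posa[of j] by (simp add: t_def field_simps)
              then have "\<bar>1 / t - 1\<bar> = \<bar>a - A\<bar> / (a + D j)" using posa[of j] by (simp add: abs_divide abs_minus_commute)
              moreover have "\<epsilon> / (M + d\<^sub>1) \<le> \<bar>a - A\<bar> / (a + D j)"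
                using far False posa[of j] D_le[of j] by (intro frac_le) auto
              ultimately show ?thesis by simp
            qed
            also have "\<dots> = \<bar>sqrt (1 / t) - 1\<bar> * (sqrt (1 / t) + 1)"
            proof -
              have "1 / t - 1 = (sqrt (1 / t) - 1) * (sqrt (1 / t) + 1)"
                using t real_sqrt_mult_self[of "1 / t"] by (simp add: algebra_simps)
              moreover have "0 \<le> sqrt (1 / t) + 1" using t by simp
              ultimately show ?thesis by (simp add: abs_mult)
            qed
            also have "\<dots> \<le> \<bar>sqrt (1 / t) - 1\<bar> * (sqrt ((A + d\<^sub>1) / d\<^sub>0) + 1)"
              by (intro mult_left_mono s) simp
            finally have "\<epsilon> / (M + d\<^sub>1) / (sqrt ((A + d\<^sub>1) / d\<^sub>0) + 1) \<le> \<bar>sqrt (1 / t) - 1\<bar>"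
              using add_nonneg_pos[OF sq0 zero_less_one] by (simp only: pos_divide_le_eq)
            then have "g \<le> \<bar>sqrt (1 / t) - 1\<bar>\<^sup>2"
              unfolding g_def using \<epsilon> M d1_pos sq0 by (intro power_mono) auto
            also have "\<dots> \<le> ln t + 1 / t - 1" using ln_plus_inverse_ge[OF t] by simp
            also have "ln t = ln (a + D j) - ln (A + D j)" unfolding t_def using posa[of j] nzA(2)[of j] by (simp add: ln_div)
            also have "1 / t = wt D a j * (A + D j)" by (simp add: t_def wt_def)
            also have "1 = wt D A j * (A + D j)" using nzA[of j] by (simp add: wt_def)
            finally show "g \<le> ln (a + D j) - ln (A + D j) + (wt D a j - wt D A j) * (A + D j)"
              by (simp add: left_diff_distrib)
          qed
          then show ?thesis by (simp add: mult.commute)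
        qed
        have "(\<Sum>j<m. ln (a + D j) - ln (A + D j) + (wt D a j - wt D A j) * (A + D j))
            = (\<Sum>j<m. ln (a + D j)) - (\<Sum>j<m. ln (A + D j)) + (\<Sum>j<m. wt D a j * (u j)\<^sup>2)
              - (\<Sum>j<m. wt D A j * (u j)\<^sup>2) - (\<Sum>j<m. wt D a j * ((u j)\<^sup>2 - (A + D j)))
              + (\<Sum>j<m. wt D A j * ((u j)\<^sup>2 - (A + D j)))"
          unfolding sum_subtractf[symmetric] sum.distrib[symmetric]
          by (intro sum.cong refl) (simp add: algebra_simps)
        moreover have "wrss x m (wt D a) u = (\<Sum>j<m. wt D a j * (u j)\<^sup>2) - wsum x m (wt D a) u \<bullet> wls x m (wt D a) u"
          by (intro wrss_eq wt_pos a)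
        moreover have "\<tau> * (1 + 2 * ubound * q\<^sup>2) * real m + \<tau> * real m + \<tau> * ((M + d\<^sub>1) * (1 + q\<^sup>2 * U)\<^sup>2) * real m
            = \<tau> * \<Lambda> * real m"
          unfolding \<Lambda>_def by (simp add: algebra_simps)
        moreover have "\<tau> * \<Lambda> * real m \<le> g / 2 * real m" by (intro mult_right_mono \<tau>) simp
        moreover have "g / 2 * real m + g / 2 * real m = g * real m" by simp
        moreover have "\<kappa> * \<bar>a - A\<bar> \<le> \<kappa> * (M + A)"
          using a False A_pos \<kappa> by (intro mult_left_mono) auto
        moreover have "\<kappa> * (M + A) < g / 2 * real m" using m2[OF m(2)] by simp
        ultimately show False
          by (rule likelihood_gap_arith[OF _ _ key 1 fluct[OF insertI1] 2 nb])
      qed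
    qed
  qed (use \<tau> in \<open>auto simp: G_def\<close>)
qed

end

section \<open>The root of the likelihood equation\<close>

section \<open>Stochastic orders and the expansion of the maximizer\<close>

lemma half_le_self: "0 \<le> r \<Longrightarrow> r / 2 \<le> (r::real)"
  by simp

context adjusted_design
begin

text \<open>
  One variable that dominates all fluctuations in use. The set \<open>G\<close> is the grid needed for consistency; the powers up to
  the fourth occur in the expansion of the score at \<open>A\<close>.
\<close>

definition envelope :: "real set \<Rightarrow> nat \<Rightarrow> (nat \<Rightarrow> real) \<Rightarrow> real"
  where "envelope G m u = 1 + (\<Sum>p\<in>insert A G \<times> {1..4}. fluctuation x D A m (\<lambda>i. wt D (fst p) i ^ snd p) u)"

lemma envelope_ge_1: "1 \<le> envelope G m u"
  unfolding envelope_def using sum_nonneg[OF fluctuation_ge(3)] by (simp add: fluctuation_ge(3) sum_nonneg)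

lemma fluctuation_le_envelope:
  assumes "finite G" "b \<in> insert A G" "k \<in> {1..4}"
  shows "fluctuation x D A m (\<lambda>i. wt D b i ^ k) u \<le> envelope G m u"
proof -
  have "fluctuation x D A m (\<lambda>i. wt D (fst (b, k)) i ^ snd (b, k)) u
      \<le> (\<Sum>p\<in>insert A G \<times> {1..4}. fluctuation x D A m (\<lambda>i. wt D (fst p) i ^ snd p) u)"
    using assms by (intro member_le_sum) (auto intro: fluctuation_ge(3))
  then show ?thesis by (simp add: envelope_def)
qed

lemma score_norm_wt_le_envelope:
  assumes "finite G"
  shows "score_norm x m (wsum x m (wt D A) u) \<le> envelope G m u"
    "score_norm x m (wsum x m (\<lambda>j. (wt D A j)\<^sup>2) u) \<le> envelope G m u"
    "score_norm x m (wsum x m (\<lambda>j. wt D A j ^ 3) u) \<le> envelope G m u"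
  using order.trans[OF fluctuation_ge(2) fluctuation_le_envelope[OF assms, of A 1]]
    order.trans[OF fluctuation_ge(2) fluctuation_le_envelope[OF assms, of A 2]]
    order.trans[OF fluctuation_ge(2) fluctuation_le_envelope[OF assms, of A 3]]
  by simp_all

lemma design_norm_wls_A_le:
  assumes "finite G" "m\<^sub>0 \<le> m"
  shows "design_norm x m (wls x m (wt D A) u) \<le> (A + d\<^sub>1) * envelope G m u"
proof -
  interpret full_rank_design x m by (rule full_rank) fact
  have pos: "0 < A + d\<^sub>1" using A_pos d1_pos by simp
  have "design_norm x m (wls x m (wt D A) u) \<le> score_norm x m (wsum x m (wt D A) u) / (1 / (A + d\<^sub>1))"
    unfolding wls_eq using pos A_pos by (intro design_norm_solution_le wt_ge) auto
  also have "\<dots> \<le> envelope G m u / (1 / (A + d\<^sub>1))"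
    using pos by (intro divide_right_mono score_norm_wt_le_envelope assms) auto
  finally show ?thesis by (simp add: mult.commute)
qed

lemma score_correction_A_le:
  assumes "finite G" "m\<^sub>0 \<le> m"
  shows "\<bar>score_correction x D m A u\<bar>
    \<le> ((A + d\<^sub>1) * cq / d\<^sub>0\<^sup>2 + (A + d\<^sub>1) + (A + d\<^sub>1)\<^sup>2 / d\<^sub>0\<^sup>2) * (envelope G m u)\<^sup>2"
proof -
  interpret full_rank_design x m by (rule full_rank) fact
  define b W where "b = wls x m (wt D A) u" and "W = envelope G m u"
  define L where "L = A + d\<^sub>1"
  have L: "0 < L" using A_pos d1_pos by (simp add: L_def)
  have A0: "0 \<le> A" using A_pos by simp
  have m: "0 < real m" using assms m0_pos by simp
  have W: "1 \<le> W" unfolding W_def by (rule envelope_ge_1)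
  have b: "design_norm x m b \<le> L * W"
    unfolding b_def W_def L_def by (rule design_norm_wls_A_le) fact+
  have sq: "\<bar>(wt D A j)\<^sup>2\<bar> \<le> 1 / d\<^sub>0\<^sup>2" for j
    using power_mono[OF wt_le[OF A0, of j], of 2] wt_pos[OF A0, of j] by (simp add: power_divide)
  have 1: "\<bar>\<Sum>j<m. (wt D A j)\<^sup>2 * gkernel x m (wt D A) j j\<bar> \<le> 1 / d\<^sub>0\<^sup>2 * (L * cq)"
  proof -
    have "\<bar>\<Sum>j<m. (wt D A j)\<^sup>2 * gkernel x m (wt D A) j j\<bar> \<le> (\<Sum>j<m. 1 / d\<^sub>0\<^sup>2 * (L * (cq / real m)))"
      unfolding L_def
      by (rule order.trans[OF sum_abs], rule sum_mono, rule abs_mult_le[OF sq], rule gkernel_le)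
         (use assms A0 in auto)
    then show ?thesis using m by simp
  qed
  have 2: "\<bar>wsum x m (\<lambda>j. (wt D A j)\<^sup>2) u \<bullet> b\<bar> \<le> W * (L * W)"
  proof (rule order.trans[OF inner_le_norms])
    have "score_norm x m (wsum x m (\<lambda>j. (wt D A j)\<^sup>2) u) \<le> W"
      unfolding W_def by (rule score_norm_wt_le_envelope(2)[OF assms(1)])
    then show "score_norm x m (wsum x m (\<lambda>j. (wt D A j)\<^sup>2) u) * design_norm x m b \<le> W * (L * W)"
      using W by (intro mult_mono b design_norm_nonneg) auto
  qed
  have 3: "\<bar>\<Sum>j<m. (wt D A j)\<^sup>2 * ((x j \<bullet> b) * (x j \<bullet> b))\<bar> \<le> 1 / d\<^sub>0\<^sup>2 * (L * W * (L * W))"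
  proof (rule order.trans[OF sum_weighted_inner_le[OF sq]])
    show "1 / d\<^sub>0\<^sup>2 * (design_norm x m b * design_norm x m b) \<le> 1 / d\<^sub>0\<^sup>2 * (L * W * (L * W))"
      using L W by (intro mult_left_mono mult_mono b design_norm_nonneg) auto
  qed simp
  have "\<bar>score_correction x D m A u\<bar> \<le> 1 / 2 * (1 / d\<^sub>0\<^sup>2 * (L * cq)) + W * (L * W) + 1 / 2 * (1 / d\<^sub>0\<^sup>2 * (L * W * (L * W)))"
    using abs_half_diff_le[of _ 0 _ _ 0 _ _ 0, unfolded diff_zero, OF 1 2 3]
    unfolding score_correction_def b_def[symmetric] by simp
  also have "\<dots> \<le> (L * cq / d\<^sub>0\<^sup>2) * W\<^sup>2 + L * W\<^sup>2 + L\<^sup>2 / d\<^sub>0\<^sup>2 * W\<^sup>2"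
  proof -
    have "1 \<le> W\<^sup>2" using W by simp
    moreover have nn: "0 \<le> L * cq / d\<^sub>0\<^sup>2" using L cq_nonneg by simp
    ultimately have ge: "L * cq / d\<^sub>0\<^sup>2 * 1 \<le> (L * cq / d\<^sub>0\<^sup>2) * W\<^sup>2" by (rule mult_left_mono)
    have "1 / 2 * (1 / d\<^sub>0\<^sup>2 * (L * cq)) = (L * cq / d\<^sub>0\<^sup>2) / 2" by simp
    also have "\<dots> \<le> L * cq / d\<^sub>0\<^sup>2 * 1" using nn by (simp only: mult_1_right) (rule half_le_self)
    also note ge
    finally have "1 / 2 * (1 / d\<^sub>0\<^sup>2 * (L * cq)) \<le> (L * cq / d\<^sub>0\<^sup>2) * W\<^sup>2" .
    moreover have "W * (L * W) = L * W\<^sup>2" by (simp add: power2_eq_square)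
    moreover have "1 / 2 * (1 / d\<^sub>0\<^sup>2 * (L * W * (L * W))) \<le> L\<^sup>2 / d\<^sub>0\<^sup>2 * W\<^sup>2"
    proof -
      have "1 / 2 * (1 / d\<^sub>0\<^sup>2 * (L * W * (L * W))) = L\<^sup>2 / d\<^sub>0\<^sup>2 * W\<^sup>2 / 2"
        by (simp add: power2_eq_square mult_ac)
      also have "\<dots> \<le> L\<^sup>2 / d\<^sub>0\<^sup>2 * W\<^sup>2" by (rule half_le_self) simp
      finally show ?thesis .
    qed
    ultimately show ?thesis by linarith
  qed
  finally show ?thesis unfolding L_def W_def by (simp add: distrib_right)
qed

lemma leading_score_A: "leading_score D m A u = 1 / 2 * (\<Sum>j<m. (wt D A j)\<^sup>2 * ((u j)\<^sup>2 - (A + D j)))"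
proof -
  have nz: "A + D j \<noteq> 0" for j using A_pos D_pos[of j] by linarith
  show ?thesis unfolding leading_score_def
    by (intro arg_cong[where f = "\<lambda>s. 1 / 2 * s"] sum.cong refl)
       (simp add: right_diff_distrib wt_def power2_eq_square nz)
qed

end

text \<open>
  The set of observations on which the likelihood equation has a unique root near \<open>A\<close> is
  \<open>envelope G m u \<le> \<eta> * sqrt (real m)\<close>, a condition on \<open>u\<close> alone.
\<close>

locale local_root = adjusted_design +
  fixes G :: "real set" and \<epsilon> \<eta> c\<^sub>0 C\<^sub>0 C\<^sub>s :: real and m\<^sub>1 :: nat
  assumes fin_G: "finite G"
    and eps: "0 < \<epsilon>" "\<epsilon> \<le> A / 2" and eta: "0 < \<eta>" "\<eta> \<le> 1" and c0: "0 < c\<^sub>0" and m01: "m\<^sub>0 \<le> m\<^sub>1"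
    and slope: "\<And>m u j a a'. m\<^sub>1 \<le> m \<Longrightarrow> envelope G m u \<le> \<eta> * sqrt (real m) \<Longrightarrow>
      j < m \<Longrightarrow> \<bar>a - A\<bar> \<le> \<epsilon> \<Longrightarrow> \<bar>a' - A\<bar> \<le> \<epsilon> \<Longrightarrow> a \<le> a' \<Longrightarrow>
      adj_score m j a' u - adj_score m j a u \<le> - c\<^sub>0 * real m * (a' - a) \<and>
      \<bar>adj_score m j a' u - adj_score m j a u\<bar> \<le> C\<^sub>0 * real m * (a' - a)"
    and score_at_A: "\<And>m u j. m\<^sub>1 \<le> m \<Longrightarrow> envelope G m u \<le> \<eta> * sqrt (real m) \<Longrightarrow> j < m \<Longrightarrow>
      \<bar>adj_score m j A u\<bar> \<le> C\<^sub>s * (envelope G m u * sqrt (real m))"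
    and eta_small: "C\<^sub>s * \<eta> \<le> c\<^sub>0 * \<epsilon>" "0 \<le> C\<^sub>s"
begin

definition good :: "nat \<Rightarrow> (nat \<Rightarrow> real) \<Rightarrow> bool"
  where "good m u \<longleftrightarrow> envelope G m u \<le> \<eta> * sqrt (real m)"

definition root :: "nat \<Rightarrow> nat \<Rightarrow> (nat \<Rightarrow> real) \<Rightarrow> real"
  where "root m j u = (THE t. \<bar>t - A\<bar> \<le> \<epsilon> \<and> adj_score m j t u = 0)"

abbreviation W :: "nat \<Rightarrow> (nat \<Rightarrow> real) \<Rightarrow> real" where "W \<equiv> envelope G"

lemma m_pos: "m\<^sub>1 \<le> m \<Longrightarrow> 1 \<le> real m" "m\<^sub>1 \<le> m \<Longrightarrow> m\<^sub>0 \<le> m"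
  using m01 m0_pos by auto

context
  fixes m u j
  assumes m: "m\<^sub>1 \<le> m" and gd: "good m u" and j: "j < m"
begin

text \<open>
  The score at \<open>A\<close> is small compared with the slope times \<open>\<epsilon>\<close>, so the score changes its sign within the distance \<open>\<epsilon>\<close>.
\<close>

lemma ex1_root: "\<exists>!t. \<bar>t - A\<bar> \<le> \<epsilon> \<and> adj_score m j t u = 0"
proof -
  note sl = slope[OF m gd[unfolded good_def] j]
  have mp: "0 < real m" using m_pos(1)[OF m] by simp
  have sA: "\<bar>adj_score m j A u\<bar> \<le> c\<^sub>0 * real m * \<epsilon>"
  proof -
    have "\<bar>adj_score m j A u\<bar> \<le> C\<^sub>s * (W m u * sqrt (real m))"
      by (rule score_at_A[OF m gd[unfolded good_def] j])
    also have "\<dots> \<le> C\<^sub>s * (\<eta> * sqrt (real m) * sqrt (real m))"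
      using gd eta_small(2) by (intro mult_left_mono mult_right_mono) (auto simp: good_def)
    also have "\<dots> = C\<^sub>s * \<eta> * real m" by simp
    also have "\<dots> \<le> c\<^sub>0 * \<epsilon> * real m" by (intro mult_right_mono eta_small) simp
    finally show ?thesis by (simp add: mult.commute mult.left_commute)
  qed
  have "adj_score m j (A + \<epsilon>) u \<le> 0" "0 \<le> adj_score m j (A - \<epsilon>) u"
    using sl[of A "A + \<epsilon>"] sl[of "A - \<epsilon>" A] eps sA by (auto simp: abs_le_iff)
  moreover have "continuous_on {A - \<epsilon>..A + \<epsilon>} (\<lambda>t. adj_score m j t u)"
  proof (rule continuous_on_subset[OF lipschitz_on_continuous_on])
    show "(max 0 (C\<^sub>0 * real m))-lipschitz_on {A - \<epsilon>..A + \<epsilon>} (\<lambda>t. adj_score m j t u)"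
    proof (rule lipschitz_onI)
      fix a b assume ab: "a \<in> {A - \<epsilon>..A + \<epsilon>}" "b \<in> {A - \<epsilon>..A + \<epsilon>}"
      then have *: "\<bar>a - A\<bar> \<le> \<epsilon>" "\<bar>b - A\<bar> \<le> \<epsilon>" by (auto simp: abs_le_iff)
      have "dist (adj_score m j a u) (adj_score m j b u) \<le> C\<^sub>0 * real m * dist a b"
      proof (cases "a \<le> b")
        case True then show ?thesis using sl[OF *(1,2)] by (auto simp: dist_real_def abs_minus_commute)
      next
        case False then show ?thesis using sl[OF *(2,1)] by (auto simp: dist_real_def)
      qed
      also have "\<dots> \<le> max 0 (C\<^sub>0 * real m) * dist a b" by (intro mult_right_mono) auto
      finally show "dist (adj_score m j a u) (adj_score m j b u) \<le> max 0 (C\<^sub>0 * real m) * dist a b" .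
    qed simp
  qed simp
  ultimately obtain t where "A - \<epsilon> \<le> t" "t \<le> A + \<epsilon>" "adj_score m j t u = 0"
    using IVT2'[of "\<lambda>t. adj_score m j t u" "A + \<epsilon>" 0 "A - \<epsilon>"] eps by auto
  moreover have "t = t'" if "\<bar>t - A\<bar> \<le> \<epsilon>" "adj_score m j t u = 0" "\<bar>t' - A\<bar> \<le> \<epsilon>" "adj_score m j t' u = 0" for t t'
  proof (rule ccontr)
    assume "t \<noteq> t'"
    then consider "t < t'" | "t' < t" by linarith
    then show False
    proof cases
      case 1
      then have "0 < c\<^sub>0 * real m * (t' - t)" using c0 mp by simp
      then show ?thesis using sl[OF that(1,3)] that 1 by simp
    next
      case 2
      then have "0 < c\<^sub>0 * real m * (t - t')" using c0 mp by simp
      then show ?thesis using sl[OF that(3,1)] that 2 by simp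
    qed
  qed
  moreover from calculation(1,2,3) have "\<exists>t. \<bar>t - A\<bar> \<le> \<epsilon> \<and> adj_score m j t u = 0"
    by (intro exI[of _ t]) (auto simp: abs_le_iff)
  ultimately show ?thesis by (intro ex_ex1I) blast+
qed

lemma root: "\<bar>root m j u - A\<bar> \<le> \<epsilon>" "adj_score m j (root m j u) u = 0"
  using theI'[OF ex1_root] by (simp_all add: root_def)

lemma root_eqI: "\<bar>t - A\<bar> \<le> \<epsilon> \<Longrightarrow> adj_score m j t u = 0 \<Longrightarrow> root m j u = t"
  using ex1_root root by blast

text \<open>
  The description of the root by the sign of the score at fixed points also makes it a measurable function of \<open>u\<close>.
\<close>

lemma root_le_iff:
  assumes t: "\<bar>t - A\<bar> \<le> \<epsilon>"
  shows "root m j u \<le> t \<longleftrightarrow> adj_score m j t u \<le> 0"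
proof -
  note sl = slope[OF m gd[unfolded good_def] j]
  have mp: "0 < real m" using m_pos(1)[OF m] by simp
  show ?thesis
  proof
    assume le: "root m j u \<le> t"
    then have "0 \<le> c\<^sub>0 * real m * (t - root m j u)" using c0 by simp
    then show "adj_score m j t u \<le> 0" using sl[OF root(1) t le] root(2) by simp
  next
    assume s: "adj_score m j t u \<le> 0"
    show "root m j u \<le> t"
    proof (rule ccontr)
      assume "\<not> ?thesis"
      then have le: "t < root m j u" by simp
      then have "0 < c\<^sub>0 * real m * (root m j u - t)" using c0 mp by simp
      then show False using sl[OF t root(1)] le s root(2) by simp
    qed
  qed
qed

lemma root_dist_le: "\<bar>root m j u - A\<bar> \<le> C\<^sub>s / c\<^sub>0 * (W m u / sqrt (real m))"
proof -
  note sl = slope[OF m gd[unfolded good_def] j]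
  have mp: "0 < real m" using m_pos(1)[OF m] by simp
  have "c\<^sub>0 * real m * \<bar>root m j u - A\<bar> \<le> \<bar>adj_score m j A u\<bar>"
  proof (cases "A \<le> root m j u")
    case True then show ?thesis using conjunct1[OF sl[of A "root m j u"]] root eps abs_ge_self[of "adj_score m j A u"] by simp
  next
    case False then show ?thesis using conjunct1[OF sl[of "root m j u" A]] root eps abs_ge_minus_self[of "adj_score m j A u"] by simp
  qed
  also have "\<dots> \<le> C\<^sub>s * (W m u * sqrt (real m))" by (rule score_at_A[OF m gd[unfolded good_def] j])
  finally have "\<bar>root m j u - A\<bar> \<le> C\<^sub>s * (W m u * sqrt (real m)) / (c\<^sub>0 * real m)"
    using c0 mp by (simp add: pos_le_divide_eq mult.commute)
  also have "\<dots> = C\<^sub>s / c\<^sub>0 * (W m u * (sqrt (real m) / real m))" by simp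
  also have "sqrt (real m) / real m = 1 / sqrt (real m)"
    using mp by (simp add: divide_eq_eq real_div_sqrt)
  finally show ?thesis by simp
qed

lemma root_pos: "A / 2 \<le> root m j u" "root m j u \<le> 2 * A" "0 < root m j u"
  using root(1) eps A_pos by (auto simp: abs_le_iff)

end

text \<open>
  \<open>bdd Q f a b c\<close> states that \<open>f\<close> is of order \<open>W ^ a * m powr (b / 2) * (1 + \<bar>u j\<bar>) ^ c\<close>, uniformly in \<open>m\<close>, in the
  area and in the observations satisfying \<open>Q\<close>. On the good set \<open>W \<le> sqrt m\<close>, so a power of \<open>W\<close> can be traded for a power of
  \<open>sqrt m\<close>; since only moments up to the fourth of \<open>W\<close> are controlled, this is what keeps the remainders integrable.
\<close>

definition bdd :: "(nat \<Rightarrow> (nat \<Rightarrow> real) \<Rightarrow> bool) \<Rightarrow> (nat \<Rightarrow> nat \<Rightarrow> (nat \<Rightarrow> real) \<Rightarrow> real) \<Rightarrow> nat \<Rightarrow> int \<Rightarrow> nat \<Rightarrow> bool"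
  where "bdd Q f a b c \<longleftrightarrow> (\<exists>C\<ge>0. \<forall>m j u. m\<^sub>1 \<le> m \<longrightarrow> j < m \<longrightarrow> Q m u \<longrightarrow>
    \<bar>f m j u\<bar> \<le> C * (W m u ^ a * sqrt (real m) powi b * (1 + \<bar>u j\<bar>) ^ c))"

lemma bddI:
  assumes "\<And>m j u. m\<^sub>1 \<le> m \<Longrightarrow> j < m \<Longrightarrow> Q m u \<Longrightarrow>
    \<bar>f m j u\<bar> \<le> C * (W m u ^ a * sqrt (real m) powi b * (1 + \<bar>u j\<bar>) ^ c)"
  shows "bdd Q f a b c"
  unfolding bdd_def
proof (intro exI[of _ "max 0 C"] conjI allI impI)
  fix m j u assume *: "m\<^sub>1 \<le> m" "j < m" "Q m u"
  have "0 \<le> W m u ^ a * sqrt (real m) powi b * (1 + \<bar>u j\<bar>) ^ c"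
    using envelope_ge_1[of G m u] by (intro mult_nonneg_nonneg zero_le_power) auto
  then show "\<bar>f m j u\<bar> \<le> max 0 C * (W m u ^ a * sqrt (real m) powi b * (1 + \<bar>u j\<bar>) ^ c)"
    by (intro order.trans[OF assms[OF *]] mult_right_mono) auto
qed simp

lemma bddE:
  assumes "bdd Q f a b c"
  obtains C where "0 \<le> C" "\<And>m j u. m\<^sub>1 \<le> m \<Longrightarrow> j < m \<Longrightarrow> Q m u \<Longrightarrow>
    \<bar>f m j u\<bar> \<le> C * (W m u ^ a * sqrt (real m) powi b * (1 + \<bar>u j\<bar>) ^ c)"
  using assms unfolding bdd_def by blast

lemma bdd_cong:
  assumes "bdd Q f a b c" "\<And>m j u. m\<^sub>1 \<le> m \<Longrightarrow> j < m \<Longrightarrow> Q m u \<Longrightarrow> g m j u = f m j u"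
  shows "bdd Q g a b c"
  using assms unfolding bdd_def by simp

lemma bdd_bounded:
  assumes "\<And>m j u. m\<^sub>1 \<le> m \<Longrightarrow> j < m \<Longrightarrow> Q m u \<Longrightarrow> \<bar>f m j u\<bar> \<le> C"
  shows "bdd Q f 0 0 0"
  using assms by (intro bddI[where C = C]) auto

lemma bdd_const: "bdd Q (\<lambda>_ _ _. c) 0 0 0"
  by (rule bdd_bounded[of _ _ "\<bar>c\<bar>"]) simp

lemma bdd_u: "bdd Q (\<lambda>m j u. u j) 0 0 1"
  by (rule bddI[where C = 1]) simp

lemma bdd_add:
  assumes "bdd Q f a b c" "bdd Q g a b c"
  shows "bdd Q (\<lambda>m j u. f m j u + g m j u) a b c"
proof -
  obtain C where C: "\<And>m j u. m\<^sub>1 \<le> m \<Longrightarrow> j < m \<Longrightarrow> Q m u \<Longrightarrow>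
    \<bar>f m j u\<bar> \<le> C * (W m u ^ a * sqrt (real m) powi b * (1 + \<bar>u j\<bar>) ^ c)" by (rule bddE[OF assms(1)]) (rule that, assumption+)
  obtain C' where C': "\<And>m j u. m\<^sub>1 \<le> m \<Longrightarrow> j < m \<Longrightarrow> Q m u \<Longrightarrow>
    \<bar>g m j u\<bar> \<le> C' * (W m u ^ a * sqrt (real m) powi b * (1 + \<bar>u j\<bar>) ^ c)" by (rule bddE[OF assms(2)]) (rule that, assumption+)
  show ?thesis
  proof (rule bddI[where C = "C + C'"])
    fix m j u assume *: "m\<^sub>1 \<le> m" "j < m" "Q m u"
    show "\<bar>f m j u + g m j u\<bar> \<le> (C + C') * (W m u ^ a * sqrt (real m) powi b * (1 + \<bar>u j\<bar>) ^ c)"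
      using C[OF *] C'[OF *] unfolding distrib_right by linarith
  qed
qed

lemma bdd_minus: "bdd Q f a b c \<Longrightarrow> bdd Q (\<lambda>m j u. - f m j u) a b c"
  unfolding bdd_def by simp

lemma bdd_diff:
  assumes "bdd Q f a b c" "bdd Q g a b c"
  shows "bdd Q (\<lambda>m j u. f m j u - g m j u) a b c"
  using bdd_add[OF assms(1) bdd_minus[OF assms(2)]] by simp

lemma bdd_mult:
  assumes "bdd Q f a b c" "bdd Q g a' b' c'"
  shows "bdd Q (\<lambda>m j u. f m j u * g m j u) (a + a') (b + b') (c + c')"
proof -
  obtain C where C: "\<And>m j u. m\<^sub>1 \<le> m \<Longrightarrow> j < m \<Longrightarrow> Q m u \<Longrightarrow>
    \<bar>f m j u\<bar> \<le> C * (W m u ^ a * sqrt (real m) powi b * (1 + \<bar>u j\<bar>) ^ c)" by (rule bddE[OF assms(1)]) (rule that, assumption+)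
  obtain C' where C': "\<And>m j u. m\<^sub>1 \<le> m \<Longrightarrow> j < m \<Longrightarrow> Q m u \<Longrightarrow>
    \<bar>g m j u\<bar> \<le> C' * (W m u ^ a' * sqrt (real m) powi b' * (1 + \<bar>u j\<bar>) ^ c')" by (rule bddE[OF assms(2)]) (rule that, assumption+)
  show ?thesis
  proof (rule bddI[where C = "C * C'"])
    fix m j u assume *: "m\<^sub>1 \<le> m" "j < m" "Q m u"
    have "sqrt (real m) \<noteq> 0" using m_pos(1)[OF *(1)] by simp
    then have eq: "C * (W m u ^ a * sqrt (real m) powi b * (1 + \<bar>u j\<bar>) ^ c) * (C' * (W m u ^ a' * sqrt (real m) powi b' * (1 + \<bar>u j\<bar>) ^ c'))
      = C * C' * (W m u ^ (a + a') * sqrt (real m) powi (b + b') * (1 + \<bar>u j\<bar>) ^ (c + c'))"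
      by (simp add: power_add power_int_add mult_ac)
    show "\<bar>f m j u * g m j u\<bar> \<le> C * C' * (W m u ^ (a + a') * sqrt (real m) powi (b + b') * (1 + \<bar>u j\<bar>) ^ (c + c'))"
      unfolding eq[symmetric] by (rule abs_mult_le[OF C[OF *] C'[OF *]])
  qed
qed

lemma bdd_weaken:
  assumes "bdd Q f a b c" "a \<le> a'" "b \<le> b'" "c \<le> c'"
  shows "bdd Q f a' b' c'"
proof -
  obtain C where C: "0 \<le> C" "\<And>m j u. m\<^sub>1 \<le> m \<Longrightarrow> j < m \<Longrightarrow> Q m u \<Longrightarrow>
    \<bar>f m j u\<bar> \<le> C * (W m u ^ a * sqrt (real m) powi b * (1 + \<bar>u j\<bar>) ^ c)" by (rule bddE[OF assms(1)]) (rule that, assumption+)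
  show ?thesis
  proof (rule bddI[where C = C])
    fix m j u assume *: "m\<^sub>1 \<le> m" "j < m" "Q m u"
    have W: "1 \<le> W m u" by (rule envelope_ge_1)
    have "1 \<le> sqrt (real m)" using m_pos(1)[OF *(1)] by simp
    then have "W m u ^ a * sqrt (real m) powi b * (1 + \<bar>u j\<bar>) ^ c \<le> W m u ^ a' * sqrt (real m) powi b' * (1 + \<bar>u j\<bar>) ^ c'"
      using W assms(2-) by (intro mult_mono power_increasing power_int_increasing) auto
    then show "\<bar>f m j u\<bar> \<le> C * (W m u ^ a' * sqrt (real m) powi b' * (1 + \<bar>u j\<bar>) ^ c')"
      by (intro order.trans[OF C(2)[OF *]] mult_left_mono C)
  qed
qed

lemma bdd_trade:
  assumes "bdd good f (a + k) b c"
  shows "bdd good f a (b + int k) c"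
proof -
  obtain C where C: "0 \<le> C" "\<And>m j u. m\<^sub>1 \<le> m \<Longrightarrow> j < m \<Longrightarrow> good m u \<Longrightarrow>
    \<bar>f m j u\<bar> \<le> C * (W m u ^ (a + k) * sqrt (real m) powi b * (1 + \<bar>u j\<bar>) ^ c)" by (rule bddE[OF assms(1)]) (rule that, assumption+)
  show ?thesis
  proof (rule bddI[where C = C])
    fix m j u assume *: "m\<^sub>1 \<le> m" "j < m" "good m u"
    have W: "1 \<le> W m u" by (rule envelope_ge_1)
    have s: "1 \<le> sqrt (real m)" using m_pos(1)[OF *(1)] by simp
    have "W m u \<le> \<eta> * sqrt (real m)" using *(3) by (simp add: good_def)
    also have "\<dots> \<le> 1 * sqrt (real m)" by (intro mult_right_mono eta) simp
    finally have Ws: "W m u \<le> sqrt (real m)" by simp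
    have "W m u ^ (a + k) * sqrt (real m) powi b * (1 + \<bar>u j\<bar>) ^ c
        \<le> W m u ^ a * sqrt (real m) ^ k * sqrt (real m) powi b * (1 + \<bar>u j\<bar>) ^ c"
      unfolding power_add using W s Ws by (intro mult_mono power_mono order.refl) auto
    also have "\<dots> = W m u ^ a * sqrt (real m) powi (b + int k) * (1 + \<bar>u j\<bar>) ^ c"
    proof -
      have "sqrt (real m) \<noteq> 0" using s by linarith
      then show ?thesis by (simp add: power_int_add power_int_of_nat mult_ac)
    qed
    finally show "\<bar>f m j u\<bar> \<le> C * (W m u ^ a * sqrt (real m) powi (b + int k) * (1 + \<bar>u j\<bar>) ^ c)"
      by (intro order.trans[OF C(2)[OF *]] mult_left_mono C)
  qed
qed

lemma sqrt_powi: "m\<^sub>1 \<le> m \<Longrightarrow> sqrt (real m) powi 2 = real m" "m\<^sub>1 \<le> m \<Longrightarrow> sqrt (real m) powi (- 2) = 1 / real m"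
  "sqrt (real m) powi (- 1) = 1 / sqrt (real m)" "sqrt (real m) powi 1 = sqrt (real m)"
  by (simp_all add: power_int_def inverse_eq_divide power_divide)

end

section \<open>Stochastic expansion of the root\<close>

lemma abs_cubic_remainder_le:
  fixes w v q d b u :: real
  assumes w: "\<bar>w\<bar> \<le> q" "\<bar>v\<bar> \<le> q" and d: "\<bar>d\<bar> \<le> b"
  shows "\<bar>1 / 2 * (d ^ 3 * (w ^ 3 * v - w ^ 3 * (4 + 3 * (d * w)) * v\<^sup>2 * u\<^sup>2))\<bar>
    \<le> \<bar>d\<bar> ^ 3 * (q ^ 4 + q ^ 5 * (4 + 3 * (b * q)) * u\<^sup>2)"
proof -
  have w3: "\<bar>w ^ 3\<bar> \<le> q ^ 3" unfolding power_abs by (intro power_mono w) simp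
  have v2: "\<bar>v\<^sup>2\<bar> \<le> q\<^sup>2" unfolding power_abs by (intro power_mono w) simp
  have u2: "\<bar>u\<^sup>2\<bar> \<le> u\<^sup>2" by simp
  have d3: "\<bar>d ^ 3\<bar> \<le> \<bar>d\<bar> ^ 3" by (simp add: power_abs)
  have "\<bar>d * w\<bar> \<le> b * q" by (intro abs_mult_le d w)
  then have "\<bar>4 + 3 * (d * w)\<bar> \<le> 4 + 3 * (b * q)" by linarith
  then have 1: "\<bar>w ^ 3 * (4 + 3 * (d * w)) * v\<^sup>2 * u\<^sup>2\<bar> \<le> q ^ 3 * (4 + 3 * (b * q)) * q\<^sup>2 * u\<^sup>2"
    by (intro abs_mult_le w3 v2 u2)
  have 2: "\<bar>w ^ 3 * v\<bar> \<le> q ^ 3 * q" by (intro abs_mult_le w3 w)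
  have "\<bar>w ^ 3 * v - w ^ 3 * (4 + 3 * (d * w)) * v\<^sup>2 * u\<^sup>2\<bar> \<le> q ^ 3 * q + q ^ 3 * (4 + 3 * (b * q)) * q\<^sup>2 * u\<^sup>2"
    by (rule order.trans[OF abs_triangle_ineq4 add_mono[OF 2 1]])
  also have "\<dots> = q ^ 4 + q ^ 5 * (4 + 3 * (b * q)) * u\<^sup>2" by algebra
  finally have "\<bar>d ^ 3 * (w ^ 3 * v - w ^ 3 * (4 + 3 * (d * w)) * v\<^sup>2 * u\<^sup>2)\<bar>
      \<le> \<bar>d\<bar> ^ 3 * (q ^ 4 + q ^ 5 * (4 + 3 * (b * q)) * u\<^sup>2)"
    by (rule abs_mult_le[OF d3])
  moreover have "\<bar>1 / 2 * r\<bar> \<le> \<bar>r\<bar>" for r :: real by simp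
  ultimately show ?thesis by (rule order.trans[rotated])
qed

context local_root
begin

lemma bdd_dominated:
  assumes "bdd Q g a b c" "\<And>m j u. m\<^sub>1 \<le> m \<Longrightarrow> j < m \<Longrightarrow> Q m u \<Longrightarrow> \<bar>f m j u\<bar> \<le> \<bar>g m j u\<bar>"
  shows "bdd Q f a b c"
proof -
  obtain C where C: "0 \<le> C" "\<And>m j u. m\<^sub>1 \<le> m \<Longrightarrow> j < m \<Longrightarrow> Q m u \<Longrightarrow>
    \<bar>g m j u\<bar> \<le> C * (W m u ^ a * sqrt (real m) powi b * (1 + \<bar>u j\<bar>) ^ c)"
    by (rule bddE[OF assms(1)]) (rule that, assumption+)
  show ?thesis
    by (rule bddI[where C = C], rule order.trans[OF assms(2) C(2)])
qed

lemma bdd_abs: "bdd Q f a b c \<Longrightarrow> bdd Q (\<lambda>m j u. \<bar>f m j u\<bar>) a b c"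
  unfolding bdd_def by simp

lemma bdd_power: "bdd Q f a b c \<Longrightarrow> bdd Q (\<lambda>m j u. f m j u ^ k) (k * a) (int k * b) (k * c)"
proof (induction k)
  case 0
  then show ?case using bdd_const[of Q 1] by simp
next
  case (Suc k)
  from bdd_mult[OF Suc.prems Suc.IH[OF Suc.prems]] show ?case by (simp add: algebra_simps)
qed

lemma bdd_W: "bdd Q (\<lambda>m j u. W m u) 1 0 0"
proof (rule bddI[where C = 1])
  fix m j u
  have "\<bar>W m u\<bar> = W m u" using envelope_ge_1[of G m u] by simp
  then show "\<bar>W m u\<bar> \<le> 1 * (W m u ^ 1 * sqrt (real m) powi 0 * (1 + \<bar>u j\<bar>) ^ 0)" by simp
qed

lemma bdd_sqrt: "bdd Q (\<lambda>m j u. sqrt (real m)) 0 1 0"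
  by (rule bddI[where C = 1]) (simp add: sqrt_powi)

lemma bdd_m: "bdd Q (\<lambda>m j u. real m) 0 2 0"
  by (rule bddI[where C = 1]) (simp add: sqrt_powi(1))

lemma bdd_root_dist: "bdd good (\<lambda>m j u. root m j u - A) 1 (- 1) 0"
proof (rule bddI[where C = "C\<^sub>s / c\<^sub>0"])
  fix m j u assume "m\<^sub>1 \<le> m" "j < m" "good m u"
  from root_dist_le[OF this(1,3,2)]
  show "\<bar>root m j u - A\<bar> \<le> C\<^sub>s / c\<^sub>0 * (W m u ^ 1 * sqrt (real m) powi (- 1) * (1 + \<bar>u j\<bar>) ^ 0)"
    unfolding sqrt_powi by simp
qed

text \<open>
  The Fisher information about \<open>A\<close>, the negative of the expected slope of the leading score.
\<close>

definition info :: "nat \<Rightarrow> real"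
  where "info m = 1 / 2 * (\<Sum>k<m. (wt D A k)\<^sup>2)"

definition wfluct :: "nat \<Rightarrow> nat \<Rightarrow> (nat \<Rightarrow> real) \<Rightarrow> real"
  where "wfluct p m u = (\<Sum>k<m. wt D A k ^ p * ((u k)\<^sup>2 - (A + D k)))"

text \<open>Half the expected second derivative of the leading score at \<open>A\<close>.\<close>

definition cubes :: "nat \<Rightarrow> real" where "cubes m = (\<Sum>k<m. wt D A k ^ 3)"

lemma bdd_wfluct: assumes "p \<in> {1..4}" shows "bdd Q (\<lambda>m j u. wfluct p m u) 1 1 0"
proof (rule bddI[where C = 1])
  fix m j and u :: "nat \<Rightarrow> real"
  have "\<bar>wfluct p m u\<bar> \<le> W m u * sqrt (real m)"
    unfolding wfluct_def
    using assms by (intro order.trans[OF fluctuation_ge(1) mult_right_mono[OF fluctuation_le_envelope]] fin_G) auto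
  then show "\<bar>wfluct p m u\<bar> \<le> 1 * (W m u ^ 1 * sqrt (real m) powi 1 * (1 + \<bar>u j\<bar>) ^ 0)" by (simp add: sqrt_powi)
qed

lemma leading_score_A_eq: "leading_score D m A u = 1 / 2 * wfluct 2 m u"
  unfolding leading_score_A wfluct_def ..

lemma wt_A: "0 < wt D A k" "wt D A k \<le> 1 / d\<^sub>0" "1 / (A + d\<^sub>1) \<le> wt D A k" "wt D A k * (A + D k) = 1"
  using wt_pos[of A k] wt_le[of A k] wt_ge[of A k] A_pos D_pos[of k] by (auto simp: wt_def)

lemma info_ge: "real m / (2 * (A + d\<^sub>1)\<^sup>2) \<le> info m"
proof -
  have "(1 / (A + d\<^sub>1))\<^sup>2 \<le> (wt D A k)\<^sup>2" for k
    using A_pos d1_pos by (intro power_mono wt_A) auto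
  then have "(\<Sum>k<m. (1 / (A + d\<^sub>1))\<^sup>2) \<le> (\<Sum>k<m. (wt D A k)\<^sup>2)" by (intro sum_mono)
  then show ?thesis by (simp add: info_def power_divide)
qed

lemma info_pos: "m\<^sub>1 \<le> m \<Longrightarrow> 0 < info m"
proof -
  assume m: "m\<^sub>1 \<le> m"
  have "0 < real m / (2 * (A + d\<^sub>1)\<^sup>2)"
    using m_pos(1)[OF m] A_pos d1_pos by (intro divide_pos_pos mult_pos_pos zero_less_power) auto
  then show ?thesis using info_ge[of m] by linarith
qed

lemma bdd_inverse_info: "bdd Q (\<lambda>m j u. 1 / info m) 0 (- 2) 0"
proof (rule bddI[where C = "2 * (A + d\<^sub>1)\<^sup>2"])
  fix m j and u :: "nat \<Rightarrow> real" assume m: "m\<^sub>1 \<le> m"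
  have pos: "0 < real m / (2 * (A + d\<^sub>1)\<^sup>2)"
    using m_pos(1)[OF m] A_pos d1_pos by (intro divide_pos_pos mult_pos_pos zero_less_power) auto
  have "1 / info m \<le> 1 / (real m / (2 * (A + d\<^sub>1)\<^sup>2))"
    using pos info_ge by (intro divide_left_mono mult_pos_pos info_pos m) auto
  then show "\<bar>1 / info m\<bar> \<le> 2 * (A + d\<^sub>1)\<^sup>2 * (W m u ^ 0 * sqrt (real m) powi (- 2) * (1 + \<bar>u j\<bar>) ^ 0)"
    using info_pos[OF m] unfolding sqrt_powi(2)[OF m] by simp
qed

lemma bdd_cubes: "bdd Q (\<lambda>m j u. cubes m) 0 2 0"
proof (rule bddI[where C = "1 / d\<^sub>0 ^ 3"])
  fix m j and u :: "nat \<Rightarrow> real" assume m: "m\<^sub>1 \<le> m"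
  have "\<bar>cubes m\<bar> \<le> (\<Sum>k<m. 1 / d\<^sub>0 ^ 3)" unfolding cubes_def
  proof (rule order.trans[OF sum_abs], rule sum_mono)
    fix k show "\<bar>wt D A k ^ 3\<bar> \<le> 1 / d\<^sub>0 ^ 3"
      using power_mono[OF wt_A(2)[of k], of 3] wt_A(1)[of k] by (simp add: power_divide)
  qed
  then show "\<bar>cubes m\<bar> \<le> 1 / d\<^sub>0 ^ 3 * (W m u ^ 0 * sqrt (real m) powi 2 * (1 + \<bar>u j\<bar>) ^ 0)"
    unfolding sqrt_powi(1)[OF m] by simp
qed

lemma bdd_score_correction_A: "bdd Q (\<lambda>m j u. score_correction x D m A u) 2 0 0"
  by (rule bddI, rule order.trans[OF score_correction_A_le[OF fin_G m_pos(2)]]) auto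

lemma bdd_l1: "bdd Q (\<lambda>m j u. l1 m j A) 0 0 0"
  by (rule bdd_bounded[where C = K]) (use m_pos(2) l1_bound A_pos in auto)

lemma good_sums:
  assumes "m\<^sub>1 \<le> m" "good m u"
  shows "(\<Sum>j<m. (u j)\<^sup>2) \<le> ubound * real m" "(\<Sum>j<m. \<bar>u j\<bar>) \<le> ubound * real m"
proof -
  have "fluctuation x D A m (wt D A) u \<le> W m u"
    using fluctuation_le_envelope[OF fin_G, of A 1 m u] by simp
  also have "\<dots> \<le> \<eta> * sqrt (real m)" using assms by (simp add: good_def)
  also have "\<dots> \<le> 1 * sqrt (real m)" by (intro mult_right_mono eta) simp
  finally show "(\<Sum>j<m. (u j)\<^sup>2) \<le> ubound * real m" "(\<Sum>j<m. \<bar>u j\<bar>) \<le> ubound * real m"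
    using sum_squares_le[of m u] by simp_all
qed

text \<open>Expansions of \<open>1 / (1 + y)\<close> and \<open>1 / (1 + y) ^ 2\<close> with exact remainders, for \<open>y = \<delta> * wt D A k\<close>.\<close>

lemma wt_expansion:
  fixes k :: nat
  assumes a: "0 \<le> a"
  defines "w \<equiv> wt D A k" and "v \<equiv> wt D a k" and "\<delta> \<equiv> a - A"
  shows "v = w - \<delta> * w\<^sup>2 + \<delta>\<^sup>2 * (w\<^sup>2 * v)"
    and "v = w - \<delta> * w\<^sup>2 + \<delta>\<^sup>2 * w ^ 3 - \<delta> ^ 3 * (w ^ 3 * v)"
    and "v\<^sup>2 = w\<^sup>2 - 2 * \<delta> * w ^ 3 + \<delta>\<^sup>2 * (w\<^sup>2 * (3 + 2 * (\<delta> * w)) * v\<^sup>2)"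
    and "v\<^sup>2 = w\<^sup>2 - 2 * \<delta> * w ^ 3 + 3 * \<delta>\<^sup>2 * w ^ 4 - \<delta> ^ 3 * (w ^ 3 * (4 + 3 * (\<delta> * w)) * v\<^sup>2)"
proof -
  have e: "v = w - \<delta> * (w * v)"
    using wt_diff[OF a less_imp_le[OF A_pos], of k] by (simp add: w_def v_def \<delta>_def mult_ac algebra_simps)
  show 1: "v = w - \<delta> * w\<^sup>2 + \<delta>\<^sup>2 * (w\<^sup>2 * v)" using e by algebra
  show "v = w - \<delta> * w\<^sup>2 + \<delta>\<^sup>2 * w ^ 3 - \<delta> ^ 3 * (w ^ 3 * v)" using e by algebra
  show "v\<^sup>2 = w\<^sup>2 - 2 * \<delta> * w ^ 3 + \<delta>\<^sup>2 * (w\<^sup>2 * (3 + 2 * (\<delta> * w)) * v\<^sup>2)" using e by algebra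
  show "v\<^sup>2 = w\<^sup>2 - 2 * \<delta> * w ^ 3 + 3 * \<delta>\<^sup>2 * w ^ 4 - \<delta> ^ 3 * (w ^ 3 * (4 + 3 * (\<delta> * w)) * v\<^sup>2)" using e by algebra
qed

lemma leading_score_expansion:
  assumes a: "0 \<le> a" "a \<le> 2 * A" and sq: "(\<Sum>j<m. (u j)\<^sup>2) \<le> ubound * real m"
  defines "\<delta> \<equiv> a - A"
  shows "\<bar>leading_score D m a u - (leading_score D m A u + \<delta> * (- wfluct 3 m u - info m)
      + \<delta>\<^sup>2 * (cubes m + 3 / 2 * wfluct 4 m u))\<bar>
    \<le> ((4 + 3 * (A / d\<^sub>0)) / d\<^sub>0 ^ 5 * ubound + 1 / d\<^sub>0 ^ 4) * (\<bar>\<delta>\<bar> ^ 3 * real m)"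
proof -
  let ?w = "wt D A" and ?v = "wt D a"
  define q where "q = 1 / d\<^sub>0"
  have q: "0 < q" using d0_pos by (simp add: q_def)
  have \<delta>: "\<bar>\<delta>\<bar> \<le> A" using a by (auto simp: \<delta>_def abs_le_iff)
  have eq: "leading_score D m a u - (leading_score D m A u + \<delta> * (- wfluct 3 m u - info m)
      + \<delta>\<^sup>2 * (cubes m + 3 / 2 * wfluct 4 m u))
    = (\<Sum>k<m. 1 / 2 * (\<delta> ^ 3 * (?w k ^ 3 * ?v k - ?w k ^ 3 * (4 + 3 * (\<delta> * ?w k)) * (?v k)\<^sup>2 * (u k)\<^sup>2)))"
  proof -
    have "1 / 2 * ((?v k)\<^sup>2 * (u k)\<^sup>2 - ?v k) - (1 / 2 * ((?w k)\<^sup>2 * (u k)\<^sup>2 - ?w k)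
        + \<delta> * (- (?w k ^ 3 * ((u k)\<^sup>2 - (A + D k))) - 1 / 2 * (?w k)\<^sup>2)
        + \<delta>\<^sup>2 * (?w k ^ 3 + 3 / 2 * (?w k ^ 4 * ((u k)\<^sup>2 - (A + D k)))))
      = 1 / 2 * (\<delta> ^ 3 * (?w k ^ 3 * ?v k - ?w k ^ 3 * (4 + 3 * (\<delta> * ?w k)) * (?v k)\<^sup>2 * (u k)\<^sup>2))" for k
    proof -
      have "?v k = ?w k - \<delta> * (?w k)\<^sup>2 + \<delta>\<^sup>2 * ?w k ^ 3 - \<delta> ^ 3 * (?w k ^ 3 * ?v k)"
        "(?v k)\<^sup>2 = (?w k)\<^sup>2 - 2 * \<delta> * ?w k ^ 3 + 3 * \<delta>\<^sup>2 * ?w k ^ 4 - \<delta> ^ 3 * (?w k ^ 3 * (4 + 3 * (\<delta> * ?w k)) * (?v k)\<^sup>2)"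
        unfolding \<delta>_def by (rule wt_expansion[OF a(1)])+
      moreover have "?w k * (A + D k) = 1" by (rule wt_A)
      ultimately show ?thesis by algebra
    qed
    then have "(\<Sum>k<m. 1 / 2 * ((?v k)\<^sup>2 * (u k)\<^sup>2 - ?v k) - (1 / 2 * ((?w k)\<^sup>2 * (u k)\<^sup>2 - ?w k)
        + \<delta> * (- (?w k ^ 3 * ((u k)\<^sup>2 - (A + D k))) - 1 / 2 * (?w k)\<^sup>2)
        + \<delta>\<^sup>2 * (?w k ^ 3 + 3 / 2 * (?w k ^ 4 * ((u k)\<^sup>2 - (A + D k)))))) = (\<Sum>k<m. 1 / 2 * (\<delta> ^ 3 * (?w k ^ 3 * ?v k - ?w k ^ 3 * (4 + 3 * (\<delta> * ?w k)) * (?v k)\<^sup>2 * (u k)\<^sup>2)))"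
      by (intro sum.cong refl)
    then show ?thesis
      unfolding leading_score_def info_def cubes_def wfluct_def sum_subtractf sum.distrib sum_negf sum_distrib_left[symmetric] .
  qed
  have "\<bar>\<Sum>k<m. 1 / 2 * (\<delta> ^ 3 * (?w k ^ 3 * ?v k - ?w k ^ 3 * (4 + 3 * (\<delta> * ?w k)) * (?v k)\<^sup>2 * (u k)\<^sup>2))\<bar>
      \<le> (\<Sum>k<m. \<bar>\<delta>\<bar> ^ 3 * (q ^ 4 + q ^ 5 * (4 + 3 * (A * q)) * (u k)\<^sup>2))"
  proof (rule order.trans[OF sum_abs], rule sum_mono)
    fix k
    show "\<bar>1 / 2 * (\<delta> ^ 3 * (?w k ^ 3 * ?v k - ?w k ^ 3 * (4 + 3 * (\<delta> * ?w k)) * (?v k)\<^sup>2 * (u k)\<^sup>2))\<bar>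
        \<le> \<bar>\<delta>\<bar> ^ 3 * (q ^ 4 + q ^ 5 * (4 + 3 * (A * q)) * (u k)\<^sup>2)"
      using wt_A[of k] wt_pos[OF a(1), of k] wt_le[OF a(1), of k]
      by (intro abs_cubic_remainder_le \<delta>) (simp_all add: q_def)
  qed
  also have "\<dots> = \<bar>\<delta>\<bar> ^ 3 * (q ^ 4 * real m + q ^ 5 * (4 + 3 * (A * q)) * (\<Sum>k<m. (u k)\<^sup>2))"
    by (simp only: sum_distrib_left[symmetric] sum.distrib sum_constant card_lessThan mult.commute[of "q ^ 4"])
  also have "\<dots> \<le> \<bar>\<delta>\<bar> ^ 3 * (q ^ 4 * real m + q ^ 5 * (4 + 3 * (A * q)) * (ubound * real m))"
    using q A_pos by (intro mult_left_mono add_mono sq) auto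
  also have "\<dots> = ((4 + 3 * (A / d\<^sub>0)) / d\<^sub>0 ^ 5 * ubound + 1 / d\<^sub>0 ^ 4) * (\<bar>\<delta>\<bar> ^ 3 * real m)"
  proof -
    have "(4 + 3 * (A / d\<^sub>0)) / d\<^sub>0 ^ 5 * ubound + 1 / d\<^sub>0 ^ 4 = (4 + 3 * (A * q)) * q ^ 5 * ubound + q ^ 4"
      by (simp add: q_def power_divide)
    then show ?thesis by (simp only:) (simp add: algebra_simps)
  qed
  finally show ?thesis unfolding eq .
qed

lemma bdd_leading_score_expansion:
  "bdd good (\<lambda>m j u. leading_score D m (root m j u) u - (leading_score D m A u
      + (root m j u - A) * (- wfluct 3 m u - info m) + (root m j u - A)\<^sup>2 * cubes m)) 3 (- 1) 0"
proof -
  have 1: "bdd good (\<lambda>m j u. leading_score D m (root m j u) u - (leading_score D m A u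
      + (root m j u - A) * (- wfluct 3 m u - info m) + (root m j u - A)\<^sup>2 * (cubes m + 3 / 2 * wfluct 4 m u))) 3 (- 1) 0"
  proof (rule bdd_dominated)
    let ?C = "(4 + 3 * (A / d\<^sub>0)) / d\<^sub>0 ^ 5 * ubound + 1 / d\<^sub>0 ^ 4"
    have "bdd good (\<lambda>m j u. ?C * (\<bar>root m j u - A\<bar> ^ 3 * real m)) (0 + (3 * 1 + 0)) (0 + (int 3 * - 1 + 2)) (0 + (3 * 0 + 0))"
      by (intro bdd_mult bdd_const bdd_power bdd_abs bdd_root_dist bdd_m)
    then show "bdd good (\<lambda>m j u. ?C * (\<bar>root m j u - A\<bar> ^ 3 * real m)) 3 (- 1) 0" by simp
    fix m j u assume *: "m\<^sub>1 \<le> m" "j < m" "good m u"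
    have C: "0 \<le> ?C" using d0_pos A_pos ubound_ge_1 by simp
    have "\<bar>leading_score D m (root m j u) u - (leading_score D m A u
      + (root m j u - A) * (- wfluct 3 m u - info m) + (root m j u - A)\<^sup>2 * (cubes m + 3 / 2 * wfluct 4 m u))\<bar>
      \<le> ?C * (\<bar>root m j u - A\<bar> ^ 3 * real m)"
      using root_pos[OF *(1,3,2)] by (intro leading_score_expansion good_sums(1) *) auto
    then show "\<bar>leading_score D m (root m j u) u - (leading_score D m A u
      + (root m j u - A) * (- wfluct 3 m u - info m) + (root m j u - A)\<^sup>2 * (cubes m + 3 / 2 * wfluct 4 m u))\<bar>
      \<le> \<bar>?C * (\<bar>root m j u - A\<bar> ^ 3 * real m)\<bar>" by (rule order.trans[OF _ abs_ge_self])
  qed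
  have "bdd good (\<lambda>m j u. (root m j u - A)\<^sup>2 * (3 / 2 * wfluct 4 m u)) (2 * 1 + (0 + 1)) (int 2 * - 1 + (0 + 1)) (2 * 0 + (0 + 0))"
    by (intro bdd_mult bdd_power bdd_root_dist bdd_const bdd_wfluct) simp
  then have "bdd good (\<lambda>m j u. (root m j u - A)\<^sup>2 * (3 / 2 * wfluct 4 m u)) 3 (- 1) 0" by simp
  from bdd_add[OF 1 this] show ?thesis
    by (rule bdd_cong) (simp add: algebra_simps)
qed

text \<open>
  The increment is \<open>root m j u - A\<close> times another weighted sum of order one, plus a term of second order in the increment of the
  weights, for which the bound by the sum of all \<open>\<bar>u k\<bar>\<close> is sufficient.
\<close>

lemma bdd_wsum_root_diff:
  "bdd good (\<lambda>m j u. score_norm x m (wsum x m (wt D (root m j u)) u - wsum x m (wt D A) u)) 2 (- 1) 0" (is ?A)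
  "bdd good (\<lambda>m j u. score_norm x m (wsum x m (\<lambda>k. (wt D (root m j u) k)\<^sup>2) u - wsum x m (\<lambda>k. (wt D A k)\<^sup>2) u)) 2 (- 1) 0" (is ?B)
proof -
  define q where "q = 1 / d\<^sub>0"
  have q: "0 < q" using d0_pos by (simp add: q_def)
  define U where "U = sqrt cq * ubound"
  have U: "0 \<le> U" using cq_nonneg ubound_ge_1 by (simp add: U_def)
  define C where "C = q ^ 3 + q ^ 4 * (3 + 2 * (A * q))"
  have C: "0 \<le> C" using q A_pos by (simp add: C_def)
  have b: "bdd good (\<lambda>m j u. 2 * \<bar>root m j u - A\<bar> * W m u + \<bar>root m j u - A\<bar>\<^sup>2 * (C * U) * sqrt (real m)) 2 (- 1) 0"
  proof (rule bdd_add)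
    have "bdd good (\<lambda>m j u. 2 * \<bar>root m j u - A\<bar> * W m u) (0 + 1 + 1) (0 + - 1 + 0) (0 + 0 + 0)"
      by (intro bdd_mult bdd_const bdd_abs bdd_root_dist bdd_W)
    then show "bdd good (\<lambda>m j u. 2 * \<bar>root m j u - A\<bar> * W m u) 2 (- 1) 0" by (simp add: numeral_2_eq_2)
    have "bdd good (\<lambda>m j u. \<bar>root m j u - A\<bar>\<^sup>2 * (C * U) * sqrt (real m)) (2 * 1 + 0 + 0) (int 2 * - 1 + 0 + 1) (2 * 0 + 0 + 0)"
      by (intro bdd_mult bdd_const bdd_abs bdd_root_dist bdd_sqrt bdd_power)
    then show "bdd good (\<lambda>m j u. \<bar>root m j u - A\<bar>\<^sup>2 * (C * U) * sqrt (real m)) 2 (- 1) 0" by simp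
  qed
  have main: "score_norm x m (wsum x m (wt D (root m j u)) u - wsum x m (wt D A) u)
      \<le> 2 * \<bar>root m j u - A\<bar> * W m u + \<bar>root m j u - A\<bar>\<^sup>2 * (C * U) * sqrt (real m)"
    "score_norm x m (wsum x m (\<lambda>k. (wt D (root m j u) k)\<^sup>2) u - wsum x m (\<lambda>k. (wt D A k)\<^sup>2) u)
      \<le> 2 * \<bar>root m j u - A\<bar> * W m u + \<bar>root m j u - A\<bar>\<^sup>2 * (C * U) * sqrt (real m)"
    if *: "m\<^sub>1 \<le> m" "j < m" "good m u" for m j u
  proof -
    define a \<delta> where "a = root m j u" and "\<delta> = a - A"
    have a: "0 \<le> a" "a \<le> 2 * A" using root_pos[OF *(1,3,2)] by (simp_all add: a_def)
    have \<delta>: "\<bar>\<delta>\<bar> \<le> A" using a by (auto simp: \<delta>_def abs_le_iff)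
    have w: "\<bar>wt D A k\<bar> \<le> q" "\<bar>wt D a k\<bar> \<le> q" for k
      using wt_A[of k] wt_pos[OF a(1), of k] wt_le[OF a(1), of k] by (simp_all add: q_def)
    have sq: "\<bar>(wt D A k)\<^sup>2\<bar> \<le> q\<^sup>2" "\<bar>(wt D a k)\<^sup>2\<bar> \<le> q\<^sup>2" for k
      using power_mono[OF w(1)[of k], of 2] power_mono[OF w(2)[of k], of 2] by (simp_all)
    have W: "0 \<le> W m u" using envelope_ge_1[of G m u] by linarith
    have lin: "wsum x m c u = t *\<^sub>R wsum x m c' u + wsum x m c'' u"
      if "\<And>k. c k = t * c' k + c'' k" for c c' c'' :: "nat \<Rightarrow> real" and t
      by (simp add: wsum_def that scaleR_sum_right sum.distrib scaleR_left_distrib distrib_right mult.assoc)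
    have rem: "score_norm x m (wsum x m c'' u) \<le> \<bar>\<delta>\<bar>\<^sup>2 * (C * U) * sqrt (real m)"
      if "\<And>k. \<bar>c'' k\<bar> \<le> \<bar>\<delta>\<bar>\<^sup>2 * C" for c''
    proof -
      have "score_norm x m (wsum x m c'' u) \<le> \<bar>\<delta>\<bar>\<^sup>2 * C * (sqrt cq * ubound) * sqrt (real m)"
        using C by (intro score_norm_wsum_le_sqrt m_pos * good_sums(2) that) auto
      then show ?thesis by (simp add: U_def mult.assoc)
    qed
    show "score_norm x m (wsum x m (wt D (root m j u)) u - wsum x m (wt D A) u)
      \<le> 2 * \<bar>root m j u - A\<bar> * W m u + \<bar>root m j u - A\<bar>\<^sup>2 * (C * U) * sqrt (real m)"
    proof -
      have eq: "wsum x m (wt D a) u - wsum x m (wt D A) u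
          = (- \<delta>) *\<^sub>R wsum x m (\<lambda>k. (wt D A k)\<^sup>2) u + wsum x m (\<lambda>k. \<delta>\<^sup>2 * ((wt D A k)\<^sup>2 * wt D a k)) u"
        unfolding wsum_diff
        by (rule lin) (use wt_expansion(1)[OF a(1)] in \<open>simp add: \<delta>_def algebra_simps\<close>)
      have "score_norm x m (wsum x m (\<lambda>k. \<delta>\<^sup>2 * ((wt D A k)\<^sup>2 * wt D a k)) u) \<le> \<bar>\<delta>\<bar>\<^sup>2 * (C * U) * sqrt (real m)"
      proof (rule rem, rule abs_mult_le)
        fix k
        have "\<bar>(wt D A k)\<^sup>2 * wt D a k\<bar> \<le> q\<^sup>2 * q" by (intro abs_mult_le sq w)
        also have "\<dots> \<le> C" using q A_pos by (simp add: C_def eval_nat_numeral mult_ac)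
        finally show "\<bar>(wt D A k)\<^sup>2 * wt D a k\<bar> \<le> C" .
      qed simp
      moreover have "\<bar>- \<delta>\<bar> * score_norm x m (wsum x m (\<lambda>k. (wt D A k)\<^sup>2) u) \<le> \<bar>- \<delta>\<bar> * W m u"
        by (intro mult_left_mono score_norm_wt_le_envelope fin_G) simp
      moreover have "\<bar>- \<delta>\<bar> * W m u \<le> 2 * \<bar>\<delta>\<bar> * W m u" using W by (intro mult_right_mono) auto
      ultimately show ?thesis
        unfolding a_def[symmetric] \<delta>_def[symmetric] eq
        using score_norm_add[of x m "(- \<delta>) *\<^sub>R wsum x m (\<lambda>k. (wt D A k)\<^sup>2) u" "wsum x m (\<lambda>k. \<delta>\<^sup>2 * ((wt D A k)\<^sup>2 * wt D a k)) u"]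
        unfolding score_norm_scaleR by linarith
    qed
    show "score_norm x m (wsum x m (\<lambda>k. (wt D (root m j u) k)\<^sup>2) u - wsum x m (\<lambda>k. (wt D A k)\<^sup>2) u)
      \<le> 2 * \<bar>root m j u - A\<bar> * W m u + \<bar>root m j u - A\<bar>\<^sup>2 * (C * U) * sqrt (real m)"
    proof -
      have eq: "wsum x m (\<lambda>k. (wt D a k)\<^sup>2) u - wsum x m (\<lambda>k. (wt D A k)\<^sup>2) u
          = (- 2 * \<delta>) *\<^sub>R wsum x m (\<lambda>k. wt D A k ^ 3) u
            + wsum x m (\<lambda>k. \<delta>\<^sup>2 * ((wt D A k)\<^sup>2 * (3 + 2 * (\<delta> * wt D A k)) * (wt D a k)\<^sup>2)) u"
        unfolding wsum_diff
      proof (rule lin)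
        fix k
        show "(wt D a k)\<^sup>2 - (wt D A k)\<^sup>2 = - 2 * \<delta> * wt D A k ^ 3
            + \<delta>\<^sup>2 * ((wt D A k)\<^sup>2 * (3 + 2 * (\<delta> * wt D A k)) * (wt D a k)\<^sup>2)"
          using wt_expansion(3)[OF a(1), of k] unfolding \<delta>_def by algebra
      qed
      have "score_norm x m (wsum x m (\<lambda>k. \<delta>\<^sup>2 * ((wt D A k)\<^sup>2 * (3 + 2 * (\<delta> * wt D A k)) * (wt D a k)\<^sup>2)) u)
          \<le> \<bar>\<delta>\<bar>\<^sup>2 * (C * U) * sqrt (real m)"
      proof (rule rem, rule abs_mult_le)
        fix k
        have "\<bar>\<delta> * wt D A k\<bar> \<le> A * q" by (intro abs_mult_le \<delta> w)
        then have "\<bar>3 + 2 * (\<delta> * wt D A k)\<bar> \<le> 3 + 2 * (A * q)" by linarith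
        then have "\<bar>(wt D A k)\<^sup>2 * (3 + 2 * (\<delta> * wt D A k)) * (wt D a k)\<^sup>2\<bar> \<le> q\<^sup>2 * (3 + 2 * (A * q)) * q\<^sup>2"
          by (intro abs_mult_le sq)
        also have "\<dots> = q ^ 4 * (3 + 2 * (A * q))" by (simp add: eval_nat_numeral mult_ac)
        also have "\<dots> \<le> C" using q by (simp add: C_def)
        finally show "\<bar>(wt D A k)\<^sup>2 * (3 + 2 * (\<delta> * wt D A k)) * (wt D a k)\<^sup>2\<bar> \<le> C" .
      qed simp
      moreover have "\<bar>- 2 * \<delta>\<bar> * score_norm x m (wsum x m (\<lambda>k. wt D A k ^ 3) u) \<le> \<bar>- 2 * \<delta>\<bar> * W m u"
        by (intro mult_left_mono score_norm_wt_le_envelope fin_G) simp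
      moreover have "\<bar>- 2 * \<delta>\<bar> = 2 * \<bar>\<delta>\<bar>" by (simp add: abs_mult)
      ultimately show ?thesis
        unfolding a_def[symmetric] \<delta>_def[symmetric] eq
        using score_norm_add[of x m "(- 2 * \<delta>) *\<^sub>R wsum x m (\<lambda>k. wt D A k ^ 3) u"
            "wsum x m (\<lambda>k. \<delta>\<^sup>2 * ((wt D A k)\<^sup>2 * (3 + 2 * (\<delta> * wt D A k)) * (wt D a k)\<^sup>2)) u"]
        unfolding score_norm_scaleR by simp
    qed
  qed
  have nn: "\<bar>score_norm x m n\<bar> = score_norm x m n" for m n by (simp add: score_norm_nonneg)
  show ?A ?B
    by (rule bdd_dominated[OF b], unfold nn, rule order.trans[OF _ abs_ge_self], rule main; assumption)+
qed

lemma bdd_score_norm_A: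
  "bdd Q (\<lambda>m j u. score_norm x m (wsum x m (wt D A) u)) 1 0 0"
  "bdd Q (\<lambda>m j u. score_norm x m (wsum x m (\<lambda>k. (wt D A k)\<^sup>2) u)) 1 0 0"
proof -
  have nn: "\<bar>score_norm x m n\<bar> = score_norm x m n" for m n by (simp add: score_norm_nonneg)
  show "bdd Q (\<lambda>m j u. score_norm x m (wsum x m (wt D A) u)) 1 0 0"
    "bdd Q (\<lambda>m j u. score_norm x m (wsum x m (\<lambda>k. (wt D A k)\<^sup>2) u)) 1 0 0"
    by (rule bdd_dominated[OF bdd_W], unfold nn, rule order.trans[OF _ abs_ge_self],
        rule score_norm_wt_le_envelope[OF fin_G])+
qed

lemma bdd_score_correction_diff:
  "bdd good (\<lambda>m j u. score_correction x D m (root m j u) u - score_correction x D m A u) 3 (- 1) 0"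
proof -
  obtain \<kappa> where \<kappa>: "0 \<le> \<kappa>" and corr: "\<And>m a a' u P H. m\<^sub>0 \<le> m \<Longrightarrow> 0 \<le> a \<Longrightarrow> a \<le> 2 * A \<Longrightarrow> 0 \<le> a' \<Longrightarrow> a' \<le> 2 * A \<Longrightarrow>
      score_norm x m (wsum x m (wt D a) u - wsum x m (wt D a') u) \<le> P \<Longrightarrow>
      score_norm x m (wsum x m (\<lambda>j. (wt D a j)\<^sup>2) u - wsum x m (\<lambda>j. (wt D a' j)\<^sup>2) u) \<le> P \<Longrightarrow>
      score_norm x m (wsum x m (wt D a) u) \<le> H \<Longrightarrow> score_norm x m (wsum x m (wt D a') u) \<le> H \<Longrightarrow>
      score_norm x m (wsum x m (\<lambda>j. (wt D a' j)\<^sup>2) u) \<le> H \<Longrightarrow>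
      \<bar>score_correction x D m a u - score_correction x D m a' u\<bar> \<le> \<kappa> * (P * H + \<bar>a - a'\<bar> * H\<^sup>2 + \<bar>a - a'\<bar>)"
    using score_correction_diff_le by metis
  define P where "P m j u = score_norm x m (wsum x m (wt D (root m j u)) u - wsum x m (wt D A) u)
    + score_norm x m (wsum x m (\<lambda>k. (wt D (root m j u) k)\<^sup>2) u - wsum x m (\<lambda>k. (wt D A k)\<^sup>2) u)" for m j u
  define H where "H m j u = P m j u + score_norm x m (wsum x m (wt D A) u)
    + score_norm x m (wsum x m (\<lambda>k. (wt D A k)\<^sup>2) u)" for m j u
  have P: "bdd good P 2 (- 1) 0" unfolding P_def by (intro bdd_add bdd_wsum_root_diff)
  have "bdd good P 1 (- 1 + int 1) 0" by (rule bdd_trade) (use P in \<open>simp add: numeral_2_eq_2\<close>)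
  then have H: "bdd good H 1 0 0" unfolding H_def by (intro bdd_add bdd_score_norm_A) simp
  have PH: "bdd good (\<lambda>m j u. P m j u * H m j u) (2 + 1) (- 1 + 0) (0 + 0)" by (intro bdd_mult P H)
  have dH: "bdd good (\<lambda>m j u. \<bar>root m j u - A\<bar> * (H m j u)\<^sup>2) (1 + 2 * 1) (- 1 + int 2 * 0) (0 + 2 * 0)"
    by (intro bdd_mult bdd_power bdd_abs bdd_root_dist H)
  have d: "bdd good (\<lambda>m j u. \<bar>root m j u - A\<bar>) 3 (- 1) 0"
    by (rule bdd_weaken[OF bdd_abs[OF bdd_root_dist]]) auto
  have "bdd good (\<lambda>m j u. P m j u * H m j u + \<bar>root m j u - A\<bar> * (H m j u)\<^sup>2 + \<bar>root m j u - A\<bar>) 3 (- 1) 0"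
    by (intro bdd_add bdd_weaken[OF PH] bdd_weaken[OF dH] d) simp_all
  from bdd_mult[OF bdd_const[of _ \<kappa>] this]
  have "bdd good (\<lambda>m j u. \<kappa> * (P m j u * H m j u + \<bar>root m j u - A\<bar> * (H m j u)\<^sup>2 + \<bar>root m j u - A\<bar>)) 3 (- 1) 0"
    by simp
  then show ?thesis
  proof (rule bdd_dominated)
    fix m j u assume *: "m\<^sub>1 \<le> m" "j < m" "good m u"
    note nn = score_norm_nonneg[of x m]
    have "\<bar>score_correction x D m (root m j u) u - score_correction x D m A u\<bar>
      \<le> \<kappa> * (P m j u * H m j u + \<bar>root m j u - A\<bar> * (H m j u)\<^sup>2 + \<bar>root m j u - A\<bar>)"
    proof (rule corr)
      show "score_norm x m (wsum x m (wt D (root m j u)) u) \<le> H m j u"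
        using score_norm_add[of x m "wsum x m (wt D (root m j u)) u - wsum x m (wt D A) u" "wsum x m (wt D A) u"]
          nn[of "wsum x m (\<lambda>k. (wt D A k)\<^sup>2) u"]
          nn[of "wsum x m (\<lambda>k. (wt D (root m j u) k)\<^sup>2) u - wsum x m (\<lambda>k. (wt D A k)\<^sup>2) u"]
        by (simp add: H_def P_def)
    qed (use root_pos[OF *(1,3,2)] A_pos m_pos(2)[OF *(1)] in \<open>auto simp: P_def H_def intro: add_nonneg_nonneg nn\<close>)
    then show "\<bar>score_correction x D m (root m j u) u - score_correction x D m A u\<bar>
      \<le> \<bar>\<kappa> * (P m j u * H m j u + \<bar>root m j u - A\<bar> * (H m j u)\<^sup>2 + \<bar>root m j u - A\<bar>)\<bar>"
      by (rule order.trans[OF _ abs_ge_self])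
  qed
qed

text \<open>
  Newton's method for the score equation, started at \<open>A\<close>. The first step uses the expected slope; the second corrects for
  the fluctuation of the slope, for the curvature, and for the terms of order one in the score.
\<close>

definition step1 :: "nat \<Rightarrow> (nat \<Rightarrow> real) \<Rightarrow> real"
  where "step1 m u = leading_score D m A u * (1 / info m)"

definition step2 :: "nat \<Rightarrow> nat \<Rightarrow> (nat \<Rightarrow> real) \<Rightarrow> real"
  where "step2 m j u = step1 m u + (score_correction x D m A u + l1 m j A - wfluct 3 m u * step1 m u
    + cubes m * (step1 m u)\<^sup>2) * (1 / info m)"

lemma bdd_leading_score_A: "bdd Q (\<lambda>m j u. leading_score D m A u) 1 1 0"
  unfolding leading_score_A_eq by (rule bdd_weaken[OF bdd_mult[OF bdd_const bdd_wfluct]]) simp_all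

lemma bdd_step1: "bdd Q (\<lambda>m j u. step1 m u) 1 (- 1) 0"
  unfolding step1_def using bdd_mult[OF bdd_leading_score_A bdd_inverse_info] by simp

definition score_remainder :: "nat \<Rightarrow> nat \<Rightarrow> (nat \<Rightarrow> real) \<Rightarrow> real"
  where "score_remainder m j u = leading_score D m A u + score_correction x D m A u + l1 m j A
    - info m * (root m j u - A) - wfluct 3 m u * (root m j u - A) + cubes m * (root m j u - A)\<^sup>2"

lemma bdd_score_remainder: "bdd good score_remainder 3 (- 1) 0"
proof -
  have l: "bdd good (\<lambda>m j u. l1 m j (root m j u) - l1 m j A) 3 (- 1) 0"
  proof (rule bdd_dominated[where g = "\<lambda>m j u. K * (root m j u - A)"])
    have "bdd good (\<lambda>m j u. K * (root m j u - A)) (0 + 1) (0 + - 1) (0 + 0)" by (intro bdd_mult bdd_const bdd_root_dist)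
    then show "bdd good (\<lambda>m j u. K * (root m j u - A)) 3 (- 1) 0" by (rule bdd_weaken) auto
    show "\<bar>l1 m j (root m j u) - l1 m j A\<bar> \<le> \<bar>K * (root m j u - A)\<bar>" if *: "m\<^sub>1 \<le> m" "j < m" "good m u" for m j u
      using l1_lipschitz[OF m_pos(2)[OF *(1)] *(2), of "root m j u" A] root_pos(3)[OF *(1,3,2)] A_pos K_nonneg
      by (simp add: abs_mult)
  qed
  from bdd_minus[OF bdd_add[OF bdd_add[OF bdd_leading_score_expansion bdd_score_correction_diff] l]]
  show ?thesis
  proof (rule bdd_cong)
    fix m j u assume *: "m\<^sub>1 \<le> m" "j < m" "good m u"
    have "leading_score D m (root m j u) u + score_correction x D m (root m j u) u + l1 m j (root m j u) = 0"
      using root(2)[OF *(1,3,2)] by (simp add: adj_score_def profile_score_eq)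
    then show "score_remainder m j u = - (leading_score D m (root m j u) u - (leading_score D m A u
        + (root m j u - A) * (- wfluct 3 m u - info m) + (root m j u - A)\<^sup>2 * cubes m)
      + (score_correction x D m (root m j u) u - score_correction x D m A u)
      + (l1 m j (root m j u) - l1 m j A))"
      unfolding score_remainder_def by algebra
  qed
qed

lemma bdd_root_step1: "bdd good (\<lambda>m j u. root m j u - A - step1 m u) 2 (- 2) 0"
proof -
  have c: "bdd good (\<lambda>m j u. score_correction x D m A u + l1 m j A) 2 0 0"
    by (intro bdd_add bdd_score_correction_A bdd_weaken[OF bdd_l1]) auto
  have z: "bdd good (\<lambda>m j u. wfluct 3 m u * (root m j u - A)) (1 + 1) (1 + - 1) (0 + 0)"
    by (intro bdd_mult bdd_wfluct bdd_root_dist) simp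
  have s: "bdd good (\<lambda>m j u. cubes m * (root m j u - A)\<^sup>2) (0 + 2 * 1) (2 + int 2 * - 1) (0 + 2 * 0)"
    by (intro bdd_mult bdd_cubes bdd_power bdd_root_dist)
  have r: "bdd good score_remainder 2 (- 1 + int 1) 0"
    by (rule bdd_trade) (use bdd_score_remainder in \<open>simp add: eval_nat_numeral\<close>)
  have "bdd good (\<lambda>m j u. score_correction x D m A u + l1 m j A - wfluct 3 m u * (root m j u - A)
      + cubes m * (root m j u - A)\<^sup>2 - score_remainder m j u) 2 0 0"
    by (rule bdd_diff[OF bdd_add[OF bdd_diff[OF c bdd_weaken[OF z]] bdd_weaken[OF s]] bdd_weaken[OF r]]) simp_all
  from bdd_mult[OF this bdd_inverse_info]
  have "bdd good (\<lambda>m j u. (score_correction x D m A u + l1 m j A - wfluct 3 m u * (root m j u - A)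
      + cubes m * (root m j u - A)\<^sup>2 - score_remainder m j u) * (1 / info m)) 2 (- 2) 0" by simp
  then show ?thesis
  proof (rule bdd_cong)
    fix m j u assume "m\<^sub>1 \<le> m"
    then have "info m \<noteq> 0" using info_pos[of m] by simp
    then have "info m * (1 / info m) = 1" by simp
    then show "root m j u - A - step1 m u = (score_correction x D m A u + l1 m j A - wfluct 3 m u * (root m j u - A)
      + cubes m * (root m j u - A)\<^sup>2 - score_remainder m j u) * (1 / info m)"
      unfolding step1_def score_remainder_def by algebra
  qed
qed

lemma bdd_root_step2: "bdd good (\<lambda>m j u. root m j u - A - step2 m j u) 3 (- 3) 0"
proof -
  have z: "bdd good (\<lambda>m j u. wfluct 3 m u * (root m j u - A - step1 m u)) (1 + 2) (1 + - 2) (0 + 0)"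
    by (intro bdd_mult bdd_wfluct bdd_root_step1) simp
  have s: "bdd good (\<lambda>m j u. cubes m * ((root m j u - A - step1 m u) * (root m j u - A + step1 m u)))
      (0 + (2 + 1)) (2 + (- 2 + - 1)) (0 + (0 + 0))"
    by (intro bdd_mult bdd_cubes bdd_root_step1 bdd_add bdd_root_dist bdd_step1)
  have "bdd good (\<lambda>m j u. cubes m * ((root m j u - A - step1 m u) * (root m j u - A + step1 m u))
      - wfluct 3 m u * (root m j u - A - step1 m u) - score_remainder m j u) 3 (- 1) 0"
    by (intro bdd_diff bdd_score_remainder bdd_weaken[OF z] bdd_weaken[OF s]) simp_all
  from bdd_mult[OF this bdd_inverse_info]
  have "bdd good (\<lambda>m j u. (cubes m * ((root m j u - A - step1 m u) * (root m j u - A + step1 m u))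
      - wfluct 3 m u * (root m j u - A - step1 m u) - score_remainder m j u) * (1 / info m)) 3 (- 3) 0" by simp
  then show ?thesis
  proof (rule bdd_cong)
    fix m j u assume "m\<^sub>1 \<le> m"
    then have "info m \<noteq> 0" using info_pos[of m] by simp
    then have i: "info m * (1 / info m) = 1" by simp
    have s: "step1 m u = leading_score D m A u * (1 / info m)" by (simp add: step1_def)
    show "root m j u - A - step2 m j u = (cubes m * ((root m j u - A - step1 m u) * (root m j u - A + step1 m u))
      - wfluct 3 m u * (root m j u - A - step1 m u) - score_remainder m j u) * (1 / info m)"
      unfolding step2_def score_remainder_def using i s by algebra
  qed
qed

lemma bdd_step2_step1: "bdd Q (\<lambda>m j u. step2 m j u - step1 m u) 2 (- 2) 0"
proof -
  have c: "bdd Q (\<lambda>m j u. score_correction x D m A u + l1 m j A) 2 0 0"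
    by (intro bdd_add bdd_score_correction_A bdd_weaken[OF bdd_l1]) auto
  have z: "bdd Q (\<lambda>m j u. wfluct 3 m u * step1 m u) (1 + 1) (1 + - 1) (0 + 0)"
    by (intro bdd_mult bdd_wfluct bdd_step1) simp
  have s: "bdd Q (\<lambda>m j u. cubes m * (step1 m u)\<^sup>2) (0 + 2 * 1) (2 + int 2 * - 1) (0 + 2 * 0)"
    by (intro bdd_mult bdd_cubes bdd_power bdd_step1)
  have "bdd Q (\<lambda>m j u. score_correction x D m A u + l1 m j A - wfluct 3 m u * step1 m u
      + cubes m * (step1 m u)\<^sup>2) 2 0 0"
    by (rule bdd_add[OF bdd_diff[OF c bdd_weaken[OF z]] bdd_weaken[OF s]]) simp_all
  from bdd_mult[OF this bdd_inverse_info] show ?thesis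
    by (rule bdd_cong[OF bdd_weaken]) (simp_all add: step2_def)
qed

end

section \<open>Expansion of the conditional coverage\<close>

section \<open>The standard normal distribution function\<close>

definition Phi :: "real \<Rightarrow> real" where "Phi = cdf std_normal_distribution"

lemma measure_std_normal_interval:
  assumes "a \<le> b"
  shows "measure std_normal_distribution {a..b} = integral {a..b} std_normal_density"
proof -
  have "measure std_normal_distribution {a..b} = (\<integral>t. indicator {a..b} t \<partial>std_normal_distribution)"
    by simp
  also have "\<dots> = (\<integral>t. std_normal_density t *\<^sub>R indicator {a..b} t \<partial>lborel)"
    by (subst integral_density) auto
  also have "\<dots> = (LINT t:{a..b}|lborel. std_normal_density t)"
    by (simp add: set_lebesgue_integral_def mult.commute)
  also have "\<dots> = integral {a..b} std_normal_density"
  proof (rule set_borel_integral_eq_integral)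
    show "set_integrable lborel {a..b} std_normal_density"
      unfolding set_integrable_def by (intro integrable_mult_indicator) auto
  qed
  finally show ?thesis .
qed

lemma std_normal_atom: "measure std_normal_distribution {a} = 0"
  using measure_std_normal_interval[of a a] by simp

lemma measure_std_normal_Icc:
  assumes "a \<le> b"
  shows "measure std_normal_distribution {a..b} = Phi b - Phi a"
proof -
  interpret real_distribution std_normal_distribution by (rule real_dist_normal_dist)
  show ?thesis
  proof (cases "a = b")
    case False
    then have "a < b" using assms by simp
    then have "Phi b - Phi a = measure std_normal_distribution {a<..b}"
      unfolding Phi_def by (rule cdf_diff_eq)
    moreover have "measure std_normal_distribution ({a} \<union> {a<..b})
        = measure std_normal_distribution {a} + measure std_normal_distribution {a<..b}"
      by (rule finite_measure_Union) auto
    moreover have "{a} \<union> {a<..b} = {a..b}" using assms by auto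
    ultimately show ?thesis by (simp add: std_normal_atom)
  qed (simp add: std_normal_atom)
qed

lemma DERIV_Phi: "(Phi has_real_derivative std_normal_density t) (at t)"
proof -
  have "((\<lambda>u. integral {t - 1..u} std_normal_density) has_real_derivative std_normal_density t)
      (at t within {t - 1..t + 1})"
  proof (rule integral_has_real_derivative)
    show "continuous_on {t - 1..t + 1} std_normal_density"
      unfolding normal_density_def[abs_def] by (intro continuous_intros) auto
  qed simp
  moreover have "at t within {t - 1..t + 1} = at t" by (rule at_within_interior) (simp add: interior_atLeastAtMost_real)
  ultimately have "((\<lambda>u. integral {t - 1..u} std_normal_density) has_real_derivative std_normal_density t) (at t)"
    by (simp only:)
  from DERIV_add[OF DERIV_const this, of "Phi (t - 1)"]
  have "((\<lambda>u. Phi (t - 1) + integral {t - 1..u} std_normal_density) has_real_derivative std_normal_density t) (at t)"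
    by simp
  then show ?thesis
  proof (rule has_field_derivative_transform_within_open)
    show "Phi (t - 1) + integral {t - 1..u} std_normal_density = Phi u" if "u \<in> {t - 1<..}" for u
      using measure_std_normal_interval[of "t - 1" u] measure_std_normal_Icc[of "t - 1" u] that by simp
  qed auto
qed

lemma std_normal_density_even: "std_normal_density (- t) = std_normal_density t"
  by (simp add: normal_density_def)

lemma Phi_symmetric: "Phi (- t) = 1 - Phi t"
proof -
  interpret real_distribution std_normal_distribution by (rule real_dist_normal_dist)
  let ?f = "\<lambda>t. Phi t + Phi (- t)"
  have "(?f has_real_derivative 0) (at t)" for t
  proof -
    have "(?f has_real_derivative std_normal_density t + std_normal_density (- t) * - 1) (at t)"
      by (intro DERIV_add DERIV_Phi DERIV_chain2[OF DERIV_Phi]) (auto intro!: derivative_eq_intros)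
    then show ?thesis by (simp add: std_normal_density_even)
  qed
  then have const: "?f t = ?f s" for t s by (intro DERIV_isconst_all) auto
  have "((\<lambda>t. Phi t + Phi (- t)) \<longlongrightarrow> 1 + 0) at_top"
    unfolding Phi_def
    by (intro tendsto_add cdf_lim_at_top_prob filterlim_compose[OF cdf_lim_at_bot filterlim_uminus_at_bot_at_top])
  moreover have "?f = (\<lambda>_. ?f t)" by (rule ext) (rule const)
  ultimately have "((\<lambda>_. ?f t) \<longlongrightarrow> 1) (at_top :: real filter)" by simp
  then have "?f t = 1" by (simp add: tendsto_const_iff)
  then show ?thesis by simp
qed

lemma Phi_mono: "s \<le> t \<Longrightarrow> Phi s \<le> Phi t"
  using measure_std_normal_Icc[of s t] measure_nonneg[of std_normal_distribution "{s..t}"] by simp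

lemma abs_cubic_density_le: "\<bar>(t\<^sup>2 - 1) * std_normal_density t\<bar> \<le> 3"
proof -
  have "1 + t\<^sup>2 / 2 \<le> exp (t\<^sup>2 / 2)" by (rule exp_ge_add_one_self)
  then have "(t\<^sup>2 + 1) \<le> 3 * exp (t\<^sup>2 / 2)" using exp_gt_zero[of "t\<^sup>2 / 2"] by linarith
  then have 1: "(t\<^sup>2 + 1) * exp (- t\<^sup>2 / 2) \<le> 3"
    by (simp add: exp_minus field_simps)
  have "\<bar>t\<^sup>2 - 1\<bar> \<le> t\<^sup>2 + 1" by (simp add: abs_le_iff)
  moreover have "\<bar>std_normal_density t\<bar> \<le> exp (- t\<^sup>2 / 2)"
  proof -
    have "1 \<le> sqrt (2 * pi)" using pi_gt3 by simp
    then have "1 / sqrt (2 * pi) \<le> 1" by simp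
    from mult_right_mono[OF this, of "exp (- t\<^sup>2 / 2)"] show ?thesis by (simp add: std_normal_density_def)
  qed
  ultimately have "\<bar>(t\<^sup>2 - 1) * std_normal_density t\<bar> \<le> (t\<^sup>2 + 1) * exp (- t\<^sup>2 / 2)" by (rule abs_mult_le)
  with 1 show ?thesis by linarith
qed

text \<open>Taylor's theorem; the third derivative is bounded by 3, and \<open>3 / fact 3 = 1 / 2\<close>.\<close>

lemma Phi_Taylor:
  "\<bar>Phi (c + d) - (Phi c + std_normal_density c * d - c * std_normal_density c / 2 * d\<^sup>2)\<bar> \<le> 1 / 2 * \<bar>d\<bar> ^ 3"
proof (cases "d = 0")
  case False
  define diff where "diff n = (if n = 0 then Phi else if n = 1 then std_normal_density
    else if n = 2 then (\<lambda>t. - (t * std_normal_density t)) else (\<lambda>t. (t\<^sup>2 - 1) * std_normal_density t))" for n :: nat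
  have d1: "(std_normal_density has_real_derivative - (t * std_normal_density t)) (at t)" for t
  proof -
    define c where "c = 1 / sqrt (2 * pi)"
    have "std_normal_density = (\<lambda>t. c * exp (- t\<^sup>2 / 2))"
      by (rule ext) (simp add: std_normal_density_def c_def)
    then show ?thesis by (auto intro!: derivative_eq_intros)
  qed
  have d2: "((\<lambda>t. - (t * std_normal_density t)) has_real_derivative (t\<^sup>2 - 1) * std_normal_density t) (at t)" for t
    by (auto intro!: derivative_eq_intros d1 simp: power2_eq_square algebra_simps)
  have "\<exists>t. (if c + d < c then c + d < t \<and> t < c else c < t \<and> t < c + d) \<and>
      Phi (c + d) = (\<Sum>n<3. diff n c / fact n * (c + d - c) ^ n) + diff 3 t / fact 3 * (c + d - c) ^ 3"
    by (rule Taylor[where a = "min c (c + d)" and b = "max c (c + d)"])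
       (use False in \<open>auto simp: diff_def less_Suc_eq numeral_3_eq_3 DERIV_Phi d1 d2\<close>)
  then obtain t where "Phi (c + d) = (\<Sum>n<3. diff n c / fact n * d ^ n) + diff 3 t / fact 3 * d ^ 3" by auto
  then have "Phi (c + d) - (Phi c + std_normal_density c * d - c * std_normal_density c / 2 * d\<^sup>2)
      = (t\<^sup>2 - 1) * std_normal_density t * (1 / 6 * d ^ 3)"
  proof -
    have "(\<Sum>n<3. diff n c / fact n * d ^ n) = Phi c + std_normal_density c * d + (- (c * std_normal_density c)) / 2 * d\<^sup>2"
      by (simp add: diff_def eval_nat_numeral)
    moreover have "diff 3 t / fact 3 * d ^ 3 = (t\<^sup>2 - 1) * std_normal_density t * (1 / 6 * d ^ 3)"
      by (simp add: diff_def fact_numeral)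
    ultimately show ?thesis using \<open>Phi (c + d) = _\<close> by simp
  qed
  also have "\<bar>\<dots>\<bar> \<le> 3 * (1 / 6 * \<bar>d\<bar> ^ 3)"
    by (intro abs_mult_le abs_cubic_density_le) (simp, simp only: power_abs order_refl)
  finally show ?thesis by simp
qed simp

section \<open>Expansion of the conditional coverage probability\<close>

context local_root
begin

lemma bdd_D: "bdd Q (\<lambda>m j u. D j) 0 0 0"
  using D_pos D_le by (intro bdd_bounded[where C = "d\<^sub>1"]) (simp add: less_imp_le)

lemma bdd_inverse_sqrt: "bdd Q (\<lambda>m j u. 1 / sqrt (real m)) 0 (- 1) 0"
  by (rule bddI[where C = 1]) (unfold sqrt_powi, simp)

lemma bdd_inverse_m: "bdd Q (\<lambda>m j u. 1 / real m) 0 (- 2) 0"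
  by (rule bddI[where C = 1]) (unfold sqrt_powi(2), simp)

lemma bdd_wt: "bdd Q (\<lambda>m j u. wt D A j) 0 0 0"
  using wt_A by (intro bdd_bounded[where C = "1 / d\<^sub>0"]) (simp add: less_imp_le)

lemma bdd_wt_root: "bdd good (\<lambda>m j u. wt D (root m j u) j) 0 0 0"
proof (rule bdd_bounded[where C = "1 / d\<^sub>0"])
  fix m j u assume *: "m\<^sub>1 \<le> m" "j < m" "good m u"
  have "0 \<le> root m j u" using root_pos[OF *(1,3,2)] by simp
  from wt_pos[OF this, of j] wt_le[OF this, of j] show "\<bar>wt D (root m j u) j\<bar> \<le> 1 / d\<^sub>0" by simp
qed

lemma cox_sd_A: "0 < cox_sd D j A" "(cox_sd D j A)\<^sup>2 = A * D j * wt D A j"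
proof -
  have p: "0 < A * D j / (A + D j)" using A_pos D_pos[of j] by simp
  then show "0 < cox_sd D j A" by (simp add: cox_sd_def)
  show "(cox_sd D j A)\<^sup>2 = A * D j * wt D A j" using p by (simp add: cox_sd_def wt_def)
qed

lemma bdd_inverse_cox_sd: "bdd Q (\<lambda>m j u. 1 / cox_sd D j A) 0 0 0"
proof (rule bdd_bounded)
  fix m j and u :: "nat \<Rightarrow> real"
  have "A * d\<^sub>0 / (A + d\<^sub>1) \<le> A * D j / (A + D j)"
    using A_pos d0_pos D_ge[of j] D_le[of j] D_pos[of j] by (intro frac_le mult_mono) auto
  then have "sqrt (A * d\<^sub>0 / (A + d\<^sub>1)) \<le> cox_sd D j A" by (simp add: cox_sd_def)
  moreover have "0 < sqrt (A * d\<^sub>0 / (A + d\<^sub>1))" using A_pos d0_pos d1_pos by simp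
  ultimately have "1 / cox_sd D j A \<le> 1 / sqrt (A * d\<^sub>0 / (A + d\<^sub>1))" using cox_sd_A(1)[of j] by (intro divide_left_mono) auto
  then show "\<bar>1 / cox_sd D j A\<bar> \<le> 1 / sqrt (A * d\<^sub>0 / (A + d\<^sub>1))" using cox_sd_A(1)[of j] by simp
qed

definition sd_ratio :: "nat \<Rightarrow> nat \<Rightarrow> (nat \<Rightarrow> real) \<Rightarrow> real"
  where "sd_ratio m j u = cox_sd D j (root m j u) / cox_sd D j A"

text \<open>The logarithmic derivative of \<open>cox_sd D j\<close> at \<open>A\<close>.\<close>

definition sd_slope :: "nat \<Rightarrow> real"
  where "sd_slope j = D j * wt D A j * (1 / (2 * A))"

lemma bdd_sd_slope: "bdd Q (\<lambda>m j u. sd_slope j) 0 0 0"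
  unfolding sd_slope_def using bdd_mult[OF bdd_mult[OF bdd_D bdd_wt] bdd_const[of Q "1 / (2 * A)"]] by simp

lemma sd_ratio_nonneg: "m\<^sub>1 \<le> m \<Longrightarrow> j < m \<Longrightarrow> good m u \<Longrightarrow> 0 \<le> sd_ratio m j u"
  using cox_sd_A(1)[of j] root_pos(3)[of m u j] D_pos[of j]
  by (simp add: sd_ratio_def cox_sd_def)

lemma sd_ratio_sq:
  assumes "m\<^sub>1 \<le> m" "j < m" "good m u"
  shows "(sd_ratio m j u)\<^sup>2 = 1 + (root m j u - A) * (wt D (root m j u) j * (2 * sd_slope j * (A + D j)))"
proof -
  define T where "T = root m j u"
  have T: "0 < T" unfolding T_def by (rule root_pos(3)) fact+
  have "0 < T * D j / (T + D j)" using T D_pos[of j] by simp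
  then have "(cox_sd D j T)\<^sup>2 = T * D j / (T + D j)" by (simp add: cox_sd_def)
  then have "(sd_ratio m j u)\<^sup>2 = T * D j / (T + D j) / (A * D j * wt D A j)"
    unfolding sd_ratio_def power_divide cox_sd_A T_def[symmetric] by simp
  also have "\<dots> = 1 + (T - A) * (wt D T j * (2 * sd_slope j * (A + D j)))"
  proof -
    have D: "0 < D j" "0 < A" using D_pos A_pos by auto
    have s: "2 * sd_slope j * (A + D j) = D j / A"
    proof -
      have "2 * sd_slope j * (A + D j) = D j / A * (wt D A j * (A + D j))" by (simp add: sd_slope_def)
      then show ?thesis by (simp add: wt_A(4))
    qed
    have nz: "T + D j \<noteq> 0" "A + D j \<noteq> 0" "A \<noteq> 0" "D j \<noteq> 0" using D T by auto
    show ?thesis unfolding s unfolding wt_def using nz by (simp add: divide_simps) (simp add: algebra_simps)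
  qed
  finally show ?thesis unfolding T_def .
qed

text \<open>
  The square of the ratio is a rational function of the root. Its square root is expanded by the identity
  \<open>e = y / 2 - y\<^sup>2 / 8 + e\<^sup>2 (e + y / 2) / 4\<close> for \<open>y = (1 + e)\<^sup>2 - 1\<close>.
\<close>

lemma bdd_sd_ratio: "bdd good (\<lambda>m j u. sd_ratio m j u - 1
    - (sd_slope j * (root m j u - A) - (sd_slope j * wt D A j + (sd_slope j)\<^sup>2 / 2) * (root m j u - A)\<^sup>2)) 3 (- 3) 0"
  "bdd good (\<lambda>m j u. sd_ratio m j u - 1) 1 (- 1) 0"
  "bdd good (\<lambda>m j u. sd_ratio m j u - 1 - sd_slope j * step1 m u) 2 (- 2) 0"
proof -
  define y where "y m j u = (sd_ratio m j u)\<^sup>2 - 1" for m j u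
  let ?d = "\<lambda>m j u. root m j u - A"
  let ?R = "\<lambda>m j u. 2 * sd_slope j * ((wt D A j) * wt D (root m j u) j)"
  have R: "bdd good ?R 0 0 0"
    using bdd_mult[OF bdd_mult[OF bdd_const[of good 2] bdd_sd_slope] bdd_mult[OF bdd_wt bdd_wt_root]] by simp
  have y_eq: "y m j u = 2 * sd_slope j * ?d m j u - 2 * sd_slope j * wt D A j * (?d m j u)\<^sup>2 + ?d m j u ^ 3 * ?R m j u"
    if *: "m\<^sub>1 \<le> m" "j < m" "good m u" for m j u
  proof -
    have e: "wt D (root m j u) j = wt D A j - ?d m j u * (wt D A j)\<^sup>2 + (?d m j u)\<^sup>2 * ((wt D A j)\<^sup>2 * wt D (root m j u) j)"
      by (rule wt_expansion(1)) (use root_pos(3)[OF *(1,3,2)] in simp)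
    have y: "y m j u = ?d m j u * (wt D (root m j u) j * (2 * sd_slope j * (A + D j)))"
      unfolding y_def sd_ratio_sq[OF *] by simp
    show ?thesis using e y wt_A(4)[of j] by algebra
  qed
  have d3: "bdd good (\<lambda>m j u. ?d m j u ^ 3 * ?R m j u) 3 (- 3) 0"
    by (rule bdd_weaken[OF bdd_mult[OF bdd_power[OF bdd_root_dist] R]]) auto
  have d2: "bdd good (\<lambda>m j u. 2 * sd_slope j * wt D A j * (?d m j u)\<^sup>2) 2 (- 2) 0"
    by (rule bdd_weaken[OF bdd_mult[OF bdd_mult[OF bdd_mult[OF bdd_const bdd_sd_slope] bdd_wt] bdd_power[OF bdd_root_dist]]]) auto
  have d1: "bdd good (\<lambda>m j u. 2 * sd_slope j * ?d m j u) 1 (- 1) 0"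
    by (rule bdd_weaken[OF bdd_mult[OF bdd_mult[OF bdd_const bdd_sd_slope] bdd_root_dist]]) auto
  have y2: "bdd good (\<lambda>m j u. y m j u - 2 * sd_slope j * ?d m j u) 2 (- 2) 0"
  proof (rule bdd_cong)
    have "bdd good (\<lambda>m j u. ?d m j u ^ 3 * ?R m j u) 2 (- 3 + int 1) 0"
      by (rule bdd_trade) (use d3 in \<open>simp add: eval_nat_numeral\<close>)
    then show "bdd good (\<lambda>m j u. ?d m j u ^ 3 * ?R m j u - 2 * sd_slope j * wt D A j * (?d m j u)\<^sup>2) 2 (- 2) 0"
      by (intro bdd_diff d2) simp
  qed (simp add: y_eq)
  have y1: "bdd good y 1 (- 1) 0"
  proof (rule bdd_cong)
    have "bdd good (\<lambda>m j u. y m j u - 2 * sd_slope j * ?d m j u) 1 (- 2 + int 1) 0"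
      by (rule bdd_trade) (use y2 in \<open>simp add: numeral_2_eq_2\<close>)
    then show "bdd good (\<lambda>m j u. y m j u - 2 * sd_slope j * ?d m j u + 2 * sd_slope j * ?d m j u) 1 (- 1) 0"
      by (intro bdd_add d1) simp
  qed simp
  let ?e = "\<lambda>m j u. sd_ratio m j u - 1"
  show e1: "bdd good ?e 1 (- 1) 0"
  proof (rule bdd_dominated[OF y1])
    fix m j u assume *: "m\<^sub>1 \<le> m" "j < m" "good m u"
    have "\<bar>?e m j u\<bar> * 1 \<le> \<bar>?e m j u\<bar> * (sd_ratio m j u + 1)"
      using sd_ratio_nonneg[OF *] by (intro mult_left_mono) auto
    also have "\<dots> = \<bar>y m j u\<bar>"
      using sd_ratio_nonneg[OF *] by (simp add: y_def power2_eq_square square_diff_one_factored abs_mult mult.commute)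
    finally show "\<bar>?e m j u\<bar> \<le> \<bar>y m j u\<bar>" by simp
  qed
  have t1: "bdd good (\<lambda>m j u. 1 / 2 * (?d m j u ^ 3 * ?R m j u)) 3 (- 3) 0"
    using bdd_mult[OF bdd_const[of good "1 / 2"] d3] by simp
  have t2: "bdd good (\<lambda>m j u. 1 / 8 * ((y m j u - 2 * sd_slope j * ?d m j u) * (y m j u + 2 * sd_slope j * ?d m j u))) 3 (- 3) 0"
    by (rule bdd_weaken[OF bdd_mult[OF bdd_const bdd_mult[OF y2 bdd_add[OF y1 d1]]]]) auto
  have t3: "bdd good (\<lambda>m j u. 1 / 4 * ((?e m j u)\<^sup>2 * (?e m j u + 1 / 2 * y m j u))) 3 (- 3) 0"
  proof (rule bdd_weaken[OF bdd_mult[OF bdd_const bdd_mult[OF bdd_power[OF e1] bdd_add[OF e1]]]])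
    show "bdd good (\<lambda>m j u. 1 / 2 * y m j u) 1 (- 1) 0"
      using bdd_mult[OF bdd_const[of good "1 / 2"] y1] by simp
  qed auto
  show s: "bdd good (\<lambda>m j u. sd_ratio m j u - 1
    - (sd_slope j * (root m j u - A) - (sd_slope j * wt D A j + (sd_slope j)\<^sup>2 / 2) * (root m j u - A)\<^sup>2)) 3 (- 3) 0"
  proof (rule bdd_cong[OF bdd_add[OF bdd_diff[OF t1 t2] t3]])
    fix m j u assume *: "m\<^sub>1 \<le> m" "j < m" "good m u"
    show "sd_ratio m j u - 1
    - (sd_slope j * (root m j u - A) - (sd_slope j * wt D A j + (sd_slope j)\<^sup>2 / 2) * (root m j u - A)\<^sup>2)
      = 1 / 2 * (?d m j u ^ 3 * ?R m j u) - 1 / 8 * ((y m j u - 2 * sd_slope j * ?d m j u) * (y m j u + 2 * sd_slope j * ?d m j u))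
        + 1 / 4 * ((?e m j u)\<^sup>2 * (?e m j u + 1 / 2 * y m j u))"
    proof -
      have e: "y m j u = (?e m j u)\<^sup>2 + 2 * ?e m j u" by (simp add: y_def power2_eq_square algebra_simps)
      have r: "?d m j u ^ 3 * ?R m j u = y m j u - 2 * sd_slope j * ?d m j u + 2 * sd_slope j * wt D A j * (?d m j u)\<^sup>2"
        using y_eq[OF *] by simp
      show ?thesis unfolding r using e by algebra
    qed
  qed
  have c: "bdd good (\<lambda>m j u. sd_slope j * (root m j u - A - step1 m u)) 2 (- 2) 0"
    by (rule bdd_weaken[OF bdd_mult[OF bdd_sd_slope bdd_root_step1]]) auto
  have c2: "bdd good (\<lambda>m j u. (sd_slope j * wt D A j + (sd_slope j)\<^sup>2 * (1 / 2)) * (root m j u - A)\<^sup>2) 2 (- 2) 0"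
    by (rule bdd_weaken[OF bdd_mult[OF bdd_add[OF bdd_mult[OF bdd_sd_slope bdd_wt]] bdd_power[OF bdd_root_dist]]])
       (use bdd_mult[OF bdd_power[OF bdd_sd_slope[of good], of 2] bdd_const[of good "1 / 2"]] in auto)
  have c3: "bdd good (\<lambda>m j u. sd_ratio m j u - 1
    - (sd_slope j * (root m j u - A) - (sd_slope j * wt D A j + (sd_slope j)\<^sup>2 / 2) * (root m j u - A)\<^sup>2)) 2 (- 3 + int 1) 0"
    by (rule bdd_trade) (use s in \<open>simp add: eval_nat_numeral\<close>)
  have "bdd good (\<lambda>m j u. sd_slope j * (root m j u - A - step1 m u) + (sd_ratio m j u - 1
    - (sd_slope j * (root m j u - A) - (sd_slope j * wt D A j + (sd_slope j)\<^sup>2 / 2) * (root m j u - A)\<^sup>2))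
    - (sd_slope j * wt D A j + (sd_slope j)\<^sup>2 * (1 / 2)) * (root m j u - A)\<^sup>2) 2 (- 2) 0"
    by (rule bdd_diff[OF bdd_add[OF c bdd_weaken[OF c3]] c2]) simp_all
  then show "bdd good (\<lambda>m j u. sd_ratio m j u - 1 - sd_slope j * step1 m u) 2 (- 2) 0"
    by (rule bdd_cong) (simp add: algebra_simps)
qed

definition root_wt :: "nat \<Rightarrow> (nat \<Rightarrow> real) \<Rightarrow> nat \<Rightarrow> real"
  where "root_wt m u k = 1 / (root m k u + D k)"

lemma wsum_affine:
  assumes "\<And>k. c k = t * c' k + c'' k"
  shows "wsum x m c u = t *\<^sub>R wsum x m c' u + wsum x m c'' u"
  by (simp add: wsum_def assms scaleR_sum_right sum.distrib scaleR_left_distrib distrib_right mult.assoc)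

text \<open>
  Each area has its own root, but all roots share the leading term \<open>step1\<close>; only this makes the error of the
  weighted least squares fit of the same order as for a common variance estimate.
\<close>

lemma bdd_fit_root: "bdd good (\<lambda>m j u. fit x m (root_wt m u) u j - fit x m (wt D A) u j) 2 (- 2) 0"
proof -
  define q where "q = 1 / d\<^sub>0"
  have q: "0 < q" using d0_pos by (simp add: q_def)
  define L where "L = 2 * A + d\<^sub>1"
  have L: "0 < L" using A_pos d1_pos by (simp add: L_def)
  define U where "U = sqrt cq * ubound"
  have U: "0 \<le> U" using cq_nonneg ubound_ge_1 by (simp add: U_def)
  obtain C where C: "0 \<le> C" "\<And>m j u. m\<^sub>1 \<le> m \<Longrightarrow> j < m \<Longrightarrow> good m u \<Longrightarrow>
      \<bar>root m j u - A - step1 m u\<bar> \<le> C * (W m u ^ 2 * sqrt (real m) powi (- 2) * (1 + \<bar>u j\<bar>) ^ 0)"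
    by (rule bddE[OF bdd_root_step1]) (rule that, assumption+)
  obtain C' where C': "0 \<le> C'" "\<And>m j u. m\<^sub>1 \<le> m \<Longrightarrow> j < m \<Longrightarrow> good m u \<Longrightarrow>
      \<bar>root m j u - A\<bar> \<le> C' * (W m u ^ 1 * sqrt (real m) powi (- 1) * (1 + \<bar>u j\<bar>) ^ 0)"
    by (rule bddE[OF bdd_root_dist]) (rule that, assumption+)
  define e1 where "e1 = (\<lambda>m (j::nat) u. C' * (W m u * (1 / sqrt (real m))))"
  define e2 where "e2 = (\<lambda>m (j::nat) u. C * ((W m u)\<^sup>2 * (1 / real m)))"
  define P where "P = (\<lambda>m j u. \<bar>step1 m u\<bar> * W m u + (q\<^sup>2 * e2 m j u + q ^ 3 * (e1 m j u)\<^sup>2) * U * sqrt (real m))"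
  have be1: "bdd Q e1 1 (- 1) 0" for Q
    unfolding e1_def by (rule bdd_weaken[OF bdd_mult[OF bdd_const bdd_mult[OF bdd_W bdd_inverse_sqrt]]]) auto
  have be2: "bdd Q e2 2 (- 2) 0" for Q
    unfolding e2_def by (rule bdd_weaken[OF bdd_mult[OF bdd_const bdd_mult[OF bdd_power[OF bdd_W] bdd_inverse_m]]]) auto
  have bP: "bdd good P 2 (- 1) 0"
  proof -
    have "bdd good (\<lambda>m j u. \<bar>step1 m u\<bar> * W m u) 2 (- 1) 0"
      by (rule bdd_weaken[OF bdd_mult[OF bdd_abs[OF bdd_step1] bdd_W]]) auto
    moreover have P2: "bdd good (\<lambda>m j u. q\<^sup>2 * e2 m j u + q ^ 3 * (e1 m j u)\<^sup>2) 2 (- 2) 0"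
      by (intro bdd_add bdd_weaken[OF bdd_mult[OF bdd_const be2]] bdd_weaken[OF bdd_mult[OF bdd_const bdd_power[OF be1]]]) auto
    moreover from bdd_mult[OF bdd_mult[OF P2 bdd_const[of good U]] bdd_sqrt]
    have "bdd good (\<lambda>m j u. (q\<^sup>2 * e2 m j u + q ^ 3 * (e1 m j u)\<^sup>2) * U * sqrt (real m)) 2 (- 1) 0"
      by (rule bdd_weaken) auto
    ultimately show ?thesis unfolding P_def by (intro bdd_add)
  qed
  have root_wt: "1 / L \<le> root_wt m u k" "0 < root_wt m u k"
    "\<bar>root_wt m u k - wt D A k\<bar> \<le> q\<^sup>2 * e1 m 0 u"
    "\<bar>root_wt m u k - wt D A k - (- step1 m u * (wt D A k)\<^sup>2)\<bar> \<le> q\<^sup>2 * e2 m 0 u + q ^ 3 * (e1 m 0 u)\<^sup>2"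
    if *: "m\<^sub>1 \<le> m" "k < m" "good m u" for m k u
  proof -
    define a where "a = root m k u"
    have a: "0 \<le> a" "a \<le> 2 * A" using root_pos[OF *(1,3,2)] by (simp_all add: a_def)
    have rw: "root_wt m u k = wt D a k" by (simp add: root_wt_def a_def wt_def)
    show "1 / L \<le> root_wt m u k"
      unfolding rw using wt_ge[OF a(1), of k] frac_le[of 1 1 "a + d\<^sub>1" L] a d1_pos by (simp add: L_def)
    show "0 < root_wt m u k" unfolding rw by (rule wt_pos[OF a(1)])
    have d: "\<bar>a - A\<bar> \<le> e1 m 0 u"
      using C'(2)[OF *] unfolding a_def sqrt_powi e1_def by simp
    have d2: "\<bar>a - A - step1 m u\<bar> \<le> e2 m 0 u"
      using C(2)[OF *] unfolding a_def sqrt_powi(2)[OF *(1)] e2_def by simp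
    have w: "\<bar>wt D A k\<bar> \<le> q" "\<bar>wt D a k\<bar> \<le> q"
      using wt_A[of k] wt_pos[OF a(1), of k] wt_le[OF a(1), of k] by (simp_all add: q_def)
    have w2: "\<bar>(wt D A k)\<^sup>2\<bar> \<le> q\<^sup>2" unfolding power_abs by (intro power_mono w) simp
    have "\<bar>wt D a k - wt D A k\<bar> \<le> \<bar>a - A\<bar> / d\<^sub>0\<^sup>2" by (rule wt_lipschitz) (use a A_pos in auto)
    also have "\<dots> = q\<^sup>2 * \<bar>a - A\<bar>" by (simp add: q_def power_divide)
    also have "\<dots> \<le> q\<^sup>2 * e1 m 0 u" by (intro mult_left_mono d) simp
    finally show "\<bar>root_wt m u k - wt D A k\<bar> \<le> q\<^sup>2 * e1 m 0 u" unfolding rw .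
    have eq: "wt D a k - wt D A k - (- step1 m u * (wt D A k)\<^sup>2)
        = - ((wt D A k)\<^sup>2 * (a - A - step1 m u)) + (wt D A k)\<^sup>2 * wt D a k * ((a - A) * (a - A))"
      using wt_expansion(1)[OF a(1), of k] by algebra
    have "\<bar>(wt D A k)\<^sup>2 * (a - A - step1 m u)\<bar> \<le> q\<^sup>2 * e2 m 0 u" by (intro abs_mult_le w2 d2)
    moreover have "\<bar>(wt D A k)\<^sup>2 * wt D a k * ((a - A) * (a - A))\<bar> \<le> q\<^sup>2 * q * (e1 m 0 u * e1 m 0 u)"
      by (intro abs_mult_le w2 w d)
    moreover have "q\<^sup>2 * q * (e1 m 0 u * e1 m 0 u) = q ^ 3 * (e1 m 0 u)\<^sup>2" by algebra
    ultimately show "\<bar>root_wt m u k - wt D A k - (- step1 m u * (wt D A k)\<^sup>2)\<bar> \<le> q\<^sup>2 * e2 m 0 u + q ^ 3 * (e1 m 0 u)\<^sup>2"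
      unfolding rw eq by linarith
  qed
  have "bdd good (\<lambda>m j u. sqrt cq * (1 / sqrt (real m)) * (L * (P m j u + q\<^sup>2 * e1 m j u * (L * W m u)))) 2 (- 2) 0"
  proof -
    have "bdd good (\<lambda>m j u. q\<^sup>2 * e1 m j u * (L * W m u)) 2 (- 1) 0"
      by (rule bdd_weaken[OF bdd_mult[OF bdd_mult[OF bdd_const be1] bdd_mult[OF bdd_const bdd_W]]]) auto
    from bdd_mult[OF bdd_mult[OF bdd_const bdd_inverse_sqrt] bdd_mult[OF bdd_const bdd_add[OF bP this]]]
    show ?thesis by (rule bdd_weaken) auto
  qed
  then show ?thesis
  proof (rule bdd_dominated)
    fix m j u assume *: "m\<^sub>1 \<le> m" "j < m" "good m u"
    have m: "m\<^sub>0 \<le> m" by (rule m_pos(2)[OF *(1)])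
    interpret full_rank_design x m by (rule full_rank) (rule m)
    have Wn: "0 \<le> W m u" using envelope_ge_1[of G m u] by linarith
    have e10: "e1 m k u = e1 m 0 u" "e2 m k u = e2 m 0 u" for k by (simp_all add: e1_def e2_def)
    have e1n: "0 \<le> e1 m 0 u" "0 \<le> e2 m 0 u" using C(1) C'(1) Wn by (simp_all add: e1_def e2_def)
    have sn: "score_norm x m (wsum x m (root_wt m u) u - wsum x m (wt D A) u) \<le> P m j u"
    proof -
      have split: "wsum x m (root_wt m u) u - wsum x m (wt D A) u = (- step1 m u) *\<^sub>R wsum x m (\<lambda>k. (wt D A k)\<^sup>2) u
          + wsum x m (\<lambda>k. root_wt m u k - wt D A k - (- step1 m u * (wt D A k)\<^sup>2)) u"
        unfolding wsum_diff by (rule wsum_affine) simp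
      have "score_norm x m (wsum x m (\<lambda>k. root_wt m u k - wt D A k - (- step1 m u * (wt D A k)\<^sup>2)) u)
          \<le> (q\<^sup>2 * e2 m 0 u + q ^ 3 * (e1 m 0 u)\<^sup>2) * (sqrt cq * ubound) * sqrt (real m)"
        using e1n q by (intro score_norm_wsum_le_sqrt m good_sums(2) * root_wt(4)) auto
      moreover have "\<bar>- step1 m u\<bar> * score_norm x m (wsum x m (\<lambda>k. (wt D A k)\<^sup>2) u) \<le> \<bar>- step1 m u\<bar> * W m u"
        by (intro mult_left_mono score_norm_wt_le_envelope fin_G) simp
      ultimately show ?thesis
        unfolding split P_def e10[of j] U_def
        using score_norm_add[of x m "(- step1 m u) *\<^sub>R wsum x m (\<lambda>k. (wt D A k)\<^sup>2) u"
            "wsum x m (\<lambda>k. root_wt m u k - wt D A k - (- step1 m u * (wt D A k)\<^sup>2)) u"]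
        unfolding score_norm_scaleR by simp
    qed
    have hA: "design_norm x m (wls x m (wt D A) u) \<le> L * W m u"
    proof (rule order.trans[OF design_norm_wls_A_le[OF fin_G m]])
      show "(A + d\<^sub>1) * W m u \<le> L * W m u" using A_pos Wn by (intro mult_right_mono) (auto simp: L_def)
    qed
    have "design_norm x m (wls x m (root_wt m u) u - wls x m (wt D A) u)
        \<le> (score_norm x m (wsum x m (root_wt m u) u - wsum x m (wt D A) u)
            + q\<^sup>2 * e1 m 0 u * design_norm x m (wls x m (wt D A) u)) / (1 / L)"
      unfolding wls_eq
      by (intro design_norm_solution_diff_le root_wt(1) * wt_A(1) root_wt(3)) (use L e1n in auto)
    also have "\<dots> \<le> (P m j u + q\<^sup>2 * e1 m 0 u * (L * W m u)) / (1 / L)"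
      using L e1n by (intro divide_right_mono add_mono sn mult_left_mono hA) auto
    also have "\<dots> = L * (P m j u + q\<^sup>2 * e1 m j u * (L * W m u))" unfolding e10[of j] by simp
    finally have hd: "design_norm x m (wls x m (root_wt m u) u - wls x m (wt D A) u)
        \<le> L * (P m j u + q\<^sup>2 * e1 m j u * (L * W m u))" .
    have "\<bar>fit x m (root_wt m u) u j - fit x m (wt D A) u j\<bar>
        \<le> score_norm x m (x j) * design_norm x m (wls x m (root_wt m u) u - wls x m (wt D A) u)"
      unfolding fit_def inner_diff_right[symmetric] by (rule inner_le_norms)
    also have "\<dots> \<le> sqrt (cq / real m) * (L * (P m j u + q\<^sup>2 * e1 m j u * (L * W m u)))"
      using cq_nonneg by (intro mult_mono score_norm_row_le m * hd design_norm_nonneg) auto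
    also have "sqrt (cq / real m) = sqrt cq * (1 / sqrt (real m))" by (simp add: real_sqrt_divide)
    finally show "\<bar>fit x m (root_wt m u) u j - fit x m (wt D A) u j\<bar>
        \<le> \<bar>sqrt cq * (1 / sqrt (real m)) * (L * (P m j u + q\<^sup>2 * e1 m j u * (L * W m u)))\<bar>"
      by (rule order.trans[OF _ abs_ge_self])
  qed
qed

lemma bdd_fit_A: "bdd Q (\<lambda>m j u. fit x m (wt D A) u j) 1 (- 1) 0"
proof (rule bddI[where C = "sqrt cq * (A + d\<^sub>1)"])
  fix m j u assume *: "m\<^sub>1 \<le> m" "j < m"
  have "\<bar>fit x m (wt D A) u j\<bar> \<le> sqrt (cq / real m) * design_norm x m (wls x m (wt D A) u)"
    by (rule fit_le[OF m_pos(2)[OF *(1)] *(2)])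
  also have "\<dots> \<le> sqrt (cq / real m) * ((A + d\<^sub>1) * W m u)"
    using cq_nonneg by (intro mult_left_mono design_norm_wls_A_le fin_G m_pos *) auto
  also have "\<dots> = sqrt cq * (A + d\<^sub>1) * (W m u ^ 1 * sqrt (real m) powi (- 1) * (1 + \<bar>u j\<bar>) ^ 0)"
    unfolding sqrt_powi by (simp add: real_sqrt_divide)
  finally show "\<bar>fit x m (wt D A) u j\<bar> \<le> sqrt cq * (A + d\<^sub>1) * (W m u ^ 1 * sqrt (real m) powi (- 1) * (1 + \<bar>u j\<bar>) ^ 0)" .
qed

text \<open>
  The deviation of the empirical Bayes predictor from the Bayes predictor in units of the posterior standard
  deviation, and its leading term.
\<close>

definition deviation :: "nat \<Rightarrow> nat \<Rightarrow> (nat \<Rightarrow> real) \<Rightarrow> real"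
  where "deviation m j u = (D j * (wt D A j - wt D (root m j u) j) * u j
    + D j * wt D (root m j u) j * fit x m (root_wt m u) u j) * (1 / cox_sd D j A)"

definition deviation1 :: "nat \<Rightarrow> nat \<Rightarrow> (nat \<Rightarrow> real) \<Rightarrow> real"
  where "deviation1 m j u = (D j * ((wt D A j)\<^sup>2 * step1 m u) * u j
    + D j * wt D A j * fit x m (wt D A) u j) * (1 / cox_sd D j A)"

lemma bdd_deviation1: "bdd Q deviation1 1 (- 1) 1"
proof -
  have 1: "bdd Q (\<lambda>m j u. D j * ((wt D A j)\<^sup>2 * step1 m u) * u j) 1 (- 1) 1"
    by (rule bdd_weaken[OF bdd_mult[OF bdd_mult[OF bdd_D bdd_mult[OF bdd_power[OF bdd_wt] bdd_step1]] bdd_u]]) auto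
  have 2: "bdd Q (\<lambda>m j u. D j * wt D A j * fit x m (wt D A) u j) 1 (- 1) 1"
    by (rule bdd_weaken[OF bdd_mult[OF bdd_mult[OF bdd_D bdd_wt] bdd_fit_A]]) auto
  show ?thesis unfolding deviation1_def
    by (rule bdd_weaken[OF bdd_mult[OF bdd_add[OF 1 2] bdd_inverse_cox_sd]]) auto
qed

lemma bdd_deviation: "bdd good (\<lambda>m j u. deviation m j u - deviation1 m j u) 2 (- 2) 1"
proof -
  let ?d = "\<lambda>m j u. root m j u - A"
  let ?v = "\<lambda>m j u. wt D (root m j u) j"
  have 1: "bdd good (\<lambda>m j u. D j * ((wt D A j)\<^sup>2 * (?d m j u - step1 m u)) * u j) 2 (- 2) 1"
    by (rule bdd_weaken[OF bdd_mult[OF bdd_mult[OF bdd_D bdd_mult[OF bdd_power[OF bdd_wt] bdd_root_step1]] bdd_u]]) auto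
  have 2: "bdd good (\<lambda>m j u. D j * ((wt D A j)\<^sup>2 * ?v m j u * (?d m j u)\<^sup>2) * u j) 2 (- 2) 1"
    by (rule bdd_weaken[OF bdd_mult[OF bdd_mult[OF bdd_D bdd_mult[OF bdd_mult[OF bdd_power[OF bdd_wt] bdd_wt_root] bdd_power[OF bdd_root_dist]]] bdd_u]]) auto
  have 3: "bdd good (\<lambda>m j u. D j * ?v m j u * (fit x m (root_wt m u) u j - fit x m (wt D A) u j)) 2 (- 2) 1"
    by (rule bdd_weaken[OF bdd_mult[OF bdd_mult[OF bdd_D bdd_wt_root] bdd_fit_root]]) auto
  have 4: "bdd good (\<lambda>m j u. D j * (wt D A j * ?v m j u * ?d m j u) * fit x m (wt D A) u j) 2 (- 2) 1"
    by (rule bdd_weaken[OF bdd_mult[OF bdd_mult[OF bdd_D bdd_mult[OF bdd_mult[OF bdd_wt bdd_wt_root] bdd_root_dist]] bdd_fit_A]]) auto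
  have "bdd good (\<lambda>m j u. (D j * ((wt D A j)\<^sup>2 * (?d m j u - step1 m u)) * u j
      - D j * ((wt D A j)\<^sup>2 * ?v m j u * (?d m j u)\<^sup>2) * u j
      + D j * ?v m j u * (fit x m (root_wt m u) u j - fit x m (wt D A) u j)
      - D j * (wt D A j * ?v m j u * ?d m j u) * fit x m (wt D A) u j) * (1 / cox_sd D j A)) 2 (- 2) 1"
    by (rule bdd_weaken[OF bdd_mult[OF bdd_diff[OF bdd_add[OF bdd_diff[OF 1 2] 3] 4] bdd_inverse_cox_sd]]) auto
  then show ?thesis
  proof (rule bdd_cong)
    fix m j u assume *: "m\<^sub>1 \<le> m" "j < m" "good m u"
    have a: "0 \<le> root m j u" using root_pos(3)[OF *(1,3,2)] by simp
    have e: "?v m j u = wt D A j - ?d m j u * (wt D A j)\<^sup>2 + (?d m j u)\<^sup>2 * ((wt D A j)\<^sup>2 * ?v m j u)"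
      by (rule wt_expansion(1)[OF a])
    have e': "?v m j u = wt D A j - ?d m j u * (wt D A j * ?v m j u)"
      using wt_diff[OF a less_imp_le[OF A_pos], of j] by (simp add: algebra_simps)
    show "deviation m j u - deviation1 m j u = (D j * ((wt D A j)\<^sup>2 * (?d m j u - step1 m u)) * u j
      - D j * ((wt D A j)\<^sup>2 * ?v m j u * (?d m j u)\<^sup>2) * u j
      + D j * ?v m j u * (fit x m (root_wt m u) u j - fit x m (wt D A) u j)
      - D j * (wt D A j * ?v m j u * ?d m j u) * fit x m (wt D A) u j) * (1 / cox_sd D j A)"
      unfolding deviation_def deviation1_def using e e' by algebra
  qed
qed

definition coverage :: "real \<Rightarrow> nat \<Rightarrow> nat \<Rightarrow> (nat \<Rightarrow> real) \<Rightarrow> real"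
  where "coverage z m j u = Phi (deviation m j u + z * sd_ratio m j u) - Phi (deviation m j u - z * sd_ratio m j u)"

text \<open>
  The second-order Taylor polynomial of \<open>coverage\<close> around \<open>deviation = 0\<close>, \<open>sd_ratio = 1\<close>, with the root replaced by its
  approximations: by \<open>step2\<close> in the linear term, by \<open>step1\<close> in the quadratic ones.
\<close>

definition coverage_approx :: "real \<Rightarrow> nat \<Rightarrow> nat \<Rightarrow> (nat \<Rightarrow> real) \<Rightarrow> real"
  where "coverage_approx z m j u = Phi z - Phi (- z) + z * std_normal_density z *
    (2 * (sd_slope j * step2 m j u - (sd_slope j * wt D A j + (sd_slope j)\<^sup>2 * (1 / 2)) * (step1 m u)\<^sup>2)
      - z\<^sup>2 * (sd_slope j * step1 m u)\<^sup>2 - (deviation1 m j u)\<^sup>2)"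

text \<open>
  The conditional coverage probability is even in the deviation, so its first-order effect cancels and
  only the leading term of the squared deviation matters.
\<close>

lemma bdd_coverage: "bdd good (\<lambda>m j u. coverage z m j u - coverage_approx z m j u) 3 (- 3) 3"
proof -
  let ?e = "\<lambda>m j u. sd_ratio m j u - 1" and ?d = "\<lambda>m j u. root m j u - A"
  let ?p = "std_normal_density z"
  define R where "R c t = Phi (c + t) - (Phi c + std_normal_density c * t - c * std_normal_density c / 2 * t\<^sup>2)" for c t
  have dev: "bdd good deviation 1 (- 1) 1"
  proof (rule bdd_cong)
    have "bdd good (\<lambda>m j u. deviation m j u - deviation1 m j u) 1 (- 2 + int 1) 1"
      by (rule bdd_trade) (use bdd_deviation in \<open>simp add: numeral_2_eq_2\<close>)
    then show "bdd good (\<lambda>m j u. deviation m j u - deviation1 m j u + deviation1 m j u) 1 (- 1) 1"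
      by (intro bdd_add bdd_deviation1) simp
  qed simp
  have ze: "bdd good (\<lambda>m j u. c * ?e m j u) 1 (- 1) 1" for c
    by (rule bdd_weaken[OF bdd_mult[OF bdd_const bdd_sd_ratio(2)]]) auto
  have rem: "bdd good (\<lambda>m j u. R c (deviation m j u + c' * ?e m j u)) 3 (- 3) 3" for c c'
  proof (rule bdd_dominated)
    show "bdd good (\<lambda>m j u. 1 / 2 * \<bar>deviation m j u + c' * ?e m j u\<bar> ^ 3) 3 (- 3) 3"
      by (rule bdd_weaken[OF bdd_mult[OF bdd_const bdd_power[OF bdd_abs[OF bdd_add[OF dev ze]]]]]) auto
    show "\<bar>R c (deviation m j u + c' * ?e m j u)\<bar> \<le> \<bar>1 / 2 * \<bar>deviation m j u + c' * ?e m j u\<bar> ^ 3\<bar>" for m j u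
      unfolding R_def by (rule order.trans[OF Phi_Taylor abs_ge_self])
  qed
  let ?c = "\<lambda>j. sd_slope j * wt D A j + (sd_slope j)\<^sup>2 * (1 / 2)"
  have cb: "bdd Q (\<lambda>m j u. ?c j) 0 0 0" for Q
    by (intro bdd_add bdd_weaken[OF bdd_mult[OF bdd_sd_slope bdd_wt]]
        bdd_weaken[OF bdd_mult[OF bdd_power[OF bdd_sd_slope] bdd_const]]) auto
  have a1: "bdd good (\<lambda>m j u. ?e m j u - (sd_slope j * ?d m j u - ?c j * (?d m j u)\<^sup>2)) 3 (- 3) 3"
    by (rule bdd_cong[OF bdd_weaken[OF bdd_sd_ratio(1)]]) auto
  have a2: "bdd good (\<lambda>m j u. sd_slope j * (?d m j u - step2 m j u)) 3 (- 3) 3"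
    by (rule bdd_weaken[OF bdd_mult[OF bdd_sd_slope bdd_root_step2]]) auto
  have a3: "bdd good (\<lambda>m j u. ?c j * ((?d m j u - step1 m u) * (?d m j u + step1 m u))) 3 (- 3) 3"
    by (rule bdd_weaken[OF bdd_mult[OF cb bdd_mult[OF bdd_root_step1 bdd_add[OF bdd_root_dist bdd_step1]]]]) auto
  have sl: "bdd good (\<lambda>m j u. sd_slope j * step1 m u) 1 (- 1) 0"
    by (rule bdd_weaken[OF bdd_mult[OF bdd_sd_slope bdd_step1]]) auto
  have a4: "bdd good (\<lambda>m j u. (?e m j u - sd_slope j * step1 m u) * (?e m j u + sd_slope j * step1 m u)) 3 (- 3) 3"
    by (rule bdd_weaken[OF bdd_mult[OF bdd_sd_ratio(3) bdd_add[OF bdd_sd_ratio(2) sl]]]) auto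
  have a5: "bdd good (\<lambda>m j u. (deviation m j u - deviation1 m j u) * (deviation m j u + deviation1 m j u)) 3 (- 3) 3"
    by (rule bdd_weaken[OF bdd_mult[OF bdd_deviation bdd_add[OF dev bdd_deviation1]]]) auto
  have m: "bdd good f 3 (- 3) 3 \<Longrightarrow> bdd good (\<lambda>m j u. k * f m j u) 3 (- 3) 3" for k f
    by (rule bdd_weaken[OF bdd_mult[OF bdd_const]]) auto
  have "bdd good (\<lambda>m j u. z * ?p * (2 * (?e m j u - (sd_slope j * ?d m j u - ?c j * (?d m j u)\<^sup>2)
      + sd_slope j * (?d m j u - step2 m j u) - ?c j * ((?d m j u - step1 m u) * (?d m j u + step1 m u)))
      - z\<^sup>2 * ((?e m j u - sd_slope j * step1 m u) * (?e m j u + sd_slope j * step1 m u))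
      - (deviation m j u - deviation1 m j u) * (deviation m j u + deviation1 m j u))
      + R z (deviation m j u + z * ?e m j u) - R (- z) (deviation m j u + - z * ?e m j u)) 3 (- 3) 3"
    by (rule bdd_diff[OF bdd_add[OF m[OF bdd_diff[OF bdd_diff[OF m[OF bdd_diff[OF bdd_add[OF a1 a2] a3]] m[OF a4]] a5]] rem] rem])
  then show ?thesis
  proof (rule bdd_cong)
    fix m j u
    have e1: "z + (deviation m j u + z * ?e m j u) = deviation m j u + z * sd_ratio m j u"
      "- z + (deviation m j u + - z * ?e m j u) = deviation m j u - z * sd_ratio m j u"
      by (simp_all add: algebra_simps)
    have p: "std_normal_density (- z) = ?p" by (rule std_normal_density_even)
    show "coverage z m j u - coverage_approx z m j u = z * ?p * (2 * (?e m j u - (sd_slope j * ?d m j u - ?c j * (?d m j u)\<^sup>2)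
      + sd_slope j * (?d m j u - step2 m j u) - ?c j * ((?d m j u - step1 m u) * (?d m j u + step1 m u)))
      - z\<^sup>2 * ((?e m j u - sd_slope j * step1 m u) * (?e m j u + sd_slope j * step1 m u))
      - (deviation m j u - deviation1 m j u) * (deviation m j u + deviation1 m j u))
      + R z (deviation m j u + z * ?e m j u) - R (- z) (deviation m j u + - z * ?e m j u)"
      unfolding R_def e1 p coverage_def coverage_approx_def by algebra
  qed
qed

text \<open>
  Off the good set \<open>W\<close> exceeds a multiple of \<open>sqrt m\<close>, so there a factor \<open>sqrt m\<close> may be replaced by \<open>W\<close>.
\<close>

lemma bdd_bad:
  assumes "bdd Q f a b c" "\<And>m u. Q m u \<Longrightarrow> \<not> good m u"
  shows "bdd Q f (a + k) (b - int k) c"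
proof -
  obtain C where C: "0 \<le> C" "\<And>m j u. m\<^sub>1 \<le> m \<Longrightarrow> j < m \<Longrightarrow> Q m u \<Longrightarrow>
    \<bar>f m j u\<bar> \<le> C * (W m u ^ a * sqrt (real m) powi b * (1 + \<bar>u j\<bar>) ^ c)"
    by (rule bddE[OF assms(1)]) (rule that, assumption+)
  show ?thesis
  proof (rule bddI[where C = "C * (1 / \<eta>) ^ k"])
    fix m j u assume *: "m\<^sub>1 \<le> m" "j < m" "Q m u"
    have W: "1 \<le> W m u" by (rule envelope_ge_1)
    have s: "1 \<le> sqrt (real m)" using m_pos(1)[OF *(1)] by simp
    have "\<eta> * sqrt (real m) < W m u" using assms(2)[OF *(3)] by (simp add: good_def)
    then have Ws: "sqrt (real m) \<le> W m u * (1 / \<eta>)" using eta by (simp add: field_simps)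
    have "sqrt (real m) powi b = sqrt (real m) ^ k * sqrt (real m) powi (b - int k)"
    proof -
      have "sqrt (real m) \<noteq> 0" using s by linarith
      then show ?thesis by (simp add: power_int_diff power_int_of_nat)
    qed
    then have "W m u ^ a * sqrt (real m) powi b * (1 + \<bar>u j\<bar>) ^ c
        = W m u ^ a * (sqrt (real m) ^ k * sqrt (real m) powi (b - int k)) * (1 + \<bar>u j\<bar>) ^ c" by simp
    also have "\<dots> \<le> W m u ^ a * ((W m u * (1 / \<eta>)) ^ k * sqrt (real m) powi (b - int k)) * (1 + \<bar>u j\<bar>) ^ c"
      using W s Ws by (intro mult_mono mult_left_mono mult_right_mono power_mono) auto
    also have "\<dots> = (1 / \<eta>) ^ k * (W m u ^ (a + k) * sqrt (real m) powi (b - int k) * (1 + \<bar>u j\<bar>) ^ c)"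
      by (simp only: power_mult_distrib power_add mult_ac)
    finally have "C * (W m u ^ a * sqrt (real m) powi b * (1 + \<bar>u j\<bar>) ^ c)
        \<le> C * ((1 / \<eta>) ^ k * (W m u ^ (a + k) * sqrt (real m) powi (b - int k) * (1 + \<bar>u j\<bar>) ^ c))"
      by (rule mult_left_mono) (rule C)
    with C(2)[OF *] show "\<bar>f m j u\<bar> \<le> C * (1 / \<eta>) ^ k * (W m u ^ (a + k) * sqrt (real m) powi (b - int k) * (1 + \<bar>u j\<bar>) ^ c)"
      by (simp only: mult.assoc)
  qed
qed

lemma bdd_coverage_approx_bad: "bdd (\<lambda>m u. \<not> good m u) (coverage_approx z) 3 (- 3) 3"
proof -
  let ?Q = "\<lambda>m u. \<not> good m u"
  have up: "bdd ?Q f (a + k) (b - int k) c \<Longrightarrow> a + k = 3 \<Longrightarrow> b - int k = - 3 \<Longrightarrow> c \<le> 3 \<Longrightarrow> bdd ?Q f 3 (- 3) 3" for f a b c k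
    by (auto intro: bdd_weaken[of ?Q f 3 "- 3" c])
  have c: "bdd ?Q (\<lambda>m j u. Phi z - Phi (- z)) 3 (- 3) 3"
    by (rule up[OF bdd_bad[OF bdd_const, where k = 3]]) auto
  have s1: "bdd ?Q (\<lambda>m j u. step1 m u) 3 (- 3) 3"
    by (rule up[OF bdd_bad[OF bdd_step1, where k = 2]]) auto
  have s21: "bdd ?Q (\<lambda>m j u. step2 m j u - step1 m u) 3 (- 3) 3"
    by (rule up[OF bdd_bad[OF bdd_step2_step1, where k = 1]]) auto
  have s2: "bdd ?Q (\<lambda>m j u. step2 m j u) 3 (- 3) 3"
    using bdd_add[OF s21 s1] by simp
  have sq: "bdd ?Q (\<lambda>m j u. (step1 m u)\<^sup>2) 3 (- 3) 3"
    by (rule up[OF bdd_bad[OF bdd_power[OF bdd_step1], where k = 1]]) auto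
  have dv: "bdd ?Q (\<lambda>m j u. (deviation1 m j u)\<^sup>2) 3 (- 3) 3"
    by (rule up[OF bdd_bad[OF bdd_power[OF bdd_deviation1], where k = 1]]) auto
  have m: "bdd ?Q g 0 0 0 \<Longrightarrow> bdd ?Q f 3 (- 3) 3 \<Longrightarrow> bdd ?Q (\<lambda>m j u. g m j u * f m j u) 3 (- 3) 3" for g f
    by (drule (1) bdd_mult) simp
  have cb: "bdd ?Q (\<lambda>m j u. sd_slope j * wt D A j + (sd_slope j)\<^sup>2 * (1 / 2)) 0 0 0"
    by (intro bdd_add bdd_weaken[OF bdd_mult[OF bdd_sd_slope bdd_wt]]
        bdd_weaken[OF bdd_mult[OF bdd_power[OF bdd_sd_slope] bdd_const]]) auto
  have ss: "bdd ?Q (\<lambda>m j u. (sd_slope j)\<^sup>2 * (step1 m u)\<^sup>2) 3 (- 3) 3"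
    by (intro m sq) (use bdd_power[OF bdd_sd_slope[of ?Q], of 2] in simp)
  have ss': "bdd ?Q (\<lambda>m j u. (sd_slope j * step1 m u)\<^sup>2) 3 (- 3) 3"
    using ss by (simp add: power_mult_distrib)
  show ?thesis unfolding coverage_approx_def[abs_def]
    by (intro bdd_add c m bdd_const bdd_diff bdd_sd_slope s2 cb sq ss' dv)
qed

lemma coverage_approx_error:
  obtains C where "0 \<le> C" "\<And>m j u. m\<^sub>1 \<le> m \<Longrightarrow> j < m \<Longrightarrow>
    \<bar>(if good m u then coverage z m j u else 0) - coverage_approx z m j u\<bar>
      \<le> C * (W m u ^ 3 * (1 + \<bar>u j\<bar>) ^ 3) * real m powr (- 3 / 2)"
proof -
  obtain C where C: "0 \<le> C" "\<And>m j u. m\<^sub>1 \<le> m \<Longrightarrow> j < m \<Longrightarrow> good m u \<Longrightarrow>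
    \<bar>coverage z m j u - coverage_approx z m j u\<bar> \<le> C * (W m u ^ 3 * sqrt (real m) powi (- 3) * (1 + \<bar>u j\<bar>) ^ 3)"
    by (rule bddE[OF bdd_coverage]) (rule that, assumption+)
  obtain C' where C': "0 \<le> C'" "\<And>m j u. m\<^sub>1 \<le> m \<Longrightarrow> j < m \<Longrightarrow> \<not> good m u \<Longrightarrow>
    \<bar>coverage_approx z m j u\<bar> \<le> C' * (W m u ^ 3 * sqrt (real m) powi (- 3) * (1 + \<bar>u j\<bar>) ^ 3)"
    by (rule bddE[OF bdd_coverage_approx_bad]) (rule that, assumption+)
  show ?thesis
  proof (rule that[of "max C C'"])
    fix m j u assume *: "m\<^sub>1 \<le> m" "j < m"
    have W: "1 \<le> W m u" by (rule envelope_ge_1)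
    have p: "sqrt (real m) powi (- 3) = real m powr (- 3 / 2)"
    proof -
      have mp: "0 < real m" using m_pos(1)[OF *(1)] by simp
      have "sqrt (real m) powi (- 3) = (real m powr (1 / 2)) powr (- 3)"
        using mp by (simp add: powr_half_sqrt powr_minus power_int_def powr_numeral inverse_eq_divide power_divide)
      then show ?thesis using mp by (simp add: powr_powr)
    qed
    have nn: "0 \<le> W m u ^ 3 * sqrt (real m) powi (- 3) * (1 + \<bar>u j\<bar>) ^ 3"
      using W by (intro mult_nonneg_nonneg zero_le_power zero_le_power_int) auto
    have "\<bar>(if good m u then coverage z m j u else 0) - coverage_approx z m j u\<bar>
        \<le> max C C' * (W m u ^ 3 * sqrt (real m) powi (- 3) * (1 + \<bar>u j\<bar>) ^ 3)"
    proof (cases "good m u")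
      case True
      then show ?thesis using order.trans[OF C(2)[OF * True] mult_right_mono[OF max.cobounded1 nn, of C C']] by simp
    next
      case False
      then show ?thesis using order.trans[OF C'(2)[OF * False] mult_right_mono[OF max.cobounded2 nn, of C' C]] by simp
    qed
    then show "\<bar>(if good m u then coverage z m j u else 0) - coverage_approx z m j u\<bar>
      \<le> max C C' * (W m u ^ 3 * (1 + \<bar>u j\<bar>) ^ 3) * real m powr (- 3 / 2)"
      unfolding p by (simp only: mult_ac)
  qed (use C(1) in auto)
qed

end

section \<open>Moments and independence\<close>

section \<open>Independent normal variables\<close>

context prob_space
begin

lemma integrable_powers_le_4:
  fixes X :: "'a \<Rightarrow> real"
  assumes [measurable]: "X \<in> borel_measurable M" and 4: "integrable M (\<lambda>\<omega>. X \<omega> ^ 4)" and k: "k \<le> 4"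
  shows "integrable M (\<lambda>\<omega>. X \<omega> ^ k)"
proof (rule Bochner_Integration.integrable_bound)
  show "integrable M (\<lambda>\<omega>. 1 + X \<omega> ^ 4)" using 4 by simp
  have "\<bar>t ^ k\<bar> \<le> 1 + t ^ 4" for t :: real
  proof (cases "\<bar>t\<bar> \<le> 1")
    case True
    then have "\<bar>t\<bar> ^ k \<le> 1" by (simp add: power_le_one)
    moreover have "0 \<le> t ^ 4" by simp
    ultimately show ?thesis unfolding power_abs by linarith
  next
    case False
    then have "\<bar>t\<bar> ^ k \<le> \<bar>t\<bar> ^ 4" using k by (intro power_increasing) auto
    moreover have "\<bar>t\<bar> ^ 4 = t ^ 4" by (simp add: power_even_abs)
    ultimately show ?thesis by (simp add: power_abs)
  qed
  then show "AE \<omega> in M. norm (X \<omega> ^ k) \<le> norm (1 + X \<omega> ^ 4)"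
    by (intro AE_I2) (auto intro: order.trans[OF _ abs_ge_self])
qed simp

lemma expectation_square_le:
  fixes X :: "'a \<Rightarrow> real"
  assumes X: "X \<in> borel_measurable M" and 4: "integrable M (\<lambda>\<omega>. X \<omega> ^ 4)"
    and le: "expectation (\<lambda>\<omega>. X \<omega> ^ 4) \<le> K\<^sup>2" and K: "0 < K"
  shows "expectation (\<lambda>\<omega>. (X \<omega>)\<^sup>2) \<le> K"
proof -
  have 2: "integrable M (\<lambda>\<omega>. (X \<omega>)\<^sup>2)" by (rule integrable_powers_le_4[OF X 4]) simp
  have "expectation (\<lambda>\<omega>. 2 * K * (X \<omega>)\<^sup>2) \<le> expectation (\<lambda>\<omega>. X \<omega> ^ 4 + K\<^sup>2)"
  proof (rule integral_mono)
    fix \<omega>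
    have "0 \<le> ((X \<omega>)\<^sup>2 - K)\<^sup>2" by simp
    also have "\<dots> = X \<omega> ^ 4 + K\<^sup>2 - 2 * K * (X \<omega>)\<^sup>2" by algebra
    finally show "2 * K * (X \<omega>)\<^sup>2 \<le> X \<omega> ^ 4 + K\<^sup>2" by simp
  qed (use 2 4 in auto)
  then have "2 * K * expectation (\<lambda>\<omega>. (X \<omega>)\<^sup>2) \<le> 2 * K * K"
    using le 2 4 by (simp add: power2_eq_square prob_space)
  then show ?thesis using K by simp
qed

text \<open>
  In the expansion of \<open>(S + X) ^ 4\<close> for a partial sum \<open>S\<close> and the next summand \<open>X\<close>, the terms that are linear in \<open>S\<close> or
  in \<open>X\<close> have mean zero. The mixed term is bounded by the second moment of \<open>S\<close>, which grows linearly, so the fourth moment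
  grows quadratically.
\<close>

lemma fourth_moment_sum_le:
  fixes X :: "nat \<Rightarrow> 'a \<Rightarrow> real"
  assumes indep: "indep_vars (\<lambda>_. borel) X UNIV"
    and 4: "\<And>j. j < n \<Longrightarrow> integrable M (\<lambda>\<omega>. X j \<omega> ^ 4)"
    and mean: "\<And>j. j < n \<Longrightarrow> expectation (X j) = 0"
    and le: "\<And>j. j < n \<Longrightarrow> expectation (\<lambda>\<omega>. X j \<omega> ^ 4) \<le> K\<^sup>2" and K: "0 < K"
  shows "integrable M (\<lambda>\<omega>. (\<Sum>j<n. X j \<omega>) ^ 4) \<and>
    expectation (\<lambda>\<omega>. (\<Sum>j<n. X j \<omega>) ^ 4) \<le> 3 * (real n)\<^sup>2 * K\<^sup>2"
proof -
  have X[measurable]: "X j \<in> borel_measurable M" for j using indep by (auto simp: indep_vars_def)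
  have "k \<le> n \<Longrightarrow> integrable M (\<lambda>\<omega>. (\<Sum>j<k. X j \<omega>) ^ 4) \<and> expectation (\<lambda>\<omega>. \<Sum>j<k. X j \<omega>) = 0 \<and>
      expectation (\<lambda>\<omega>. (\<Sum>j<k. X j \<omega>)\<^sup>2) \<le> real k * K \<and>
      expectation (\<lambda>\<omega>. (\<Sum>j<k. X j \<omega>) ^ 4) \<le> 3 * (real k)\<^sup>2 * K\<^sup>2" for k
  proof (induction k)
    case (Suc k)
    define S where "S \<omega> = (\<Sum>j<k. X j \<omega>)" for \<omega>
    define Y where "Y = X k"
    have k: "k < n" using Suc.prems by simp
    have [measurable]: "S \<in> borel_measurable M" "Y \<in> borel_measurable M" by (simp_all add: S_def[abs_def] Y_def)
    have S4: "integrable M (\<lambda>\<omega>. S \<omega> ^ 4)" and S1: "expectation S = 0"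
      and S2: "expectation (\<lambda>\<omega>. (S \<omega>)\<^sup>2) \<le> real k * K" and S4le: "expectation (\<lambda>\<omega>. S \<omega> ^ 4) \<le> 3 * (real k)\<^sup>2 * K\<^sup>2"
      using Suc by (simp_all add: S_def[abs_def])
    have Y4: "integrable M (\<lambda>\<omega>. Y \<omega> ^ 4)" and Y1: "expectation Y = 0" and Y4le: "expectation (\<lambda>\<omega>. Y \<omega> ^ 4) \<le> K\<^sup>2"
      using 4[OF k] mean[OF k] le[OF k] by (simp_all add: Y_def)
    have Y2: "expectation (\<lambda>\<omega>. (Y \<omega>)\<^sup>2) \<le> K" by (rule expectation_square_le[OF _ Y4 Y4le K]) simp
    have Sp: "integrable M (\<lambda>\<omega>. S \<omega> ^ i)" if "i \<le> 4" for i by (rule integrable_powers_le_4[OF _ S4 that]) simp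
    have Yp: "integrable M (\<lambda>\<omega>. Y \<omega> ^ i)" if "i \<le> 4" for i by (rule integrable_powers_le_4[OF _ Y4 that]) simp
    have ind: "indep_var borel Y borel S"
      unfolding Y_def S_def by (rule indep_vars_sum) (auto intro: indep_vars_subset[OF indep])
    have prod: "integrable M (\<lambda>\<omega>. Y \<omega> ^ i * S \<omega> ^ l)"
      "expectation (\<lambda>\<omega>. Y \<omega> ^ i * S \<omega> ^ l) = expectation (\<lambda>\<omega>. Y \<omega> ^ i) * expectation (\<lambda>\<omega>. S \<omega> ^ l)"
      if "i \<le> 4" "l \<le> 4" for i l
    proof -
      have "indep_var borel ((\<lambda>t. t ^ i) \<circ> Y) borel ((\<lambda>t. t ^ l) \<circ> S)" by (rule indep_var_compose[OF ind]) auto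
      then have *: "indep_var borel (\<lambda>\<omega>. Y \<omega> ^ i) borel (\<lambda>\<omega>. S \<omega> ^ l)" by (simp add: comp_def)
      show "integrable M (\<lambda>\<omega>. Y \<omega> ^ i * S \<omega> ^ l)"
        by (rule indep_var_integrable[OF * Yp[OF that(1)] Sp[OF that(2)]])
      show "expectation (\<lambda>\<omega>. Y \<omega> ^ i * S \<omega> ^ l) = expectation (\<lambda>\<omega>. Y \<omega> ^ i) * expectation (\<lambda>\<omega>. S \<omega> ^ l)"
        by (rule indep_var_lebesgue_integral[OF * Yp[OF that(1)] Sp[OF that(2)]])
    qed
    have e4: "(\<Sum>j<Suc k. X j \<omega>) ^ 4 = S \<omega> ^ 4 + 4 * (Y \<omega> ^ 1 * S \<omega> ^ 3) + 6 * (Y \<omega> ^ 2 * S \<omega> ^ 2)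
        + 4 * (Y \<omega> ^ 3 * S \<omega> ^ 1) + Y \<omega> ^ 4" for \<omega>
      unfolding sum.lessThan_Suc S_def[symmetric] Y_def[symmetric] power_one_right by algebra
    have e2: "(\<Sum>j<Suc k. X j \<omega>)\<^sup>2 = S \<omega> ^ 2 + 2 * (Y \<omega> ^ 1 * S \<omega> ^ 1) + Y \<omega> ^ 2" for \<omega>
      unfolding sum.lessThan_Suc S_def[symmetric] Y_def[symmetric] power_one_right by algebra
    have i1: "integrable M S" "integrable M Y" using Sp[of 1] Yp[of 1] by simp_all
    have int4: "integrable M (\<lambda>\<omega>. (\<Sum>j<Suc k. X j \<omega>) ^ 4)"
      unfolding e4 by (intro Bochner_Integration.integrable_add integrable_mult_right prod Sp Yp) auto
    have "expectation (\<lambda>\<omega>. \<Sum>j<Suc k. X j \<omega>) = expectation (\<lambda>\<omega>. S \<omega> + Y \<omega>)"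
      by (simp add: S_def Y_def)
    also have "\<dots> = 0" using i1 S1 Y1 by simp
    finally have m1: "expectation (\<lambda>\<omega>. \<Sum>j<Suc k. X j \<omega>) = 0" .
    have "expectation (\<lambda>\<omega>. (\<Sum>j<Suc k. X j \<omega>)\<^sup>2) = expectation (\<lambda>\<omega>. S \<omega> ^ 2) + 2 * expectation (\<lambda>\<omega>. Y \<omega> ^ 1 * S \<omega> ^ 1)
        + expectation (\<lambda>\<omega>. Y \<omega> ^ 2)"
      unfolding e2
      by (subst Bochner_Integration.integral_add Bochner_Integration.integral_mult_right,
          (intro Bochner_Integration.integrable_add integrable_mult_right prod Sp Yp; simp)+)+ simp
    also have "expectation (\<lambda>\<omega>. Y \<omega> ^ 1 * S \<omega> ^ 1) = 0" using prod(2)[of 1 1] Y1 by simp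
    finally have m2: "expectation (\<lambda>\<omega>. (\<Sum>j<Suc k. X j \<omega>)\<^sup>2) \<le> real (Suc k) * K"
      using S2 Y2 by (simp add: distrib_right)
    have "expectation (\<lambda>\<omega>. (\<Sum>j<Suc k. X j \<omega>) ^ 4) = expectation (\<lambda>\<omega>. S \<omega> ^ 4) + 4 * expectation (\<lambda>\<omega>. Y \<omega> ^ 1 * S \<omega> ^ 3)
        + 6 * expectation (\<lambda>\<omega>. Y \<omega> ^ 2 * S \<omega> ^ 2) + 4 * expectation (\<lambda>\<omega>. Y \<omega> ^ 3 * S \<omega> ^ 1) + expectation (\<lambda>\<omega>. Y \<omega> ^ 4)"
    proof -
      have ints: "integrable M (\<lambda>\<omega>. S \<omega> ^ 4)" "integrable M (\<lambda>\<omega>. 4 * (Y \<omega> ^ 1 * S \<omega> ^ 3))"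
        "integrable M (\<lambda>\<omega>. 6 * (Y \<omega> ^ 2 * S \<omega> ^ 2))" "integrable M (\<lambda>\<omega>. 4 * (Y \<omega> ^ 3 * S \<omega> ^ 1))" "integrable M (\<lambda>\<omega>. Y \<omega> ^ 4)"
        by (intro integrable_mult_right prod Sp Yp; simp)+
      show ?thesis unfolding e4
        using ints by (simp only: Bochner_Integration.integral_add Bochner_Integration.integrable_add
            Bochner_Integration.integral_mult_right_zero)
    qed
    also have "expectation (\<lambda>\<omega>. Y \<omega> ^ 1 * S \<omega> ^ 3) = 0" using prod(2)[of 1 3] Y1 by simp
    also have "expectation (\<lambda>\<omega>. Y \<omega> ^ 3 * S \<omega> ^ 1) = 0" using prod(2)[of 3 1] S1 by simp
    also have "expectation (\<lambda>\<omega>. Y \<omega> ^ 2 * S \<omega> ^ 2) = expectation (\<lambda>\<omega>. Y \<omega> ^ 2) * expectation (\<lambda>\<omega>. S \<omega> ^ 2)"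
      by (rule prod(2)) auto
    finally have "expectation (\<lambda>\<omega>. (\<Sum>j<Suc k. X j \<omega>) ^ 4) \<le> 3 * (real k)\<^sup>2 * K\<^sup>2 + 6 * (K * (real k * K)) + K\<^sup>2"
      using S4le Y4le mult_mono[OF Y2 S2] K by simp
    also have "\<dots> \<le> 3 * (real (Suc k))\<^sup>2 * K\<^sup>2" by (simp add: power2_eq_square algebra_simps)
    finally show ?case using int4 m1 m2 by simp
  qed simp
  from this[of n] show ?thesis by simp
qed

text \<open>
  The predicate \<open>indep_var\<close> relates variables with values in one type; this is the same notion for two types.
\<close>

definition indep_pair :: "'b measure \<Rightarrow> ('a \<Rightarrow> 'b) \<Rightarrow> 'c measure \<Rightarrow> ('a \<Rightarrow> 'c) \<Rightarrow> bool"
  where "indep_pair S X T Y \<longleftrightarrow> X \<in> measurable M S \<and> Y \<in> measurable M T \<and>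
    distr M S X \<Otimes>\<^sub>M distr M T Y = distr M (S \<Otimes>\<^sub>M T) (\<lambda>\<omega>. (X \<omega>, Y \<omega>))"

lemma indep_pair_compose:
  assumes XY: "indep_pair S X T Y" and [measurable]: "f \<in> measurable S S'" "g \<in> measurable T T'"
  shows "indep_pair S' (\<lambda>\<omega>. f (X \<omega>)) T' (\<lambda>\<omega>. g (Y \<omega>))"
proof -
  have [measurable]: "X \<in> measurable M S" "Y \<in> measurable M T" using XY by (auto simp: indep_pair_def)
  have d: "distr M S' (\<lambda>\<omega>. f (X \<omega>)) = distr (distr M S X) S' f" "distr M T' (\<lambda>\<omega>. g (Y \<omega>)) = distr (distr M T Y) T' g"
    by (simp_all add: distr_distr comp_def)
  interpret G: prob_space "distr (distr M T Y) T' g" unfolding d[symmetric] by (rule prob_space_distr) simp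
  have "distr (distr M S X) S' f \<Otimes>\<^sub>M distr (distr M T Y) T' g
      = distr (distr M S X \<Otimes>\<^sub>M distr M T Y) (S' \<Otimes>\<^sub>M T') (\<lambda>(a, b). (f a, g b))"
    by (rule pair_measure_distr) (auto intro: G.sigma_finite_measure_axioms)
  also have "\<dots> = distr M (S' \<Otimes>\<^sub>M T') (\<lambda>\<omega>. (f (X \<omega>), g (Y \<omega>)))"
    using XY by (simp add: indep_pair_def distr_distr comp_def)
  finally show ?thesis unfolding indep_pair_def d by simp
qed

text \<open>
  The joint law of \<open>((X, Y), Z)\<close> is a threefold product, and may be bracketed the other way.
\<close>

lemma indep_pair_assoc:
  assumes XY: "indep_pair S X T Y" and XYZ: "indep_pair (S \<Otimes>\<^sub>M T) (\<lambda>\<omega>. (X \<omega>, Y \<omega>)) R Z"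
  shows "indep_pair S X (T \<Otimes>\<^sub>M R) (\<lambda>\<omega>. (Y \<omega>, Z \<omega>))"
proof -
  have X[measurable]: "X \<in> measurable M S" and Y[measurable]: "Y \<in> measurable M T"
    using XY by (auto simp: indep_pair_def)
  have Z[measurable]: "Z \<in> measurable M R" using XYZ by (auto simp: indep_pair_def)
  have YZ: "indep_pair T Y R Z"
    using indep_pair_compose[OF XYZ, of snd T "\<lambda>z. z" R] by simp
  interpret DX: prob_space "distr M S X" by (rule prob_space_distr) simp
  interpret DY: prob_space "distr M T Y" by (rule prob_space_distr) simp
  interpret DZ: prob_space "distr M R Z" by (rule prob_space_distr) simp
  interpret DYZ: prob_space "distr M (T \<Otimes>\<^sub>M R) (\<lambda>\<omega>. (Y \<omega>, Z \<omega>))" by (rule prob_space_distr) simp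
  have e1: "distr M (S \<Otimes>\<^sub>M T) (\<lambda>\<omega>. (X \<omega>, Y \<omega>)) = distr M S X \<Otimes>\<^sub>M distr M T Y"
    using XY by (simp add: indep_pair_def)
  have e2: "distr M (T \<Otimes>\<^sub>M R) (\<lambda>\<omega>. (Y \<omega>, Z \<omega>)) = distr M T Y \<Otimes>\<^sub>M distr M R Z"
    using YZ by (simp add: indep_pair_def)
  have e3: "distr M ((S \<Otimes>\<^sub>M T) \<Otimes>\<^sub>M R) (\<lambda>\<omega>. ((X \<omega>, Y \<omega>), Z \<omega>)) = (distr M S X \<Otimes>\<^sub>M distr M T Y) \<Otimes>\<^sub>M distr M R Z"
    using XYZ e1 by (simp add: indep_pair_def)
  interpret DXY: prob_space "distr M S X \<Otimes>\<^sub>M distr M T Y" unfolding e1[symmetric] by (rule prob_space_distr) simp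
  interpret P1: pair_sigma_finite "distr M S X \<Otimes>\<^sub>M distr M T Y" "distr M R Z" ..
  interpret P2: pair_sigma_finite "distr M T Y" "distr M R Z" ..
  have "distr M S X \<Otimes>\<^sub>M distr M (T \<Otimes>\<^sub>M R) (\<lambda>\<omega>. (Y \<omega>, Z \<omega>)) = distr M (S \<Otimes>\<^sub>M (T \<Otimes>\<^sub>M R)) (\<lambda>\<omega>. (X \<omega>, (Y \<omega>, Z \<omega>)))"
  proof (rule pair_measure_eqI)
    fix B E assume "B \<in> sets (distr M S X)" "E \<in> sets (distr M (T \<Otimes>\<^sub>M R) (\<lambda>\<omega>. (Y \<omega>, Z \<omega>)))"
    then have B[measurable]: "B \<in> sets S" and E[measurable]: "E \<in> sets (T \<Otimes>\<^sub>M R)" by simp_all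
    let ?F = "{p \<in> space ((S \<Otimes>\<^sub>M T) \<Otimes>\<^sub>M R). fst (fst p) \<in> B \<and> (snd (fst p), snd p) \<in> E}"
    have F: "?F \<in> sets ((S \<Otimes>\<^sub>M T) \<Otimes>\<^sub>M R)" by measurable
    have "emeasure (distr M (S \<Otimes>\<^sub>M (T \<Otimes>\<^sub>M R)) (\<lambda>\<omega>. (X \<omega>, (Y \<omega>, Z \<omega>)))) (B \<times> E)
        = emeasure (distr M ((S \<Otimes>\<^sub>M T) \<Otimes>\<^sub>M R) (\<lambda>\<omega>. ((X \<omega>, Y \<omega>), Z \<omega>))) ?F"
      using F measurable_space[OF X] measurable_space[OF Y] measurable_space[OF Z]
      by (subst (1 2) emeasure_distr) (auto intro!: arg_cong[where f = "emeasure M"] simp: space_pair_measure)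
    also have "\<dots> = (\<integral>\<^sup>+ z. emeasure (distr M S X \<Otimes>\<^sub>M distr M T Y) ((\<lambda>p. (p, z)) -` ?F) \<partial>distr M R Z)"
      unfolding e3 using F by (intro P1.emeasure_pair_measure_alt2) simp
    also have "\<dots> = (\<integral>\<^sup>+ z. emeasure (distr M S X) B * emeasure (distr M T Y) ((\<lambda>y. (y, z)) -` E) \<partial>distr M R Z)"
    proof (rule nn_integral_cong)
      fix z assume z: "z \<in> space (distr M R Z)"
      have "(\<lambda>p. (p, z)) -` ?F = B \<times> ((\<lambda>y. (y, z)) -` E)"
        using z sets.sets_into_space[OF B] sets.sets_into_space[OF E] by (auto simp: space_pair_measure)
      moreover have "(\<lambda>y. (y, z)) -` E \<in> sets (distr M T Y)" using sets_Pair2[OF E, of z] by simp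
      ultimately show "emeasure (distr M S X \<Otimes>\<^sub>M distr M T Y) ((\<lambda>p. (p, z)) -` ?F)
          = emeasure (distr M S X) B * emeasure (distr M T Y) ((\<lambda>y. (y, z)) -` E)"
        by (simp add: DY.emeasure_pair_measure_Times)
    qed
    also have "\<dots> = emeasure (distr M S X) B * (\<integral>\<^sup>+ z. emeasure (distr M T Y) ((\<lambda>y. (y, z)) -` E) \<partial>distr M R Z)"
      by (intro nn_integral_cmult P2.measurable_emeasure_Pair2) simp
    also have "(\<integral>\<^sup>+ z. emeasure (distr M T Y) ((\<lambda>y. (y, z)) -` E) \<partial>distr M R Z)
        = emeasure (distr M (T \<Otimes>\<^sub>M R) (\<lambda>\<omega>. (Y \<omega>, Z \<omega>))) E"
      unfolding e2 by (intro P2.emeasure_pair_measure_alt2[symmetric]) simp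
    finally show "emeasure (distr M S X) B * emeasure (distr M (T \<Otimes>\<^sub>M R) (\<lambda>\<omega>. (Y \<omega>, Z \<omega>))) E
        = emeasure (distr M (S \<Otimes>\<^sub>M (T \<Otimes>\<^sub>M R)) (\<lambda>\<omega>. (X \<omega>, (Y \<omega>, Z \<omega>)))) (B \<times> E)" ..
  qed (auto intro: DX.sigma_finite_measure_axioms DYZ.sigma_finite_measure_axioms)
  then show ?thesis by (simp add: indep_pair_def)
qed

lemma normal_density_rotation:
  assumes s: "0 < s" and t: "0 < t"
  defines "\<rho> \<equiv> s\<^sup>2 / (s\<^sup>2 + t\<^sup>2)" and "\<tau> \<equiv> s * t / sqrt (s\<^sup>2 + t\<^sup>2)"
  shows "normal_density 0 s (r + \<rho> * w) * normal_density 0 t (w - (r + \<rho> * w))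
    = normal_density 0 \<tau> r * normal_density 0 (sqrt (s\<^sup>2 + t\<^sup>2)) w"
proof -
  define n where "n = s\<^sup>2 + t\<^sup>2"
  have n: "0 < n" using s t by (simp add: n_def add_pos_pos)
  have \<tau>2: "\<tau>\<^sup>2 = s\<^sup>2 * t\<^sup>2 / n" using n by (simp add: \<tau>_def n_def[symmetric] power_divide power_mult_distrib)
  have ex: "- (r + \<rho> * w)\<^sup>2 / (2 * s\<^sup>2) + - (w - (r + \<rho> * w))\<^sup>2 / (2 * t\<^sup>2) = - r\<^sup>2 / (2 * \<tau>\<^sup>2) + - w\<^sup>2 / (2 * n)"
  proof -
    have \<rho>: "\<rho> * n = s\<^sup>2" using n by (simp add: \<rho>_def n_def[symmetric])
    have "(t\<^sup>2 * (r + \<rho> * w)\<^sup>2 + s\<^sup>2 * (w - (r + \<rho> * w))\<^sup>2) * n = (r\<^sup>2 * n) * n + s\<^sup>2 * t\<^sup>2 * w\<^sup>2"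
      using \<rho> n_def by algebra
    then have "(t\<^sup>2 * (r + \<rho> * w)\<^sup>2 + s\<^sup>2 * (w - (r + \<rho> * w))\<^sup>2) = r\<^sup>2 * n + s\<^sup>2 * t\<^sup>2 * w\<^sup>2 / n"
      using n by (simp add: field_simps)
    then have "(t\<^sup>2 * (r + \<rho> * w)\<^sup>2 + s\<^sup>2 * (w - (r + \<rho> * w))\<^sup>2) / (s\<^sup>2 * t\<^sup>2) = (r\<^sup>2 * n + s\<^sup>2 * t\<^sup>2 * w\<^sup>2 / n) / (s\<^sup>2 * t\<^sup>2)"
      by simp
    then have "(r + \<rho> * w)\<^sup>2 / s\<^sup>2 + (w - (r + \<rho> * w))\<^sup>2 / t\<^sup>2 = r\<^sup>2 * n / (s\<^sup>2 * t\<^sup>2) + w\<^sup>2 / n"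
      using s t by (simp add: add_divide_distrib)
    moreover have "r\<^sup>2 * n / (s\<^sup>2 * t\<^sup>2) = r\<^sup>2 / \<tau>\<^sup>2" unfolding \<tau>2 by simp
    ultimately show ?thesis by (simp add: minus_divide_left[symmetric] field_simps)
  qed
  have c: "1 / sqrt (2 * pi * s\<^sup>2) * (1 / sqrt (2 * pi * t\<^sup>2)) = 1 / sqrt (2 * pi * \<tau>\<^sup>2) * (1 / sqrt (2 * pi * n))"
  proof -
    have "2 * pi * s\<^sup>2 * (2 * pi * t\<^sup>2) = 2 * pi * \<tau>\<^sup>2 * (2 * pi * n)" using n by (simp add: \<tau>2)
    then have "sqrt (2 * pi * s\<^sup>2) * sqrt (2 * pi * t\<^sup>2) = sqrt (2 * pi * \<tau>\<^sup>2) * sqrt (2 * pi * n)"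
      unfolding real_sqrt_mult[symmetric] by simp
    then show ?thesis by (simp only: times_divide_times_eq mult_1_left)
  qed
  have sn: "(sqrt (s\<^sup>2 + t\<^sup>2))\<^sup>2 = n" using n by (simp add: n_def)
  have "normal_density 0 s (r + \<rho> * w) * normal_density 0 t (w - (r + \<rho> * w))
      = (1 / sqrt (2 * pi * s\<^sup>2) * (1 / sqrt (2 * pi * t\<^sup>2)))
        * exp (- (r + \<rho> * w)\<^sup>2 / (2 * s\<^sup>2) + - (w - (r + \<rho> * w))\<^sup>2 / (2 * t\<^sup>2))"
    unfolding normal_density_def exp_add by simp
  also have "\<dots> = normal_density 0 \<tau> r * normal_density 0 (sqrt (s\<^sup>2 + t\<^sup>2)) w"
    unfolding c ex unfolding normal_density_def exp_add sn by simp
  finally show ?thesis .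
qed

text \<open>
  The posterior residual of a normal mean is normal and independent of the observation. The change of variables
  \<open>w = a + b\<close>, \<open>r = a - \<rho> * w\<close> turns the joint density into a product.
\<close>

lemma posterior_residual:
  assumes X: "distributed M lborel X (normal_density 0 s)" and Y: "distributed M lborel Y (normal_density 0 t)"
    and s: "0 < s" and t: "0 < t" and XY: "indep_var borel X borel Y"
  defines "\<rho> \<equiv> s\<^sup>2 / (s\<^sup>2 + t\<^sup>2)" and "\<tau> \<equiv> s * t / sqrt (s\<^sup>2 + t\<^sup>2)"
  shows "indep_var borel (\<lambda>\<omega>. X \<omega> - \<rho> * (X \<omega> + Y \<omega>)) borel (\<lambda>\<omega>. X \<omega> + Y \<omega>)"
    and "distr M borel (\<lambda>\<omega>. X \<omega> - \<rho> * (X \<omega> + Y \<omega>)) = density lborel (normal_density 0 \<tau>)"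
proof -
  have [measurable]: "X \<in> borel_measurable M" "Y \<in> borel_measurable M"
    using X Y by (auto dest: distributed_measurable)
  have n: "0 < s\<^sup>2 + t\<^sup>2" using s t by (simp add: add_pos_pos)
  have \<tau>: "0 < \<tau>" using s t n by (simp add: \<tau>_def)
  let ?N1 = "density lborel (normal_density 0 \<tau>)" and ?N2 = "density lborel (normal_density 0 (sqrt (s\<^sup>2 + t\<^sup>2)))"
  interpret N1: prob_space ?N1 by (rule prob_space_normal_density) (rule \<tau>)
  interpret N2: prob_space ?N2 by (rule prob_space_normal_density) (use n in simp)
  let ?R = "\<lambda>\<omega>. X \<omega> - \<rho> * (X \<omega> + Y \<omega>)" and ?W = "\<lambda>\<omega>. X \<omega> + Y \<omega>"
  have joint: "distributed M (lborel \<Otimes>\<^sub>M lborel) (\<lambda>\<omega>. (X \<omega>, Y \<omega>)) (\<lambda>(a, b). ennreal (normal_density 0 s a) * ennreal (normal_density 0 t b))"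
  proof (rule distributed_joint_indep[OF _ _ X Y])
    show "indep_var lborel X lborel Y"
      using indep_var_compose[OF XY, of "\<lambda>t. t" lborel "\<lambda>t. t" lborel] by (simp add: comp_def)
  qed (auto intro: lborel.sigma_finite_measure_axioms)
  have law: "?N1 \<Otimes>\<^sub>M ?N2 = distr M (borel \<Otimes>\<^sub>M borel) (\<lambda>\<omega>. (?R \<omega>, ?W \<omega>))"
  proof (rule pair_measure_eqI)
    fix B C assume "B \<in> sets ?N1" "C \<in> sets ?N2"
    then have [measurable]: "B \<in> sets borel" "C \<in> sets borel" by simp_all
    have "emeasure (distr M (borel \<Otimes>\<^sub>M borel) (\<lambda>\<omega>. (?R \<omega>, ?W \<omega>))) (B \<times> C)
        = emeasure M {\<omega> \<in> space M. ?R \<omega> \<in> B \<and> ?W \<omega> \<in> C}"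
      by (subst emeasure_distr) (auto intro!: arg_cong[where f = "emeasure M"])
    also have "\<dots> = (\<integral>\<^sup>+\<omega>. indicator {\<omega> \<in> space M. ?R \<omega> \<in> B \<and> ?W \<omega> \<in> C} \<omega> \<partial>M)"
      by (rule nn_integral_indicator[symmetric]) measurable
    also have "\<dots> = (\<integral>\<^sup>+\<omega>. indicator B (?R \<omega>) * indicator C (?W \<omega>) \<partial>M)"
      by (intro nn_integral_cong) (auto split: split_indicator)
    also have "\<dots> = (\<integral>\<^sup>+\<omega>. (\<lambda>(a, b). indicator B (a - \<rho> * (a + b)) * indicator C (a + b)) (X \<omega>, Y \<omega>) \<partial>M)"
      by simp
    also have "\<dots> = (\<integral>\<^sup>+p. (\<lambda>(a, b). ennreal (normal_density 0 s a) * ennreal (normal_density 0 t b)) p *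
        (\<lambda>(a, b). indicator B (a - \<rho> * (a + b)) * indicator C (a + b)) p \<partial>(lborel \<Otimes>\<^sub>M lborel))"
      by (rule distributed_nn_integral[OF joint, symmetric]) (auto simp: split_beta')
    also have "\<dots> = (\<integral>\<^sup>+a. \<integral>\<^sup>+b. ennreal (normal_density 0 s a) * ennreal (normal_density 0 t b) *
        (indicator B (a - \<rho> * (a + b)) * indicator C (a + b)) \<partial>lborel \<partial>lborel)"
      by (subst lborel.nn_integral_fst[symmetric]) (auto simp: split_beta')
    also have "\<dots> = (\<integral>\<^sup>+a. \<integral>\<^sup>+w. ennreal (normal_density 0 s a) * ennreal (normal_density 0 t (w - a)) *
        (indicator B (a - \<rho> * w) * indicator C w) \<partial>lborel \<partial>lborel)"
    proof (rule nn_integral_cong)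
      fix a :: real
      show "(\<integral>\<^sup>+b. ennreal (normal_density 0 s a) * ennreal (normal_density 0 t b) *
        (indicator B (a - \<rho> * (a + b)) * indicator C (a + b)) \<partial>lborel) = (\<integral>\<^sup>+w. ennreal (normal_density 0 s a) * ennreal (normal_density 0 t (w - a)) *
        (indicator B (a - \<rho> * w) * indicator C w) \<partial>lborel)"
        by (subst nn_integral_real_affine[where c = 1 and t = "- a"]) simp_all
    qed
    also have "\<dots> = (\<integral>\<^sup>+w. \<integral>\<^sup>+a. ennreal (normal_density 0 s a) * ennreal (normal_density 0 t (w - a)) *
        (indicator B (a - \<rho> * w) * indicator C w) \<partial>lborel \<partial>lborel)"
      by (rule lborel_pair.Fubini') (simp add: split_beta')
    also have "\<dots> = (\<integral>\<^sup>+w. \<integral>\<^sup>+r. (ennreal (normal_density 0 \<tau> r) * indicator B r) *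
        (ennreal (normal_density 0 (sqrt (s\<^sup>2 + t\<^sup>2)) w) * indicator C w) \<partial>lborel \<partial>lborel)"
    proof (rule nn_integral_cong)
      fix w :: real
      have "(\<integral>\<^sup>+a. ennreal (normal_density 0 s a) * ennreal (normal_density 0 t (w - a)) *
          (indicator B (a - \<rho> * w) * indicator C w) \<partial>lborel)
        = (\<integral>\<^sup>+r. ennreal (normal_density 0 s (r + \<rho> * w)) * ennreal (normal_density 0 t (w - (r + \<rho> * w))) *
          (indicator B r * indicator C w) \<partial>lborel)"
        by (subst nn_integral_real_affine[where c = 1 and t = "\<rho> * w"]) (simp_all add: add.commute)
      also have "\<dots> = (\<integral>\<^sup>+r. (ennreal (normal_density 0 \<tau> r) * indicator B r) *
        (ennreal (normal_density 0 (sqrt (s\<^sup>2 + t\<^sup>2)) w) * indicator C w) \<partial>lborel)"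
      proof (rule nn_integral_cong)
        fix r :: real
        have "ennreal (normal_density 0 s (r + \<rho> * w)) * ennreal (normal_density 0 t (w - (r + \<rho> * w)))
          = ennreal (normal_density 0 \<tau> r) * ennreal (normal_density 0 (sqrt (s\<^sup>2 + t\<^sup>2)) w)"
          unfolding ennreal_mult[OF normal_density_nonneg normal_density_nonneg, symmetric]
            \<rho>_def \<tau>_def normal_density_rotation[OF s t] ..
        then show "ennreal (normal_density 0 s (r + \<rho> * w)) * ennreal (normal_density 0 t (w - (r + \<rho> * w))) *
            (indicator B r * indicator C w)
          = (ennreal (normal_density 0 \<tau> r) * indicator B r) *
            (ennreal (normal_density 0 (sqrt (s\<^sup>2 + t\<^sup>2)) w) * indicator C w)"
          by (simp only: mult_ac)
      qed
      finally show "(\<integral>\<^sup>+a. ennreal (normal_density 0 s a) * ennreal (normal_density 0 t (w - a)) *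
          (indicator B (a - \<rho> * w) * indicator C w) \<partial>lborel) = (\<integral>\<^sup>+r. (ennreal (normal_density 0 \<tau> r) * indicator B r) *
        (ennreal (normal_density 0 (sqrt (s\<^sup>2 + t\<^sup>2)) w) * indicator C w) \<partial>lborel)" .
    qed
    also have "\<dots> = emeasure ?N1 B * emeasure ?N2 C"
      by (simp add: nn_integral_multc nn_integral_cmult emeasure_density)
    finally show "emeasure ?N1 B * emeasure ?N2 C = emeasure (distr M (borel \<Otimes>\<^sub>M borel) (\<lambda>\<omega>. (?R \<omega>, ?W \<omega>))) (B \<times> C)" ..
  qed (auto intro: N1.sigma_finite_measure_axioms N2.sigma_finite_measure_axioms cong: sets_pair_measure_cong)
  have 1: "distr M borel ?R = ?N1"
  proof (rule measure_eqI)
    fix B assume "B \<in> sets (distr M borel ?R)"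
    then have [measurable]: "B \<in> sets borel" by simp
    have "emeasure (distr M borel ?R) B = emeasure (distr M (borel \<Otimes>\<^sub>M borel) (\<lambda>\<omega>. (?R \<omega>, ?W \<omega>))) (B \<times> UNIV)"
      by (subst (1 2) emeasure_distr) (auto intro!: arg_cong[where f = "emeasure M"])
    also have "\<dots> = emeasure ?N1 B * emeasure ?N2 UNIV"
      unfolding law[symmetric] by (rule N2.emeasure_pair_measure_Times) auto
    also have "emeasure ?N2 UNIV = 1" using N2.emeasure_space_1 by simp
    finally show "emeasure (distr M borel ?R) B = emeasure ?N1 B" by simp
  qed simp
  have 2: "distr M borel ?W = ?N2"
  proof (rule measure_eqI)
    fix C assume "C \<in> sets (distr M borel ?W)"
    then have [measurable]: "C \<in> sets borel" by simp
    have "emeasure (distr M borel ?W) C = emeasure (distr M (borel \<Otimes>\<^sub>M borel) (\<lambda>\<omega>. (?R \<omega>, ?W \<omega>))) (UNIV \<times> C)"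
      by (subst (1 2) emeasure_distr) (auto intro!: arg_cong[where f = "emeasure M"])
    also have "\<dots> = emeasure ?N1 UNIV * emeasure ?N2 C"
      unfolding law[symmetric] by (rule N2.emeasure_pair_measure_Times) auto
    also have "emeasure ?N1 UNIV = 1" using N1.emeasure_space_1 by simp
    finally show "emeasure (distr M borel ?W) C = emeasure ?N2 C" by simp
  qed simp
  show "distr M borel ?R = density lborel (normal_density 0 \<tau>)" by (rule 1)
  show "indep_var borel ?R borel ?W"
    unfolding indep_var_distribution_eq 1 2 law by simp
qed

end

section \<open>Moments of normal errors\<close>

lemma power4_add_le: "(a + b) ^ 4 \<le> 8 * (a ^ 4 + b ^ 4 :: real)"
proof -
  have "0 \<le> (a - b)\<^sup>2 * (7 * (a\<^sup>2 + b\<^sup>2) + 10 * (a * b))"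
  proof (rule mult_nonneg_nonneg)
    have "0 \<le> 5 * (a + b)\<^sup>2 + 2 * (a\<^sup>2 + b\<^sup>2)" by simp
    also have "\<dots> = 7 * (a\<^sup>2 + b\<^sup>2) + 10 * (a * b)" by algebra
    finally show "0 \<le> 7 * (a\<^sup>2 + b\<^sup>2) + 10 * (a * b)" .
  qed simp
  also have "\<dots> = 8 * (a ^ 4 + b ^ 4) - (a + b) ^ 4 - (a ^ 2 - b ^ 2) ^ 2 * 0" by algebra
  finally show ?thesis by simp
qed

locale normal_errors = prob_space M for M :: "'a measure" +
  fixes U :: "nat \<Rightarrow> 'a \<Rightarrow> real" and v :: "nat \<Rightarrow> real"
  assumes v_pos: "0 < v j"
    and indep_U: "indep_vars (\<lambda>_. borel) U UNIV"
    and normal_U: "distributed M lborel (U j) (normal_density 0 (sqrt (v j)))"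
begin

lemma U_measurable[measurable]: "U j \<in> borel_measurable M"
  using indep_U by (auto simp: indep_vars_def)

lemma integrable_U_power: "integrable M (\<lambda>\<omega>. U j \<omega> ^ k)"
  using distributed_integrable[OF normal_U, of "\<lambda>t. t ^ k" j] integrable_normal_moment[of "sqrt (v j)" 0 k] v_pos[of j]
  by simp

lemma expectation_U_power:
  "expectation (\<lambda>\<omega>. U j \<omega> ^ (2 * k)) = fact (2 * k) / ((2 / v j) ^ k * fact k)"
  "expectation (\<lambda>\<omega>. U j \<omega> ^ (2 * k + 1)) = 0"
proof -
  have s: "0 < sqrt (v j)" "(sqrt (v j))\<^sup>2 = v j" using v_pos[of j] by auto
  show "expectation (\<lambda>\<omega>. U j \<omega> ^ (2 * k)) = fact (2 * k) / ((2 / v j) ^ k * fact k)"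
    using distributed_integral[OF normal_U, of "\<lambda>t. t ^ (2 * k)" j] integral_normal_moment_even[OF s(1), of 0 k] s(2)
    by simp
  show "expectation (\<lambda>\<omega>. U j \<omega> ^ (2 * k + 1)) = 0"
    using distributed_integral[OF normal_U, of "\<lambda>t. t ^ (2 * k + 1)" j] integral_normal_moment_odd[OF s(1), of 0 k]
    by simp
qed

lemma expectation_U: "expectation (U j) = 0" "expectation (\<lambda>\<omega>. (U j \<omega>)\<^sup>2) = v j"
  "expectation (\<lambda>\<omega>. U j \<omega> ^ 3) = 0" "expectation (\<lambda>\<omega>. U j \<omega> ^ 4) = 3 * (v j)\<^sup>2"
  "expectation (\<lambda>\<omega>. U j \<omega> ^ 8) = 105 * v j ^ 4" "expectation (\<lambda>\<omega>. U j \<omega> ^ 12) = 10395 * v j ^ 6"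
proof -
  have "v j \<noteq> 0" using v_pos[of j] by simp
  then show "expectation (U j) = 0" "expectation (\<lambda>\<omega>. (U j \<omega>)\<^sup>2) = v j"
    "expectation (\<lambda>\<omega>. U j \<omega> ^ 3) = 0" "expectation (\<lambda>\<omega>. U j \<omega> ^ 4) = 3 * (v j)\<^sup>2"
    "expectation (\<lambda>\<omega>. U j \<omega> ^ 8) = 105 * v j ^ 4" "expectation (\<lambda>\<omega>. U j \<omega> ^ 12) = 10395 * v j ^ 6"
    using expectation_U_power(2)[of j 0] expectation_U_power(1)[of j 1] expectation_U_power(2)[of j 1]
      expectation_U_power(1)[of j 2] expectation_U_power(1)[of j 4] expectation_U_power(1)[of j 6]
    by (simp_all add: fact_numeral power_divide)
qed

lemma indep_U_rest:
  assumes "f \<in> borel_measurable borel" "g \<in> borel_measurable (PiM (- {j}) (\<lambda>_. borel))"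
  shows "indep_var borel (\<lambda>\<omega>. f (U j \<omega>)) borel (\<lambda>\<omega>. g (restrict (\<lambda>k. U k \<omega>) (- {j})))"
proof -
  have "indep_var (PiM {j} (\<lambda>_. borel)) (\<lambda>\<omega>. restrict (\<lambda>i. U i \<omega>) {j}) (PiM (- {j}) (\<lambda>_. borel)) (\<lambda>\<omega>. restrict (\<lambda>i. U i \<omega>) (- {j}))"
    by (rule indep_var_restrict[OF indep_U]) auto
  from indep_var_compose[OF this, of "\<lambda>p. f (p j)" borel g borel] assms
  show ?thesis by (simp add: comp_def)
qed

lemma indep_U_pair:
  assumes "j \<noteq> k" "f \<in> borel_measurable borel" "g \<in> borel_measurable borel"
  shows "indep_var borel (\<lambda>\<omega>. f (U j \<omega>)) borel (\<lambda>\<omega>. g (U k \<omega>))"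
proof -
  have "(\<lambda>p. g (p k)) \<in> borel_measurable (PiM (- {j}) (\<lambda>_. borel))"
    using assms by (intro measurable_compose[OF measurable_component_singleton[of k "- {j}" "\<lambda>_. borel"] assms(3)]) simp
  from indep_U_rest[OF assms(2) this] show ?thesis using assms(1) by simp
qed

definition xi :: "nat \<Rightarrow> 'a \<Rightarrow> real" where "xi j \<omega> = (U j \<omega>)\<^sup>2 - v j"

lemma xi_measurable[measurable]: "xi j \<in> borel_measurable M"
  unfolding xi_def[abs_def] by measurable

lemma integrable_xi_power: "integrable M (\<lambda>\<omega>. xi j \<omega> ^ 4)" and xi_power4_le: "expectation (\<lambda>\<omega>. xi j \<omega> ^ 4) \<le> (30 * (v j)\<^sup>2)\<^sup>2"
proof -
  have le: "xi j \<omega> ^ 4 \<le> 8 * (U j \<omega> ^ 8 + v j ^ 4)" for \<omega>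
    using power4_add_le[of "(U j \<omega>)\<^sup>2" "- v j"] by (simp add: xi_def)
  have i8: "integrable M (\<lambda>\<omega>. 8 * (U j \<omega> ^ 8 + v j ^ 4))" using integrable_U_power[of j 8] by simp
  show i: "integrable M (\<lambda>\<omega>. xi j \<omega> ^ 4)"
    by (rule Bochner_Integration.integrable_bound[OF i8]) (auto intro!: AE_I2 order.trans[OF le])
  have "expectation (\<lambda>\<omega>. xi j \<omega> ^ 4) \<le> expectation (\<lambda>\<omega>. 8 * (U j \<omega> ^ 8 + v j ^ 4))"
    by (rule integral_mono[OF i i8 le])
  also have "\<dots> = 848 * v j ^ 4" using integrable_U_power[of j 8] by (simp add: expectation_U prob_space)
  also have "\<dots> \<le> (30 * (v j)\<^sup>2)\<^sup>2"
  proof -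
    have "(30 * (v j)\<^sup>2)\<^sup>2 = 900 * v j ^ 4" by algebra
    moreover have "0 \<le> v j ^ 4" by simp
    ultimately show ?thesis by linarith
  qed
  finally show "expectation (\<lambda>\<omega>. xi j \<omega> ^ 4) \<le> (30 * (v j)\<^sup>2)\<^sup>2" .
qed

lemma integrable_xi: "integrable M (xi j)" "integrable M (\<lambda>\<omega>. (xi j \<omega>)\<^sup>2)"
  using integrable_powers_le_4[OF xi_measurable integrable_xi_power, of 1 j] integrable_powers_le_4[OF xi_measurable integrable_xi_power, of 2 j]
  by simp_all

lemma expectation_xi: "expectation (xi j) = 0" "expectation (\<lambda>\<omega>. (xi j \<omega>)\<^sup>2) = 2 * (v j)\<^sup>2"
  "expectation (\<lambda>\<omega>. xi j \<omega> * U j \<omega>) = 0" "expectation (\<lambda>\<omega>. xi j \<omega> * (U j \<omega>)\<^sup>2) = 2 * (v j)\<^sup>2"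
proof -
  note i = integrable_U_power
  have i1: "integrable M (\<lambda>\<omega>. U j \<omega>)" using i[of j 1] by simp
  show "expectation (xi j) = 0" unfolding xi_def[abs_def] using i[of j 2] by (simp add: expectation_U prob_space)
  have "(xi j \<omega>)\<^sup>2 = U j \<omega> ^ 4 - 2 * v j * (U j \<omega>)\<^sup>2 + (v j)\<^sup>2" for \<omega> unfolding xi_def by algebra
  then show "expectation (\<lambda>\<omega>. (xi j \<omega>)\<^sup>2) = 2 * (v j)\<^sup>2"
    using i[of j 2] i[of j 4] by (simp add: expectation_U prob_space) (simp add: power2_eq_square)
  have "xi j \<omega> * U j \<omega> = U j \<omega> ^ 3 - v j * U j \<omega>" for \<omega> unfolding xi_def by algebra
  then show "expectation (\<lambda>\<omega>. xi j \<omega> * U j \<omega>) = 0"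
    using i1 i[of j 3] by (simp add: expectation_U)
  have "xi j \<omega> * (U j \<omega>)\<^sup>2 = U j \<omega> ^ 4 - v j * (U j \<omega>)\<^sup>2" for \<omega> unfolding xi_def by algebra
  then show "expectation (\<lambda>\<omega>. xi j \<omega> * (U j \<omega>)\<^sup>2) = 2 * (v j)\<^sup>2"
    using i[of j 2] i[of j 4] by (simp add: expectation_U) (simp add: power2_eq_square)
qed

lemma product_moments:
  "integrable M (\<lambda>\<omega>. U j \<omega> * U k \<omega>)" "expectation (\<lambda>\<omega>. U j \<omega> * U k \<omega>) = (if j = k then v j else 0)"
  "integrable M (\<lambda>\<omega>. xi j \<omega> * xi k \<omega>)" "expectation (\<lambda>\<omega>. xi j \<omega> * xi k \<omega>) = (if j = k then 2 * (v j)\<^sup>2 else 0)"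
proof -
  have iU: "integrable M (U j)" for j using integrable_U_power[of j 1] by simp
  have ind: "j \<noteq> k \<Longrightarrow> indep_var borel (U j) borel (U k)" using indep_U_pair[of j k "\<lambda>t. t" "\<lambda>t. t"] by simp
  show "integrable M (\<lambda>\<omega>. U j \<omega> * U k \<omega>)"
    using indep_var_integrable[OF ind iU iU] integrable_U_power[of j 2] by (cases "j = k") (auto simp: power2_eq_square)
  show "expectation (\<lambda>\<omega>. U j \<omega> * U k \<omega>) = (if j = k then v j else 0)"
    using indep_var_lebesgue_integral[OF ind iU iU] expectation_U(1,2)[of j] by (auto simp: power2_eq_square)
  have ind: "j \<noteq> k \<Longrightarrow> indep_var borel (xi j) borel (xi k)"
    using indep_U_pair[of j k "\<lambda>t. t\<^sup>2 - v j" "\<lambda>t. t\<^sup>2 - v k"] by (simp add: xi_def[abs_def])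
  show "integrable M (\<lambda>\<omega>. xi j \<omega> * xi k \<omega>)"
    using indep_var_integrable[OF ind integrable_xi(1) integrable_xi(1)] integrable_xi(2)[of j] by (cases "j = k") (auto simp: power2_eq_square)
  show "expectation (\<lambda>\<omega>. xi j \<omega> * xi k \<omega>) = (if j = k then 2 * (v j)\<^sup>2 else 0)"
    using indep_var_lebesgue_integral[OF ind integrable_xi(1) integrable_xi(1)] expectation_xi(1,2)[of j] by (auto simp: power2_eq_square)
qed

lemma expectation_bilinear:
  fixes Y :: "nat \<Rightarrow> 'a \<Rightarrow> real"
  assumes i: "\<And>j k. integrable M (\<lambda>\<omega>. Y j \<omega> * Y k \<omega>)" and e: "\<And>j k. expectation (\<lambda>\<omega>. Y j \<omega> * Y k \<omega>) = (if j = k then s j else 0)"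
  shows "integrable M (\<lambda>\<omega>. (\<Sum>j<m. a j * Y j \<omega>) * (\<Sum>k<m. b k * Y k \<omega>))"
    and "expectation (\<lambda>\<omega>. (\<Sum>j<m. a j * Y j \<omega>) * (\<Sum>k<m. b k * Y k \<omega>)) = (\<Sum>j<m. a j * b j * s j)"
proof -
  have eq: "(\<Sum>j<m. a j * Y j \<omega>) * (\<Sum>k<m. b k * Y k \<omega>) = (\<Sum>j<m. \<Sum>k<m. (a j * b k) * (Y j \<omega> * Y k \<omega>))" for \<omega>
    unfolding sum_product by (intro sum.cong refl) simp
  show "integrable M (\<lambda>\<omega>. (\<Sum>j<m. a j * Y j \<omega>) * (\<Sum>k<m. b k * Y k \<omega>))"
    unfolding eq by (intro Bochner_Integration.integrable_sum integrable_mult_right i)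
  have "expectation (\<lambda>\<omega>. (\<Sum>j<m. a j * Y j \<omega>) * (\<Sum>k<m. b k * Y k \<omega>)) = (\<Sum>j<m. \<Sum>k<m. (a j * b k) * (if j = k then s j else 0))"
    unfolding eq by (subst Bochner_Integration.integral_sum, intro Bochner_Integration.integrable_sum integrable_mult_right i,
        intro sum.cong refl, subst Bochner_Integration.integral_sum, intro integrable_mult_right i) (simp add: i e)
  also have "\<dots> = (\<Sum>j<m. a j * b j * s j)"
  proof (intro sum.cong refl)
    fix j assume "j \<in> {..<m}"
    have "(\<Sum>k<m. (a j * b k) * (if j = k then s j else 0)) = (\<Sum>k<m. if j = k then a j * b k * s k else 0)"
      by (intro sum.cong refl) simp
    then show "(\<Sum>k<m. (a j * b k) * (if j = k then s j else 0)) = a j * b j * s j" using \<open>j \<in> {..<m}\<close> by simp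
  qed
  finally show "expectation (\<lambda>\<omega>. (\<Sum>j<m. a j * Y j \<omega>) * (\<Sum>k<m. b k * Y k \<omega>)) = (\<Sum>j<m. a j * b j * s j)" .
qed

end

abbreviation reals :: "(nat \<Rightarrow> real) measure" where "reals \<equiv> PiM UNIV (\<lambda>_. borel)"

lemma measurable_coordinate[measurable]: "(\<lambda>u. u k) \<in> borel_measurable reals"
  by (rule measurable_component_singleton) simp

lemma measurable_fit[measurable]: "(\<lambda>u. fit x m c u j) \<in> borel_measurable reals"
  unfolding fit_eq_sum by measurable

lemma score_norm_wsum_eq:
  "score_norm x m (wsum x m c u) = L2_set (\<lambda>l. \<Sum>k<m. gkernel x m (\<lambda>_. 1) l k * (c k * u k)) {..<m}"
  by (simp add: score_norm_def design_norm_def gkernel_def wsum_def inner_sum_right matrix_vector_mult_scaleR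
      linear_sum[OF matrix_vector_mul_linear] ac_simps)

lemma measurable_score_norm[measurable]: "(\<lambda>u. score_norm x m (wsum x m c u)) \<in> borel_measurable reals"
  unfolding score_norm_wsum_eq L2_set_def by measurable

lemma measurable_fluctuation[measurable]: "(\<lambda>u. fluctuation x D A m c u) \<in> borel_measurable reals"
  unfolding fluctuation_def by measurable

lemma measurable_profile_score[measurable]: "(\<lambda>u. profile_score x D m a u) \<in> borel_measurable reals"
  unfolding profile_score_def by measurable

locale fay_herriot_normal = local_root x D d\<^sub>0 d\<^sub>1 cq m\<^sub>0 A K l1 G \<epsilon> \<eta> c\<^sub>0 C\<^sub>0 C\<^sub>s m\<^sub>1 + normal_errors M U "\<lambda>j. A + D j"
  for x :: "nat \<Rightarrow> real ^ 'p" and D d\<^sub>0 d\<^sub>1 cq m\<^sub>0 A K l1 G \<epsilon> \<eta> c\<^sub>0 C\<^sub>0 C\<^sub>s m\<^sub>1 and M :: "'a measure" and U +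
  assumes G_nonneg: "b \<in> G \<Longrightarrow> 0 \<le> b"
begin

lemma measurable_adj_score[measurable]: "(\<lambda>u. adj_score m j a u) \<in> borel_measurable reals"
  unfolding adj_score_def by measurable

lemma measurable_W[measurable]: "(\<lambda>u. W m u) \<in> borel_measurable reals"
  unfolding envelope_def by measurable

lemma measurable_U[measurable]: "(\<lambda>\<omega> k. U k \<omega>) \<in> measurable M reals"
  by (rule measurable_PiM_single') auto

text \<open>The square of the score norm is a sum of \<open>m\<close> squares of fourth moment of order \<open>m ^ (- 2)\<close>.\<close>

lemma fluctuation_fourth_moment:
  assumes \<gamma>: "0 < \<gamma>"
  obtains C where "\<And>m c. m\<^sub>1 \<le> m \<Longrightarrow> (\<And>k. \<bar>c k\<bar> \<le> \<gamma>) \<Longrightarrow>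
    integrable M (\<lambda>\<omega>. fluctuation x D A m c (\<lambda>k. U k \<omega>) ^ 4) \<and>
    expectation (\<lambda>\<omega>. fluctuation x D A m c (\<lambda>k. U k \<omega>) ^ 4) \<le> C"
proof -
  define s where "s = A + d\<^sub>1"
  have s: "0 < s" using A_pos d1_pos by (simp add: s_def)
  have vs: "A + D j \<le> s" "0 < A + D j" for j using D_le[of j] v_pos[of j] by (simp_all add: s_def)
  define K1 where "K1 = \<gamma>\<^sup>2 * (30 * s\<^sup>2)"
  have K1: "0 < K1" using \<gamma> s by (simp add: K1_def)
  define C where "C = 8 * (3 * K1\<^sup>2 + 12 * ((cq + 1) ^ 4 * \<gamma> ^ 4 * s\<^sup>2))"
  show ?thesis
  proof (rule that[of C])
    fix m and c :: "nat \<Rightarrow> real" assume m: "m\<^sub>1 \<le> m" and c: "\<And>k. \<bar>c k\<bar> \<le> \<gamma>"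
    have mp: "0 < real m" using m_pos(1)[OF m] by simp
    have m0: "m\<^sub>0 \<le> m" by (rule m_pos(2)[OF m])
    interpret full_rank_design x m by (rule full_rank) (rule m0)
    have c4: "c k ^ 4 \<le> \<gamma> ^ 4" for k
      using power_mono[OF c[of k], of 4] by (simp add: power_even_abs)
    have ind: "indep_vars (\<lambda>_. borel) (\<lambda>j \<omega>. f j (U j \<omega>)) UNIV" if "\<And>j. f j \<in> borel_measurable borel" for f :: "nat \<Rightarrow> real \<Rightarrow> real"
      using indep_vars_compose2[OF indep_U, of f "\<lambda>_. borel"] that by simp
    have 1: "integrable M (\<lambda>\<omega>. (\<Sum>j<m. c j * xi j \<omega>) ^ 4) \<and>
        expectation (\<lambda>\<omega>. (\<Sum>j<m. c j * xi j \<omega>) ^ 4) \<le> 3 * (real m)\<^sup>2 * K1\<^sup>2"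
    proof (rule fourth_moment_sum_le[OF _ _ _ _ K1])
      show "indep_vars (\<lambda>_. borel) (\<lambda>j \<omega>. c j * xi j \<omega>) UNIV"
        unfolding xi_def by (rule ind) simp
      fix j
      show "integrable M (\<lambda>\<omega>. (c j * xi j \<omega>) ^ 4)"
        unfolding power_mult_distrib by (intro integrable_mult_right integrable_xi_power)
      show "expectation (\<lambda>\<omega>. c j * xi j \<omega>) = 0" by (simp add: expectation_xi)
      have "expectation (\<lambda>\<omega>. (c j * xi j \<omega>) ^ 4) = c j ^ 4 * expectation (\<lambda>\<omega>. xi j \<omega> ^ 4)"
        by (simp add: power_mult_distrib)
      also have "\<dots> \<le> \<gamma> ^ 4 * (30 * s\<^sup>2)\<^sup>2"
      proof (rule mult_mono)
        show "expectation (\<lambda>\<omega>. xi j \<omega> ^ 4) \<le> (30 * s\<^sup>2)\<^sup>2"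
          using vs[of j] by (intro order.trans[OF xi_power4_le] power_mono mult_left_mono) auto
      qed (use c4 \<gamma> in auto)
      also have "\<dots> = K1\<^sup>2" unfolding K1_def by algebra
      finally show "expectation (\<lambda>\<omega>. (c j * xi j \<omega>) ^ 4) \<le> K1\<^sup>2" .
    qed
    define L where "L l \<omega> = (\<Sum>k<m. gkernel x m (\<lambda>_. 1) l k * (c k * U k \<omega>))" for l \<omega>
    define K2 where "K2 = ((cq + 1) / real m)\<^sup>2 * \<gamma>\<^sup>2 * (2 * s)"
    have K2: "0 < K2" using \<gamma> s mp cq_nonneg by (simp add: K2_def)
    have g: "\<bar>gkernel x m (\<lambda>_. 1) l k\<bar> \<le> (cq + 1) / real m" if "l < m" "k < m" for l k
    proof -
      have "\<bar>gkernel x m (\<lambda>_. 1) l k\<bar> \<le> score_norm x m (x l) * score_norm x m (x k)"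
        using inner_le_norms[of "x l" "matrix_inv (gram x m (\<lambda>_. 1)) *v x k"]
        by (simp add: gkernel_def score_norm_def[of x m "x k"])
      also have "\<dots> \<le> sqrt (cq / real m) * sqrt (cq / real m)"
        using cq_nonneg by (intro mult_mono score_norm_row_le m0 that score_norm_nonneg) auto
      also have "\<dots> = cq / real m" using cq_nonneg by simp
      also have "\<dots> \<le> (cq + 1) / real m" by (intro divide_right_mono) auto
      finally show ?thesis .
    qed
    have 2: "integrable M (\<lambda>\<omega>. L l \<omega> ^ 4) \<and> expectation (\<lambda>\<omega>. L l \<omega> ^ 4) \<le> 3 * (real m)\<^sup>2 * K2\<^sup>2" if l: "l < m" for l
      unfolding L_def
    proof (rule fourth_moment_sum_le[OF _ _ _ _ K2])
      show "indep_vars (\<lambda>_. borel) (\<lambda>k \<omega>. gkernel x m (\<lambda>_. 1) l k * (c k * U k \<omega>)) UNIV"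
        by (rule ind) simp
      fix k assume k: "k < m"
      let ?g = "gkernel x m (\<lambda>_. 1) l k"
      have i1: "integrable M (U k)" using integrable_U_power[of k 1] by simp
      show "integrable M (\<lambda>\<omega>. (?g * (c k * U k \<omega>)) ^ 4)"
        unfolding power_mult_distrib by (intro integrable_mult_right integrable_U_power)
      show "expectation (\<lambda>\<omega>. ?g * (c k * U k \<omega>)) = 0" by (simp add: expectation_U)
      have "expectation (\<lambda>\<omega>. (?g * (c k * U k \<omega>)) ^ 4) = ?g ^ 4 * (c k ^ 4 * (3 * (A + D k)\<^sup>2))"
        by (simp add: power_mult_distrib expectation_U)
      also have "\<dots> \<le> ((cq + 1) / real m) ^ 4 * (\<gamma> ^ 4 * (2 * s)\<^sup>2)"
      proof (intro mult_mono)
        show "?g ^ 4 \<le> ((cq + 1) / real m) ^ 4"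
          using power_mono[OF g[OF l k], of 4] by (simp add: power_even_abs)
        have "(A + D k)\<^sup>2 \<le> s\<^sup>2" using vs[of k] by (intro power_mono) auto
        then have "3 * (A + D k)\<^sup>2 \<le> 4 * s\<^sup>2" using zero_le_power2[of s] by linarith
        then show "3 * (A + D k)\<^sup>2 \<le> (2 * s)\<^sup>2" by (simp add: power_mult_distrib)
      qed (use c4 \<gamma> cq_nonneg in auto)
      also have "\<dots> = K2\<^sup>2" unfolding K2_def by algebra
      finally show "expectation (\<lambda>\<omega>. (?g * (c k * U k \<omega>)) ^ 4) \<le> K2\<^sup>2" .
    qed
    let ?f = "\<lambda>\<omega>. fluctuation x D A m c (\<lambda>k. U k \<omega>)"
    let ?b = "\<lambda>\<omega>. 8 * ((\<Sum>j<m. c j * xi j \<omega>) ^ 4 / (real m)\<^sup>2 + real m * (\<Sum>l<m. L l \<omega> ^ 4))"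
    have le: "?f \<omega> ^ 4 \<le> ?b \<omega>" for \<omega>
    proof -
      have "?f \<omega> = \<bar>\<Sum>j<m. c j * xi j \<omega>\<bar> / sqrt (real m) + score_norm x m (wsum x m c (\<lambda>k. U k \<omega>))"
        by (simp add: fluctuation_def xi_def)
      then have "?f \<omega> ^ 4 \<le> 8 * ((\<bar>\<Sum>j<m. c j * xi j \<omega>\<bar> / sqrt (real m)) ^ 4 + score_norm x m (wsum x m c (\<lambda>k. U k \<omega>)) ^ 4)"
        using power4_add_le by simp
      also have "(\<bar>\<Sum>j<m. c j * xi j \<omega>\<bar> / sqrt (real m)) ^ 4 = (\<Sum>j<m. c j * xi j \<omega>) ^ 4 / (real m)\<^sup>2"
      proof -
        have "sqrt (real m) ^ 4 = ((sqrt (real m))\<^sup>2)\<^sup>2" by algebra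
        then show ?thesis by (simp add: power_divide power_even_abs)
      qed
      also have "score_norm x m (wsum x m c (\<lambda>k. U k \<omega>)) ^ 4 = (\<Sum>l<m. (L l \<omega>)\<^sup>2)\<^sup>2"
      proof -
        have "score_norm x m (wsum x m c (\<lambda>k. U k \<omega>)) ^ 4 = ((score_norm x m (wsum x m c (\<lambda>k. U k \<omega>)))\<^sup>2)\<^sup>2" by algebra
        then show ?thesis by (simp add: score_norm_wsum_eq L2_set_def L_def sum_nonneg)
      qed
      also have "(\<Sum>l<m. (L l \<omega>)\<^sup>2)\<^sup>2 \<le> (\<Sum>l<m. ((L l \<omega>)\<^sup>2)\<^sup>2) * real (card {..<m})"
        by (rule sum_squared_le_sum_of_squares)
      also have "(\<Sum>l<m. ((L l \<omega>)\<^sup>2)\<^sup>2) * real (card {..<m}) = real m * (\<Sum>l<m. L l \<omega> ^ 4)"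
        by (simp add: power_mult[symmetric])
      finally show ?thesis by simp
    qed
    have ib: "integrable M ?b"
      using 1 2 by (intro integrable_mult_right Bochner_Integration.integrable_add integrable_divide Bochner_Integration.integrable_sum) auto
    have meas: "(\<lambda>\<omega>. ?f \<omega> ^ 4) \<in> borel_measurable M"
      using measurable_compose[OF measurable_U measurable_fluctuation[of x D A m c]] by measurable
    have i: "integrable M (\<lambda>\<omega>. ?f \<omega> ^ 4)"
      by (rule Bochner_Integration.integrable_bound[OF ib meas]) (auto intro!: AE_I2 order.trans[OF le])
    have "expectation (\<lambda>\<omega>. ?f \<omega> ^ 4) \<le> expectation ?b" by (rule integral_mono[OF i ib le])
    also have "\<dots> = 8 * (expectation (\<lambda>\<omega>. (\<Sum>j<m. c j * xi j \<omega>) ^ 4) / (real m)\<^sup>2 + real m * (\<Sum>l<m. expectation (\<lambda>\<omega>. L l \<omega> ^ 4)))"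
    proof -
      have i1: "integrable M (\<lambda>\<omega>. (\<Sum>j<m. c j * xi j \<omega>) ^ 4 / (real m)\<^sup>2)" using 1 by (intro integrable_divide) auto
      have i2: "integrable M (\<lambda>\<omega>. real m * (\<Sum>l<m. L l \<omega> ^ 4))"
        using 2 by (intro integrable_mult_right Bochner_Integration.integrable_sum) auto
      have i3: "expectation (\<lambda>\<omega>. \<Sum>l<m. L l \<omega> ^ 4) = (\<Sum>l<m. expectation (\<lambda>\<omega>. L l \<omega> ^ 4))"
        using 2 by (intro Bochner_Integration.integral_sum) auto
      have "expectation ?b = 8 * expectation (\<lambda>\<omega>. (\<Sum>j<m. c j * xi j \<omega>) ^ 4 / (real m)\<^sup>2 + real m * (\<Sum>l<m. L l \<omega> ^ 4))"
        by (rule integral_mult_right_zero)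
      also have "\<dots> = 8 * (expectation (\<lambda>\<omega>. (\<Sum>j<m. c j * xi j \<omega>) ^ 4 / (real m)\<^sup>2) + expectation (\<lambda>\<omega>. real m * (\<Sum>l<m. L l \<omega> ^ 4)))"
        by (subst Bochner_Integration.integral_add[OF i1 i2]) (rule refl)
      finally show ?thesis unfolding integral_mult_right_zero integral_divide_zero i3 .
    qed
    also have "\<dots> \<le> 8 * (3 * (real m)\<^sup>2 * K1\<^sup>2 / (real m)\<^sup>2 + real m * (\<Sum>l<m. 3 * (real m)\<^sup>2 * K2\<^sup>2))"
      using 1 2 by (intro mult_left_mono add_mono divide_right_mono sum_mono) auto
    also have "\<dots> = C"
    proof -
      have "real m * (\<Sum>l<m. 3 * (real m)\<^sup>2 * K2\<^sup>2) = 3 * ((real m)\<^sup>2 * K2)\<^sup>2" by (simp add: power2_eq_square)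
      also have "(real m)\<^sup>2 * K2 = (cq + 1)\<^sup>2 * \<gamma>\<^sup>2 * (2 * s)" using mp by (simp add: K2_def power_divide)
      also have "3 * ((cq + 1)\<^sup>2 * \<gamma>\<^sup>2 * (2 * s))\<^sup>2 = 12 * ((cq + 1) ^ 4 * \<gamma> ^ 4 * s\<^sup>2)" by algebra
      finally show ?thesis using mp by (simp add: C_def)
    qed
    finally show "integrable M (\<lambda>\<omega>. ?f \<omega> ^ 4) \<and> expectation (\<lambda>\<omega>. ?f \<omega> ^ 4) \<le> C" using i by simp
  qed
qed

lemma W_fourth_moment:
  obtains C where "\<And>m. m\<^sub>1 \<le> m \<Longrightarrow> integrable M (\<lambda>\<omega>. W m (\<lambda>k. U k \<omega>) ^ 4) \<and>
    expectation (\<lambda>\<omega>. W m (\<lambda>k. U k \<omega>) ^ 4) \<le> C"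
proof -
  let ?f = "\<lambda>m p \<omega>. fluctuation x D A m (\<lambda>i. wt D (fst p) i ^ snd p) (\<lambda>k. U k \<omega>)"
  have "\<exists>C. \<forall>m\<ge>m\<^sub>1. integrable M (\<lambda>\<omega>. (1 + (\<Sum>p\<in>P. ?f m p \<omega>)) ^ 4) \<and> expectation (\<lambda>\<omega>. (1 + (\<Sum>p\<in>P. ?f m p \<omega>)) ^ 4) \<le> C"
    if "finite P" "\<forall>p\<in>P. 0 \<le> fst p" for P :: "(real \<times> nat) set"
    using that
  proof (induction P rule: finite_induct)
    case empty
    show ?case by (intro exI[of _ 1]) (simp add: prob_space)
  next
    case (insert p P)
    then obtain C where C: "\<And>m. m\<^sub>1 \<le> m \<Longrightarrow> integrable M (\<lambda>\<omega>. (1 + (\<Sum>p\<in>P. ?f m p \<omega>)) ^ 4)"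
      "\<And>m. m\<^sub>1 \<le> m \<Longrightarrow> expectation (\<lambda>\<omega>. (1 + (\<Sum>p\<in>P. ?f m p \<omega>)) ^ 4) \<le> C" by auto
    have p: "0 \<le> fst p" using insert.prems by simp
    obtain C' where C': "\<And>m c. m\<^sub>1 \<le> m \<Longrightarrow> (\<And>k. \<bar>c k\<bar> \<le> (1 / d\<^sub>0) ^ snd p) \<Longrightarrow>
      integrable M (\<lambda>\<omega>. fluctuation x D A m c (\<lambda>k. U k \<omega>) ^ 4) \<and>
      expectation (\<lambda>\<omega>. fluctuation x D A m c (\<lambda>k. U k \<omega>) ^ 4) \<le> C'"
      using fluctuation_fourth_moment[of "(1 / d\<^sub>0) ^ snd p"] d0_pos by (metis divide_pos_pos zero_less_one zero_less_power)
    have w: "\<bar>wt D (fst p) k ^ snd p\<bar> \<le> (1 / d\<^sub>0) ^ snd p" for k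
      unfolding power_abs using wt_pos[OF p, of k] wt_le[OF p, of k] by (intro power_mono) auto
    show ?case
    proof (intro exI[of _ "8 * (C + C')"] allI impI)
      fix m assume m: "m\<^sub>1 \<le> m"
      note C'm = C'[OF m, of "\<lambda>i. wt D (fst p) i ^ snd p", OF w]
      note i = C(1)[OF m] conjunct1[OF C'm]
      let ?S = "\<lambda>\<omega>. 1 + (\<Sum>p\<in>P. ?f m p \<omega>)"
      have eq: "1 + (\<Sum>p\<in>insert p P. ?f m p \<omega>) = ?S \<omega> + ?f m p \<omega>" for \<omega>
        using insert.hyps by simp
      have le: "(?S \<omega> + ?f m p \<omega>) ^ 4 \<le> 8 * (?S \<omega> ^ 4 + ?f m p \<omega> ^ 4)" for \<omega> by (rule power4_add_le)
      have ib: "integrable M (\<lambda>\<omega>. 8 * (?S \<omega> ^ 4 + ?f m p \<omega> ^ 4))" using i by simp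
      have fm: "(\<lambda>\<omega>. ?f m p \<omega>) \<in> borel_measurable M" for p
        using measurable_compose[OF measurable_U measurable_fluctuation[of x D A m "\<lambda>i. wt D (fst p) i ^ snd p"]] .
      have ii: "integrable M (\<lambda>\<omega>. (?S \<omega> + ?f m p \<omega>) ^ 4)"
        by (rule Bochner_Integration.integrable_bound[OF ib])
           (use fm in \<open>auto intro!: AE_I2 order.trans[OF le] borel_measurable_power borel_measurable_add borel_measurable_sum\<close>)
      have "expectation (\<lambda>\<omega>. (?S \<omega> + ?f m p \<omega>) ^ 4) \<le> expectation (\<lambda>\<omega>. 8 * (?S \<omega> ^ 4 + ?f m p \<omega> ^ 4))"
        by (rule integral_mono[OF ii ib le])
      also have "\<dots> = 8 * (expectation (\<lambda>\<omega>. ?S \<omega> ^ 4) + expectation (\<lambda>\<omega>. ?f m p \<omega> ^ 4))" using i by simp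
      also have "\<dots> \<le> 8 * (C + C')" using C(2)[OF m] conjunct2[OF C'm] by simp
      finally show "integrable M (\<lambda>\<omega>. (1 + (\<Sum>p\<in>insert p P. ?f m p \<omega>)) ^ 4) \<and>
          expectation (\<lambda>\<omega>. (1 + (\<Sum>p\<in>insert p P. ?f m p \<omega>)) ^ 4) \<le> 8 * (C + C')"
        unfolding eq using ii by simp
    qed
  qed
  note bound = this
  let ?P = "insert A G \<times> {1..4::nat}"
  have P: "finite ?P" "\<forall>p\<in>?P. 0 \<le> fst p" using fin_G G_nonneg A_pos by (simp, auto simp: less_imp_le)
  obtain C where C: "\<forall>m\<ge>m\<^sub>1. integrable M (\<lambda>\<omega>. (1 + (\<Sum>p\<in>?P. ?f m p \<omega>)) ^ 4) \<and>
      expectation (\<lambda>\<omega>. (1 + (\<Sum>p\<in>?P. ?f m p \<omega>)) ^ 4) \<le> C"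
    by (rule exE[OF bound[OF P]])
  show ?thesis
  proof (rule that[of C])
    fix m assume "m\<^sub>1 \<le> m"
    then show "integrable M (\<lambda>\<omega>. W m (\<lambda>k. U k \<omega>) ^ 4) \<and> expectation (\<lambda>\<omega>. W m (\<lambda>k. U k \<omega>) ^ 4) \<le> C"
      unfolding envelope_def by (rule mp[OF spec[OF C]])
  qed
qed

end

section \<open>The expected coverage\<close>

text \<open>
  With exponents \<open>4 / 3\<close> and \<open>4\<close>: the fourth moment of \<open>W\<close> and the twelfth moment of an observation suffice for the
  remainder of the coverage.
\<close>

lemma Young_weight:
  fixes w v :: real
  assumes w: "1 \<le> w" and v: "0 \<le> v"
  shows "w ^ 3 * (1 + v) ^ 3 \<le> w ^ 4 + 4096 * (1 + v ^ 12)"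
proof (cases "(1 + v) ^ 3 \<le> w")
  case True
  then have "w ^ 3 * (1 + v) ^ 3 \<le> w ^ 3 * w" using w by (intro mult_left_mono) auto
  also have "\<dots> = w ^ 4" by algebra
  finally show ?thesis using v by (simp add: add_increasing2)
next
  case False
  then have le: "w \<le> (1 + v) ^ 3" by simp
  have "w ^ 3 * (1 + v) ^ 3 \<le> ((1 + v) ^ 3) ^ 3 * (1 + v) ^ 3"
    using w v by (intro mult_right_mono power_mono le) auto
  also have "\<dots> = (1 + v) ^ 12" by (simp add: power_mult[symmetric] power_add[symmetric])
  also have "\<dots> \<le> (2 * max 1 v) ^ 12" using v by (intro power_mono) auto
  also have "\<dots> = 4096 * (max 1 v) ^ 12" by (simp add: power_mult_distrib)
  also have "(max 1 v) ^ 12 \<le> 1 + v ^ 12" using v by (auto simp: max_def)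
  also have "4096 * (1 + v ^ 12) \<le> w ^ 4 + 4096 * (1 + v ^ 12)" using w by simp
  finally show ?thesis by simp
qed

context normal_errors
begin

lemma expectation_xi_cubed:
  "integrable M (\<lambda>\<omega>. xi j \<omega> ^ 3)" "expectation (\<lambda>\<omega>. xi j \<omega> ^ 3) = 8 * v j ^ 3"
proof -
  note i = integrable_U_power
  have e6: "expectation (\<lambda>\<omega>. U j \<omega> ^ 6) = 15 * v j ^ 3"
    using expectation_U_power(1)[of j 3] v_pos[of j] by (simp add: fact_numeral power_divide)
  have eq: "xi j \<omega> ^ 3 = U j \<omega> ^ 6 - 3 * v j * U j \<omega> ^ 4 + 3 * (v j)\<^sup>2 * (U j \<omega>)\<^sup>2 - v j ^ 3" for \<omega>
    unfolding xi_def by algebra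
  show "integrable M (\<lambda>\<omega>. xi j \<omega> ^ 3)" unfolding eq using i[of j 6] i[of j 4] i[of j 2] by simp
  have "expectation (\<lambda>\<omega>. xi j \<omega> ^ 3) = 15 * v j ^ 3 - 3 * v j * (3 * (v j)\<^sup>2) + 3 * (v j)\<^sup>2 * v j - v j ^ 3"
    unfolding eq using i[of j 6] i[of j 4] i[of j 2] by (simp add: e6 expectation_U prob_space)
  also have "\<dots> = 8 * v j ^ 3" by algebra
  finally show "expectation (\<lambda>\<omega>. xi j \<omega> ^ 3) = 8 * v j ^ 3" .
qed

lemma expectation_product_rest:
  assumes f: "f \<in> borel_measurable borel" and g: "g \<in> borel_measurable (PiM (- {j}) (\<lambda>_. borel))"
    and F: "\<And>\<omega>. F \<omega> = f (U j \<omega>)" and H: "\<And>\<omega>. H \<omega> = g (restrict (\<lambda>k. U k \<omega>) (- {j}))"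
    and i: "integrable M F" "integrable M H"
  shows "integrable M (\<lambda>\<omega>. F \<omega> * H \<omega>)" "expectation (\<lambda>\<omega>. F \<omega> * H \<omega>) = expectation F * expectation (H :: 'a \<Rightarrow> real)"
proof -
  have F': "F = (\<lambda>\<omega>. f (U j \<omega>))" and H': "H = (\<lambda>\<omega>. g (restrict (\<lambda>k. U k \<omega>) (- {j})))" using F H by auto
  have "indep_var borel F borel H" unfolding F' H' by (rule indep_U_rest[OF f g])
  from indep_var_integrable[OF this i] indep_var_lebesgue_integral[OF this i]
  show "integrable M (\<lambda>\<omega>. F \<omega> * H \<omega>)" "expectation (\<lambda>\<omega>. F \<omega> * H \<omega>) = expectation F * expectation H" by auto
qed

end

context fay_herriot_normal
begin

lemma fluctuation_weight_moment:
  obtains C where "0 \<le> C" "\<And>m j. m\<^sub>1 \<le> m \<Longrightarrow> integrable M (\<lambda>\<omega>. W m (\<lambda>k. U k \<omega>) ^ 3 * (1 + \<bar>U j \<omega>\<bar>) ^ 3) \<and>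
    expectation (\<lambda>\<omega>. W m (\<lambda>k. U k \<omega>) ^ 3 * (1 + \<bar>U j \<omega>\<bar>) ^ 3) \<le> C"
proof -
  obtain C where C: "\<And>m. m\<^sub>1 \<le> m \<Longrightarrow> integrable M (\<lambda>\<omega>. W m (\<lambda>k. U k \<omega>) ^ 4) \<and>
    expectation (\<lambda>\<omega>. W m (\<lambda>k. U k \<omega>) ^ 4) \<le> C" using W_fourth_moment by blast
  define C' where "C' = \<bar>C\<bar> + 4096 * (1 + 10395 * (A + d\<^sub>1) ^ 6)"
  show ?thesis
  proof (rule that[of C'])
    show "0 \<le> C'" using A_pos d1_pos by (simp add: C'_def)
    fix m j assume m: "m\<^sub>1 \<le> m"
    let ?f = "\<lambda>\<omega>. W m (\<lambda>k. U k \<omega>) ^ 3 * (1 + \<bar>U j \<omega>\<bar>) ^ 3"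
    let ?g = "\<lambda>\<omega>. W m (\<lambda>k. U k \<omega>) ^ 4 + 4096 * (1 + U j \<omega> ^ 12)"
    have i12: "integrable M (\<lambda>\<omega>. 4096 * (1 + U j \<omega> ^ 12))" using integrable_U_power[of j 12] by simp
    have ig: "integrable M ?g" by (rule Bochner_Integration.integrable_add[OF conjunct1[OF C[OF m]] i12])
    have le: "?f \<omega> \<le> ?g \<omega>" for \<omega>
      using Young_weight[OF envelope_ge_1[of G m "\<lambda>k. U k \<omega>"], of "\<bar>U j \<omega>\<bar>"] by (simp add: power_even_abs)
    have W0: "0 \<le> W m u" for u using envelope_ge_1[of G m u] by simp
    have Wm: "(\<lambda>\<omega>. W m (\<lambda>k. U k \<omega>)) \<in> borel_measurable M" by (rule measurable_compose[OF measurable_U measurable_W])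
    have i: "integrable M ?f"
      by (rule Bochner_Integration.integrable_bound[OF ig])
         (use Wm W0 in \<open>auto intro!: AE_I2 order.trans[OF le]\<close>)
    have "expectation ?f \<le> expectation ?g" by (rule integral_mono[OF i ig le])
    also have "\<dots> = expectation (\<lambda>\<omega>. W m (\<lambda>k. U k \<omega>) ^ 4) + expectation (\<lambda>\<omega>. 4096 * (1 + U j \<omega> ^ 12))"
      by (rule Bochner_Integration.integral_add[OF conjunct1[OF C[OF m]] i12])
    also have "expectation (\<lambda>\<omega>. 4096 * (1 + U j \<omega> ^ 12)) = 4096 * (1 + 10395 * (A + D j) ^ 6)"
      using integrable_U_power[of j 12] by (simp add: expectation_U prob_space)
    also have "4096 * (1 + 10395 * (A + D j) ^ 6) \<le> 4096 * (1 + 10395 * (A + d\<^sub>1) ^ 6)"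
      using A_pos D_pos[of j] D_le[of j] by (intro mult_left_mono add_left_mono power_mono) auto
    finally show "integrable M ?f \<and> expectation ?f \<le> C'" using C[OF m] i unfolding C'_def by auto
  qed
qed

text \<open>The correction of order \<open>1 / m\<close>, with the variance of the fit in the form of the kernel \<open>gkernel\<close>.\<close>

definition cox_correction :: "nat \<Rightarrow> nat \<Rightarrow> real \<Rightarrow> real"
  where "cox_correction m j z = - (1 / trace_V_inv_sq D m A) *
      (4 * D j / (A * (A + D j)\<^sup>2) + (1 + z\<^sup>2) * (D j)\<^sup>2 / (2 * A\<^sup>2 * (A + D j)\<^sup>2))
    - D j / (A * (A + D j)) * gkernel x m (wt D A) j j + 2 / trace_V_inv_sq D m A * (D j / (A * (A + D j))) * l1 m j A"

text \<open>The expectations of the terms that make up the second-order approximation of the coverage.\<close>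

context
  fixes m j :: nat
  assumes m: "m\<^sub>1 \<le> m" and j: "j < m"
begin

interpretation full_rank_design x m by (rule full_rank) (rule m_pos(2)[OF m])

abbreviation (input) "w \<equiv> wt D A"
abbreviation (input) "\<kappa> \<equiv> gkernel x m (wt D A)"
abbreviation (input) "UU \<omega> \<equiv> (\<lambda>k. U k \<omega>)"

lemma leading_score_xi: "leading_score D m A (UU \<omega>) = (\<Sum>k<m. (1 / 2 * (w k)\<^sup>2) * xi k \<omega>)"
  unfolding leading_score_A xi_def sum_distrib_left by (simp add: mult.assoc)

lemma wfluct_xi: "wfluct p m (UU \<omega>) = (\<Sum>k<m. w k ^ p * xi k \<omega>)"
  unfolding wfluct_def xi_def ..

lemma fit_A_U: "fit x m w (UU \<omega>) i = (\<Sum>k<m. (\<kappa> i k * w k) * U k \<omega>)"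
  unfolding fit_eq_sum by (simp add: mult.assoc)

lemmas xi_bilinear = expectation_bilinear[of xi "\<lambda>j. 2 * (A + D j)\<^sup>2", OF product_moments(3,4)]
lemmas U_bilinear = expectation_bilinear[of U "\<lambda>j. A + D j", OF product_moments(1,2)]

lemma step1_moments:
  "integrable M (\<lambda>\<omega>. leading_score D m A (UU \<omega>))" "expectation (\<lambda>\<omega>. leading_score D m A (UU \<omega>)) = 0"
  "integrable M (\<lambda>\<omega>. (leading_score D m A (UU \<omega>))\<^sup>2)" "expectation (\<lambda>\<omega>. (leading_score D m A (UU \<omega>))\<^sup>2) = info m"
  "integrable M (\<lambda>\<omega>. wfluct 3 m (UU \<omega>) * leading_score D m A (UU \<omega>))"
  "expectation (\<lambda>\<omega>. wfluct 3 m (UU \<omega>) * leading_score D m A (UU \<omega>)) = cubes m"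
proof -
  show "integrable M (\<lambda>\<omega>. leading_score D m A (UU \<omega>))"
    unfolding leading_score_xi by (intro Bochner_Integration.integrable_sum integrable_mult_right integrable_xi)
  have "expectation (\<lambda>\<omega>. leading_score D m A (UU \<omega>)) = (\<Sum>k<m. expectation (\<lambda>\<omega>. (1 / 2 * (w k)\<^sup>2) * xi k \<omega>))"
    unfolding leading_score_xi by (intro Bochner_Integration.integral_sum integrable_mult_right integrable_xi)
  then show "expectation (\<lambda>\<omega>. leading_score D m A (UU \<omega>)) = 0"
    by (simp only: integral_mult_right_zero expectation_xi mult_zero_right sum.neutral_const)
  show "integrable M (\<lambda>\<omega>. (leading_score D m A (UU \<omega>))\<^sup>2)"
    unfolding leading_score_xi power2_eq_square by (rule xi_bilinear)
  have t: "1 / 2 * (w k)\<^sup>2 * (1 / 2 * (w k)\<^sup>2) * (2 * (A + D k)\<^sup>2) = 1 / 2 * (w k)\<^sup>2" for k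
  proof -
    have "1 / 2 * (w k)\<^sup>2 * (1 / 2 * (w k)\<^sup>2) * (2 * (A + D k)\<^sup>2) = 1 / 2 * (w k)\<^sup>2 * (w k * (A + D k))\<^sup>2" by algebra
    then show ?thesis by (simp add: wt_A)
  qed
  have t3: "w k ^ 3 * (1 / 2 * (w k)\<^sup>2) * (2 * (A + D k)\<^sup>2) = w k ^ 3" for k
  proof -
    have "w k ^ 3 * (1 / 2 * (w k)\<^sup>2) * (2 * (A + D k)\<^sup>2) = w k ^ 3 * (w k * (A + D k))\<^sup>2" by algebra
    then show ?thesis by (simp add: wt_A)
  qed
  have "expectation (\<lambda>\<omega>. (leading_score D m A (UU \<omega>))\<^sup>2) = (\<Sum>k<m. 1 / 2 * (w k)\<^sup>2 * (1 / 2 * (w k)\<^sup>2) * (2 * (A + D k)\<^sup>2))"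
    unfolding leading_score_xi power2_eq_square[of "sum _ _"] by (rule xi_bilinear)
  then show "expectation (\<lambda>\<omega>. (leading_score D m A (UU \<omega>))\<^sup>2) = info m"
    unfolding t by (simp add: info_def sum_distrib_left)
  show "integrable M (\<lambda>\<omega>. wfluct 3 m (UU \<omega>) * leading_score D m A (UU \<omega>))"
    unfolding leading_score_xi wfluct_xi by (rule xi_bilinear)
  have "expectation (\<lambda>\<omega>. wfluct 3 m (UU \<omega>) * leading_score D m A (UU \<omega>)) = (\<Sum>k<m. w k ^ 3 * (1 / 2 * (w k)\<^sup>2) * (2 * (A + D k)\<^sup>2))"
    unfolding leading_score_xi wfluct_xi by (rule xi_bilinear)
  then show "expectation (\<lambda>\<omega>. wfluct 3 m (UU \<omega>) * leading_score D m A (UU \<omega>)) = cubes m"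
    unfolding t3 by (simp add: cubes_def)
qed

lemma fit_moments:
  "integrable M (\<lambda>\<omega>. fit x m w (UU \<omega>) i * fit x m w (UU \<omega>) i)"
  "i < m \<Longrightarrow> expectation (\<lambda>\<omega>. fit x m w (UU \<omega>) i * fit x m w (UU \<omega>) i) = \<kappa> i i"
  "i < m \<Longrightarrow> integrable M (\<lambda>\<omega>. U i \<omega> * fit x m w (UU \<omega>) i)"
  "i < m \<Longrightarrow> expectation (\<lambda>\<omega>. U i \<omega> * fit x m w (UU \<omega>) i) = \<kappa> i i"
proof -
  show "integrable M (\<lambda>\<omega>. fit x m w (UU \<omega>) i * fit x m w (UU \<omega>) i)"
    unfolding fit_A_U by (rule U_bilinear)
  have "expectation (\<lambda>\<omega>. fit x m w (UU \<omega>) i * fit x m w (UU \<omega>) i) = (\<Sum>k<m. \<kappa> i k * w k * (\<kappa> i k * w k) * (A + D k))"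
    unfolding fit_A_U by (rule U_bilinear)
  also have "\<dots> = (\<Sum>k<m. w k * (\<kappa> k i * \<kappa> k i))"
  proof (intro sum.cong refl)
    fix k
    have "\<kappa> i k * w k * (\<kappa> i k * w k) * (A + D k) = w k * (w k * (A + D k)) * (\<kappa> i k * \<kappa> i k)" by algebra
    then show "\<kappa> i k * w k * (\<kappa> i k * w k) * (A + D k) = w k * (\<kappa> k i * \<kappa> k i)"
      using gkernel_sym[of w i k] wt_A(1) by (simp add: wt_A(4))
  qed
  also have "\<dots> = \<kappa> i i" using wt_A(1) by (intro gkernel_reproducing)
  finally show "expectation (\<lambda>\<omega>. fit x m w (UU \<omega>) i * fit x m w (UU \<omega>) i) = \<kappa> i i" .
  assume i: "i < m"
  have u: "U i \<omega> = (\<Sum>k<m. (if k = i then 1 else 0) * U k \<omega>)" for \<omega>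
  proof -
    have "(\<Sum>k<m. (if k = i then 1 else 0) * U k \<omega>) = (\<Sum>k<m. if k = i then U k \<omega> else 0)" by (intro sum.cong refl) simp
    then show ?thesis using i by simp
  qed
  show "integrable M (\<lambda>\<omega>. U i \<omega> * fit x m w (UU \<omega>) i)"
    unfolding fit_A_U by (subst u) (rule U_bilinear)
  have "expectation (\<lambda>\<omega>. U i \<omega> * fit x m w (UU \<omega>) i) = (\<Sum>k<m. (if k = i then 1 else 0) * (\<kappa> i k * w k) * (A + D k))"
    unfolding fit_A_U by (subst u) (rule U_bilinear)
  also have "\<dots> = (\<Sum>k<m. if k = i then \<kappa> i k else 0)"
    by (intro sum.cong refl) (simp add: mult.assoc wt_A)
  finally show "expectation (\<lambda>\<omega>. U i \<omega> * fit x m w (UU \<omega>) i) = \<kappa> i i" using i by simp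
qed

lemma score_correction_mean:
  "integrable M (\<lambda>\<omega>. score_correction x D m A (UU \<omega>))" "expectation (\<lambda>\<omega>. score_correction x D m A (UU \<omega>)) = 0"
proof -
  have eq: "score_correction x D m A (UU \<omega>) = 1 / 2 * (\<Sum>k<m. (w k)\<^sup>2 * \<kappa> k k)
      - (\<Sum>k<m. (w k)\<^sup>2 * (U k \<omega> * fit x m w (UU \<omega>) k))
      + 1 / 2 * (\<Sum>k<m. (w k)\<^sup>2 * (fit x m w (UU \<omega>) k * fit x m w (UU \<omega>) k))" for \<omega>
    unfolding score_correction_def inner_wsum fit_def by (simp add: mult.assoc)
  have i1: "integrable M (\<lambda>\<omega>. \<Sum>k<m. (w k)\<^sup>2 * (U k \<omega> * fit x m w (UU \<omega>) k))"
    by (intro Bochner_Integration.integrable_sum integrable_mult_right fit_moments) simp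
  have i2: "integrable M (\<lambda>\<omega>. \<Sum>k<m. (w k)\<^sup>2 * (fit x m w (UU \<omega>) k * fit x m w (UU \<omega>) k))"
    by (intro Bochner_Integration.integrable_sum integrable_mult_right fit_moments)
  have e1: "expectation (\<lambda>\<omega>. \<Sum>k<m. (w k)\<^sup>2 * (U k \<omega> * fit x m w (UU \<omega>) k)) = (\<Sum>k<m. (w k)\<^sup>2 * \<kappa> k k)"
    by (subst Bochner_Integration.integral_sum, intro integrable_mult_right fit_moments, simp)
       (intro sum.cong refl, simp only: integral_mult_right_zero lessThan_iff fit_moments(4))
  have e2: "expectation (\<lambda>\<omega>. \<Sum>k<m. (w k)\<^sup>2 * (fit x m w (UU \<omega>) k * fit x m w (UU \<omega>) k)) = (\<Sum>k<m. (w k)\<^sup>2 * \<kappa> k k)"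
    by (subst Bochner_Integration.integral_sum, intro integrable_mult_right fit_moments)
       (intro sum.cong refl, simp only: integral_mult_right_zero lessThan_iff fit_moments(2))
  show "integrable M (\<lambda>\<omega>. score_correction x D m A (UU \<omega>))" unfolding eq
    by (intro Bochner_Integration.integrable_add Bochner_Integration.integrable_diff integrable_mult_right i1 i2) simp
  have "expectation (\<lambda>\<omega>. score_correction x D m A (UU \<omega>)) = 1 / 2 * (\<Sum>k<m. (w k)\<^sup>2 * \<kappa> k k)
      - expectation (\<lambda>\<omega>. \<Sum>k<m. (w k)\<^sup>2 * (U k \<omega> * fit x m w (UU \<omega>) k))
      + 1 / 2 * expectation (\<lambda>\<omega>. \<Sum>k<m. (w k)\<^sup>2 * (fit x m w (UU \<omega>) k * fit x m w (UU \<omega>) k))"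
    unfolding eq by (subst Bochner_Integration.integral_add, intro Bochner_Integration.integrable_diff i1, simp, intro integrable_mult_right i2)
       (subst Bochner_Integration.integral_diff[OF _ i1], simp, simp only: integral_mult_right_zero, simp add: prob_space)
  then show "expectation (\<lambda>\<omega>. score_correction x D m A (UU \<omega>)) = 0" unfolding e1 e2 by simp
qed

text \<open>
  The score correction has mean zero, and the mean of \<open>wfluct 3 m u * step1 m u\<close> equals that of \<open>cubes m * (step1 m u)\<^sup>2\<close>: the
  residual maximum likelihood estimator is unbiased to this order, and only the adjustment contributes.
\<close>

lemma step2_mean:
  "integrable M (\<lambda>\<omega>. step2 m j (UU \<omega>))" "expectation (\<lambda>\<omega>. step2 m j (UU \<omega>)) = l1 m j A * (1 / info m)"
proof -
  define \<iota> where "\<iota> = 1 / info m"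
  have \<iota>: "\<iota> * info m = 1" using info_pos[OF m] by (simp add: \<iota>_def)
  let ?S = "\<lambda>\<omega>. leading_score D m A (UU \<omega>)" and ?R = "\<lambda>\<omega>. score_correction x D m A (UU \<omega>)"
    and ?F = "\<lambda>\<omega>. wfluct 3 m (UU \<omega>) * leading_score D m A (UU \<omega>)"
  have eq: "step2 m j (UU \<omega>) = \<iota> * ?S \<omega> + \<iota> * ?R \<omega> + \<iota> * l1 m j A - \<iota>\<^sup>2 * ?F \<omega> + (\<iota> ^ 3 * cubes m) * (?S \<omega>)\<^sup>2" for \<omega>
    unfolding step2_def step1_def \<iota>_def[symmetric] by algebra
  note i = integrable_mult_right[OF step1_moments(1), of \<iota>] integrable_mult_right[OF score_correction_mean(1), of \<iota>]
    integrable_mult_right[OF step1_moments(5), of "\<iota>\<^sup>2"] integrable_mult_right[OF step1_moments(3), of "\<iota> ^ 3 * cubes m"]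
  show "integrable M (\<lambda>\<omega>. step2 m j (UU \<omega>))" unfolding eq
    by (intro Bochner_Integration.integrable_add Bochner_Integration.integrable_diff i integrable_const)
  have "expectation (\<lambda>\<omega>. step2 m j (UU \<omega>)) = \<iota> * expectation ?S + \<iota> * expectation ?R + \<iota> * l1 m j A
      - \<iota>\<^sup>2 * expectation ?F + (\<iota> ^ 3 * cubes m) * expectation (\<lambda>\<omega>. (?S \<omega>)\<^sup>2)"
    unfolding eq using i by (simp add: prob_space)
  also have "\<dots> = l1 m j A * \<iota> + \<iota>\<^sup>2 * cubes m * (\<iota> * info m - 1)"
    unfolding step1_moments score_correction_mean by algebra
  finally show "expectation (\<lambda>\<omega>. step2 m j (UU \<omega>)) = l1 m j A * (1 / info m)" by (simp add: \<iota> \<iota>_def)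
qed

text \<open>
  The score is correlated with the observation of its own area only through one of its \<open>m\<close> summands. Splitting off this
  summand leaves products of independent factors, which are evaluated exactly.
\<close>

lemma own_area_moments:
  "integrable M (\<lambda>\<omega>. (leading_score D m A (UU \<omega>))\<^sup>2 * (U j \<omega>)\<^sup>2)"
  "expectation (\<lambda>\<omega>. (leading_score D m A (UU \<omega>))\<^sup>2 * (U j \<omega>)\<^sup>2) = (A + D j) * info m + 2 * w j"
  "integrable M (\<lambda>\<omega>. leading_score D m A (UU \<omega>) * U j \<omega> * fit x m w (UU \<omega>) j)"
  "expectation (\<lambda>\<omega>. leading_score D m A (UU \<omega>) * U j \<omega> * fit x m w (UU \<omega>) j) = \<kappa> j j * w j"
proof -
  define s where "s k = (if k = j then 0 else 1 / 2 * (w k)\<^sup>2)" for k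
  define t where "t k = (if k = j then 0 else \<kappa> j k * w k)" for k
  \<comment> \<open>The score and the fit without the contribution of area \<open>j\<close>.\<close>
  define S where "S \<omega> = (\<Sum>k<m. s k * xi k \<omega>)" for \<omega>
  define T where "T \<omega> = (\<Sum>k<m. t k * U k \<omega>)" for \<omega>
  have split: "(\<Sum>k<m. c k * Y k) = (\<Sum>k<m. (if k = j then 0 else c k) * Y k) + c j * Y j" for c Y :: "nat \<Rightarrow> real"
    using j by (subst (1 2) sum.remove[of "{..<m}" j]) (auto intro!: sum.cong)
  have LS: "leading_score D m A (UU \<omega>) = S \<omega> + 1 / 2 * (w j)\<^sup>2 * xi j \<omega>" for \<omega>
    unfolding leading_score_xi S_def s_def by (subst split) (rule refl)
  have FT: "fit x m w (UU \<omega>) j = T \<omega> + \<kappa> j j * w j * U j \<omega>" for \<omega>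
    unfolding fit_A_U T_def t_def by (subst split) (rule refl)
  define gS where "gS p = (\<Sum>k<m. s k * ((p k)\<^sup>2 - (A + D k)))" for p :: "nat \<Rightarrow> real"
  define gT where "gT p = (\<Sum>k<m. t k * p k)" for p :: "nat \<Rightarrow> real"
  have coord: "(\<lambda>p. p k) \<in> borel_measurable (PiM (- {j}) (\<lambda>_. borel))" if "k \<noteq> j" for k
    using that by (intro measurable_component_singleton) simp
  have mS: "gS \<in> borel_measurable (PiM (- {j}) (\<lambda>_. borel))" unfolding gS_def
  proof (rule borel_measurable_sum)
    fix k show "(\<lambda>p. s k * ((p k)\<^sup>2 - (A + D k))) \<in> borel_measurable (PiM (- {j}) (\<lambda>_. borel))"
      using coord[of k] by (cases "k = j") (simp_all add: s_def)
  qed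
  have mT: "gT \<in> borel_measurable (PiM (- {j}) (\<lambda>_. borel))" unfolding gT_def
  proof (rule borel_measurable_sum)
    fix k show "(\<lambda>p. t k * p k) \<in> borel_measurable (PiM (- {j}) (\<lambda>_. borel))"
      using coord[of k] by (cases "k = j") (simp_all add: t_def)
  qed
  have S: "S \<omega> = gS (restrict (UU \<omega>) (- {j}))" for \<omega>
    unfolding S_def gS_def xi_def by (intro sum.cong refl) (simp add: s_def)
  have T: "T \<omega> = gT (restrict (UU \<omega>) (- {j}))" for \<omega>
    unfolding T_def gT_def by (intro sum.cong refl) (simp add: t_def)
  have iU: "integrable M (U k)" for k using integrable_U_power[of k 1] by simp
  have iS: "integrable M S" unfolding S_def by (intro Bochner_Integration.integrable_sum integrable_mult_right integrable_xi)
  have iT: "integrable M T" unfolding T_def by (intro Bochner_Integration.integrable_sum integrable_mult_right iU)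
  have iS2: "integrable M (\<lambda>\<omega>. (S \<omega>)\<^sup>2)" unfolding S_def power2_eq_square by (rule xi_bilinear)
  have iT2: "integrable M (\<lambda>\<omega>. (T \<omega>)\<^sup>2)" unfolding T_def power2_eq_square by (rule U_bilinear)
  have S0: "expectation S = 0"
    unfolding S_def by (subst Bochner_Integration.integral_sum, intro integrable_mult_right integrable_xi)
       (simp only: integral_mult_right_zero expectation_xi mult_zero_right sum.neutral_const)
  have T0: "expectation T = 0"
    unfolding T_def by (subst Bochner_Integration.integral_sum, intro integrable_mult_right iU)
       (simp only: integral_mult_right_zero expectation_U mult_zero_right sum.neutral_const)
  have iST: "integrable M (\<lambda>\<omega>. S \<omega> * T \<omega>)"
  proof (rule Bochner_Integration.integrable_bound[OF Bochner_Integration.integrable_add[OF iS2 iT2]])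
    show "(\<lambda>\<omega>. S \<omega> * T \<omega>) \<in> borel_measurable M" using iS iT by auto
    have "\<bar>a * b\<bar> \<le> a\<^sup>2 + b\<^sup>2" for a b :: real
    proof -
      have "0 \<le> (\<bar>a\<bar> - \<bar>b\<bar>)\<^sup>2" by simp
      then have "2 * \<bar>a * b\<bar> \<le> a\<^sup>2 + b\<^sup>2" by (simp add: power2_diff abs_mult)
      then show ?thesis using abs_ge_zero[of "a * b"] by linarith
    qed
    then show "AE \<omega> in M. norm (S \<omega> * T \<omega>) \<le> norm ((S \<omega>)\<^sup>2 + (T \<omega>)\<^sup>2)" by simp
  qed
  let ?x = "\<lambda>n t. (t\<^sup>2 - (A + D j)) ^ n :: real"
  have x: "?x n \<in> borel_measurable borel" for n by measurable
  note ix = integrable_xi(1)[of j] integrable_xi(2)[of j]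
  have p1: "integrable M (\<lambda>\<omega>. xi j \<omega> * (S \<omega>)\<^sup>2)" "expectation (\<lambda>\<omega>. xi j \<omega> * (S \<omega>)\<^sup>2) = 0"
    using expectation_product_rest[OF x[of 1] borel_measurable_power[OF mS, of 2], of "xi j" "\<lambda>\<omega>. (S \<omega>)\<^sup>2"] ix iS2
    by (auto simp: S xi_def expectation_xi(1))
  have p2: "integrable M (\<lambda>\<omega>. (xi j \<omega>)\<^sup>2 * S \<omega>)" "expectation (\<lambda>\<omega>. (xi j \<omega>)\<^sup>2 * S \<omega>) = 0"
    using expectation_product_rest[OF x[of 2] mS, of "\<lambda>\<omega>. (xi j \<omega>)\<^sup>2" S] ix iS S0
    by (auto simp: S xi_def)
  have pS: "expectation (\<lambda>\<omega>. (leading_score D m A (UU \<omega>))\<^sup>2) = info m" by (rule step1_moments)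
  have eq1: "(leading_score D m A (UU \<omega>))\<^sup>2 * (U j \<omega>)\<^sup>2 = (A + D j) * (leading_score D m A (UU \<omega>))\<^sup>2
      + xi j \<omega> * (S \<omega>)\<^sup>2 + (w j)\<^sup>2 * ((xi j \<omega>)\<^sup>2 * S \<omega>) + 1 / 4 * w j ^ 4 * xi j \<omega> ^ 3" for \<omega>
  proof -
    have u: "(U j \<omega>)\<^sup>2 = xi j \<omega> + (A + D j)" by (simp add: xi_def)
    show ?thesis unfolding u LS by algebra
  qed
  note i1 = integrable_mult_right[OF step1_moments(3), of "A + D j"] p1(1) integrable_mult_right[OF p2(1), of "(w j)\<^sup>2"]
    integrable_mult_right[OF expectation_xi_cubed(1)[of j], of "1 / 4 * w j ^ 4"]
  show "integrable M (\<lambda>\<omega>. (leading_score D m A (UU \<omega>))\<^sup>2 * (U j \<omega>)\<^sup>2)"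
    unfolding eq1 by (intro Bochner_Integration.integrable_add i1)
  have "expectation (\<lambda>\<omega>. (leading_score D m A (UU \<omega>))\<^sup>2 * (U j \<omega>)\<^sup>2) = (A + D j) * info m + 0 + (w j)\<^sup>2 * 0
      + 1 / 4 * w j ^ 4 * (8 * (A + D j) ^ 3)"
    unfolding eq1 using i1 by (simp only: Bochner_Integration.integral_add Bochner_Integration.integrable_add
      integral_mult_right_zero step1_moments p1 p2 expectation_xi_cubed)
  also have "\<dots> = (A + D j) * info m + 2 * w j * (w j * (A + D j)) ^ 3" by algebra
  finally show "expectation (\<lambda>\<omega>. (leading_score D m A (UU \<omega>))\<^sup>2 * (U j \<omega>)\<^sup>2) = (A + D j) * info m + 2 * w j"
    by (simp add: wt_A)
  have id: "(\<lambda>t. t) \<in> borel_measurable borel" "(\<lambda>t :: real. t\<^sup>2) \<in> borel_measurable borel"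
    "(\<lambda>t. (t\<^sup>2 - (A + D j)) * t) \<in> borel_measurable borel" by measurable
  have ixU: "integrable M (\<lambda>\<omega>. xi j \<omega> * U j \<omega>)" "integrable M (\<lambda>\<omega>. xi j \<omega> * (U j \<omega>)\<^sup>2)"
  proof -
    have "xi j \<omega> * U j \<omega> = U j \<omega> ^ 3 - (A + D j) * U j \<omega>" "xi j \<omega> * (U j \<omega>)\<^sup>2 = U j \<omega> ^ 4 - (A + D j) * (U j \<omega>)\<^sup>2" for \<omega>
      unfolding xi_def by algebra+
    then show "integrable M (\<lambda>\<omega>. xi j \<omega> * U j \<omega>)" "integrable M (\<lambda>\<omega>. xi j \<omega> * (U j \<omega>)\<^sup>2)"
      using iU[of j] integrable_U_power[of j 3] integrable_U_power[of j 4] integrable_U_power[of j 2] by simp_all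
  qed
  have q1: "integrable M (\<lambda>\<omega>. U j \<omega> * (S \<omega> * T \<omega>))" "expectation (\<lambda>\<omega>. U j \<omega> * (S \<omega> * T \<omega>)) = 0"
    using expectation_product_rest[OF id(1) borel_measurable_times[OF mS mT], of "U j" "\<lambda>\<omega>. S \<omega> * T \<omega>"] iU[of j] iST
    by (auto simp: S T expectation_U)
  have q2: "integrable M (\<lambda>\<omega>. (U j \<omega>)\<^sup>2 * S \<omega>)" "expectation (\<lambda>\<omega>. (U j \<omega>)\<^sup>2 * S \<omega>) = 0"
    using expectation_product_rest[OF id(2) mS, of "\<lambda>\<omega>. (U j \<omega>)\<^sup>2" S] integrable_U_power[of j 2] iS S0
    by (auto simp: S)
  have q3: "integrable M (\<lambda>\<omega>. (xi j \<omega> * U j \<omega>) * T \<omega>)" "expectation (\<lambda>\<omega>. (xi j \<omega> * U j \<omega>) * T \<omega>) = 0"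
    using expectation_product_rest[OF id(3) mT, of "\<lambda>\<omega>. xi j \<omega> * U j \<omega>" T] ixU(1) iT T0
    by (auto simp: T xi_def)
  have eq2: "leading_score D m A (UU \<omega>) * U j \<omega> * fit x m w (UU \<omega>) j = U j \<omega> * (S \<omega> * T \<omega>)
      + (\<kappa> j j * w j) * ((U j \<omega>)\<^sup>2 * S \<omega>) + 1 / 2 * (w j)\<^sup>2 * ((xi j \<omega> * U j \<omega>) * T \<omega>)
      + 1 / 2 * w j ^ 3 * \<kappa> j j * (xi j \<omega> * (U j \<omega>)\<^sup>2)" for \<omega>
    unfolding LS FT by algebra
  note i2 = q1(1) integrable_mult_right[OF q2(1), of "\<kappa> j j * w j"] integrable_mult_right[OF q3(1), of "1 / 2 * (w j)\<^sup>2"]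
    integrable_mult_right[OF ixU(2), of "1 / 2 * w j ^ 3 * \<kappa> j j"]
  show "integrable M (\<lambda>\<omega>. leading_score D m A (UU \<omega>) * U j \<omega> * fit x m w (UU \<omega>) j)"
    unfolding eq2 by (intro Bochner_Integration.integrable_add i2)
  have "expectation (\<lambda>\<omega>. leading_score D m A (UU \<omega>) * U j \<omega> * fit x m w (UU \<omega>) j) = 0 + (\<kappa> j j * w j) * 0 + 1 / 2 * (w j)\<^sup>2 * 0
      + 1 / 2 * w j ^ 3 * \<kappa> j j * (2 * (A + D j)\<^sup>2)"
    unfolding eq2 using i2 by (simp only: Bochner_Integration.integral_add Bochner_Integration.integrable_add
      integral_mult_right_zero q1 q2 q3 expectation_xi)
  also have "\<dots> = \<kappa> j j * w j * (w j * (A + D j))\<^sup>2" by algebra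
  finally show "expectation (\<lambda>\<omega>. leading_score D m A (UU \<omega>) * U j \<omega> * fit x m w (UU \<omega>) j) = \<kappa> j j * w j"
    by (simp add: wt_A)
qed

text \<open>
  The first two summands are of order \<open>1 / m\<close>: the effect of estimating \<open>A\<close> and of estimating \<open>\<beta>\<close>. The bracket is of
  order \<open>1 / m\<^sup>2\<close>.
\<close>

lemma deviation1_second_moment:
  "integrable M (\<lambda>\<omega>. (deviation1 m j (UU \<omega>))\<^sup>2)"
  "expectation (\<lambda>\<omega>. (deviation1 m j (UU \<omega>))\<^sup>2) = D j * (w j)\<^sup>2 * (1 / info m) / A + D j * w j * \<kappa> j j / A
    + (2 * (w j ^ 4 * (1 / info m)\<^sup>2) + 2 * (w j ^ 3 * \<kappa> j j * (1 / info m))) * D j / A"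
proof -
  define \<iota> where "\<iota> = 1 / info m"
  have \<iota>: "\<iota> * info m = 1" using info_pos[OF m] by (simp add: \<iota>_def)
  define \<sigma> where "\<sigma> = 1 / cox_sd D j A"
  have wp: "w j \<noteq> 0" "A \<noteq> 0" "D j \<noteq> 0" using wt_A(1)[of j] A_pos D_pos[of j] by auto
  have \<sigma>2: "\<sigma>\<^sup>2 * (D j * w j) = 1 / A"
    unfolding \<sigma>_def power_divide cox_sd_A using wp by (simp add: field_simps)
  let ?S = "\<lambda>\<omega>. leading_score D m A (UU \<omega>)" and ?t = "\<lambda>\<omega>. fit x m w (UU \<omega>) j"
  define c1 where "c1 = (\<sigma>\<^sup>2 * (D j * w j)) * D j * w j ^ 3 * \<iota>\<^sup>2"
  define c2 where "c2 = (\<sigma>\<^sup>2 * (D j * w j)) * D j * 2 * (w j)\<^sup>2 * \<iota>"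
  define c3 where "c3 = (\<sigma>\<^sup>2 * (D j * w j)) * D j * w j"
  have eq: "(deviation1 m j (UU \<omega>))\<^sup>2 = c1 * ((?S \<omega>)\<^sup>2 * (U j \<omega>)\<^sup>2) + c2 * (?S \<omega> * U j \<omega> * ?t \<omega>) + c3 * (?t \<omega> * ?t \<omega>)" for \<omega>
    unfolding deviation1_def step1_def \<iota>_def[symmetric] \<sigma>_def[symmetric] c1_def c2_def c3_def by algebra
  note i = integrable_mult_right[OF own_area_moments(1), of c1] integrable_mult_right[OF own_area_moments(3), of c2]
    integrable_mult_right[OF fit_moments(1)[of j], of c3]
  show "integrable M (\<lambda>\<omega>. (deviation1 m j (UU \<omega>))\<^sup>2)" unfolding eq by (intro Bochner_Integration.integrable_add i)
  have "expectation (\<lambda>\<omega>. (deviation1 m j (UU \<omega>))\<^sup>2) = c1 * ((A + D j) * info m + 2 * w j) + c2 * (\<kappa> j j * w j) + c3 * \<kappa> j j"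
    unfolding eq using i by (simp only: Bochner_Integration.integral_add Bochner_Integration.integrable_add
      integral_mult_right_zero own_area_moments fit_moments(2)[OF j])
  also have "\<dots> = (1 / A) * (D j * (w j)\<^sup>2 * \<iota> * ((w j * (A + D j)) * (\<iota> * info m)) + D j * w j * \<kappa> j j
      + (2 * (w j ^ 4 * \<iota>\<^sup>2) + 2 * (w j ^ 3 * \<kappa> j j * \<iota>)) * D j)"
    unfolding c1_def c2_def c3_def \<sigma>2 by algebra
  also have "\<dots> = D j * (w j)\<^sup>2 * \<iota> / A + D j * w j * \<kappa> j j / A + (2 * (w j ^ 4 * \<iota>\<^sup>2) + 2 * (w j ^ 3 * \<kappa> j j * \<iota>)) * D j / A"
    unfolding \<iota> wt_A(4) by (simp add: add_divide_distrib)
  finally show "expectation (\<lambda>\<omega>. (deviation1 m j (UU \<omega>))\<^sup>2) = D j * (w j)\<^sup>2 * (1 / info m) / A + D j * w j * \<kappa> j j / A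
    + (2 * (w j ^ 4 * (1 / info m)\<^sup>2) + 2 * (w j ^ 3 * \<kappa> j j * (1 / info m))) * D j / A" unfolding \<iota>_def .
qed

lemma coverage_approx_mean:
  "integrable M (\<lambda>\<omega>. coverage_approx z m j (UU \<omega>))"
  "expectation (\<lambda>\<omega>. coverage_approx z m j (UU \<omega>)) = Phi z - Phi (- z) + z * std_normal_density z *
    (cox_correction m j z - (2 * (w j ^ 4 * (1 / info m)\<^sup>2) + 2 * (w j ^ 3 * \<kappa> j j * (1 / info m))) * D j / A)"
proof -
  define \<iota> where "\<iota> = 1 / info m"
  have \<iota>: "\<iota> * info m = 1" using info_pos[OF m] by (simp add: \<iota>_def)
  define s where "s = sd_slope j"
  define p where "p = z * std_normal_density z"
  define q where "q = (2 * (s * w j + s\<^sup>2 * (1 / 2)) + z\<^sup>2 * s\<^sup>2) * \<iota>\<^sup>2"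
  let ?S = "\<lambda>\<omega>. leading_score D m A (UU \<omega>)"
  have eq: "coverage_approx z m j (UU \<omega>) = (Phi z - Phi (- z)) + p * (2 * s) * step2 m j (UU \<omega>) + (- p * q) * (?S \<omega>)\<^sup>2
      + (- p) * (deviation1 m j (UU \<omega>))\<^sup>2" for \<omega>
    unfolding coverage_approx_def step1_def \<iota>_def[symmetric] s_def[symmetric] p_def[symmetric] q_def by algebra
  note i = integrable_mult_right[OF step2_mean(1), of "p * (2 * s)"] integrable_mult_right[OF step1_moments(3), of "- p * q"]
    integrable_mult_right[OF deviation1_second_moment(1), of "- p"]
  have ic: "integrable M (\<lambda>\<omega>. Phi z - Phi (- z))" by simp
  show "integrable M (\<lambda>\<omega>. coverage_approx z m j (UU \<omega>))" unfolding eq by (intro Bochner_Integration.integrable_add i ic)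
  have tr: "trace_V_inv_sq D m A = 2 * info m"
    by (simp add: trace_V_inv_sq_def info_def wt_def power_divide)
  define rho where "rho = (2 * (w j ^ 4 * \<iota>\<^sup>2) + 2 * (w j ^ 3 * \<kappa> j j * \<iota>)) * D j / A"
  define Ai where "Ai = 1 / A"
  have "expectation (\<lambda>\<omega>. coverage_approx z m j (UU \<omega>)) = (Phi z - Phi (- z)) + p * (2 * s) * (l1 m j A * \<iota>) + (- p * q) * info m
      + (- p) * (D j * (w j)\<^sup>2 * \<iota> / A + D j * w j * \<kappa> j j / A + rho)"
    unfolding eq using i ic
    by (simp only: Bochner_Integration.integral_add Bochner_Integration.integrable_add integral_mult_right_zero
      step2_mean step1_moments deviation1_second_moment rho_def \<iota>_def) (simp add: prob_space)
  also have "\<dots> = Phi z - Phi (- z) + p * (cox_correction m j z - rho)"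
  proof -
    have s: "s = D j * w j * Ai / 2" by (simp add: s_def sd_slope_def Ai_def)
    have qi: "q * info m = (2 * (s * w j + s\<^sup>2 * (1 / 2)) + z\<^sup>2 * s\<^sup>2) * \<iota> * (\<iota> * info m)" unfolding q_def by algebra
    have cc: "cox_correction m j z = - (\<iota> / 2) * (4 * D j * Ai * (w j)\<^sup>2 + (1 + z\<^sup>2) * (D j)\<^sup>2 * Ai\<^sup>2 * (w j)\<^sup>2 / 2)
        - D j * Ai * w j * \<kappa> j j + \<iota> * (D j * Ai * w j) * l1 m j A"
    proof -
      have t: "4 * D j / (A * (A + D j)\<^sup>2) = 4 * D j * Ai * (w j)\<^sup>2"
        "(1 + z\<^sup>2) * (D j)\<^sup>2 / (2 * A\<^sup>2 * (A + D j)\<^sup>2) = (1 + z\<^sup>2) * (D j)\<^sup>2 * Ai\<^sup>2 * (w j)\<^sup>2 / 2"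
        "D j / (A * (A + D j)) = D j * Ai * w j" "1 / (2 * info m) = \<iota> / 2" "2 / (2 * info m) = \<iota>"
        by (simp_all add: Ai_def wt_def power_divide \<iota>_def)
      show ?thesis unfolding cox_correction_def tr t ..
    qed
    have "p * (2 * s) * (l1 m j A * \<iota>) + (- p * q) * info m + (- p) * (D j * (w j)\<^sup>2 * \<iota> / A + D j * w j * \<kappa> j j / A + rho)
        = p * (2 * s * (l1 m j A * \<iota>) - q * info m - (D j * (w j)\<^sup>2 * \<iota> * Ai + D j * w j * \<kappa> j j * Ai + rho))"
      unfolding Ai_def by (simp add: algebra_simps)
    also have "2 * s * (l1 m j A * \<iota>) - q * info m - (D j * (w j)\<^sup>2 * \<iota> * Ai + D j * w j * \<kappa> j j * Ai + rho) = cox_correction m j z - rho"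
      unfolding qi \<iota> cc s by (simp add: field_simps power2_eq_square)
    finally show ?thesis by simp
  qed
  finally show "expectation (\<lambda>\<omega>. coverage_approx z m j (UU \<omega>)) = Phi z - Phi (- z) + z * std_normal_density z *
    (cox_correction m j z - (2 * (w j ^ 4 * (1 / info m)\<^sup>2) + 2 * (w j ^ 3 * \<kappa> j j * (1 / info m))) * D j / A)"
    unfolding p_def rho_def \<iota>_def .
qed

lemma covariance_wls:
  assumes y: "\<And>k \<omega>. y k \<omega> = x k \<bullet> b + U k \<omega>"
  shows "x i \<bullet> (covariance_matrix M (\<lambda>\<omega>. wls x m (\<lambda>k. 1 / (A + D k)) (\<lambda>k. y k \<omega>)) *v x i) = \<kappa> i i"
proof -
  define g where "g k a = w k * (matrix_inv (gram x m w) *v x k) $ a" for k a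
  have wf: "(\<lambda>k. 1 / (A + D k)) = w" by (simp add: wt_def[abs_def])
  have iU: "integrable M (U k)" for k using integrable_U_power[of k 1] by simp
  have yf: "(\<lambda>k. y k \<omega>) = (\<lambda>k. x k \<bullet> b + U k \<omega>)" for \<omega> using y by auto
  have comp: "wls x m w (\<lambda>k. y k \<omega>) $ a = b $ a + (\<Sum>k<m. g k a * U k \<omega>)" for a \<omega>
  proof -
    have "wls x m w (\<lambda>k. y k \<omega>) = b + wls x m w (\<lambda>k. U k \<omega>)"
      unfolding yf by (rule wls_add_fixed) (rule wt_A)
    then show ?thesis
      by (simp add: wls_def g_def matrix_vector_mult_scaleR linear_sum[OF matrix_vector_mul_linear] mult_ac)
  qed
  have mean: "expectation (\<lambda>\<omega>. wls x m w (\<lambda>k. y k \<omega>) $ a) = b $ a" for a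
  proof -
    have "expectation (\<lambda>\<omega>. \<Sum>k<m. g k a * U k \<omega>) = 0"
      by (subst Bochner_Integration.integral_sum, intro integrable_mult_right iU)
         (simp only: integral_mult_right_zero expectation_U mult_zero_right sum.neutral_const)
    moreover have "integrable M (\<lambda>\<omega>. \<Sum>k<m. g k a * U k \<omega>)"
      by (intro Bochner_Integration.integrable_sum integrable_mult_right iU)
    ultimately show ?thesis unfolding comp by (simp add: prob_space)
  qed
  have cov: "covariance_matrix M (\<lambda>\<omega>. wls x m w (\<lambda>k. y k \<omega>)) $ a $ c = (\<Sum>k<m. g k a * g k c * (A + D k))" for a c
  proof -
    have "covariance_matrix M (\<lambda>\<omega>. wls x m w (\<lambda>k. y k \<omega>)) $ a $ c
      = expectation (\<lambda>\<omega>. (\<Sum>k<m. g k a * U k \<omega>) * (\<Sum>k<m. g k c * U k \<omega>))"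
      unfolding covariance_matrix_def by (simp add: mean) (simp add: comp)
    also have "\<dots> = (\<Sum>k<m. g k a * g k c * (A + D k))" by (rule U_bilinear)
    finally show ?thesis .
  qed
  have g: "(\<Sum>a\<in>UNIV. x i $ a * g k a) = w k * \<kappa> i k" for k
    by (simp add: g_def gkernel_def inner_vec_def sum_distrib_left mult_ac)
  have "x i \<bullet> (covariance_matrix M (\<lambda>\<omega>. wls x m w (\<lambda>k. y k \<omega>)) *v x i)
      = (\<Sum>a\<in>UNIV. \<Sum>c\<in>UNIV. \<Sum>k<m. (A + D k) * ((x i $ a * g k a) * (x i $ c * g k c)))"
    by (simp add: inner_vec_def matrix_vector_mult_def cov sum_distrib_left sum_distrib_right mult_ac)
  also have "\<dots> = (\<Sum>k<m. \<Sum>a\<in>UNIV. \<Sum>c\<in>UNIV. (A + D k) * ((x i $ a * g k a) * (x i $ c * g k c)))"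
    by (simp only: sum.swap[of _ "{..<m}" UNIV])
  also have "\<dots> = (\<Sum>k<m. (A + D k) * ((\<Sum>a\<in>UNIV. x i $ a * g k a) * (\<Sum>c\<in>UNIV. x i $ c * g k c)))"
    unfolding sum_product unfolding sum_distrib_left ..
  also have "\<dots> = (\<Sum>k<m. w k * (\<kappa> k i * \<kappa> k i))"
  proof (intro sum.cong refl)
    fix k
    have "(A + D k) * (w k * \<kappa> i k * (w k * \<kappa> i k)) = w k * (w k * (A + D k)) * (\<kappa> i k * \<kappa> i k)" by algebra
    then show "(A + D k) * ((\<Sum>a\<in>UNIV. x i $ a * g k a) * (\<Sum>c\<in>UNIV. x i $ c * g k c)) = w k * (\<kappa> k i * \<kappa> k i)"
      unfolding g using gkernel_sym[of w i k] wt_A(1) by (simp add: wt_A(4))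
  qed
  also have "\<dots> = \<kappa> i i" using wt_A(1) by (intro gkernel_reproducing)
  finally show ?thesis unfolding wf .
qed

end

lemma inverse_m_squared_le:
  assumes "m\<^sub>1 \<le> m"
  shows "1 / (real m)\<^sup>2 \<le> real m powr (- 3 / 2)"
proof -
  have "real m powr - 2 \<le> real m powr (- 3 / 2)" using m_pos(1)[OF assms] by (intro powr_mono) auto
  moreover have "real m powr - 2 = 1 / (real m)\<^sup>2" using m_pos(1)[OF assms] by (simp add: powr_minus divide_inverse powr_numeral)
  ultimately show ?thesis by simp
qed

lemma expected_coverage:
  obtains C where "0 \<le> C" and "\<And>m j. m\<^sub>1 \<le> m \<Longrightarrow> j < m \<Longrightarrow>
    (\<lambda>\<omega>. if good m (\<lambda>k. U k \<omega>) then coverage z m j (\<lambda>k. U k \<omega>) else 0) \<in> borel_measurable M \<Longrightarrow>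
    \<bar>expectation (\<lambda>\<omega>. if good m (\<lambda>k. U k \<omega>) then coverage z m j (\<lambda>k. U k \<omega>) else 0)
      - (Phi z - Phi (- z) + z * std_normal_density z * cox_correction m j z)\<bar> \<le> C * real m powr (- 3 / 2)"
proof -
  obtain C1 where C1: "0 \<le> C1" "\<And>m j u. m\<^sub>1 \<le> m \<Longrightarrow> j < m \<Longrightarrow>
    \<bar>(if good m u then coverage z m j u else 0) - coverage_approx z m j u\<bar>
      \<le> C1 * (W m u ^ 3 * (1 + \<bar>u j\<bar>) ^ 3) * real m powr (- 3 / 2)"
    by (rule coverage_approx_error) (rule that, assumption+)
  obtain C2 where C2: "0 \<le> C2" "\<And>m j. m\<^sub>1 \<le> m \<Longrightarrow> integrable M (\<lambda>\<omega>. W m (\<lambda>k. U k \<omega>) ^ 3 * (1 + \<bar>U j \<omega>\<bar>) ^ 3) \<and>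
    expectation (\<lambda>\<omega>. W m (\<lambda>k. U k \<omega>) ^ 3 * (1 + \<bar>U j \<omega>\<bar>) ^ 3) \<le> C2"
    by (rule fluctuation_weight_moment) (rule that, assumption+)
  have "bdd (\<lambda>_ _. True) (\<lambda>m j u. 1 / info m) 0 (- 2) 0" by (rule bdd_inverse_info)
  then obtain C3 where C3: "0 \<le> C3" "\<And>m j u. m\<^sub>1 \<le> m \<Longrightarrow> j < m \<Longrightarrow> True \<Longrightarrow>
    \<bar>1 / info m\<bar> \<le> C3 * (W m u ^ 0 * sqrt (real m) powi (- 2) * (1 + \<bar>u j\<bar>) ^ 0)" by (rule bddE) (rule that, assumption+)
  define q where "q = 1 / d\<^sub>0"
  define B where "B = (2 * (q ^ 4 * C3\<^sup>2) + 2 * (q ^ 3 * ((A + d\<^sub>1) * cq) * C3)) * d\<^sub>1 / A"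
  define C where "C = C1 * C2 + \<bar>z * std_normal_density z\<bar> * B"
  have q: "0 < q" using d0_pos by (simp add: q_def)
  have B: "0 \<le> B" using q C3(1) A_pos d1_pos cq_nonneg by (simp add: B_def)
  show ?thesis
  proof (rule that[of C])
    show "0 \<le> C" using C1(1) C2(1) B by (simp add: C_def)
    fix m j assume m: "m\<^sub>1 \<le> m" and j: "j < m"
    let ?U = "\<lambda>\<omega> k. U k \<omega>"
    let ?c = "\<lambda>\<omega>. if good m (?U \<omega>) then coverage z m j (?U \<omega>) else 0"
    let ?a = "\<lambda>\<omega>. coverage_approx z m j (?U \<omega>)"
    let ?r = "real m powr (- 3 / 2)"
    let ?g = "\<lambda>\<omega>. C1 * (W m (?U \<omega>) ^ 3 * (1 + \<bar>U j \<omega>\<bar>) ^ 3) * ?r"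
    assume meas: "?c \<in> borel_measurable M"
    note ia = coverage_approx_mean(1)[OF m j, of z]
    have ig: "integrable M ?g" using C2(2)[OF m, of j] by (intro integrable_mult_left integrable_mult_right) auto
    have le: "\<bar>?c \<omega> - ?a \<omega>\<bar> \<le> ?g \<omega>" for \<omega> by (rule C1(2)[OF m j])
    have id: "integrable M (\<lambda>\<omega>. ?c \<omega> - ?a \<omega>)"
    proof (rule Bochner_Integration.integrable_bound[OF ig])
      show "(\<lambda>\<omega>. ?c \<omega> - ?a \<omega>) \<in> borel_measurable M" using meas borel_measurable_integrable[OF ia] by (rule borel_measurable_diff)
      show "AE \<omega> in M. norm (?c \<omega> - ?a \<omega>) \<le> norm (?g \<omega>)"
        by (rule AE_I2, unfold real_norm_def) (rule order.trans[OF le abs_ge_self])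
    qed
    have "integrable M (\<lambda>\<omega>. (?c \<omega> - ?a \<omega>) + ?a \<omega>)" by (rule Bochner_Integration.integrable_add[OF id ia])
    then have ic: "integrable M ?c" by simp
    have "\<bar>expectation ?c - expectation ?a\<bar> = \<bar>expectation (\<lambda>\<omega>. ?c \<omega> - ?a \<omega>)\<bar>"
      by (simp only: Bochner_Integration.integral_diff[OF ic ia])
    also have "\<dots> \<le> expectation (\<lambda>\<omega>. \<bar>?c \<omega> - ?a \<omega>\<bar>)" by (rule integral_abs_bound)
    also have "\<dots> \<le> expectation ?g" by (rule integral_mono[OF integrable_abs[OF id] ig le])
    also have "\<dots> = C1 * expectation (\<lambda>\<omega>. W m (?U \<omega>) ^ 3 * (1 + \<bar>U j \<omega>\<bar>) ^ 3) * ?r"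
      by (simp only: integral_mult_left_zero integral_mult_right_zero)
    also have "\<dots> \<le> C1 * C2 * ?r"
      using C2(2)[OF m, of j] C1(1) by (intro mult_right_mono mult_left_mono) auto
    finally have 1: "\<bar>expectation ?c - expectation ?a\<bar> \<le> C1 * C2 * ?r" .
    let ?R = "(2 * (wt D A j ^ 4 * (1 / info m)\<^sup>2) + 2 * (wt D A j ^ 3 * gkernel x m (wt D A) j j * (1 / info m))) * D j / A"
    have inf: "\<bar>1 / info m\<bar> \<le> C3 * (1 / real m)" using C3(2)[OF m j TrueI, of "\<lambda>_. 0"] unfolding sqrt_powi(2)[OF m] by simp
    have inf': "0 \<le> 1 / info m" "1 / info m \<le> C3 * (1 / real m)" using info_pos[OF m] inf by auto
    have wq: "wt D A j ^ n \<le> q ^ n" for n using wt_A(1,2)[of j] unfolding q_def by (intro power_mono) auto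
    have w0: "0 \<le> wt D A j" using wt_A(1)[of j] by simp
    have k: "0 \<le> gkernel x m (wt D A) j j" "gkernel x m (wt D A) j j \<le> (A + d\<^sub>1) * (cq / real m)"
      using gkernel_diag_nonneg[OF m_pos(2)[OF m], of A j] gkernel_le[OF m_pos(2)[OF m] j j, of A] A_pos by auto
    have "?R \<le> (2 * (q ^ 4 * (C3 * (1 / real m))\<^sup>2) + 2 * (q ^ 3 * ((A + d\<^sub>1) * (cq / real m)) * (C3 * (1 / real m)))) * d\<^sub>1 / A"
      using A_pos D_pos[of j] D_le[of j] q w0 k inf' C3(1) cq_nonneg d1_pos
      by (intro divide_right_mono mult_mono add_mono power_mono wq mult_nonneg_nonneg add_nonneg_nonneg) auto
    also have "\<dots> = B * (1 / (real m)\<^sup>2)" 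
    proof -
      define r where "r = 1 / real m"
      have "(2 * (q ^ 4 * (C3 * r)\<^sup>2) + 2 * (q ^ 3 * ((A + d\<^sub>1) * (cq * r)) * (C3 * r))) * d\<^sub>1
          = (2 * (q ^ 4 * C3\<^sup>2) + 2 * (q ^ 3 * ((A + d\<^sub>1) * cq) * C3)) * d\<^sub>1 * r\<^sup>2" by algebra
      moreover have "cq / real m = cq * r" "1 / (real m)\<^sup>2 = r\<^sup>2" by (simp_all add: r_def power_divide)
      ultimately show ?thesis unfolding B_def r_def[symmetric] by simp
    qed
    also have "\<dots> \<le> B * ?r" by (intro mult_left_mono inverse_m_squared_le m B)
    finally have R: "?R \<le> B * ?r" .
    have R0: "0 \<le> ?R" using A_pos D_pos[of j] w0 k inf' by (intro divide_nonneg_nonneg mult_nonneg_nonneg add_nonneg_nonneg) auto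
    define t where "t = Phi z - Phi (- z) + z * std_normal_density z * cox_correction m j z"
    have "expectation ?a - t = - (z * std_normal_density z) * ?R"
      unfolding coverage_approx_mean(2)[OF m j] t_def right_diff_distrib by simp
    then have "\<bar>expectation ?a - t\<bar> = \<bar>z * std_normal_density z\<bar> * ?R" using R0 by (simp only: abs_mult abs_minus_cancel abs_of_nonneg)
    also have "\<dots> \<le> \<bar>z * std_normal_density z\<bar> * (B * ?r)" by (intro mult_left_mono R) simp
    finally have 2: "\<bar>expectation ?a - t\<bar> \<le> \<bar>z * std_normal_density z\<bar> * B * ?r" by simp
    have "\<bar>expectation ?c - t\<bar> \<le> C1 * C2 * ?r + \<bar>z * std_normal_density z\<bar> * B * ?r" using 1 2 by linarith
    also have "\<dots> = C * ?r" by (simp add: C_def distrib_right)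
    finally show "\<bar>expectation ?c - (Phi z - Phi (- z) + z * std_normal_density z * cox_correction m j z)\<bar> \<le> C * ?r" unfolding t_def .
  qed
qed

text \<open>Markov's inequality for the fourth power of \<open>W\<close>.\<close>

lemma prob_not_good:
  obtains C where "0 \<le> C" "\<And>m. m\<^sub>1 \<le> m \<Longrightarrow> prob {\<omega> \<in> space M. \<not> good m (\<lambda>k. U k \<omega>)} \<le> C * real m powr (- 3 / 2)"
proof -
  obtain C where C: "\<And>m. m\<^sub>1 \<le> m \<Longrightarrow> integrable M (\<lambda>\<omega>. W m (\<lambda>k. U k \<omega>) ^ 4) \<and>
    expectation (\<lambda>\<omega>. W m (\<lambda>k. U k \<omega>) ^ 4) \<le> C" using W_fourth_moment by blast
  show ?thesis
  proof (rule that[of "\<bar>C\<bar> / \<eta> ^ 4"])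
    show "0 \<le> \<bar>C\<bar> / \<eta> ^ 4" using eta by simp
    fix m assume m: "m\<^sub>1 \<le> m"
    let ?f = "\<lambda>\<omega>. W m (\<lambda>k. U k \<omega>) ^ 4" and ?c = "\<eta> ^ 4 * (real m)\<^sup>2"
    have mp: "0 < real m" using m_pos(1)[OF m] by simp
    have c: "0 < ?c" using eta mp by simp
    have Wm: "(\<lambda>\<omega>. W m (\<lambda>k. U k \<omega>)) \<in> borel_measurable M" by (rule measurable_compose[OF measurable_U measurable_W])
    have s4: "(\<eta> * sqrt (real m)) ^ 4 = ?c"
    proof -
      have "(\<eta> * sqrt (real m)) ^ 4 = \<eta> ^ 4 * ((sqrt (real m))\<^sup>2)\<^sup>2" by algebra
      then show ?thesis by simp
    qed
    have "{\<omega> \<in> space M. \<not> good m (\<lambda>k. U k \<omega>)} \<subseteq> {\<omega> \<in> space M. ?c \<le> ?f \<omega>}"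
    proof safe
      fix \<omega> assume "\<not> good m (\<lambda>k. U k \<omega>)"
      then have "\<eta> * sqrt (real m) \<le> W m (\<lambda>k. U k \<omega>)" by (simp add: good_def)
      then have "(\<eta> * sqrt (real m)) ^ 4 \<le> ?f \<omega>" using eta by (intro power_mono) auto
      then show "?c \<le> ?f \<omega>" unfolding s4 .
    qed
    moreover have "{\<omega> \<in> space M. ?c \<le> ?f \<omega>} \<in> sets M" using Wm by measurable
    ultimately have "prob {\<omega> \<in> space M. \<not> good m (\<lambda>k. U k \<omega>)} \<le> prob {\<omega> \<in> space M. ?c \<le> ?f \<omega>}"
      by (intro finite_measure_mono)
    also have "\<dots> \<le> expectation ?f / ?c"
      by (rule integral_Markov_inequality_measure[where A = "{}"]) (use C[OF m] c in auto)
    also have "\<dots> \<le> \<bar>C\<bar> / ?c" using C[OF m] c by (intro divide_right_mono) auto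
    also have "\<dots> = \<bar>C\<bar> / \<eta> ^ 4 * (1 / (real m)\<^sup>2)" by simp
    also have "\<dots> \<le> \<bar>C\<bar> / \<eta> ^ 4 * real m powr (- 3 / 2)"
      using eta by (intro mult_left_mono inverse_m_squared_le m) auto
    finally show "prob {\<omega> \<in> space M. \<not> good m (\<lambda>k. U k \<omega>)} \<le> \<bar>C\<bar> / \<eta> ^ 4 * real m powr (- 3 / 2)" .
  qed
qed

end

section \<open>Measurability and conditioning on the observations\<close>

lemma wls_cong:
  assumes "\<And>k. k < m \<Longrightarrow> c k = c' k" "\<And>k. k < m \<Longrightarrow> u k = u' k"
  shows "wls x m c u = wls x m c' u'"
proof -
  have "gram x m c = gram x m c'" unfolding gram_def using assms by simp
  moreover have "(\<Sum>j<m. (c j * u j) *\<^sub>R x j) = (\<Sum>j<m. (c' j * u' j) *\<^sub>R x j)" using assms by (intro sum.cong refl) simp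
  ultimately show ?thesis by (simp add: wls_def)
qed

lemma measurable_det:
  fixes F :: "'b \<Rightarrow> real ^ 'n ^ 'n"
  assumes "\<And>i j. (\<lambda>\<omega>. F \<omega> $ i $ j) \<in> borel_measurable N"
  shows "(\<lambda>\<omega>. det (F \<omega>)) \<in> borel_measurable N"
  unfolding det_def by (intro borel_measurable_sum borel_measurable_times borel_measurable_prod assms borel_measurable_const)

text \<open>By Cramer's rule; where the Gram matrix is singular, \<open>matrix_inv\<close> is a fixed arbitrary matrix.\<close>

lemma measurable_wls:
  fixes x :: "nat \<Rightarrow> real ^ 'p"
  assumes [measurable]: "\<And>k. (\<lambda>\<omega>. c k \<omega>) \<in> borel_measurable N" "\<And>k. (\<lambda>\<omega>. u k \<omega>) \<in> borel_measurable N"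
  shows "(\<lambda>\<omega>. b \<bullet> wls x m (\<lambda>k. c k \<omega>) (\<lambda>k. u k \<omega>)) \<in> borel_measurable N"
proof -
  define G where "G \<omega> = gram x m (\<lambda>k. c k \<omega>)" for \<omega>
  define s where "s \<omega> = (\<Sum>k<m. (c k \<omega> * u k \<omega>) *\<^sub>R x k)" for \<omega>
  define N0 :: "real ^ 'p ^ 'p" where "N0 = (SOME A'. False)"
  have G: "(\<lambda>\<omega>. G \<omega> $ i $ j) \<in> borel_measurable N" for i j unfolding G_def gram_def by simp
  have s: "(\<lambda>\<omega>. s \<omega> $ i) \<in> borel_measurable N" for i unfolding s_def by simp
  have d: "(\<lambda>\<omega>. det (G \<omega>)) \<in> borel_measurable N" by (rule measurable_det[OF G])
  have d': "(\<lambda>\<omega>. det (\<chi> i j. if j = k then s \<omega> $ i else G \<omega> $ i $ j)) \<in> borel_measurable N" for k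
  proof (rule measurable_det)
    fix i j show "(\<lambda>\<omega>. (\<chi> i j. if j = k then s \<omega> $ i else G \<omega> $ i $ j) $ i $ j) \<in> borel_measurable N"
      using G s by (cases "j = k") auto
  qed
  have sing: "matrix_inv B = N0" if "det B = 0" for B :: "real ^ 'p ^ 'p"
  proof -
    have "\<not> invertible B" using that by (simp add: invertible_det_nz)
    then have "(\<lambda>A'. B ** A' = mat 1 \<and> A' ** B = mat 1) = (\<lambda>A'. False)" unfolding invertible_def by auto
    then show ?thesis unfolding matrix_inv_def N0_def by simp
  qed
  have reg: "matrix_inv B *v t = (\<chi> k. det (\<chi> i j. if j = k then t $ i else B $ i $ j) / det B)" if "det B \<noteq> 0"
    for B :: "real ^ 'p ^ 'p" and t
  proof -
    have inv: "invertible B" using that by (simp add: invertible_det_nz)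
    have "B ** matrix_inv B = mat 1"
      using someI_ex[OF inv[unfolded invertible_def]] unfolding matrix_inv_def by blast
    then have "B *v (matrix_inv B *v t) = t" by (simp add: matrix_vector_mul_assoc)
    then show ?thesis using cramer[OF that] by blast
  qed
  have eq: "(matrix_inv (G \<omega>) *v s \<omega>) $ k = (if det (G \<omega>) = 0 then (\<Sum>j\<in>UNIV. N0 $ k $ j * s \<omega> $ j)
      else det (\<chi> i j. if j = k then s \<omega> $ i else G \<omega> $ i $ j) / det (G \<omega>))" for \<omega> k
  proof (cases "det (G \<omega>) = 0")
    case True
    then show ?thesis by (simp add: sing matrix_vector_mult_def)
  next
    case False
    then show ?thesis by (simp add: reg)
  qed
  have comp: "(\<lambda>\<omega>. (matrix_inv (G \<omega>) *v s \<omega>) $ k) \<in> borel_measurable N" for k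
    unfolding eq using d d'[of k] s by measurable
  have "b \<bullet> wls x m (\<lambda>k. c k \<omega>) (\<lambda>k. u k \<omega>) = (\<Sum>k\<in>UNIV. b $ k * (matrix_inv (G \<omega>) *v s \<omega>) $ k)" for \<omega>
    by (simp add: wls_def G_def s_def inner_vec_def)
  then show ?thesis using comp by simp
qed

lemma measurable_EB_predictor:
  assumes "\<And>k. (\<lambda>\<omega>. a k \<omega>) \<in> borel_measurable N" "\<And>k. (\<lambda>\<omega>. y k \<omega>) \<in> borel_measurable N"
  shows "(\<lambda>\<omega>. EB_predictor x D m i (\<lambda>k. a k \<omega>) (\<lambda>k. y k \<omega>)) \<in> borel_measurable N"
proof -
  have "(\<lambda>\<omega>. x i \<bullet> wls x m (\<lambda>j. 1 / (a j \<omega> + D j)) (\<lambda>k. y k \<omega>)) \<in> borel_measurable N"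
    using assms by (intro measurable_wls) auto
  then show ?thesis unfolding EB_predictor_def Let_def using assms(1)[of i] assms(2)[of i] by measurable
qed

lemma measurable_cox_sd:
  assumes "a \<in> borel_measurable N"
  shows "(\<lambda>\<omega>. cox_sd D i (a \<omega>)) \<in> borel_measurable N"
  unfolding cox_sd_def using assms by measurable

lemma measurable_Phi: "Phi \<in> borel_measurable borel"
  by (intro borel_measurable_continuous_onI continuous_at_imp_continuous_on ballI DERIV_isCont[OF DERIV_Phi])

context fay_herriot_normal
begin

lemma measurable_good: "{u \<in> space reals. good m u} \<in> sets reals" "Measurable.pred reals (good m)"
proof -
  show "Measurable.pred reals (good m)" unfolding good_def using measurable_W[of m] by measurable
  then show "{u \<in> space reals. good m u} \<in> sets reals" by (simp add: pred_def)
qed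

text \<open>The root, extended by the true variance to a function of all observations and areas.\<close>

definition local_estimate :: "nat \<Rightarrow> nat \<Rightarrow> (nat \<Rightarrow> real) \<Rightarrow> real"
  where "local_estimate m j u = (if good m u \<and> j < m then root m j u else A)"

lemma local_estimate_pos: "m\<^sub>1 \<le> m \<Longrightarrow> 0 < local_estimate m j u"
  using root_pos(3)[of m u j] A_pos by (simp add: local_estimate_def)

lemma measurable_local_estimate: assumes m: "m\<^sub>1 \<le> m" shows "(\<lambda>u. local_estimate m j u) \<in> borel_measurable reals"
proof (cases "j < m")
  case True
  show ?thesis
  proof (rule borel_measurableI_le)
    fix t
    have le: "root m j u \<le> t \<longleftrightarrow> A + \<epsilon> < t \<or> (A - \<epsilon> \<le> t \<and> t \<le> A + \<epsilon> \<and> adj_score m j t u \<le> 0)" if "good m u" for u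
    proof -
      have r: "A - \<epsilon> \<le> root m j u" "root m j u \<le> A + \<epsilon>" using root(1)[OF m that True] by (simp_all add: abs_le_iff)
      show ?thesis
      proof (cases "A - \<epsilon> \<le> t \<and> t \<le> A + \<epsilon>")
        case t: True
        then have "\<bar>t - A\<bar> \<le> \<epsilon>" by (simp add: abs_le_iff)
        from root_le_iff[OF m that True this] t show ?thesis by auto
      qed (use r in auto)
    qed
    have "{u \<in> space reals. local_estimate m j u \<le> t} = {u \<in> space reals.
        (good m u \<and> (A + \<epsilon> < t \<or> (A - \<epsilon> \<le> t \<and> t \<le> A + \<epsilon> \<and> adj_score m j t u \<le> 0))) \<or> (\<not> good m u \<and> A \<le> t)}"
      using le True by (auto simp: local_estimate_def)
    also have "\<dots> \<in> sets reals" using measurable_good(2)[of m] measurable_adj_score[of m j t] by measurable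
    finally show "{u \<in> space reals. local_estimate m j u \<le> t} \<in> sets reals" .
  qed
qed (simp add: local_estimate_def)

lemma fit_local_estimate:
  "good m u \<Longrightarrow> x j \<bullet> wls x m (\<lambda>k. 1 / (local_estimate m k u + D k)) u = fit x m (root_wt m u) u j"
  unfolding fit_def by (intro arg_cong[where f = "\<lambda>b. x j \<bullet> b"] wls_cong) (simp_all add: local_estimate_def root_wt_def)

lemma measurable_deviation:
  assumes m: "m\<^sub>1 \<le> m" "j < m"
  shows "(\<lambda>u. if good m u then deviation m j u else 0) \<in> borel_measurable reals"
    "(\<lambda>u. if good m u then sd_ratio m j u else 0) \<in> borel_measurable reals"
proof -
  note e = measurable_local_estimate[OF m(1)]
  have w: "(\<lambda>u. x j \<bullet> wls x m (\<lambda>k. 1 / (local_estimate m k u + D k)) (\<lambda>k. u k)) \<in> borel_measurable reals"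
  proof (rule measurable_wls)
    fix k
    show "(\<lambda>u. 1 / (local_estimate m k u + D k)) \<in> borel_measurable reals" using e[of k] by measurable
  qed measurable
  have c: "(\<lambda>u :: nat \<Rightarrow> real. u j) \<in> borel_measurable reals" by measurable
  have eq: "(\<lambda>u. if good m u then deviation m j u else 0) = (\<lambda>u. if good m u then
      (D j * (wt D A j - 1 / (local_estimate m j u + D j)) * u j + D j * (1 / (local_estimate m j u + D j)) *
        (x j \<bullet> wls x m (\<lambda>k. 1 / (local_estimate m k u + D k)) (\<lambda>k. u k))) * (1 / cox_sd D j A) else 0)"
    using fit_local_estimate m(2) by (auto simp: fun_eq_iff deviation_def wt_def local_estimate_def)
  show "(\<lambda>u. if good m u then deviation m j u else 0) \<in> borel_measurable reals"
    unfolding eq using w c e[of j] measurable_good(2)[of m] by measurable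
  have eq: "(\<lambda>u. if good m u then sd_ratio m j u else 0) =
      (\<lambda>u. if good m u then cox_sd D j (local_estimate m j u) / cox_sd D j A else 0)"
    using m(2) by (auto simp: fun_eq_iff sd_ratio_def local_estimate_def)
  show "(\<lambda>u. if good m u then sd_ratio m j u else 0) \<in> borel_measurable reals"
    unfolding eq using measurable_cox_sd[OF e[of j], of D j] measurable_good(2)[of m] by measurable
qed

lemma measurable_coverage:
  assumes m: "m\<^sub>1 \<le> m" "j < m"
  shows "(\<lambda>u. if good m u then coverage z m j u else 0) \<in> borel_measurable reals"
proof -
  let ?d = "\<lambda>u. if good m u then deviation m j u else 0" and ?s = "\<lambda>u. if good m u then sd_ratio m j u else 0"
  have f: "(\<lambda>u. Phi (?d u + z * ?s u)) \<in> borel_measurable reals" "(\<lambda>u. Phi (?d u - z * ?s u)) \<in> borel_measurable reals"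
    using measurable_deviation[OF m] by (intro measurable_compose[OF _ measurable_Phi]; measurable)+
  have "(\<lambda>u. if good m u then coverage z m j u else 0)
      = (\<lambda>u. if good m u then Phi (?d u + z * ?s u) - Phi (?d u - z * ?s u) else 0)"
    by (auto simp: fun_eq_iff coverage_def)
  then show ?thesis
    by (simp only:) (rule measurable_If[OF borel_measurable_diff[OF f] borel_measurable_const measurable_good(1)])
qed

text \<open>
  The standardised error \<open>R\<close> of the best predictor is independent of all observations, so that conditionally on the
  observations the coverage probability is the probability of an interval under the standard normal distribution.
\<close>

lemma coverage_probability:
  assumes m: "m\<^sub>1 \<le> m" "j < m" and z: "0 \<le> z"
    and R: "indep_pair borel R reals (\<lambda>\<omega> k. U k \<omega>)" "distr M borel R = std_normal_distribution"
  shows "prob {\<omega> \<in> space M. good m (\<lambda>k. U k \<omega>) \<and> \<bar>R \<omega> - deviation m j (\<lambda>k. U k \<omega>)\<bar> \<le> z * sd_ratio m j (\<lambda>k. U k \<omega>)}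
    = expectation (\<lambda>\<omega>. if good m (\<lambda>k. U k \<omega>) then coverage z m j (\<lambda>k. U k \<omega>) else 0)" (is "prob ?E = expectation ?c")
proof -
  let ?U = "\<lambda>\<omega> k. U k \<omega>"
  let ?d = "\<lambda>u. if good m u then deviation m j u else 0" and ?s = "\<lambda>u. if good m u then sd_ratio m j u else 0"
  note d = measurable_deviation[OF m]
  have Rm[measurable]: "R \<in> borel_measurable M" using R(1) by (simp add: indep_pair_def)
  interpret N: real_distribution std_normal_distribution by (rule real_dist_normal_dist)
  interpret Q: prob_space "distr M reals ?U" by (rule prob_space_distr[OF measurable_U])
  interpret P: pair_sigma_finite std_normal_distribution "distr M reals ?U" ..
  \<comment> \<open>The event as a set of pairs of \<open>R\<close> and the observations; its sections for fixed observations are intervals.\<close>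
  define S where "S = {p \<in> space (borel \<Otimes>\<^sub>M reals). good m (snd p) \<and> \<bar>fst p - ?d (snd p)\<bar> \<le> z * ?s (snd p)}"
  have S: "S \<in> sets (borel \<Otimes>\<^sub>M reals)"
  proof -
    have "(\<lambda>p. ?d (snd p)) \<in> borel_measurable (borel \<Otimes>\<^sub>M reals)" "(\<lambda>p. ?s (snd p)) \<in> borel_measurable (borel \<Otimes>\<^sub>M reals)"
      "Measurable.pred (borel \<Otimes>\<^sub>M reals) (\<lambda>p. good m (snd p))"
      using d measurable_good(2)[of m] by (auto intro: measurable_compose[OF measurable_snd])
    then show ?thesis unfolding S_def by measurable
  qed
  have RU: "(\<lambda>\<omega>. (R \<omega>, ?U \<omega>)) \<in> measurable M (borel \<Otimes>\<^sub>M reals)" using measurable_U by measurable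
  have E: "?E = (\<lambda>\<omega>. (R \<omega>, ?U \<omega>)) -` S \<inter> space M"
    using measurable_space[OF RU] by (auto simp: S_def space_pair_measure)
  have c01: "0 \<le> ?c \<omega>" "?c \<omega> \<le> 1" for \<omega>
  proof -
    have "0 \<le> sd_ratio m j (?U \<omega>)" if "good m (?U \<omega>)" using sd_ratio_nonneg[OF m that] .
    then have le: "deviation m j (?U \<omega>) - z * sd_ratio m j (?U \<omega>) \<le> deviation m j (?U \<omega>) + z * sd_ratio m j (?U \<omega>)"
      if "good m (?U \<omega>)" using z that mult_nonneg_nonneg[of z "sd_ratio m j (?U \<omega>)"] by linarith
    show "0 \<le> ?c \<omega>" using Phi_mono[OF le] by (simp add: coverage_def)
    have "coverage z m j (?U \<omega>) \<le> 1" if "good m (?U \<omega>)"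
      unfolding coverage_def measure_std_normal_Icc[OF le[OF that], symmetric] by (rule N.prob_le_1)
    then show "?c \<omega> \<le> 1" by simp
  qed
  have cm: "(\<lambda>\<omega>. ?c \<omega>) \<in> borel_measurable M" by (rule measurable_compose[OF measurable_U measurable_coverage[OF m]])
  have ic: "integrable M ?c" by (rule integrable_const_bound[of _ 1]) (use c01 cm in auto)
  have slice: "emeasure std_normal_distribution ((\<lambda>r. (r, u)) -` S) = ennreal (if good m u then coverage z m j u else 0)"
    if u: "u \<in> space reals" for u
  proof (cases "good m u")
    case True
    have "(\<lambda>r. (r, u)) -` S = {deviation m j u - z * sd_ratio m j u .. deviation m j u + z * sd_ratio m j u}"
      using True u by (auto simp: S_def space_pair_measure abs_le_iff)
    moreover have "deviation m j u - z * sd_ratio m j u \<le> deviation m j u + z * sd_ratio m j u"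
      using z sd_ratio_nonneg[OF m True] mult_nonneg_nonneg[of z "sd_ratio m j u"] by linarith
    ultimately show ?thesis using True
      by (simp add: N.emeasure_eq_measure measure_std_normal_Icc coverage_def)
  next
    case False
    then have "(\<lambda>r. (r, u)) -` S = {}" by (auto simp: S_def)
    then show ?thesis using False by simp
  qed
  have sets_eq: "sets (std_normal_distribution \<Otimes>\<^sub>M distr M reals ?U) = sets (borel \<Otimes>\<^sub>M reals)"
    by (intro sets_pair_measure_cong) auto
  have "emeasure M ?E = emeasure (distr M (borel \<Otimes>\<^sub>M reals) (\<lambda>\<omega>. (R \<omega>, ?U \<omega>))) S"
    unfolding E by (rule emeasure_distr[OF RU S, symmetric])
  also have "distr M (borel \<Otimes>\<^sub>M reals) (\<lambda>\<omega>. (R \<omega>, ?U \<omega>)) = std_normal_distribution \<Otimes>\<^sub>M distr M reals ?U"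
    using R by (simp add: indep_pair_def)
  also have "emeasure \<dots> S = (\<integral>\<^sup>+u. emeasure std_normal_distribution ((\<lambda>r. (r, u)) -` S) \<partial>distr M reals ?U)"
    using S by (intro P.emeasure_pair_measure_alt2) (simp only: sets_eq)
  also have "\<dots> = (\<integral>\<^sup>+u. ennreal (if good m u then coverage z m j u else 0) \<partial>distr M reals ?U)"
    by (rule nn_integral_cong, rule slice) simp
  also have "\<dots> = (\<integral>\<^sup>+\<omega>. ennreal (?c \<omega>) \<partial>M)"
    by (rule nn_integral_distr[OF measurable_U]) (use measurable_coverage[OF m] in measurable)
  also have "\<dots> = ennreal (expectation ?c)"
    by (rule nn_integral_eq_integral[OF ic]) (use c01 in auto)
  finally have "ennreal (prob ?E) = ennreal (expectation ?c)" by (simp add: emeasure_eq_measure)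
  moreover have "0 \<le> expectation ?c" by (rule Bochner_Integration.integral_nonneg) (rule c01)
  ultimately show ?thesis by (simp add: measure_nonneg)
qed

text \<open>In terms of the error of the best predictor, the estimation of the variance shifts and rescales the interval.\<close>

lemma cox_interval_iff:
  assumes m: "m\<^sub>1 \<le> m" "j < m" and good: "good m u" and y: "\<And>k. y k = x k \<bullet> b + u k"
  shows "x j \<bullet> b + t \<in> cox_interval x D z m j (\<lambda>k. local_estimate m k u) y \<longleftrightarrow>
    \<bar>(t - A / (A + D j) * u j) / cox_sd D j A - deviation m j u\<bar> \<le> z * sd_ratio m j u"
proof -
  interpret full_rank_design x m by (rule full_rank) (rule m_pos(2)[OF m(1)])
  define \<sigma> where "\<sigma> = cox_sd D j A"
  have \<sigma>: "0 < \<sigma>" unfolding \<sigma>_def by (rule cox_sd_A)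
  define T where "T = root m j u"
  have Tj: "local_estimate m j u = T" using good m(2) by (simp add: T_def local_estimate_def)
  have T: "0 < T" unfolding T_def by (rule root_pos(3)[OF m(1) good m(2)])
  have yf: "y = (\<lambda>k. x k \<bullet> b + u k)" using y by auto
  have pos: "0 < 1 / (local_estimate m k u + D k)" for k
    using local_estimate_pos[OF m(1), of k u] D_pos[of k] by simp
  define f where "f = fit x m (root_wt m u) u j"
  have wls: "x j \<bullet> wls x m (\<lambda>k. 1 / (local_estimate m k u + D k)) y = x j \<bullet> b + f"
    unfolding yf f_def fit_local_estimate[OF good, symmetric] using wls_add_fixed[of "\<lambda>k. 1 / (local_estimate m k u + D k)" b u] pos by (simp add: inner_add_right)
  define B where "B = D j * wt D T j"
  have EB: "EB_predictor x D m j (\<lambda>k. local_estimate m k u) y = x j \<bullet> b + u j - B * (u j - f)"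
  proof -
    have "D j / (T + D j) = B" by (simp add: B_def wt_def)
    then show ?thesis unfolding EB_predictor_def Let_def wls Tj unfolding yf by (simp add: algebra_simps)
  qed
  have dev: "\<sigma> * deviation m j u = (D j * wt D A j - B) * u j + B * f"
    using \<sigma> unfolding deviation_def \<sigma>_def[symmetric] T_def[symmetric] f_def[symmetric] B_def
    by (simp add: algebra_simps)
  have sd: "\<sigma> * sd_ratio m j u = cox_sd D j T"
    using \<sigma> by (simp add: sd_ratio_def \<sigma>_def T_def)
  have w: "A / (A + D j) = 1 - D j * wt D A j" using A_pos D_pos[of j] by (simp add: wt_def field_simps)
  define r where "r = t - A / (A + D j) * u j"
  have diff: "x j \<bullet> b + t - EB_predictor x D m j (\<lambda>k. local_estimate m k u) y = r - \<sigma> * deviation m j u"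
    unfolding EB dev r_def w by (simp add: algebra_simps)
  have "x j \<bullet> b + t \<in> cox_interval x D z m j (\<lambda>k. local_estimate m k u) y \<longleftrightarrow>
      \<bar>x j \<bullet> b + t - EB_predictor x D m j (\<lambda>k. local_estimate m k u) y\<bar> \<le> z * cox_sd D j T"
    unfolding cox_interval_def Tj by (auto simp: abs_le_iff)
  also have "\<dots> \<longleftrightarrow> \<bar>r - \<sigma> * deviation m j u\<bar> \<le> z * (\<sigma> * sd_ratio m j u)" unfolding diff sd ..
  also have "r - \<sigma> * deviation m j u = \<sigma> * (r / \<sigma> - deviation m j u)" using \<sigma> by (simp add: right_diff_distrib)
  also have "\<bar>\<sigma> * (r / \<sigma> - deviation m j u)\<bar> \<le> z * (\<sigma> * sd_ratio m j u) \<longleftrightarrow> \<sigma> * \<bar>r / \<sigma> - deviation m j u\<bar> \<le> \<sigma> * (z * sd_ratio m j u)"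
    using \<sigma> by (simp add: abs_mult mult_ac)
  also have "\<dots> \<longleftrightarrow> \<bar>r / \<sigma> - deviation m j u\<bar> \<le> z * sd_ratio m j u" using \<sigma> by simp
  finally show ?thesis unfolding r_def \<sigma>_def .
qed

end

context local_root
begin

text \<open>
  A maximiser has at least the likelihood of the true variance. The adjustment changes this comparison by at most
  \<open>K * \<bar>T - A\<bar>\<close>, so \<open>T\<close> is close to \<open>A\<close> by consistency; then it is an interior maximum, where the score vanishes.
\<close>

lemma maximizer_eq_root:
  assumes m: "m\<^sub>1 \<le> m" "j < m" "good m u" and y: "\<And>k. y k = x k \<bullet> b + u k"
    and hpos: "\<And>a. 0 < a \<Longrightarrow> 0 < h m j a" and hcont: "continuous_on {0..} (h m j)"
    and hder: "\<And>a. 0 < a \<Longrightarrow> ((\<lambda>a. ln (h m j a)) has_real_derivative l1 m j a) (at a)"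
    and max: "is_arg_max (adjusted_likelihood x D h m j y) (\<lambda>a. 0 \<le> a) T"
    and consistent: "profile_loglik x D m A u \<le> profile_loglik x D m T u + K * \<bar>T - A\<bar> \<Longrightarrow> \<bar>T - A\<bar> < \<epsilon>"
  shows "root m j u = T"
proof -
  have m0: "m\<^sub>0 \<le> m" by (rule m_pos(2)[OF m(1)])
  let ?L = "adjusted_likelihood x D h m j y" and ?p = "\<lambda>a. profile_loglik x D m a u"
  have L: "?L a = h m j a * exp (?p a)" if "0 \<le> a" for a
    unfolding adjusted_likelihood_def residual_likelihood_eq[OF m0 that y] ..
  have T: "0 \<le> T" and mx: "0 \<le> a \<Longrightarrow> ?L a \<le> ?L T" for a
    using max by (auto simp: is_arg_max_def not_less)
  have hK: "h m j a \<le> h m j A * exp (K * \<bar>a - A\<bar>)" if a: "0 < a" for a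
  proof -
    have "norm (ln (h m j a) - ln (h m j A)) \<le> K * norm (a - A)"
    proof (rule field_differentiable_bound[where S = "{0<..}" and f' = "l1 m j"])
      fix s :: real assume "s \<in> {0<..}"
      then have s: "0 < s" by simp
      show "((\<lambda>a. ln (h m j a)) has_field_derivative l1 m j s) (at s within {0<..})"
        by (rule has_field_derivative_at_within[OF hder[OF s]])
      show "norm (l1 m j s) \<le> K" using l1_bound[OF m0 m(2) s] by simp
    qed (use a A_pos in auto)
    then have "ln (h m j a) \<le> ln (h m j A) + K * \<bar>a - A\<bar>" by (simp add: abs_le_iff)
    then have "exp (ln (h m j a)) \<le> exp (ln (h m j A) + K * \<bar>a - A\<bar>)" by simp
    then show ?thesis using hpos[OF a] hpos[OF A_pos] by (simp add: exp_add)
  qed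
  \<comment> \<open>The adjustment is differentiable for positive arguments only; at 0 the bound follows by continuity.\<close>
  have hT: "h m j T \<le> h m j A * exp (K * \<bar>T - A\<bar>)"
  proof (cases "T = 0")
    case True
    let ?a = "\<lambda>n. inverse (real (Suc n))"
    have a: "?a \<longlonglongrightarrow> 0" by (rule LIMSEQ_inverse_real_of_nat)
    have "(\<lambda>n. h m j (?a n)) \<longlonglongrightarrow> h m j 0"
      using continuous_on_tendsto_compose[OF hcont a] by simp
    moreover have "(\<lambda>n. h m j A * exp (K * \<bar>?a n - A\<bar>)) \<longlonglongrightarrow> h m j A * exp (K * \<bar>0 - A\<bar>)"
      by (intro tendsto_intros a)
    ultimately have "h m j 0 \<le> h m j A * exp (K * \<bar>0 - A\<bar>)"
      by (rule LIMSEQ_le) (use hK in auto)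
    then show ?thesis using True by simp
  qed (use T hK in auto)
  have "h m j A * exp (?p A) \<le> h m j T * exp (?p T)"
    using mx[of A] L[of A] L[OF T] A_pos by simp
  also have "\<dots> \<le> h m j A * exp (K * \<bar>T - A\<bar>) * exp (?p T)" by (intro mult_right_mono hT) simp
  also have "\<dots> = h m j A * exp (?p T + K * \<bar>T - A\<bar>)" by (simp add: exp_add mult_ac)
  finally have "?p A \<le> ?p T + K * \<bar>T - A\<bar>" using hpos[OF A_pos] by simp
  from consistent[OF this] have near: "\<bar>T - A\<bar> < \<epsilon>" .
  have Tp: "0 < T" using near eps A_pos by (simp add: abs_less_iff)
  have "((\<lambda>a. ln (h m j a) + ?p a) has_real_derivative l1 m j T + profile_score x D m T u) (at T)"
    by (rule DERIV_add[OF hder[OF Tp] has_real_derivative_profile_loglik[OF m0 Tp]])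
  moreover have "\<forall>a. \<bar>T - a\<bar> < T \<longrightarrow> ln (h m j a) + ?p a \<le> ln (h m j T) + ?p T"
  proof safe
    fix a assume "\<bar>T - a\<bar> < T"
    then have a: "0 < a" by (simp add: abs_less_iff)
    have "exp (ln (h m j a) + ?p a) \<le> exp (ln (h m j T) + ?p T)"
      using mx[of a] L[of a] L[OF T] a hpos[OF a] hpos[OF Tp] by (simp add: exp_add)
    then show "ln (h m j a) + ?p a \<le> ln (h m j T) + ?p T" by simp
  qed
  ultimately have "l1 m j T + profile_score x D m T u = 0" by (rule DERIV_local_max[OF _ Tp])
  then show ?thesis using near by (intro root_eqI m) (simp_all add: adj_score_def)
qed

end

section \<open>The Fay--Herriot model\<close>

context adjusted_design
begin

text \<open>
  The constants are chosen in this order: a neighbourhood on which the score is steep, then the grid on which fluctuations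
  have to be controlled for consistency, then a bound on fluctuations that serves both and keeps the root inside the
  neighbourhood.
\<close>

lemma local_root_exists:
  assumes C: "0 \<le> C" and lam: "0 < lam" "lam < 1"
  obtains G \<epsilon> \<eta> c\<^sub>0 C\<^sub>0 C\<^sub>s m\<^sub>1 where "local_root x D d\<^sub>0 d\<^sub>1 cq m\<^sub>0 A K l1 G \<epsilon> \<eta> c\<^sub>0 C\<^sub>0 C\<^sub>s m\<^sub>1"
    and "\<And>b. b \<in> G \<Longrightarrow> 0 \<le> b"
    and "\<And>m u a. m\<^sub>1 \<le> m \<Longrightarrow> envelope G m u \<le> \<eta> * sqrt (real m) \<Longrightarrow> 0 \<le> a \<Longrightarrow> a \<le> C * real m powr lam \<Longrightarrow>
      profile_loglik x D m A u \<le> profile_loglik x D m a u + K * \<bar>a - A\<bar> \<Longrightarrow> \<bar>a - A\<bar> < \<epsilon>"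
proof -
  obtain \<epsilon> \<eta>\<^sub>1 c\<^sub>0 C\<^sub>0 ms where e: "0 < \<epsilon>" "\<epsilon> \<le> A / 2" "0 < \<eta>\<^sub>1" "\<eta>\<^sub>1 \<le> 1" "0 < c\<^sub>0" "m\<^sub>0 \<le> ms"
    and slope: "\<And>m u j a a'. ms \<le> m \<Longrightarrow>
      (\<And>k. k \<in> {1, 2, 3} \<Longrightarrow> fluctuation x D A m (\<lambda>i. wt D A i ^ k) u \<le> \<eta>\<^sub>1 * sqrt (real m)) \<Longrightarrow>
      j < m \<Longrightarrow> \<bar>a - A\<bar> \<le> \<epsilon> \<Longrightarrow> \<bar>a' - A\<bar> \<le> \<epsilon> \<Longrightarrow> a \<le> a' \<Longrightarrow>
      adj_score m j a' u - adj_score m j a u \<le> - c\<^sub>0 * real m * (a' - a) \<and>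
      \<bar>adj_score m j a' u - adj_score m j a u\<bar> \<le> C\<^sub>0 * real m * (a' - a)"
  proof (rule adj_score_slope)
    fix \<epsilon> \<eta> c\<^sub>0 C\<^sub>0 :: real and n
    assume a: "0 < \<epsilon>" "\<epsilon> \<le> A / 2" "0 < \<eta>" "\<eta> \<le> 1" "0 < c\<^sub>0" "m\<^sub>0 \<le> n"
      "\<And>m u j a a'. n \<le> m \<Longrightarrow>
        (\<And>k. k \<in> {1, 2, 3} \<Longrightarrow> fluctuation x D A m (\<lambda>i. wt D A i ^ k) u \<le> \<eta> * sqrt (real m)) \<Longrightarrow>
        j < m \<Longrightarrow> \<bar>a - A\<bar> \<le> \<epsilon> \<Longrightarrow> \<bar>a' - A\<bar> \<le> \<epsilon> \<Longrightarrow> a \<le> a' \<Longrightarrow>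
        adj_score m j a' u - adj_score m j a u \<le> - c\<^sub>0 * real m * (a' - a) \<and>
        \<bar>adj_score m j a' u - adj_score m j a u\<bar> \<le> C\<^sub>0 * real m * (a' - a)"
    show thesis by (rule that[OF a])
  qed
  obtain G \<eta>\<^sub>2 mc where G: "finite G" "\<And>b. b \<in> G \<Longrightarrow> 0 \<le> b" "0 < \<eta>\<^sub>2" "\<eta>\<^sub>2 \<le> 1" "m\<^sub>0 \<le> mc"
    and cons: "\<And>m u a. mc \<le> m \<Longrightarrow>
      (\<And>b. b \<in> insert A G \<Longrightarrow> fluctuation x D A m (wt D b) u \<le> \<eta>\<^sub>2 * sqrt (real m)) \<Longrightarrow>
      0 \<le> a \<Longrightarrow> a \<le> C * real m powr lam \<Longrightarrow>
      profile_loglik x D m A u \<le> profile_loglik x D m a u + K * \<bar>a - A\<bar> \<Longrightarrow> \<bar>a - A\<bar> < \<epsilon>"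
  proof (rule likelihood_consistency[OF e(1) C lam])
    fix G :: "real set" and \<eta> :: real and n
    assume a: "finite G" "\<And>b. b \<in> G \<Longrightarrow> 0 \<le> b" "0 < \<eta>" "\<eta> \<le> 1" "m\<^sub>0 \<le> n"
      "\<And>m u a. n \<le> m \<Longrightarrow>
        (\<And>b. b \<in> insert A G \<Longrightarrow> fluctuation x D A m (wt D b) u \<le> \<eta> * sqrt (real m)) \<Longrightarrow>
        0 \<le> a \<Longrightarrow> a \<le> C * real m powr lam \<Longrightarrow>
        profile_loglik x D m A u \<le> profile_loglik x D m a u + K * \<bar>a - A\<bar> \<Longrightarrow> \<bar>a - A\<bar> < \<epsilon>"
    show thesis by (rule that[OF a])
  qed
  define K' where "K' = (A + d\<^sub>1) * cq / d\<^sub>0\<^sup>2 + (A + d\<^sub>1) + (A + d\<^sub>1)\<^sup>2 / d\<^sub>0\<^sup>2"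
  have K': "0 \<le> K'" using A_pos d1_pos cq_nonneg by (simp add: K'_def)
  define Cs where "Cs = 1 / 2 + K' + K"
  have Cs: "0 \<le> Cs" using K' K_nonneg by (simp add: Cs_def)
  define \<eta> where "\<eta> = min \<eta>\<^sub>1 (min \<eta>\<^sub>2 (c\<^sub>0 * \<epsilon> / (Cs + 1)))"
  have \<eta>: "0 < \<eta>" "\<eta> \<le> \<eta>\<^sub>1" "\<eta> \<le> \<eta>\<^sub>2" "\<eta> \<le> c\<^sub>0 * \<epsilon> / (Cs + 1)" using e G Cs by (auto simp: \<eta>_def)
  define m1 where "m1 = max ms mc"
  have fl: "fluctuation x D A m (\<lambda>i. wt D b i ^ k) u \<le> \<eta>' * sqrt (real m)"
    if "envelope G m u \<le> \<eta> * sqrt (real m)" "\<eta> \<le> \<eta>'" "b \<in> insert A G" "k \<in> {1..4}" for m u b k \<eta>'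
  proof -
    have "fluctuation x D A m (\<lambda>i. wt D b i ^ k) u \<le> envelope G m u" by (rule fluctuation_le_envelope[OF G(1) that(3,4)])
    also note that(1)
    also have "\<eta> * sqrt (real m) \<le> \<eta>' * sqrt (real m)" using that(2) by (intro mult_right_mono) auto
    finally show ?thesis .
  qed
  show ?thesis
  proof (rule that[of G \<epsilon> \<eta> c\<^sub>0 C\<^sub>0 Cs m1])
    show "local_root x D d\<^sub>0 d\<^sub>1 cq m\<^sub>0 A K l1 G \<epsilon> \<eta> c\<^sub>0 C\<^sub>0 Cs m1"
    proof unfold_locales
      fix m u j a a' assume *: "m1 \<le> m" "envelope G m u \<le> \<eta> * sqrt (real m)" "j < m"
        "\<bar>a - A\<bar> \<le> \<epsilon>" "\<bar>a' - A\<bar> \<le> \<epsilon>" "a \<le> a'"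
      have f: "fluctuation x D A m (\<lambda>i. wt D A i ^ k) u \<le> \<eta>\<^sub>1 * sqrt (real m)" if "k \<in> {1, 2, 3}" for k
        using that by (intro fl *(2) \<eta>(2)) auto
      show "adj_score m j a' u - adj_score m j a u \<le> - c\<^sub>0 * real m * (a' - a) \<and>
        \<bar>adj_score m j a' u - adj_score m j a u\<bar> \<le> C\<^sub>0 * real m * (a' - a)"
        by (rule slope[OF _ f *(3-6)]) (use *(1) in \<open>simp add: m1_def\<close>)
    next
      fix m u j assume *: "m1 \<le> m" "envelope G m u \<le> \<eta> * sqrt (real m)" "j < m"
      define W where "W = envelope G m u"
      define s where "s = sqrt (real m)"
      have m0: "m\<^sub>0 \<le> m" using *(1) e(6) by (simp add: m1_def)
      have s: "1 \<le> s" using *(3) by (simp add: s_def)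
      have W: "1 \<le> W" unfolding W_def by (rule envelope_ge_1)
      have Ws: "W \<le> s"
      proof -
        have "\<eta> * s \<le> 1 * s" using \<eta>(2) e(4) s by (intro mult_right_mono) auto
        then show ?thesis using *(2) by (simp add: W_def s_def)
      qed
      have W1: "1 \<le> W * s" using mult_mono[OF W s] W by simp
      have 1: "\<bar>leading_score D m A u\<bar> \<le> 1 / 2 * (W * s)"
      proof -
        have "\<bar>\<Sum>j<m. (wt D A j)\<^sup>2 * ((u j)\<^sup>2 - (A + D j))\<bar> \<le> fluctuation x D A m (\<lambda>i. wt D A i ^ 2) u * s"
          unfolding s_def by (rule fluctuation_ge(1))
        also have "\<dots> \<le> W * s" unfolding W_def using s by (intro mult_right_mono fluctuation_le_envelope G(1)) auto
        finally show ?thesis unfolding leading_score_A by (simp add: abs_mult)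
      qed
      have 2: "\<bar>score_correction x D m A u\<bar> \<le> K' * (W * s)"
      proof -
        have "\<bar>score_correction x D m A u\<bar> \<le> K' * W\<^sup>2"
          unfolding K'_def W_def by (rule score_correction_A_le[OF G(1) m0])
        also have "\<dots> \<le> K' * (W * s)" unfolding power2_eq_square using K' W Ws by (intro mult_left_mono) auto
        finally show ?thesis .
      qed
      have 3: "\<bar>l1 m j A\<bar> \<le> K * (W * s)"
        using l1_bound[OF m0 *(3) A_pos] mult_left_mono[OF W1 K_nonneg] by simp
      have "\<bar>adj_score m j A u\<bar> \<le> 1 / 2 * (W * s) + K' * (W * s) + K * (W * s)"
        unfolding adj_score_def profile_score_eq using 1 2 3 by linarith
      then show "\<bar>adj_score m j A u\<bar> \<le> Cs * (envelope G m u * sqrt (real m))"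
        unfolding Cs_def W_def s_def by (simp add: algebra_simps)
    next
      have "Cs * \<eta> \<le> (Cs + 1) * \<eta>" using \<eta>(1) by (intro mult_right_mono) auto
      also have "\<dots> \<le> (Cs + 1) * (c\<^sub>0 * \<epsilon> / (Cs + 1))" using Cs by (intro mult_left_mono \<eta>) auto
      also have "\<dots> = c\<^sub>0 * \<epsilon>" using Cs by (simp add: add_nonneg_eq_0_iff)
      finally show "Cs * \<eta> \<le> c\<^sub>0 * \<epsilon>" .
    qed (use e G \<eta> Cs in \<open>auto simp: m1_def\<close>)
    fix b assume "b \<in> G" then show "0 \<le> b" by (rule G)
  next
    fix m u a assume *: "m1 \<le> m" "envelope G m u \<le> \<eta> * sqrt (real m)" "0 \<le> a" "a \<le> C * real m powr lam"
      "profile_loglik x D m A u \<le> profile_loglik x D m a u + K * \<bar>a - A\<bar>"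
    have f: "fluctuation x D A m (wt D b) u \<le> \<eta>\<^sub>2 * sqrt (real m)" if "b \<in> insert A G" for b
      using fl[OF *(2) \<eta>(3) that, of 1] by simp
    show "\<bar>a - A\<bar> < \<epsilon>" by (rule cons[OF _ f *(3-5)]) (use *(1) in \<open>simp add: m1_def\<close>)
  qed
qed

end

lemma has_real_derivative_log_adj_deriv:
  assumes h: "regular_adjustment p h" and m: "p < m" "j < m" and k: "k < 5" and a: "0 < a"
  shows "(log_adj_deriv h m j k has_real_derivative log_adj_deriv h m j (Suc k) a) (at a)"
proof -
  have "log_adj_deriv h m j k differentiable_on {0<..}" using h m k unfolding regular_adjustment_def by blast
  then have "log_adj_deriv h m j k differentiable (at a)"
    using a by (simp add: differentiable_on_eq_differentiable_at)
  then have "(log_adj_deriv h m j k has_real_derivative deriv (log_adj_deriv h m j k) a) (at a)"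
    by (simp add: DERIV_deriv_iff_real_differentiable)
  then show ?thesis by (simp add: log_adj_deriv_def)
qed

context fay_herriot
begin

definition observation :: "nat \<Rightarrow> 'a \<Rightarrow> real" where "observation j \<omega> = v j \<omega> + e j \<omega>"

lemma y_observation: "y k \<omega> = x k \<bullet> \<beta> + observation k \<omega>"
  by (simp add: y_eq theta_eq observation_def)

lemma measurable_effects[measurable]: "v j \<in> borel_measurable M" "e j \<in> borel_measurable M"
  using effect_distr[of j] error_distr[of j] by (auto dest: distributed_measurable)

lemma measurable_observation[measurable]: "observation j \<in> borel_measurable M"
  unfolding observation_def[abs_def] by measurable

lemma measurable_y[measurable]: "y j \<in> borel_measurable M" "\<theta> j \<in> borel_measurable M"
  unfolding y_observation[abs_def] theta_eq[abs_def] by measurable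

lemma indep_effect_error: "indep_var borel (v i) borel (e i)"
proof -
  have "indep_var (PiM {Inl i} (\<lambda>_. borel)) (\<lambda>\<omega>. restrict (\<lambda>k. case_sum v e k \<omega>) {Inl i})
      (PiM {Inr i} (\<lambda>_. borel)) (\<lambda>\<omega>. restrict (\<lambda>k. case_sum v e k \<omega>) {Inr i})"
    by (rule indep_var_restrict[OF indep_effects_errors]) auto
  from indep_var_compose[OF this, of "\<lambda>p. p (Inl i)" borel "\<lambda>p. p (Inr i)" borel]
  show ?thesis by (simp add: comp_def measurable_component_singleton)
qed

lemma observation_normal_errors: "normal_errors M observation (\<lambda>j. A + D j)"
proof unfold_locales
  fix j show "0 < A + D j" using A_pos D_pos[of j] by simp
next
  have "indep_vars (\<lambda>j. PiM {Inl j, Inr j} (\<lambda>_. borel)) (\<lambda>j \<omega>. restrict (\<lambda>k. case_sum v e k \<omega>) {Inl j, Inr j}) (UNIV :: nat set)"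
    by (rule indep_vars_restrict[OF indep_effects_errors]) (auto simp: disjoint_family_on_def)
  from indep_vars_compose2[OF this, of "\<lambda>j p. p (Inl j) + p (Inr j)" "\<lambda>_. borel"]
  have "indep_vars (\<lambda>_. borel) (\<lambda>j \<omega>. v j \<omega> + e j \<omega>) UNIV" by simp
  then show "indep_vars (\<lambda>_. borel) observation UNIV" by (simp add: observation_def[abs_def])
next
  fix j
  have ind: "indep_vars (\<lambda>_. borel) (case_bool (v j) (e j)) UNIV"
    using indep_effect_error[of j] unfolding indep_var_def by (rule indep_vars_cong[THEN iffD1, rotated -1]) (auto split: bool.split)
  have "distributed M lborel (\<lambda>\<omega>. \<Sum>b\<in>UNIV. case_bool (v j) (e j) b \<omega>)
      (normal_density (\<Sum>b\<in>(UNIV :: bool set). 0) (sqrt (\<Sum>b\<in>UNIV. (case_bool (sqrt A) (sqrt (D j)) b)\<^sup>2)))"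
    using ind A_pos D_pos[of j] effect_distr[of j] error_distr[of j]
    by (intro sum_indep_normal) (auto split: bool.split)
  then show "distributed M lborel (observation j) (normal_density 0 (sqrt (A + D j)))"
    using A_pos D_pos[of j] by (simp add: UNIV_bool observation_def[abs_def] add.commute)
qed

text \<open>
  Area \<open>i\<close> is independent of the others, and within it the posterior residual is independent of the observation. So the
  residual is independent of the pair of its own observation and the sequence of the others.
\<close>

lemma best_predictor_error:
  defines "R i \<omega> \<equiv> (v i \<omega> - A / (A + D i) * observation i \<omega>) / cox_sd D i A"
  shows "indep_pair borel (R i) reals (\<lambda>\<omega> k. observation k \<omega>)" "distr M borel (R i) = std_normal_distribution"
proof -
  define \<sigma> where "\<sigma> = cox_sd D i A"
  have Dp: "0 < D i" by (rule D_pos)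
  have sA: "0 < sqrt A" "0 < sqrt (D i)" using A_pos Dp by auto
  have \<sigma>: "\<sigma> = sqrt A * sqrt (D i) / sqrt ((sqrt A)\<^sup>2 + (sqrt (D i))\<^sup>2)" and \<sigma>p: "0 < \<sigma>"
    using A_pos Dp by (simp_all add: \<sigma>_def cox_sd_def real_sqrt_mult real_sqrt_divide)
  have rho: "(sqrt A)\<^sup>2 / ((sqrt A)\<^sup>2 + (sqrt (D i))\<^sup>2) = A / (A + D i)" using A_pos Dp by simp
  define r where "r \<omega> = v i \<omega> - A / (A + D i) * observation i \<omega>" for \<omega>
  have rm[measurable]: "r \<in> borel_measurable M" unfolding r_def[abs_def] by measurable
  have r: "indep_var borel r borel (observation i)" "distr M borel r = density lborel (normal_density 0 \<sigma>)"
    using posterior_residual[OF effect_distr[of i] error_distr[of i] sA indep_effect_error[of i]]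
    unfolding rho \<sigma>[symmetric] r_def[abs_def] observation_def[abs_def] by auto
  have ru: "indep_pair borel r borel (observation i)"
    using r(1) by (simp add: indep_pair_def indep_var_distribution_eq)
  let ?B = "{Inl i, Inr i} :: (nat + nat) set"
  have "indep_var (PiM ?B (\<lambda>_. borel)) (\<lambda>\<omega>. restrict (\<lambda>k. case_sum v e k \<omega>) ?B)
      (PiM (- ?B) (\<lambda>_. borel)) (\<lambda>\<omega>. restrict (\<lambda>k. case_sum v e k \<omega>) (- ?B))"
    by (rule indep_var_restrict[OF indep_effects_errors]) auto
  then have 1: "indep_pair (PiM ?B (\<lambda>_. borel)) (\<lambda>\<omega>. restrict (\<lambda>k. case_sum v e k \<omega>) ?B)
      (PiM (- ?B) (\<lambda>_. borel)) (\<lambda>\<omega>. restrict (\<lambda>k. case_sum v e k \<omega>) (- ?B))"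
    by (simp add: indep_pair_def indep_var_distribution_eq)
  define f where "f p = (p (Inl i) - A / (A + D i) * (p (Inl i) + p (Inr i)), p (Inl i) + p (Inr i))" for p :: "nat + nat \<Rightarrow> real"
  define g where "g p k = (if k = i then 0 else p (Inl k) + p (Inr k))" for p :: "nat + nat \<Rightarrow> real" and k
  have f: "f \<in> measurable (PiM ?B (\<lambda>_. borel)) (borel \<Otimes>\<^sub>M borel)"
  proof -
    have "(\<lambda>p. p (Inl i)) \<in> borel_measurable (PiM ?B (\<lambda>_. borel))" "(\<lambda>p. p (Inr i)) \<in> borel_measurable (PiM ?B (\<lambda>_. borel))"
      by (intro measurable_component_singleton; simp)+
    then show ?thesis unfolding f_def by measurable
  qed
  have g: "g \<in> measurable (PiM (- ?B) (\<lambda>_. borel)) reals"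
  proof (rule measurable_PiM_single')
    fix k
    show "(\<lambda>p. g p k) \<in> borel_measurable (PiM (- ?B) (\<lambda>_. borel))"
    proof (cases "k = i")
      case False
      then have "(\<lambda>p. p (Inl k)) \<in> borel_measurable (PiM (- ?B) (\<lambda>_. borel))" "(\<lambda>p. p (Inr k)) \<in> borel_measurable (PiM (- ?B) (\<lambda>_. borel))"
        by (intro measurable_component_singleton; simp)+
      then show ?thesis using False by (simp add: g_def)
    qed (simp add: g_def)
  qed auto
  have ff: "f (restrict (\<lambda>k. case_sum v e k \<omega>) ?B) = (r \<omega>, observation i \<omega>)" for \<omega>
    by (simp add: f_def r_def observation_def)
  have gg: "g (restrict (\<lambda>k. case_sum v e k \<omega>) (- ?B)) = (\<lambda>k. if k = i then 0 else observation k \<omega>)" for \<omega>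
    by (auto simp: g_def observation_def fun_eq_iff)
  from indep_pair_compose[OF 1 f g]
  have "indep_pair (borel \<Otimes>\<^sub>M borel) (\<lambda>\<omega>. (r \<omega>, observation i \<omega>)) reals (\<lambda>\<omega> k. if k = i then 0 else observation k \<omega>)"
    unfolding ff gg .
  from indep_pair_assoc[OF ru this]
  have 2: "indep_pair borel r (borel \<Otimes>\<^sub>M reals) (\<lambda>\<omega>. (observation i \<omega>, \<lambda>k. if k = i then 0 else observation k \<omega>))" .
  \<comment> \<open>Puts the observation of area \<open>i\<close> back into the sequence of the others.\<close>
  define j where "j p k = (if k = i then fst p else snd p k)" for p :: "real \<times> (nat \<Rightarrow> real)" and k
  have j: "j \<in> measurable (borel \<Otimes>\<^sub>M reals) reals"
  proof (rule measurable_PiM_single')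
    fix k
    have "(\<lambda>p. snd p k) \<in> borel_measurable (borel \<Otimes>\<^sub>M reals)" by (rule measurable_compose[OF measurable_snd measurable_coordinate])
    then show "(\<lambda>p. j p k) \<in> borel_measurable (borel \<Otimes>\<^sub>M reals)" by (cases "k = i") (simp_all add: j_def)
  qed auto
  have jj: "j (observation i \<omega>, \<lambda>k. if k = i then 0 else observation k \<omega>) = (\<lambda>k. observation k \<omega>)" for \<omega>
    by (auto simp: j_def fun_eq_iff)
  have s: "(\<lambda>t. t / \<sigma>) \<in> borel_measurable borel" by measurable
  have R: "R i = (\<lambda>\<omega>. r \<omega> / \<sigma>)" unfolding R_def r_def \<sigma>_def ..
  show "indep_pair borel (R i) reals (\<lambda>\<omega> k. observation k \<omega>)"
    unfolding R using indep_pair_compose[OF 2 s j] unfolding jj .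
  have "distributed M lborel r (normal_density 0 \<sigma>)"
    using r(2) by (simp add: distributed_def cong: distr_cong)
  then have "distributed M lborel (\<lambda>\<omega>. (r \<omega> - 0) / \<sigma>) std_normal_density"
    using normal_standard_normal_convert[OF \<sigma>p] by blast
  then have "distr M lborel (R i) = std_normal_distribution"
    unfolding R by (simp add: distributed_distr_eq_density)
  then show "distr M borel (R i) = std_normal_distribution" by (simp cong: distr_cong)
qed

end

lemma cox_interval_cong:
  assumes i: "i < m" and eq: "\<And>k. k < m \<Longrightarrow> a k = a' k"
  shows "cox_interval x D z m i a y = cox_interval x D z m i a' y"
proof -
  have "wls x m (\<lambda>j. 1 / (a j + D j)) y = wls x m (\<lambda>j. 1 / (a' j + D j)) y" by (rule wls_cong) (simp_all add: eq)
  then show ?thesis by (simp add: cox_interval_def EB_predictor_def Let_def eq[OF i])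
qed

theorem theorem1:
  fixes M :: "'a measure"
    and x :: "nat \<Rightarrow> real ^ 'p"
    and D :: "nat \<Rightarrow> real"
    and \<beta> :: "real ^ 'p"
    and A \<alpha> z C lam :: real
    and v e \<theta> y :: "nat \<Rightarrow> 'a \<Rightarrow> real"
    and h :: "nat \<Rightarrow> nat \<Rightarrow> real \<Rightarrow> real"
    and Ahat :: "nat \<Rightarrow> nat \<Rightarrow> 'a \<Rightarrow> real"
    and i :: nat
  assumes model: "fay_herriot M x D \<beta> A v e \<theta> y"
    and Ahat_measurable: "\<And>m j. Ahat m j \<in> borel_measurable M"
    and Ahat_argmax: "\<forall>\<^sub>F m in sequentially. \<forall>j<m. AE \<omega> in M.
          is_arg_max (adjusted_likelihood x D h m j (\<lambda>k. y k \<omega>)) (\<lambda>a. 0 \<le> a) (Ahat m j \<omega>)"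
    and R1: "regular_adjustment CARD('p) h"
    and R2: "\<forall>\<^sub>F m in sequentially. design_rank x m = CARD('p)"
    and R3: "\<exists>K. \<forall>j a. \<bar>x j $ a\<bar> \<le> K"
            "(\<lambda>m. SUP j\<in>{..<m}. leverage x m j) \<in> O(\<lambda>m. 1 / real m)"
    and R4: "0 < (INF j. D j)" "bdd_above (range D)"
    and R5: "0 < C" "0 < lam" "lam < 1 / 2"
            "(\<lambda>m. measure M {\<omega> \<in> space M. \<not> (\<forall>j<m. \<bar>Ahat m j \<omega>\<bar> < C * real m powr lam)})
               \<in> O(\<lambda>m. real m powr (- 3 / 2))"
    and alpha: "0 < \<alpha>" "\<alpha> < 1"
    and z: "cdf std_normal_distribution z = 1 - \<alpha> / 2"
  shows "(\<lambda>m. measure M {\<omega> \<in> space M.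
                \<theta> i \<omega> \<in> cox_interval x D z m i (\<lambda>j. Ahat m j \<omega>) (\<lambda>j. y j \<omega>)} -
              (1 - \<alpha> + z * std_normal_density z *
                 ((cox_a x D A z
                     (covariance_matrix M (\<lambda>\<omega>. wls x m (\<lambda>j. 1 / (A + D j)) (\<lambda>j. y j \<omega>))) m i
                   + cox_b D A h m i) / real m)))
         \<in> O(\<lambda>m. real m powr (- 3 / 2))"
proof -
  interpret fay_herriot M x D \<beta> A v e \<theta> y by (rule model)
  define d\<^sub>0 d\<^sub>1 where "d\<^sub>0 = (INF j. D j)" and "d\<^sub>1 = (SUP j. D j)"
  have bb: "bdd_below (range D)" by (rule bdd_belowI[of _ 0]) (use D_pos in \<open>auto simp: less_imp_le\<close>)
  obtain cq where cq: "\<forall>\<^sub>F m in sequentially. norm (SUP j\<in>{..<m}. leverage x m j) \<le> cq * norm (1 / real m)"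
    using R3(2) by (rule landau_o.bigE)
  have "\<forall>\<^sub>F m in sequentially. (\<forall>j<m. AE \<omega> in M.
      is_arg_max (adjusted_likelihood x D h m j (\<lambda>k. y k \<omega>)) (\<lambda>a. 0 \<le> a) (Ahat m j \<omega>)) \<and>
      design_rank x m = CARD('p) \<and> norm (SUP j\<in>{..<m}. leverage x m j) \<le> cq * norm (1 / real m) \<and> CARD('p) < m"
    using Ahat_argmax R2 cq eventually_gt_at_top[of "CARD('p)"] by eventually_elim (intro conjI)
  then obtain m\<^sub>0 where m0: "\<And>m. m\<^sub>0 \<le> m \<Longrightarrow> (\<forall>j<m. AE \<omega> in M.
      is_arg_max (adjusted_likelihood x D h m j (\<lambda>k. y k \<omega>)) (\<lambda>a. 0 \<le> a) (Ahat m j \<omega>)) \<and>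
      design_rank x m = CARD('p) \<and> norm (SUP j\<in>{..<m}. leverage x m j) \<le> cq * norm (1 / real m) \<and> CARD('p) < m"
    unfolding eventually_sequentially by blast
  note argmax = conjunct1[OF m0] and rank = conjunct1[OF conjunct2[OF m0]]
    and lev = conjunct1[OF conjunct2[OF conjunct2[OF m0]]] and card = conjunct2[OF conjunct2[OF conjunct2[OF m0]]]
  have h: "\<And>m j. CARD('p) < m \<Longrightarrow> j < m \<Longrightarrow> (\<forall>A>0. 0 < h m j A) \<and> continuous_on {0..} (h m j)"
    and "\<exists>K. \<forall>m>CARD('p). \<forall>j<m. \<forall>k\<in>{1..5}. \<forall>A>0. \<bar>log_adj_deriv h m j k A\<bar> powr 1 \<le> K"
    using R1 zero_less_one unfolding regular_adjustment_def by blast+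
  then obtain K where "\<forall>m>CARD('p). \<forall>j<m. \<forall>k\<in>{1..5}. \<forall>A>0. \<bar>log_adj_deriv h m j k A\<bar> powr 1 \<le> K" by blast
  then have K: "\<bar>log_adj_deriv h m j k a\<bar> \<le> K" if "m\<^sub>0 \<le> m" "j < m" "k \<in> {1..5}" "0 < a" for m j k a
    using card[OF that(1)] that by (metis powr_one abs_ge_zero)
  define l1 where "l1 m j = log_adj_deriv h m j 1" for m j
  interpret ad: adjusted_design x D d\<^sub>0 d\<^sub>1 cq m\<^sub>0 A K l1
  proof unfold_locales
    show "0 < d\<^sub>0" unfolding d\<^sub>0_def by (rule R4(1))
    show "d\<^sub>0 \<le> D j" for j unfolding d\<^sub>0_def by (rule cINF_lower[OF bb UNIV_I])
    show "D j \<le> d\<^sub>1" for j unfolding d\<^sub>1_def by (rule cSUP_upper[OF UNIV_I R4(2)])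
    show "0 < m\<^sub>0" using card[of m\<^sub>0] by simp
    show "span (x ` {..<m}) = UNIV" if "m\<^sub>0 \<le> m" for m
      using rank[OF that] by (simp add: design_rank_def dim_eq_full[symmetric])
    show "leverage x m j \<le> cq / real m" if "m\<^sub>0 \<le> m" "j < m" for m j
    proof -
      have "leverage x m j \<le> (SUP j\<in>{..<m}. leverage x m j)" using that(2) by (intro cSUP_upper) auto
      then show ?thesis using lev[OF that(1)] by simp
    qed
    show "0 < A" by (rule A_pos)
    show "\<bar>l1 m j a\<bar> \<le> K" if "m\<^sub>0 \<le> m" "j < m" "0 < a" for m j a
      unfolding l1_def by (rule K) (use that in auto)
    show "\<bar>l1 m j a - l1 m j a'\<bar> \<le> K * \<bar>a - a'\<bar>" if "m\<^sub>0 \<le> m" "j < m" "0 < a" "0 < a'" for m j a a'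
    proof -
      have "norm (l1 m j a - l1 m j a') \<le> K * norm (a - a')"
      proof (rule field_differentiable_bound[where S = "{0<..}" and f' = "log_adj_deriv h m j 2"])
        fix s :: real assume "s \<in> {0<..}"
        then have s: "0 < s" by simp
        show "(l1 m j has_field_derivative log_adj_deriv h m j 2 s) (at s within {0<..})"
        proof -
          have "(log_adj_deriv h m j 1 has_real_derivative log_adj_deriv h m j (Suc 1) s) (at s)"
            by (rule has_real_derivative_log_adj_deriv[OF R1 card[OF that(1)] that(2) _ s]) simp
          then show ?thesis unfolding l1_def Suc_1 by (rule has_field_derivative_at_within)
        qed
        show "norm (log_adj_deriv h m j 2 s) \<le> K" using K[OF that(1,2) _ s, of 2] by simp
      qed (use that in auto)
      then show ?thesis by simp
    qed
  qed
  have "0 \<le> C" "lam < 1" using R5(1,3) by auto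
  obtain G \<epsilon> \<eta> c\<^sub>0 C\<^sub>0 C\<^sub>s m\<^sub>1 where lr: "local_root x D d\<^sub>0 d\<^sub>1 cq m\<^sub>0 A K l1 G \<epsilon> \<eta> c\<^sub>0 C\<^sub>0 C\<^sub>s m\<^sub>1"
    and G: "\<And>b. b \<in> G \<Longrightarrow> 0 \<le> b"
    and consistent: "\<And>m u a. m\<^sub>1 \<le> m \<Longrightarrow> ad.envelope G m u \<le> \<eta> * sqrt (real m) \<Longrightarrow> 0 \<le> a \<Longrightarrow> a \<le> C * real m powr lam \<Longrightarrow>
      profile_loglik x D m A u \<le> profile_loglik x D m a u + K * \<bar>a - A\<bar> \<Longrightarrow> \<bar>a - A\<bar> < \<epsilon>"
  proof (rule ad.local_root_exists[OF \<open>0 \<le> C\<close> R5(2) \<open>lam < 1\<close>])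
    fix G \<epsilon> \<eta> c\<^sub>0 C\<^sub>0 C\<^sub>s m\<^sub>1
    assume a: "local_root x D d\<^sub>0 d\<^sub>1 cq m\<^sub>0 A K l1 G \<epsilon> \<eta> c\<^sub>0 C\<^sub>0 C\<^sub>s m\<^sub>1" "\<And>b. b \<in> G \<Longrightarrow> 0 \<le> b"
      "\<And>m u a. m\<^sub>1 \<le> m \<Longrightarrow> ad.envelope G m u \<le> \<eta> * sqrt (real m) \<Longrightarrow> 0 \<le> a \<Longrightarrow> a \<le> C * real m powr lam \<Longrightarrow>
        profile_loglik x D m A u \<le> profile_loglik x D m a u + K * \<bar>a - A\<bar> \<Longrightarrow> \<bar>a - A\<bar> < \<epsilon>"
    show thesis by (rule that[OF a])
  qed
  interpret fhn: fay_herriot_normal x D d\<^sub>0 d\<^sub>1 cq m\<^sub>0 A K l1 G \<epsilon> \<eta> c\<^sub>0 C\<^sub>0 C\<^sub>s m\<^sub>1 M observation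
    by (intro fay_herriot_normal.intro fay_herriot_normal_axioms.intro lr observation_normal_errors) (rule G)
  have Phi_z: "Phi z = 1 - \<alpha> / 2" using z by (simp add: Phi_def)
  have central: "Phi z - Phi (- z) = 1 - \<alpha>" unfolding Phi_symmetric Phi_z by (simp add: field_simps)
  have z0: "0 \<le> z"
  proof (rule ccontr)
    assume "\<not> 0 \<le> z"
    then have "Phi z \<le> Phi (- z)" by (intro Phi_mono) simp
    then show False using central alpha by simp
  qed
  obtain C\<^sub>1 where C1: "\<And>m j. m\<^sub>1 \<le> m \<Longrightarrow> j < m \<Longrightarrow>
    (\<lambda>\<omega>. if fhn.good m (\<lambda>k. observation k \<omega>) then fhn.coverage z m j (\<lambda>k. observation k \<omega>) else 0) \<in> borel_measurable M \<Longrightarrow>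
    \<bar>expectation (\<lambda>\<omega>. if fhn.good m (\<lambda>k. observation k \<omega>) then fhn.coverage z m j (\<lambda>k. observation k \<omega>) else 0)
      - (Phi z - Phi (- z) + z * std_normal_density z * fhn.cox_correction m j z)\<bar> \<le> C\<^sub>1 * real m powr (- 3 / 2)"
    by (rule fhn.expected_coverage[of z]) (rule that, assumption)
  obtain C\<^sub>2 where C2: "\<And>m. m\<^sub>1 \<le> m \<Longrightarrow> prob {\<omega> \<in> space M. \<not> fhn.good m (\<lambda>k. observation k \<omega>)} \<le> C\<^sub>2 * real m powr (- 3 / 2)"
    by (rule fhn.prob_not_good) (rule that, assumption)
  obtain C\<^sub>3 where C3: "\<forall>\<^sub>F m in sequentially. norm (prob {\<omega> \<in> space M. \<not> (\<forall>j<m. \<bar>Ahat m j \<omega>\<bar> < C * real m powr lam)})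
      \<le> C\<^sub>3 * norm (real m powr (- 3 / 2))"
    using R5(4) by (rule landau_o.bigE)
  show ?thesis
  proof (rule bigoI[where c = "C\<^sub>1 + C\<^sub>2 + C\<^sub>3"])
    show "\<forall>\<^sub>F m in sequentially. norm (prob {\<omega> \<in> space M.
          \<theta> i \<omega> \<in> cox_interval x D z m i (\<lambda>j. Ahat m j \<omega>) (\<lambda>j. y j \<omega>)} -
        (1 - \<alpha> + z * std_normal_density z *
          ((cox_a x D A z (covariance_matrix M (\<lambda>\<omega>. wls x m (\<lambda>j. 1 / (A + D j)) (\<lambda>j. y j \<omega>))) m i
            + cox_b D A h m i) / real m)))
        \<le> (C\<^sub>1 + C\<^sub>2 + C\<^sub>3) * norm (real m powr (- 3 / 2))"
      using C3 eventually_ge_at_top[of m\<^sub>1] eventually_gt_at_top[of i]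
    proof eventually_elim
      fix m
      assume F: "norm (prob {\<omega> \<in> space M. \<not> (\<forall>j<m. \<bar>Ahat m j \<omega>\<bar> < C * real m powr lam)}) \<le> C\<^sub>3 * norm (real m powr (- 3 / 2))"
        and m: "m\<^sub>1 \<le> m" and i: "i < m"
      have mm: "m\<^sub>0 \<le> m" by (rule fhn.m_pos(2)[OF m])
      let ?r = "real m powr (- 3 / 2)"
      let ?U = "\<lambda>\<omega> k. observation k \<omega>"
      let ?R = "\<lambda>\<omega>. (v i \<omega> - A / (A + D i) * observation i \<omega>) / cox_sd D i A"
      let ?T = "\<lambda>\<omega> k. fhn.local_estimate m k (?U \<omega>)"
      define E\<^sub>1 where "E\<^sub>1 = {\<omega> \<in> space M. \<theta> i \<omega> \<in> cox_interval x D z m i (\<lambda>j. Ahat m j \<omega>) (\<lambda>j. y j \<omega>)}"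
      define E\<^sub>2 where "E\<^sub>2 = {\<omega> \<in> space M. fhn.good m (?U \<omega>) \<and> \<theta> i \<omega> \<in> cox_interval x D z m i (?T \<omega>) (\<lambda>j. y j \<omega>)}"
      \<comment> \<open>Off these two sets, and off a null set, the estimates of all areas are the roots.\<close>
      define N\<^sub>1 where "N\<^sub>1 = {\<omega> \<in> space M. \<not> fhn.good m (?U \<omega>)}"
      define N\<^sub>2 where "N\<^sub>2 = {\<omega> \<in> space M. \<not> (\<forall>j<m. \<bar>Ahat m j \<omega>\<bar> < C * real m powr lam)}"
      have goodM: "Measurable.pred M (\<lambda>\<omega>. fhn.good m (?U \<omega>))"
        by (rule measurable_compose[OF fhn.measurable_U fhn.measurable_good(2)])
      have TM: "(\<lambda>\<omega>. ?T \<omega> k) \<in> borel_measurable M" for k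
        by (rule measurable_compose[OF fhn.measurable_U fhn.measurable_local_estimate[OF m]])
      have interval: "Measurable.pred M (\<lambda>\<omega>. \<theta> i \<omega> \<in> cox_interval x D z m i (\<lambda>j. a j \<omega>) (\<lambda>j. y j \<omega>))"
        if a: "\<And>k. a k \<in> borel_measurable M" for a
        unfolding cox_interval_def atLeastAtMost_iff
        using measurable_EB_predictor[of a M y x D m i, OF a measurable_y(1)] measurable_cox_sd[OF a[of i], of D i] measurable_y(2)[of i]
        by measurable
      have E1M: "E\<^sub>1 \<in> sets M" unfolding E\<^sub>1_def using interval[of "Ahat m", OF Ahat_measurable] by (simp add: pred_def)
      have E2M: "E\<^sub>2 \<in> sets M" unfolding E\<^sub>2_def using interval[of "\<lambda>k \<omega>. ?T \<omega> k", OF TM] goodM by measurable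
      have N1M: "N\<^sub>1 \<in> sets M" unfolding N\<^sub>1_def using goodM by measurable
      have N2M: "N\<^sub>2 \<in> sets M" unfolding N\<^sub>2_def using Ahat_measurable by measurable
      have arg: "AE \<omega> in M. \<forall>j\<in>{..<m}. is_arg_max (adjusted_likelihood x D h m j (\<lambda>k. y k \<omega>)) (\<lambda>a. 0 \<le> a) (Ahat m j \<omega>)"
        using argmax[OF mm] by (intro AE_finite_allI) auto
      have same: "\<omega> \<in> E\<^sub>1 \<longleftrightarrow> \<omega> \<in> E\<^sub>2" if \<omega>: "\<omega> \<in> space M" "\<omega> \<notin> N\<^sub>1" "\<omega> \<notin> N\<^sub>2"
        and mx: "\<forall>j\<in>{..<m}. is_arg_max (adjusted_likelihood x D h m j (\<lambda>k. y k \<omega>)) (\<lambda>a. 0 \<le> a) (Ahat m j \<omega>)" for \<omega>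
      proof -
        have good: "fhn.good m (?U \<omega>)" and small: "\<And>j. j < m \<Longrightarrow> \<bar>Ahat m j \<omega>\<bar> < C * real m powr lam"
          using \<omega> by (auto simp: N\<^sub>1_def N\<^sub>2_def)
        have eq: "Ahat m j \<omega> = ?T \<omega> j" if j: "j < m" for j
        proof -
          have arg: "is_arg_max (adjusted_likelihood x D h m j (\<lambda>k. y k \<omega>)) (\<lambda>a. 0 \<le> a) (Ahat m j \<omega>)" using mx j by simp
          then have nn: "0 \<le> Ahat m j \<omega>" by (simp add: is_arg_max_def)
          have "fhn.root m j (?U \<omega>) = Ahat m j \<omega>"
          proof (rule fhn.maximizer_eq_root[OF m j good _ _ _ _ arg])
            show "y k \<omega> = x k \<bullet> \<beta> + observation k \<omega>" for k by (rule y_observation)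
            show "0 < h m j a" if "0 < a" for a using h[OF card[OF mm] j] that by blast
            show "continuous_on {0..} (h m j)" using h[OF card[OF mm] j] by blast
            show "((\<lambda>a. ln (h m j a)) has_real_derivative l1 m j a) (at a)" if "0 < a" for a
            proof -
              have zero: "log_adj_deriv h m j 0 = (\<lambda>a. ln (h m j a))" by (simp add: log_adj_deriv_def fun_eq_iff)
              have "(log_adj_deriv h m j 0 has_real_derivative log_adj_deriv h m j (Suc 0) a) (at a)"
                by (rule has_real_derivative_log_adj_deriv[OF R1 card[OF mm] j _ that]) simp
              then show ?thesis unfolding l1_def zero One_nat_def .
            qed
            assume "profile_loglik x D m A (?U \<omega>) \<le> profile_loglik x D m (Ahat m j \<omega>) (?U \<omega>) + K * \<bar>Ahat m j \<omega> - A\<bar>"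
            then show "\<bar>Ahat m j \<omega> - A\<bar> < \<epsilon>"
              using good small[OF j] nn by (intro consistent[OF m _ nn]) (auto simp: fhn.good_def)
          qed
          then show ?thesis using good j by (simp add: fhn.local_estimate_def)
        qed
        have "cox_interval x D z m i (\<lambda>j. Ahat m j \<omega>) (\<lambda>j. y j \<omega>) = cox_interval x D z m i (?T \<omega>) (\<lambda>j. y j \<omega>)"
          by (rule cox_interval_cong[OF i]) (rule eq)
        then show ?thesis using good \<omega>(1) by (simp add: E\<^sub>1_def E\<^sub>2_def)
      qed
      have sub: "prob B \<le> prob B' + prob N\<^sub>1 + prob N\<^sub>2"
        if "B' \<in> sets M" and imp: "\<And>\<omega>. \<omega> \<in> space M \<Longrightarrow> \<omega> \<notin> N\<^sub>1 \<Longrightarrow> \<omega> \<notin> N\<^sub>2 \<Longrightarrow>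
          \<forall>j\<in>{..<m}. is_arg_max (adjusted_likelihood x D h m j (\<lambda>k. y k \<omega>)) (\<lambda>a. 0 \<le> a) (Ahat m j \<omega>) \<Longrightarrow> \<omega> \<in> B \<Longrightarrow> \<omega> \<in> B'" for B B'
      proof -
        have "AE \<omega> in M. \<omega> \<in> B \<longrightarrow> \<omega> \<in> B' \<union> N\<^sub>1 \<union> N\<^sub>2"
          using arg AE_space by eventually_elim (use imp in blast)
        then have "prob B \<le> prob (B' \<union> N\<^sub>1 \<union> N\<^sub>2)"
          using that(1) N1M N2M by (intro finite_measure_mono_AE) auto
        also have "\<dots> \<le> prob (B' \<union> N\<^sub>1) + prob N\<^sub>2"
          using that(1) N1M N2M by (intro measure_Un_le) auto
        also have "prob (B' \<union> N\<^sub>1) \<le> prob B' + prob N\<^sub>1"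
          using that(1) N1M by (intro measure_Un_le) auto
        finally show ?thesis by simp
      qed
      have "prob E\<^sub>1 \<le> prob E\<^sub>2 + prob N\<^sub>1 + prob N\<^sub>2" "prob E\<^sub>2 \<le> prob E\<^sub>1 + prob N\<^sub>1 + prob N\<^sub>2"
        by (rule sub[OF E2M], use same in blast, rule sub[OF E1M], use same in blast)
      moreover have "prob N\<^sub>1 \<le> C\<^sub>2 * ?r" unfolding N\<^sub>1_def by (rule C2[OF m])
      moreover have "prob N\<^sub>2 \<le> C\<^sub>3 * ?r" unfolding N\<^sub>2_def using F by simp
      ultimately have 1: "\<bar>prob E\<^sub>1 - prob E\<^sub>2\<bar> \<le> C\<^sub>2 * ?r + C\<^sub>3 * ?r" by linarith
      have "E\<^sub>2 = {\<omega> \<in> space M. fhn.good m (?U \<omega>) \<and> \<bar>?R \<omega> - fhn.deviation m i (?U \<omega>)\<bar> \<le> z * fhn.sd_ratio m i (?U \<omega>)}"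
        unfolding E\<^sub>2_def theta_eq
        by (intro Collect_cong conj_cong refl fhn.cox_interval_iff[OF m i] y_observation)
      then have 2: "prob E\<^sub>2 = expectation (\<lambda>\<omega>. if fhn.good m (?U \<omega>) then fhn.coverage z m i (?U \<omega>) else 0)"
        using fhn.coverage_probability[OF m i z0 best_predictor_error] by simp
      have cov: "x i \<bullet> (covariance_matrix M (\<lambda>\<omega>. wls x m (\<lambda>j. 1 / (A + D j)) (\<lambda>j. y j \<omega>)) *v x i) = gkernel x m (wt D A) i i"
        by (rule fhn.covariance_wls[OF m i]) (rule y_observation)
      have corr: "(cox_a x D A z (covariance_matrix M (\<lambda>\<omega>. wls x m (\<lambda>j. 1 / (A + D j)) (\<lambda>j. y j \<omega>))) m i
          + cox_b D A h m i) / real m = fhn.cox_correction m i z"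
        unfolding cox_a_def cox_b_def cov fhn.cox_correction_def l1_def
        using i by (simp add: add_divide_distrib diff_divide_distrib)
      have 3: "\<bar>prob E\<^sub>2 - (1 - \<alpha> + z * std_normal_density z * fhn.cox_correction m i z)\<bar> \<le> C\<^sub>1 * ?r"
        unfolding 2 central[symmetric]
        by (rule C1[OF m i]) (rule measurable_compose[OF fhn.measurable_U fhn.measurable_coverage[OF m i]])
      have "\<bar>prob E\<^sub>1 - (1 - \<alpha> + z * std_normal_density z * fhn.cox_correction m i z)\<bar> \<le> C\<^sub>1 * ?r + C\<^sub>2 * ?r + C\<^sub>3 * ?r"
        using 1 3 by linarith
      then show "norm (prob {\<omega> \<in> space M.
          \<theta> i \<omega> \<in> cox_interval x D z m i (\<lambda>j. Ahat m j \<omega>) (\<lambda>j. y j \<omega>)} -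
        (1 - \<alpha> + z * std_normal_density z *
          ((cox_a x D A z (covariance_matrix M (\<lambda>\<omega>. wls x m (\<lambda>j. 1 / (A + D j)) (\<lambda>j. y j \<omega>))) m i
            + cox_b D A h m i) / real m)))
        \<le> (C\<^sub>1 + C\<^sub>2 + C\<^sub>3) * norm (real m powr (- 3 / 2))"
        unfolding corr E\<^sub>1_def[symmetric] by (simp add: distrib_right)
    qed
  qed
qed

end
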